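(* Let $d\ge3$ and let $Q$ be an external field on $\mathbb{S}^{d-1}$ that is rotationally invariant with respect to rotations about the polar axis, and such that $Q\in C^2(N)$, where $N$ is an open neighborhood of $S_Q$ in $\mathbb{S}^{d-1}$. Assume that $S_Q$ is a spherical cap $C_{N,\alpha}$ centered at the North Pole, with $0<\alpha\le\pi$. Let $$F(\eta)=\frac{\Gamma((d-2)/2)}{2\pi^{(d+2)/2}}\,\frac{1}{\sin\eta}\,\sec^{d-3}\Big(\frac{\eta}{2}\Big)\,\frac{d}{d\eta}\int_\eta^\alpha\frac{g(\zeta)\sin\zeta\,d\zeta}{\sqrt{\cos\eta-\cos\zeta}},\qquad 0\le\eta\le\alpha,$$ where $$g(\zeta)=\cot^{d-3}\Big(\frac{\zeta}{2}\Big)\,\frac{d}{d\zeta}\int_0^\zeta\frac{Q(\theta)\sin^{d-3}(\theta/2)\sin\theta\,d\theta}{\sqrt{\cos\theta-\cos\zeta}},\qquad 0\le\zeta\le\alpha.$$ Then the density $f$ of the equilibrium measure $\mu_Q$ (that is, $d\mu_Q=f\,d\sigma_d$ with $f$ a function of the polar angle $\eta$) is given by $$f(\eta)=C_Q\Big(\frac{1+\cos\alpha}{1+\cos\eta}\Big)^{\frac{d-1}{2}}\Big(\frac{1+\cos\alpha}{\cos\eta-\cos\alpha}\Big)^{\frac12}\,{}_2F_1\Big(1,\frac{d-1}{2};\frac12;\frac{\cos\eta-\cos\alpha}{1+\cos\eta}\Big)+F(\eta),\qquad 0\le\eta\le\alpha,$$ where the constant $C_Q$ is uniquely defined by $$C_Q=\frac{\Gamma(d/2-1)}{2^{d-2}\sqrt{\pi}\,\Gamma((d-1)/2)}\Big(\mathrm{B}\Big(\sin^2\Big(\frac{\alpha}{2}\Big);\frac{d-2}{2},\frac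 d2\Big)\Big)^{-1}\Big\{\frac{\Gamma((d-1)/2)}{2\pi^{(d-1)/2}}-\int_0^\alpha F(\eta)\sin^{d-2}\eta\,d\eta\Big\}.$$
   Context: $\mathbb{S}^{d-1}=\{x\in\mathbb{R}^d:|x|=1\}$, $d\ge3$, with Lebesgue surface measure $\sigma_d$. For $x=(x_1,\dots,x_d)\in\mathbb{S}^{d-1}$ the polar angle $\theta\in[0,\pi]$ is defined by $x_1=\cos\theta$; the polar axis is the $x_1$-axis, the North Pole is $(1,0,\dots,0)$. A rotationally invariant $Q$ depends only on the polar angle and is written $Q(\theta)$. For $0<\alpha\le\pi$, $C_{N,\alpha}$ is the set of points of $\mathbb{S}^{d-1}$ with polar angle in $[0,\alpha]$. An external field on $\mathbb{S}^{d-1}$ is a non-negative lower semicontinuous function $Q:\mathbb{S}^{d-1}\to[0,\infty]$ with $Q(x)<\infty$ on a set of positive surface measure. For a unit positive Borel measure $\mu$ on $\mathbb{S}^{d-1}$ put $$I(\mu)=\iint\frac{1}{|x-y|^{d-2}}\,d\mu(x)\,d\mu(y),\qquad I_Q(\mu)=I(\mu)+2\int Q\,d\mu,$$ and $V_Q=\inf\{I_Q(\mu)\}$ over all unit positive Borel measures $\mu$ on $\mathbb{S}^{d-1}$. The extremal (or equilibrium) measure $\mu_Q$ is the unit positive Borel measure on $\mathbb{S}^{d-1}$ with $I_Q(\mu_Q)=V_Q$, and $S_Q=\operatorname{supp}\mu_Q$. Incomplete Beta function: $\mathrm{B}(z;a,b)=\int_0^z t^{a-1}(1-t)^{b-1}\,dt$.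 Gauss hypergeometric function: ${}_2F_1(a,b;c;z)=\sum_{n\ge0}\frac{(a)_n(b)_n}{(c)_n}\frac{z^n}{n!}$ for $|z|<1$, with $(a)_0=1$, $(a)_n=a(a+1)\cdots(a+n-1)$. As usual, formulas for densities are understood almost everywhere. When $\alpha=\pi$, the expression multiplying $C_Q$ in the formula for $f$ is understood as its (finite) limit as $\alpha\to\pi^-$ with $\eta$ fixed. *)

theory Defs
  imports "HOL-Analysis.Analysis"
begin

section \<open>The sphere, polar angle and surface measure\<close>

text \<open>The index \<open>k\<close> marks the coordinate \<open>x\<^sub>1\<close>, so the North Pole is \<open>axis k 1\<close>. The unit sphere
  of \<open>real ^ 'n\<close> is \<open>sphere 0 1\<close>, and \<open>d\<close> is \<open>CARD('n)\<close>.\<close>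

definition polar_angle :: "'n::finite \<Rightarrow> real ^ 'n \<Rightarrow> real" where
  "polar_angle k x = arccos (x $ k)"

definition north_cap :: "'n::finite \<Rightarrow> real \<Rightarrow> (real ^ 'n) set" where
  "north_cap k \<alpha> = {x \<in> sphere 0 1. polar_angle k x \<le> \<alpha>}"

abbreviation sphere_borel :: "(real ^ 'n::finite) measure" where
  "sphere_borel \<equiv> restrict_space borel (sphere 0 1)"

text \<open>Polar coordinates: \<open>\<sigma> A\<close> is \<open>d\<close> times the Lebesgue measure of the cone
  \<open>{t *\<^sub>R a | t a. 0 < t \<and> t < 1 \<and> a \<in> A}\<close>. The map \<open>sgn\<close> is \<open>x \<mapsto> x / norm x\<close>.\<close>

definition surface_measure :: "(real ^ 'n::finite) measure" where
  "surface_measure =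
     scale_measure (of_nat CARD('n))
       (distr (restrict_space lborel (ball 0 1 - {0})) sphere_borel sgn)"

section \<open>External fields\<close>

definition lsc_on :: "'a::topological_space set \<Rightarrow> ('a \<Rightarrow> ennreal) \<Rightarrow> bool" where
  "lsc_on S h \<longleftrightarrow> (\<forall>c. openin (top_of_set S) {x \<in> S. c < h x})"

definition external_field :: "(real ^ 'n::finite \<Rightarrow> ennreal) \<Rightarrow> bool" where
  "external_field Q \<longleftrightarrow>
     lsc_on (sphere 0 1) Q \<and> emeasure surface_measure {x \<in> sphere 0 1. Q x < \<infinity>} > 0"

definition rotation_invariant :: "'n::finite \<Rightarrow> (real ^ 'n \<Rightarrow> ennreal) \<Rightarrow> bool" where
  "rotation_invariant k Q \<longleftrightarrow>
     (\<forall>A. rotation_matrix A \<and> A *v axis k 1 = axis k 1 \<longrightarrow> (\<forall>x \<in> sphere 0 1. Q (A *v x) = Q x))"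

text \<open>\<open>Q(\<theta>)\<close>: the common value of a rotationally invariant \<open>Q\<close> on the points of polar angle \<open>\<theta>\<close>.\<close>

definition profile :: "'n::finite \<Rightarrow> (real ^ 'n \<Rightarrow> ennreal) \<Rightarrow> real \<Rightarrow> ennreal" where
  "profile k Q \<theta> = (THE q. \<forall>x \<in> sphere 0 1. polar_angle k x = \<theta> \<longrightarrow> Q x = q)"

definition C2_on :: "'a::euclidean_space set \<Rightarrow> ('a \<Rightarrow> real) \<Rightarrow> bool" where
  "C2_on U h \<longleftrightarrow>
     (\<exists>(h' :: 'a \<Rightarrow> 'a \<Rightarrow>\<^sub>L real) (h'' :: 'a \<Rightarrow> 'a \<Rightarrow>\<^sub>L 'a \<Rightarrow>\<^sub>L real).
        (\<forall>x \<in> U. (h has_derivative blinfun_apply (h' x)) (at x)) \<and>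
        (\<forall>x \<in> U. (h' has_derivative blinfun_apply (h'' x)) (at x)) \<and>
        continuous_on U h'')"

text \<open>Being twice continuously differentiable on a relatively open subset \<open>N\<close> of the sphere: near
  each point, the restriction of a \<open>C\<^sup>2\<close> function on an open set of the ambient space.\<close>

definition C2_on_sphere :: "(real ^ 'n::finite) set \<Rightarrow> (real ^ 'n \<Rightarrow> ennreal) \<Rightarrow> bool" where
  "C2_on_sphere N Q \<longleftrightarrow>
     (\<forall>x \<in> N. Q x < \<infinity>) \<and>
     (\<forall>p \<in> N. \<exists>U h. open U \<and> p \<in> U \<and> C2_on U h \<and> (\<forall>x \<in> U \<inter> N. enn2real (Q x) = h x))"

section \<open>Energy and equilibrium measure\<close>

definition unit_sphere_measure :: "(real ^ 'n::finite) measure \<Rightarrow> bool" where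
  "unit_sphere_measure \<mu> \<longleftrightarrow> sets \<mu> = sets sphere_borel \<and> emeasure \<mu> (space \<mu>) = 1"

text \<open>The inverse is taken in \<open>ennreal\<close>, so that the kernel is \<open>\<infinity>\<close> on the diagonal (if \<open>d \<ge> 3\<close>).\<close>

definition energy :: "(real ^ 'n::finite) measure \<Rightarrow> ennreal" where
  "energy \<mu> = (\<integral>\<^sup>+ x. \<integral>\<^sup>+ y. inverse (ennreal (norm (x - y) ^ (CARD('n) - 2))) \<partial>\<mu> \<partial>\<mu>)"

definition weighted_energy :: "(real ^ 'n::finite \<Rightarrow> ennreal) \<Rightarrow> (real ^ 'n) measure \<Rightarrow> ennreal" where
  "weighted_energy Q \<mu> = energy \<mu> + 2 * (\<integral>\<^sup>+ x. Q x \<partial>\<mu>)"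

definition min_energy :: "(real ^ 'n::finite \<Rightarrow> ennreal) \<Rightarrow> ennreal" where
  "min_energy Q = (INF \<mu> \<in> Collect unit_sphere_measure. weighted_energy Q \<mu>)"

definition equilibrium_measure ::
    "(real ^ 'n::finite \<Rightarrow> ennreal) \<Rightarrow> (real ^ 'n) measure \<Rightarrow> bool" where
  "equilibrium_measure Q \<mu> \<longleftrightarrow> unit_sphere_measure \<mu> \<and> weighted_energy Q \<mu> = min_energy Q"

definition supp :: "'a::topological_space measure \<Rightarrow> 'a set" where
  "supp \<mu> = {x \<in> space \<mu>. \<forall>U. open U \<and> x \<in> U \<longrightarrow> emeasure \<mu> (U \<inter> space \<mu>) > 0}"

section \<open>The explicit density\<close>

definition inc_Beta :: "real \<Rightarrow> real \<Rightarrow> real \<Rightarrow> real" where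
  "inc_Beta z a b = integral {0..z} (\<lambda>t. t powr (a - 1) * (1 - t) powr (b - 1))"

definition hyp2F1 :: "real \<Rightarrow> real \<Rightarrow> real \<Rightarrow> real \<Rightarrow> real" where
  "hyp2F1 a b c z =
     (\<Sum>n. pochhammer a n * pochhammer b n / pochhammer c n * (z ^ n / fact n))"

text \<open>Below, \<open>q\<close> is the field as a function of the polar angle.\<close>

definition g_fun :: "nat \<Rightarrow> (real \<Rightarrow> real) \<Rightarrow> real \<Rightarrow> real" where
  "g_fun d q \<zeta> =
     cot (\<zeta> / 2) ^ (d - 3) *
     deriv (\<lambda>z. integral {0..z}
       (\<lambda>\<theta>. q \<theta> * sin (\<theta> / 2) ^ (d - 3) * sin \<theta> / sqrt (cos \<theta> - cos z))) \<zeta>"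

definition F_fun :: "nat \<Rightarrow> (real \<Rightarrow> real) \<Rightarrow> real \<Rightarrow> real \<Rightarrow> real" where
  "F_fun d q \<alpha> \<eta> =
     Gamma ((real d - 2) / 2) / (2 * pi powr ((real d + 2) / 2)) *
     (1 / sin \<eta>) * (1 / cos (\<eta> / 2)) ^ (d - 3) *
     deriv (\<lambda>h. integral {h..\<alpha>} (\<lambda>\<zeta>. g_fun d q \<zeta> * sin \<zeta> / sqrt (cos h - cos \<zeta>))) \<eta>"

definition C_const :: "nat \<Rightarrow> (real \<Rightarrow> real) \<Rightarrow> real \<Rightarrow> real" where
  "C_const d q \<alpha> =
     Gamma (real d / 2 - 1) / (2 ^ (d - 2) * sqrt pi * Gamma ((real d - 1) / 2)) *
     inverse (inc_Beta ((sin (\<alpha> / 2))\<^sup>2) ((real d - 2) / 2) (real d / 2)) *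
     (Gamma ((real d - 1) / 2) / (2 * pi powr ((real d - 1) / 2))
        - integral {0..\<alpha>} (\<lambda>\<eta>. F_fun d q \<alpha> \<eta> * sin \<eta> ^ (d - 2)))"

definition cap_factor :: "nat \<Rightarrow> real \<Rightarrow> real \<Rightarrow> real" where
  "cap_factor d \<alpha> \<eta> =
     ((1 + cos \<alpha>) / (1 + cos \<eta>)) powr ((real d - 1) / 2) *
     sqrt ((1 + cos \<alpha>) / (cos \<eta> - cos \<alpha>)) *
     hyp2F1 1 ((real d - 1) / 2) (1 / 2) ((cos \<eta> - cos \<alpha>) / (1 + cos \<eta>))"

text \<open>At \<open>\<alpha> = \<pi>\<close> the formula of \<open>cap_factor\<close> degenerates (the hypergeometric series is evaluated
  at \<open>1\<close>, where it diverges), and its left limit in \<open>\<alpha>\<close> is used instead.\<close>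

definition cap_factor_ext :: "nat \<Rightarrow> real \<Rightarrow> real \<Rightarrow> real" where
  "cap_factor_ext d \<alpha> \<eta> =
     (if \<alpha> = pi then Lim (at_left pi) (\<lambda>a. cap_factor d a \<eta>) else cap_factor d \<alpha> \<eta>)"

definition eq_density :: "nat \<Rightarrow> (real \<Rightarrow> real) \<Rightarrow> real \<Rightarrow> real \<Rightarrow> real" where
  "eq_density d q \<alpha> \<eta> = C_const d q \<alpha> * cap_factor_ext d \<alpha> \<eta> + F_fun d q \<alpha> \<eta>"

text \<open>\<open>d\<mu> = f d\<sigma>\<close> for a real function \<open>f\<close>. The coercion \<open>ennreal\<close> truncates negative values, hence
  the explicit nonnegativity.\<close>

definition has_real_density :: "'a measure \<Rightarrow> 'a measure \<Rightarrow> ('a \<Rightarrow> real) \<Rightarrow> bool" where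
  "has_real_density \<mu> \<sigma> f \<longleftrightarrow>
     f \<in> borel_measurable \<sigma> \<and> (AE x in \<sigma>. 0 \<le> f x) \<and> \<mu> = density \<sigma> (\<lambda>x. ennreal (f x))"

end

theory Submission
 imports Defs "HOL-Real_Asymp.Real_Asymp"
begin

text \<open>Write d = n + 2 and measure latitude by s = (1 - x_1)/2 = sin^2(theta/2), so that the
  pole is s = 0 and the cap is s <= a with a = sin^2(alpha/2). The kernel is |x - y|^(-n).

  The averaged kernel factorizes. Averaging |x - y|^(-n) over all x of latitude s, for y of latitude
  t, gives up to a power of s t the integral over 0 < w < min(s, t) of w^(n/2 - 1) (1 - w)^(-n/2) (s
  - w)^(-1/2) (t - w)^(-1/2) (\<open>copson_factorization\<close>). Potentials of zonal densities
  are therefore products of two Abel transforms (\<open>surface_potential\<close>), and Abel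
  transforms can be inverted.

  The equilibrium condition supplies the equation. Moving mu slightly towards a measure of finite
  energy cannot lower the weighted energy (\<open>equilibrium_variational_inequality\<close>). Hence
  U^mu + Q >= c almost everywhere for surface measure, with equality mu-almost everywhere; lower
  semicontinuity of potentials gives U^mu + Q <= c on the support
  (\<open>potential_le_on_supp\<close>). So U^mu + Q = c almost everywhere on the cap
  (\<open>potential_eq\<close>). Testing this with a zonal function that is itself an Abel kernel
  yields an equation for the distribution m of the latitudes of mu (\<open>abel_equation\<close>).
  One differentiation and one more Abel transform solve it (\<open>abel_inversion\<close>); m is
  only known to be a measure, and every sign and finiteness needed comes from that. On the side of
  the field, Q of class C^2 becomes a profile q(s) with controlled derivatives
  (\<open>field_abel_profile\<close>).

  The shape of the formula follows. The solution is linear in c and in the field. The field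
  contributes F, whose two nested derivatives of integrals are the two Abel steps written in angles
  (\<open>F_fun_eq\<close>). The constant contributes the derivative of an Abel integral of (1 -
  w)^(n/2), which is \<open>cap_R\<close>; a first-order differential equation identifies it with
  the hypergeometric factor (\<open>cap_R_eq_hyp2F1\<close>). The unknown coefficient is found from
  the total mass 1 (\<open>G3_integral\<close>, \<open>C_const_eq\<close>).

  So far only the latitudes of mu are known. Let nu be the zonal measure with the density found; it
  has the same latitude distribution. As U^nu depends on latitude only, I(mu, nu) = I(nu, nu); as
  U^mu = c - Q almost everywhere on the cap and Q is zonal there, I(mu, nu) = I(mu, mu). The signed
  measure mu - nu thus has energy zero. The kernel is strictly positive definite, because its power
  series in x . y has positive coefficients (\<open>measure_eqI_energy\<close>), so mu = nu
  (\<open>mu_eq_nu\<close>).\<close>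

abbreviation lborel_nn_integral :: "('a::euclidean_space => ennreal) => ennreal" (binder "II " 10) where
  "lborel_nn_integral f \<equiv> integral\<^sup>N lborel f"

section \<open>Isometries, substitution and polar coordinates for Lebesgue measure\<close>

lemma nn_integral_lborel_translation:
 fixes f :: "'a::euclidean_space => ennreal"
 assumes [measurable]: "f \<in> borel_measurable borel"
 shows "(II x. f (x + c)) = (II x. f x)"
proof -
 have "(II x. f x) = (\<integral>\<^sup>+x. f x \<partial>distr lborel borel ((+) c))"
  by (simp add: lborel_distr_plus)
 also have "... = (II x. f (x + c))"
  by (subst nn_integral_distr) (auto simp: add.commute)
 finally show ?thesis ..
qed

text \<open>The image of Lebesgue measure under a surjective linear map is again translation
  invariant, hence proportional to Lebesgue measure; the unit ball, which an isometry maps to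
  itself, shows that the factor is 1.\<close>

lemma lborel_distr_linear_isometry:
 fixes T :: "'a::euclidean_space => 'a"
 assumes T: "linear T" "!!x. norm (T x) = norm x"
 shows "distr lborel borel T = lborel"
proof -
 define M where "M = distr lborel borel T"
 have [measurable]: "T \<in> borel_measurable borel"
  by (intro borel_measurable_continuous_onI linear_continuous_on linear_conv_bounded_linear[THEN iffD1] T)
 have inj: "inj T"
  using T by (metis linear_injective_0 norm_eq_zero)
 then have surj: "surj T"
  using T(1) linear_injective_imp_surjective by blast
 have [measurable_cong]: "sets M = sets borel"
  by (simp add: M_def)
 have ball: "emeasure M (ball 0 r) = emeasure lborel (ball (0::'a) r)" for r
 proof -
  have "T -` ball 0 r = ball 0 r"
   using T by (auto simp: mem_ball_0)
  then show ?thesis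
   by (simp add: M_def emeasure_distr)
 qed
 interpret M: sigma_finite_measure M
 proof
  have "emeasure M (ball 0 (real i)) ~= \<infinity>" for i
   unfolding ball using emeasure_bounded_finite[of "ball (0::'a) (real i)"] by auto
  moreover have "(\<Union>i. ball (0::'a) (real i)) = UNIV"
   by (auto simp: reals_Archimedean2)
  moreover have "space M = UNIV" by (simp add: M_def)
  ultimately show "\<exists>A. countable A \<and> A \<subseteq> sets M \<and> \<Union> A = space M \<and> (\<forall>a\<in>A. emeasure M a ~= \<infinity>)"
   by (intro exI[of _ "range (%i. ball (0::'a) (real i))"]) (auto simp: M_def)
 qed
 interpret P: pair_sigma_finite M "lborel :: 'a measure" ..
 have trans: "(\<integral>\<^sup>+x. f (x + v) \<partial>M) = (\<integral>\<^sup>+x. f x \<partial>M)" if [measurable]: "f \<in> borel_measurable borel" for f v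
 proof -
  obtain u where u: "v = T u" using surj by (metis surjD)
  have "(\<integral>\<^sup>+x. f (x + v) \<partial>M) = (II x. f (T (x + u)))"
   unfolding M_def u by (simp add: nn_integral_distr linear_add[OF T(1)])
  also have "... = (II x. f (T x))"
   by (rule nn_integral_lborel_translation) measurable
  also have "... = (\<integral>\<^sup>+x. f x \<partial>M)"
   unfolding M_def by (simp add: nn_integral_distr)
  finally show ?thesis .
 qed
 let ?B = "ball (0::'a) 1"
 have [measurable]: "?B \<in> sets borel" by simp
 have fin: "emeasure lborel ?B ~= \<infinity>" and pos: "emeasure lborel ?B ~= 0"
  using emeasure_bounded_finite[of ?B] unit_ball_vol_pos[of "real DIM('a)"]
  by (auto simp: emeasure_ball simp del: unit_ball_vol_pos)
 have "emeasure M A = emeasure lborel A" if "A \<in> sets borel" for A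
 proof -
  have [measurable]: "A \<in> sets borel" by fact
  \<comment> \<open>The uniqueness argument for Haar measure: the indicator of A at x times that of
    the ball at y - x is integrated over both measures, and translation invariance of both separates
    the two factors.\<close>
  have "emeasure M A * emeasure lborel ?B = (\<integral>\<^sup>+x. indicator A x * emeasure lborel ?B \<partial>M)"
   by (simp add: nn_integral_multc M_def)
  also have "... = (\<integral>\<^sup>+x. indicator A x * (II y. indicator ?B (y + (- x))) \<partial>M)"
   by (subst nn_integral_lborel_translation) (auto intro: borel_measurable_indicator)
  also have "... = (\<integral>\<^sup>+x. (II y. indicator A x * indicator ?B (y + (- x))) \<partial>M)"
   by (intro nn_integral_cong) (simp split: split_indicator)
  also have "... = (II y. (\<integral>\<^sup>+x. indicator A x * indicator ?B (y + (- x)) \<partial>M))"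
   by (rule P.Fubini'[symmetric]) measurable
  also have "... = (II y. (\<integral>\<^sup>+x. indicator A (x + y) * indicator ?B (- x) \<partial>M))"
  proof (rule nn_integral_cong, goal_cases)
   case (1 y)
   show ?case
    by (subst trans[of "%x. indicator A x * indicator ?B (y + (- x))" y, symmetric]) auto
  qed
  also have "... = (\<integral>\<^sup>+x. (II y. indicator A (x + y) * indicator ?B (- x)) \<partial>M)"
   by (rule P.Fubini') measurable
  also have "... = (\<integral>\<^sup>+x. emeasure lborel A * indicator ?B x \<partial>M)"
  proof (rule nn_integral_cong, goal_cases)
   case (1 x)
   have "(II y. indicator A (x + y) * indicator ?B (- x))
     = (II y. indicator A (y + x)) * indicator ?B (- x)"
    by (subst nn_integral_multc) (auto simp: add.commute)
   also have "... = emeasure lborel A * indicator ?B x"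
    by (subst nn_integral_lborel_translation) (auto simp: indicator_def)
   finally show ?case .
  qed
  also have "... = emeasure lborel A * emeasure lborel ?B"
   by (simp add: nn_integral_cmult M_def ball[unfolded M_def])
  finally have "emeasure lborel ?B * emeasure M A = emeasure lborel ?B * emeasure lborel A"
   by (simp only: mult.commute)
  then show ?thesis
   using fin pos unfolding ennreal_mult_cancel_left infinity_ennreal_def by blast
 qed
 then show ?thesis
  by (intro measure_eqI) (auto simp: M_def)
qed

text \<open>For indicators of bounded sets this is the substitution rule for absolutely integrable
  functions. Exhaustion by bounded sets and induction over Borel functions extend it to the case
  where both sides may be infinite.\<close>

lemma nn_integral_change_of_variables:
 fixes f :: "real => ennreal" and g :: "real => real"
 assumes f: "f \<in> borel_measurable borel"
  and S[measurable]: "S \<in> sets borel" and T[measurable]: "T \<in> sets borel"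
  and gm[measurable]: "g \<in> borel_measurable borel" and g'm[measurable]: "g' \<in> borel_measurable borel"
  and der: "!!x. x \<in> S ==> (g has_real_derivative g' x) (at x)"
  and bij: "bij_betw g S T"
 shows "(II x. f x * indicator T x) = (II x. f (g x) * ennreal \<bar>g' x\<bar> * indicator S x)"
 using f
proof (induction rule: borel_measurable_induct)
 case (cong f h)
 then show ?case by simp
next
 case (set A)
 have [measurable]: "A \<in> sets borel" using set by simp
 have img: "g ` S = T" and inj: "inj_on g S"
  using bij by (auto simp: bij_betw_def)
 \<comment> \<open>Boundedness of B makes its indicator absolutely integrable on T.\<close>
 have bounded: "(II x. indicator B x * indicator T x) =
   (II x. indicator B (g x) * ennreal \<bar>g' x\<bar> * indicator S x)"
  if [measurable]: "B \<in> sets borel" and "bounded B" for B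
 proof -
  have "emeasure lborel (B \<inter> T) < \<infinity>"
   by (intro emeasure_bounded_finite bounded_Int) (use that in auto)
  then have "integrable lborel (%x. indicator T x *\<^sub>R indicator B x :: real)"
   by (simp flip: indicator_inter_arith add: Int_commute)
  then have "(indicator B :: real => real) absolutely_integrable_on T"
   unfolding set_integrable_def by (subst integrable_completion) auto
  note 1 = this
  define I where "I = integral T (indicator B :: real => real)"
  have "(%x. \<bar>g' x\<bar> * indicator B (g x)) absolutely_integrable_on S \<and>
      integral S (%x. \<bar>g' x\<bar> * indicator B (g x)) = I"
   using has_absolute_integral_change_of_variables_1'[of S g g' "indicator B" I] 1 inj der
   by (simp add: img I_def has_field_derivative_at_within)
  then have 2: "((%x. \<bar>g' x\<bar> * indicator B (g x)) has_integral I) S"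
   by (auto simp: absolutely_integrable_on_def has_integral_iff)
  have "(indicator B has_integral I) T"
   using 1 by (auto simp: I_def absolutely_integrable_on_def has_integral_iff)
  from nn_integral_has_integral_lebesgue'[OF _ this]
  have "(II x. ennreal (indicator B x) * indicator T x) = ennreal I" by auto
  moreover from nn_integral_has_integral_lebesgue'[OF _ 2]
  have "(II x. ennreal (\<bar>g' x\<bar> * indicator B (g x)) * indicator S x) = ennreal I" by auto
  ultimately show ?thesis
   by (simp add: ennreal_mult ennreal_indicator mult_ac)
 qed
 define B where "B i = A \<inter> {- real i .. real i}" for i :: nat
 have [measurable]: "B i \<in> sets borel" for i by (auto simp: B_def)
 have SUPB: "indicator A x = (SUP i. indicator (B i) x :: ennreal)" for x
 proof -
  obtain n where "\<bar>x\<bar> <= real n" using real_arch_simple by blast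
  then have "indicator A x = (indicator (B n) x :: ennreal)" by (auto simp: B_def indicator_def)
  moreover have "indicator (B i) x <= (indicator A x :: ennreal)" for i by (auto simp: B_def indicator_def)
  ultimately show ?thesis
   by (intro antisym SUP_least) (metis SUP_upper UNIV_I, auto)
 qed
 have inc: "incseq (%i. indicator (B i) x * c :: ennreal)" for x c
  by (auto simp: incseq_def B_def indicator_def)
 have "(II x. indicator A x * indicator T x) = (II x. (SUP i. indicator (B i) x * indicator T x))"
  by (simp add: SUPB SUP_mult_right_ennreal)
 also have "... = (SUP i. II x. indicator (B i) x * indicator T x)"
  using inc by (intro nn_integral_monotone_convergence_SUP) (auto simp: incseq_def le_fun_def)
 also have "... = (SUP i. II x. indicator (B i) (g x) * ennreal \<bar>g' x\<bar> * indicator S x)"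
  by (intro SUP_cong bounded refl) (auto simp: B_def bounded_Int)
 also have "... = (II x. (SUP i. indicator (B i) (g x) * (ennreal \<bar>g' x\<bar> * indicator S x)))"
  unfolding mult.assoc using inc
  by (intro nn_integral_monotone_convergence_SUP[symmetric]) (auto simp: incseq_def le_fun_def)
 also have "... = (II x. indicator A (g x) * ennreal \<bar>g' x\<bar> * indicator S x)"
  by (simp add: SUPB SUP_mult_right_ennreal mult.assoc)
 finally show ?case .
next
 case (mult u c)
 then show ?case by (simp add: mult.assoc nn_integral_cmult)
next
 case (add u v)
 then show ?case by (simp add: distrib_right nn_integral_add)
next
 case (seq U)
 have [measurable]: "U i \<in> borel_measurable borel" for i by (rule seq)
 have inc: "U i x <= U (Suc i) x" for i x using seq(3) by (auto simp: incseq_Suc_iff le_fun_def)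
 have mono: "mono (%i x. U i (h x) * w x)" for h :: "real => real" and w
  unfolding mono_iff_le_Suc le_fun_def using inc by (auto intro: mult_right_mono)
 have "(II x. (SUP i. U i) x * indicator T x) = (II x. (SUP i. U i x * indicator T x))"
  by (simp add: SUP_mult_right_ennreal image_comp)
 also have "... = (SUP i. II x. U i x * indicator T x)"
  using mono[of "%x. x"] by (intro nn_integral_monotone_convergence_SUP) auto
 also have "... = (SUP i. II x. U i (g x) * ennreal \<bar>g' x\<bar> * indicator S x)"
  using seq by simp
 also have "... = (II x. (SUP i. U i (g x) * (ennreal \<bar>g' x\<bar> * indicator S x)))"
  unfolding mult.assoc using mono[of g]
  by (intro nn_integral_monotone_convergence_SUP[symmetric]) auto
 also have "... = (II x. (SUP i. U i) (g x) * ennreal \<bar>g' x\<bar> * indicator S x)"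
  by (simp add: SUP_mult_right_ennreal mult.assoc image_comp)
 finally show ?case .
qed

lemma measure_eqI_atMost:
 fixes M N :: "real measure"
 assumes sets: "sets M = sets borel" "sets N = sets borel"
 assumes fin: "!!x. emeasure M {..x} < \<infinity>"
 assumes eq: "!!x. emeasure M {..x} = emeasure N {..x}"
 shows "M = N"
proof (rule measure_eqI_generator_eq[where E="range atMost" and \<Omega>=UNIV and A="%i. {..real i}"])
 show "Int_stable (range (atMost :: real => _))"
  by (auto simp: Int_stable_def)
 show "sets M = sigma_sets UNIV (range atMost)" "sets N = sigma_sets UNIV (range atMost)"
  unfolding sets borel_eq_atMost by (auto)
 show "(\<Union>i. {..real i}) = UNIV"
  by (auto simp: real_arch_simple)
 show "emeasure M {..real i} ~= \<infinity>" for i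
  using fin[of "real i"] by simp
qed (use eq in auto)

lemma nn_integral_power_lborel:
 fixes r :: real
 assumes "0 <= r" "0 < n"
 shows "(II x. ennreal (real n * x ^ (n - 1)) * indicator {0<..r} x) = ennreal (r ^ n)"
proof -
 have "(II x. ennreal (real n * x ^ (n - 1)) * indicator {0..r} x) = ennreal (r ^ n - 0 ^ n)"
  using assms by (intro nn_integral_FTC_Icc) (auto intro!: derivative_eq_intros)
 moreover have "(II x. ennreal (real n * x ^ (n - 1)) * indicator {0<..r} x)
   = (II x. ennreal (real n * x ^ (n - 1)) * indicator {0..r} x)"
  by (rule nn_integral_cong_AE, rule AE_mp[OF AE_lborel_singleton[of 0]]) (auto simp: indicator_def)
 ultimately show ?thesis using assms by (simp add: zero_power)
qed

text \<open>The distribution function of the norm is the volume of a ball, and the density is its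
  derivative.\<close>

lemma distr_PiM_lborel_norm:
 assumes A: "finite A" "A ~= {}"
 shows "distr (Pi\<^sub>M A (%_. lborel)) borel (%f. sqrt (\<Sum>i\<in>A. (f i)\<^sup>2)) =
  density lborel (%r. ennreal (real (card A) * unit_ball_vol (card A) * r ^ (card A - 1)) * indicator {0<..} r)"
  (is "?M = ?N")
proof (rule measure_eqI_atMost)
 have m[measurable]: "(%f. sqrt (\<Sum>i\<in>A. (f i)\<^sup>2)) \<in> borel_measurable (Pi\<^sub>M A (%_. lborel))"
  by measurable
 let ?n = "card A" and ?V = "unit_ball_vol (card A)"
 have n: "0 < ?n" using A by (auto simp: card_gt_0_iff)
 have pos: "emeasure ?M {..x} = ennreal (?V * x ^ ?n)" if "0 < x" for x
  using emeasure_cball_aux[OF A(1) that] by (simp add: emeasure_distr vimage_def Int_def conj_commute)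
 \<comment> \<open>The radius 0 carries no mass either, since it lies in balls of arbitrarily small
   volume.\<close>
 have neg: "emeasure ?M {..x} = 0" if "x <= 0" for x
 proof -
  have "emeasure ?M {..x} <= ennreal (?V * e ^ ?n)" if "0 < e" for e
   using emeasure_mono[of "{..x}" "{..e}" ?M] pos[OF that] \<open>x <= 0\<close> that by auto
  then have le: "emeasure ?M {..x} <= ennreal (?V * (inverse (real (Suc i))) ^ ?n)" for i
   by simp
  have lim: "(%i. ennreal (?V * (inverse (real (Suc i))) ^ ?n)) \<longlonglongrightarrow> ennreal (?V * 0 ^ ?n)"
   by (intro tendsto_ennrealI tendsto_intros LIMSEQ_inverse_real_of_nat)
  have "emeasure ?M {..x} <= ennreal (?V * 0 ^ ?n)"
   using le by (intro LIMSEQ_le_const[OF lim]) blast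
  then show ?thesis using n by (simp add: zero_power)
 qed
 show "emeasure ?M {..x} < \<infinity>" for x
  using pos[of x] neg[of x] by (cases "0 < x") auto
 show "emeasure ?M {..x} = emeasure ?N {..x}" for x
 proof -
  have "emeasure ?N {..x} = (II r. ennreal ?V * (ennreal (real ?n * r ^ (?n - 1)) * indicator {0<..x} r))"
   by (subst emeasure_density)
    (auto intro!: nn_integral_cong simp: indicator_def ennreal_mult[symmetric] mult_ac)
  also have "... = ennreal ?V * (II r. (ennreal (real ?n * r ^ (?n - 1)) * indicator {0<..x} r))"
   by (intro nn_integral_cmult) auto
  also have "... = emeasure ?M {..x}"
  proof (cases "0 < x")
   case True
   then show ?thesis
    using pos[OF True] n by (subst nn_integral_power_lborel) (auto simp: ennreal_mult)
  next
   case False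
   then have "{0<..x} = {}" by auto
   then show ?thesis using neg[of x] False by simp
  qed
  finally show ?thesis ..
 qed
qed auto

text \<open>Two coordinates are kept, and the other n enter only through their Euclidean length r.
  The norm of the whole vector is an argument of \<open>G\<close> because the projection to the
  sphere divides by it.\<close>

lemma nn_integral_lborel_two_coords:
 fixes k j :: "'n::finite" and G :: "real \<times> real \<times> real => ennreal"
 assumes kj: "k ~= j" and n: "CARD('n) = n + 2" "0 < n"
  and [measurable]: "G \<in> borel_measurable borel"
 shows "(\<integral>\<^sup>+z. G (z $ k, z $ j, norm z) \<partial>(lborel :: (real ^ 'n) measure)) =
  (II a. II b. II r. G (a, b, sqrt (a\<^sup>2 + b\<^sup>2 + r\<^sup>2)) *
    (ennreal (real n * unit_ball_vol n * r ^ (n - 1)) * indicator {0<..} r))"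
proof -
 interpret product_sigma_finite "%_::real^'n. lborel :: real measure"
  by standard
 define ek ej where "ek = (axis k 1 :: real ^ 'n)" and "ej = (axis j 1 :: real ^ 'n)"
 define R where "R = (Basis :: (real ^ 'n) set) - {ek, ej}"
 have ne: "ek ~= ej" using kj by (simp add: ek_def ej_def axis_eq_axis)
 have inB: "ek \<in> Basis" "ej \<in> Basis" by (auto simp: ek_def ej_def axis_in_Basis_iff)
 have B: "Basis = insert ek (insert ej R)" using inB by (auto simp: R_def)
 have fin: "finite R" and notin: "ek \<notin> insert ej R" "ej \<notin> R" using ne by (auto simp: R_def)
 have "card (Basis :: (real^'n) set) = n + 2" using n by simp
 then have card: "card R = n" using fin notin by (simp add: B)
 have coord: "(\<Sum>b\<in>Basis. f b *\<^sub>R b) $ i = f (axis i 1)" for f :: "real^'n => real" and i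
  using inner_sum_left_Basis[of "axis i 1" f]
  by (simp add: cart_eq_inner_axis axis_in_Basis_iff)
 have nrm: "norm (\<Sum>b\<in>Basis. f b *\<^sub>R b) = sqrt (\<Sum>b\<in>Basis. (f b)\<^sup>2)" for f :: "real^'n => real"
  using euclidean_dist_l2[of "\<Sum>b\<in>Basis. f b *\<^sub>R b" 0] by (simp add: L2_set_def)
 have "(\<integral>\<^sup>+z. G (z $ k, z $ j, norm z) \<partial>(lborel :: (real ^ 'n) measure)) =
  (\<integral>\<^sup>+f. G (f ek, f ej, sqrt (\<Sum>b\<in>Basis. (f b)\<^sup>2)) \<partial>Pi\<^sub>M Basis (%_. lborel))"
  by (subst lborel_eq, subst nn_integral_distr, measurable, simp only: coord nrm ek_def ej_def)
 also have "... = (II a. \<integral>\<^sup>+f. G (a, f ej, sqrt (a\<^sup>2 + (\<Sum>b\<in>insert ej R. (f b)\<^sup>2))) \<partial>Pi\<^sub>M (insert ej R) (%_. lborel))"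
  unfolding B using fin notin ne
  by (subst product_nn_integral_insert_rev)
    (auto intro!: nn_integral_cong simp del: sum.insert simp: sum.insert[of "insert ej R"] intro!: sum.cong arg_cong[where f=G])
 also have "... = (II a. II b. \<integral>\<^sup>+f. G (a, b, sqrt (a\<^sup>2 + (b\<^sup>2 + (\<Sum>b\<in>R. (f b)\<^sup>2)))) \<partial>Pi\<^sub>M R (%_. lborel))"
  using fin notin
  by (subst product_nn_integral_insert_rev)
    (auto intro!: nn_integral_cong arg_cong[where f=G] sum.cong)
 also have "... = (II a. II b. II r. G (a, b, sqrt (a\<^sup>2 + b\<^sup>2 + r\<^sup>2)) *
    (ennreal (real n * unit_ball_vol n * r ^ (n - 1)) * indicator {0<..} r))"
 proof (intro nn_integral_cong)
  fix a b
  have "(\<integral>\<^sup>+f. G (a, b, sqrt (a\<^sup>2 + (b\<^sup>2 + (\<Sum>b\<in>R. (f b)\<^sup>2)))) \<partial>Pi\<^sub>M R (%_. lborel)) =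
    (\<integral>\<^sup>+r. G (a, b, sqrt (a\<^sup>2 + b\<^sup>2 + r\<^sup>2)) \<partial>distr (Pi\<^sub>M R (%_. lborel)) borel (%f. sqrt (\<Sum>i\<in>R. (f i)\<^sup>2)))"
   by (subst nn_integral_distr) (simp_all add: sum_nonneg add.assoc)
  also have "... = (II r. G (a, b, sqrt (a\<^sup>2 + b\<^sup>2 + r\<^sup>2)) *
    (ennreal (real n * unit_ball_vol n * r ^ (n - 1)) * indicator {0<..} r))"
   using card n fin by (subst distr_PiM_lborel_norm, simp, force, subst nn_integral_density) (auto simp: mult.commute)
  finally show "(\<integral>\<^sup>+f. G (a, b, sqrt (a\<^sup>2 + (b\<^sup>2 + (\<Sum>b\<in>R. (f b)\<^sup>2)))) \<partial>Pi\<^sub>M R (%_. lborel)) = ..." .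
 qed
 finally show ?thesis .
qed

text \<open>Spherical coordinates with cotangents in place of angles: R is the length of (b, r), c =
  b / r and e = a / R. Angular variables then range over whole lines and all formulas stay
  algebraic. \<open>F0\<close> confines the integral to positive radii.\<close>

lemma nn_integral_projective:
 fixes F :: "real \<times> real \<times> real => ennreal"
 assumes [measurable]: "F \<in> borel_measurable borel"
  and F0: "!!a b r. r <= 0 ==> F (a, b, r) = 0"
 shows "(II a. II b. II r. F (a, b, r)) =
  (II c. II e. II R. ennreal (R\<^sup>2 / (1 + c\<^sup>2)) * F (R * e, R * c / sqrt (1 + c\<^sup>2), R / sqrt (1 + c\<^sup>2))
)"
proof -
 have q: "0 < sqrt (1 + c\<^sup>2)" for c :: real by (simp add: add_pos_nonneg)
 have "(II a. II b. II r. F (a, b, r)) = (II a. II r. II b. F (a, b, r))"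
  by (rule nn_integral_cong, rule lborel_pair.Fubini') measurable
 also have "... = (II a. II r. II c. ennreal r * F (a, r * c, r))"
 proof (rule nn_integral_cong, rule nn_integral_cong)
  fix a r
  show "(II b. F (a, b, r)) = (II c. ennreal r * F (a, r * c, r))"
  proof (cases "0 < r")
   case True
   then show ?thesis
    by (subst nn_integral_real_affine[where c=r and t=0]) (auto simp: nn_integral_cmult)
  qed (auto simp: F0)
 qed
 also have "... = (II a. II c. II r. ennreal r * F (a, r * c, r))"
  by (rule nn_integral_cong, rule lborel_pair.Fubini') measurable
 also have "... = (II c. II a. II r. ennreal r * F (a, r * c, r))"
  by (rule lborel_pair.Fubini') measurable
 also have "... = (II c. II a. II R. ennreal (R / (1 + c\<^sup>2)) * F (a, R * c / sqrt (1 + c\<^sup>2), R / sqrt (1 + c\<^sup>2)))"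
 proof (rule nn_integral_cong, rule nn_integral_cong)
  fix c a :: real
  let ?q = "sqrt (1 + c\<^sup>2)"
  have "(II r. ennreal r * F (a, r * c, r)) = (II R. ennreal (1 / ?q) * (ennreal (R / ?q) * F (a, R * c / ?q, R / ?q)))"
   using q[of c] by (subst nn_integral_real_affine[where c="1/?q" and t=0]) (auto simp: nn_integral_cmult)
  also have "... = (II R. ennreal (R / (1 + c\<^sup>2)) * F (a, R * c / ?q, R / ?q))"
  proof (rule nn_integral_cong)
   fix R
   have "ennreal (1 / ?q) * ennreal (R / ?q) = ennreal (R / (1 + c\<^sup>2))" if "0 < R"
    using q[of c] that by (subst ennreal_mult[symmetric]) (auto simp: real_sqrt_mult_self)
   moreover have "F (a, R * c / ?q, R / ?q) = 0" if "R <= 0"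
    using q[of c] that by (intro F0) (simp add: divide_nonpos_pos)
   ultimately show "ennreal (1 / ?q) * (ennreal (R / ?q) * F (a, R * c / ?q, R / ?q)) = ennreal (R / (1 + c\<^sup>2)) * F (a, R * c / ?q, R / ?q)"
    by (cases "0 < R") (auto simp flip: mult.assoc)
  qed
  finally show "(II r. ennreal r * F (a, r * c, r)) = ..." .
 qed
 also have "... = (II c. II R. II a. ennreal (R / (1 + c\<^sup>2)) * F (a, R * c / sqrt (1 + c\<^sup>2), R / sqrt (1 + c\<^sup>2)))"
  by (rule nn_integral_cong, rule lborel_pair.Fubini') measurable
 also have "... = (II c. II R. II e. ennreal (R\<^sup>2 / (1 + c\<^sup>2)) * F (R * e, R * c / sqrt (1 + c\<^sup>2), R / sqrt (1 + c\<^sup>2)))"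
 proof (rule nn_integral_cong, rule nn_integral_cong)
  fix c R :: real
  show "(II a. ennreal (R / (1 + c\<^sup>2)) * F (a, R * c / sqrt (1 + c\<^sup>2), R / sqrt (1 + c\<^sup>2))) =
    (II e. ennreal (R\<^sup>2 / (1 + c\<^sup>2)) * F (R * e, R * c / sqrt (1 + c\<^sup>2), R / sqrt (1 + c\<^sup>2)))"
  proof (cases "0 < R")
   case True
   have "ennreal R * ennreal (R / (1 + c\<^sup>2)) = ennreal (R\<^sup>2 / (1 + c\<^sup>2))"
    using True by (subst ennreal_mult[symmetric]) (auto simp: power2_eq_square)
   then show ?thesis using True
    by (subst nn_integral_real_affine[where c=R and t=0]) (auto simp: nn_integral_cmult simp flip: mult.assoc)
  next
   case False
   then have "R / sqrt (1 + c\<^sup>2) <= 0" using q[of c] by (simp add: divide_nonpos_pos)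
   then show ?thesis by (simp add: F0)
  qed
 qed
 also have "... = (II c. II e. II R. ennreal (R\<^sup>2 / (1 + c\<^sup>2)) * F (R * e, R * c / sqrt (1 + c\<^sup>2), R / sqrt (1 + c\<^sup>2)))"
  by (rule nn_integral_cong, rule lborel_pair.Fubini') measurable
 finally show ?thesis .
qed

section \<open>Surface measure in two coordinates\<close>

lemma nn_integral_surface_measure:
 fixes f :: "real ^ 'n::finite => ennreal"
 assumes [measurable]: "f \<in> borel_measurable borel"
 shows "(\<integral>\<^sup>+x. f x \<partial>surface_measure) =
  of_nat CARD('n) * (II z. f (sgn z) * indicator (ball 0 1 - {0}) z)"
proof -
 have [measurable]: "ball 0 1 - {0} \<in> sets (lborel :: (real^'n) measure)" by simp
 have m: "sgn \<in> (restrict_space lborel (ball 0 1 - {0}) :: (real^'n) measure) \<rightarrow>\<^sub>M restrict_space borel (sphere 0 1)"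
  by (intro measurable_restrict_space2 measurable_restrict_space1)
    (auto simp: space_restrict_space norm_sgn)
 have "(\<integral>\<^sup>+x. f x \<partial>surface_measure) = of_nat CARD('n) * (\<integral>\<^sup>+z. f (sgn z) \<partial>restrict_space lborel (ball 0 1 - {0}))"
  unfolding surface_measure_def
  by (subst nn_integral_scale_measure)
    (auto simp: measurable_restrict_space1 nn_integral_distr[OF m])
 also have "(\<integral>\<^sup>+z. f (sgn z) \<partial>restrict_space lborel (ball 0 1 - {0})) =
   (II z. f (sgn z) * indicator (ball 0 1 - {0}) z)"
  by (subst nn_integral_restrict_space) auto
 finally show ?thesis .
qed

text \<open>With e = cot theta and c = cot phi the two coordinates are cos theta and sin theta cos
  phi, and the density is the usual sin^n(theta) sin^(n-1)(phi) rewritten for de dc. The constant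
  \<open>real n * unit_ball_vol n\<close> is the area of the remaining sphere of dimension n - 1;
  the radial integral cancels the factor d in the surface measure.\<close>

lemma nn_integral_surface_two_coords:
 fixes k j :: "'n::finite" and P :: "real \<times> real => ennreal"
 assumes kj: "k ~= j" and n: "CARD('n) = n + 2" "0 < n"
  and [measurable]: "P \<in> borel_measurable borel"
 shows "(\<integral>\<^sup>+x. P (x $ k, x $ j) \<partial>(surface_measure :: (real ^ 'n) measure)) =
  (II e. II c. P (e / sqrt (1 + e\<^sup>2), c / (sqrt (1 + c\<^sup>2) * sqrt (1 + e\<^sup>2))) *
    ennreal (real n * unit_ball_vol n / (sqrt (1 + c\<^sup>2) ^ (n + 1) * sqrt (1 + e\<^sup>2) ^ (n + 2))))"
proof -
 let ?K = "real n * unit_ball_vol n"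
 have K: "0 <= ?K" by simp
 have q: "0 < sqrt (1 + c\<^sup>2)" for c :: real by (simp add: add_pos_nonneg)
 define G where "G = (%(a, b, r). P (a / r, b / r) * indicator {0<..<1::real} r)"
 have [measurable]: "G \<in> borel_measurable borel"
  unfolding G_def split_beta' borel_prod[symmetric] by measurable
 have "(\<integral>\<^sup>+x. P (x $ k, x $ j) \<partial>(surface_measure :: (real ^ 'n) measure)) =
   of_nat (n + 2) * (\<integral>\<^sup>+z. G (z $ k, z $ j, norm z) \<partial>(lborel :: (real^'n) measure))"
  unfolding n(1)[symmetric]
  by (subst nn_integral_surface_measure, measurable, intro arg_cong2[where f="(*)"] refl nn_integral_cong)
    (auto simp: G_def indicator_def sgn_div_norm divide_inverse mult.commute)
 also have "(\<integral>\<^sup>+z. G (z $ k, z $ j, norm z) \<partial>(lborel :: (real^'n) measure)) =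
  (II a. II b. II r. (%(a, b, r). G (a, b, sqrt (a\<^sup>2 + b\<^sup>2 + r\<^sup>2)) *
    (ennreal (?K * r ^ (n - 1)) * indicator {0<..} r)) (a, b, r))"
  using nn_integral_lborel_two_coords[OF kj n, of G] by simp
 also have "... = (II c. II e. II R. ennreal (R\<^sup>2 / (1 + c\<^sup>2)) *
   (%(a, b, r). G (a, b, sqrt (a\<^sup>2 + b\<^sup>2 + r\<^sup>2)) *
    (ennreal (?K * r ^ (n - 1)) * indicator {0<..} r)) (R * e, R * c / sqrt (1 + c\<^sup>2), R / sqrt (1 + c\<^sup>2))
)"
  proof (rule nn_integral_projective)
  show "(%(a, b, r). G (a, b, sqrt (a\<^sup>2 + b\<^sup>2 + r\<^sup>2)) * (ennreal (?K * r ^ (n - 1)) * indicator {0<..} r)) \<in> borel_measurable borel"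
   unfolding G_def split_beta' borel_prod[symmetric] fst_conv snd_conv by measurable
 qed auto
 also have "... = (II c. II e. II R. P (e / sqrt (1 + e\<^sup>2), c / (sqrt (1 + c\<^sup>2) * sqrt (1 + e\<^sup>2))) *
    ennreal (?K / (real (n + 2) * sqrt (1 + c\<^sup>2) ^ (n + 1))) *
    (ennreal (real (n + 2) * R ^ (n + 2 - 1)) * indicator {0<..1 / sqrt (1 + e\<^sup>2)} R))"
 proof (rule nn_integral_cong, rule nn_integral_cong, rule nn_integral_cong_AE)
  fix c e :: real
  let ?q = "sqrt (1 + c\<^sup>2)" and ?E = "sqrt (1 + e\<^sup>2)"
  \<comment> \<open>The length of the full vector, so the cone over the sphere is given by R sqrt(1
    + e^2) < 1.\<close>
  have *: "sqrt ((R * e)\<^sup>2 + (R * c / ?q)\<^sup>2 + (R / ?q)\<^sup>2) = R * ?E" if "0 < R" for R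
  proof -
   have "(R * c / ?q)\<^sup>2 + (R / ?q)\<^sup>2 = (R\<^sup>2 * (1 + c\<^sup>2)) / ?q\<^sup>2"
    by (simp add: power_divide power_mult_distrib add_divide_distrib[symmetric] algebra_simps)
   also have "... = R\<^sup>2" using q[of c] by simp
   finally have "(R * e)\<^sup>2 + (R * c / ?q)\<^sup>2 + (R / ?q)\<^sup>2 = R\<^sup>2 * (1 + e\<^sup>2)"
    by (simp add: power_mult_distrib algebra_simps)
   then show ?thesis using that by (simp add: real_sqrt_mult)
  qed
  \<comment> \<open>The ball is open and the radial integral is computed on a half-open interval;
    the end point is discarded.\<close>
  have "AE R in lborel. R ~= 1 / ?E" by (rule AE_lborel_singleton)
  then show "AE R in lborel. ennreal (R\<^sup>2 / (1 + c\<^sup>2)) *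
   (%(a, b, r). G (a, b, sqrt (a\<^sup>2 + b\<^sup>2 + r\<^sup>2)) *
    (ennreal (?K * r ^ (n - 1)) * indicator {0<..} r)) (R * e, R * c / ?q, R / ?q) =
    P (e / ?E, c / (?q * ?E)) * ennreal (?K / (real (n + 2) * ?q ^ (n + 1))) *
    (ennreal (real (n + 2) * R ^ (n + 2 - 1)) * indicator {0<..1 / ?E} R)"
  proof eventually_elim
   case (elim R)
   show ?case
   proof (cases "0 < R")
    case True
    have 1: "R * e / (R * ?E) = e / ?E" "R * c / ?q / (R * ?E) = c / (?q * ?E)"
     using True by auto
    have 2: "(R * ?E < 1) = (R <= 1 / ?E)"
     using elim q[of e] by (auto simp: field_simps)
    have "R\<^sup>2 / (1 + c\<^sup>2) * (?K * (R / ?q) ^ (n - 1)) = ?K * R ^ (n + 1) / ?q ^ (n + 1)"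
    proof -
     obtain m where m: "n = Suc m" using n by (cases n) auto
     have "R\<^sup>2 / (s * s) * (K * (R / s) ^ (n - 1)) = K * R ^ (n + 1) / s ^ (n + 1)" if "0 < s" for s K :: real
      unfolding m using that by (simp add: power_divide power2_eq_square mult_ac)
     from this[OF q] show ?thesis by (simp add: add_nonneg_nonneg)
    qed
    also have "... = ?K / (real (n + 2) * ?q ^ (n + 1)) * (real (n + 2) * R ^ (n + 2 - 1))"
     by (simp del: of_nat_add)
    finally have "ennreal (R\<^sup>2 / (1 + c\<^sup>2)) * ennreal (?K * (R / ?q) ^ (n - 1)) =
      ennreal (?K / (real (n + 2) * ?q ^ (n + 1))) * ennreal (real (n + 2) * R ^ (n + 2 - 1))"
     using True q[of c] K by (simp add: ennreal_mult[symmetric])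
    moreover have "R * ?E \<in> {0<..<1} \<longleftrightarrow> R \<in> {0<..1 / ?E}"
     by (simp only: greaterThanLessThan_iff greaterThanAtMost_iff 2 True mult_pos_pos[OF True q] simp_thms)
    then have "G (R * e, R * c / ?q, sqrt ((R * e)\<^sup>2 + (R * c / ?q)\<^sup>2 + (R / ?q)\<^sup>2)) =
      P (e / ?E, c / (?q * ?E)) * indicator {0<..1 / ?E} R"
     unfolding *[OF True] G_def split_conv 1 by (simp only: indicator_def)
    moreover have "indicator {0<..} (R / ?q) = (1 :: ennreal)"
     using divide_pos_pos[OF True q] by (simp only: indicator_simps greaterThan_iff)
    moreover have "X * (Y * (Z * 1)) = Y * (X * Z)" for X Y Z :: ennreal
     by (simp only: mult_1_right mult.left_commute)
    ultimately show ?thesis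
     by (simp only: split_conv) (simp only: mult_ac)
   next
    case False
    then have "R / ?q <= 0" using q[of c] by (simp add: divide_nonpos_pos)
    then show ?thesis using False by simp
   qed
  qed
 qed
 also have "... = (II c. II e. P (e / sqrt (1 + e\<^sup>2), c / (sqrt (1 + c\<^sup>2) * sqrt (1 + e\<^sup>2))) *
    ennreal (?K / (real (n + 2) * sqrt (1 + c\<^sup>2) ^ (n + 1))) *
    ennreal ((1 / sqrt (1 + e\<^sup>2)) ^ (n + 2)))"
  using q by (subst nn_integral_cmult, measurable, subst nn_integral_power_lborel) (auto simp: less_imp_le)
 also have "... = (II c. II e. inverse (of_nat (n + 2)) * (P (e / sqrt (1 + e\<^sup>2), c / (sqrt (1 + c\<^sup>2) * sqrt (1 + e\<^sup>2))) *
    ennreal (?K / (sqrt (1 + c\<^sup>2) ^ (n + 1) * sqrt (1 + e\<^sup>2) ^ (n + 2)))))"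
 proof (rule nn_integral_cong, rule nn_integral_cong)
  fix c e :: real
  let ?q = "sqrt (1 + c\<^sup>2)" and ?E = "sqrt (1 + e\<^sup>2)"
  have "?K / (real (n + 2) * ?q ^ (n + 1)) * (1 / ?E) ^ (n + 2) = inverse (real (n + 2)) * (?K / (?q ^ (n + 1) * ?E ^ (n + 2)))"
   by (simp add: divide_inverse power_inverse mult_ac del: of_nat_add)
  moreover have "inverse (of_nat (n + 2)) = ennreal (inverse (real (n + 2)))"
   by (subst inverse_ennreal[symmetric]) (simp_all add: ennreal_of_nat_eq_real_of_nat)
  ultimately have "ennreal (?K / (real (n + 2) * ?q ^ (n + 1))) * ennreal ((1 / ?E) ^ (n + 2)) =
    inverse (of_nat (n + 2)) * ennreal (?K / (?q ^ (n + 1) * ?E ^ (n + 2)))"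
   using q[of c] q[of e] K by (simp add: ennreal_mult[symmetric] del: of_nat_add)
  then show "P (e / ?E, c / (?q * ?E)) * ennreal (?K / (real (n + 2) * ?q ^ (n + 1))) * ennreal ((1 / ?E) ^ (n + 2)) =
   inverse (of_nat (n + 2)) * (P (e / ?E, c / (?q * ?E)) * ennreal (?K / (?q ^ (n + 1) * ?E ^ (n + 2))))"
   unfolding mult.assoc by (simp only: mult.left_commute)
 qed
 also have "... = inverse (of_nat (n + 2)) * (II c. II e. (P (e / sqrt (1 + e\<^sup>2), c / (sqrt (1 + c\<^sup>2) * sqrt (1 + e\<^sup>2))) *
    ennreal (?K / (sqrt (1 + c\<^sup>2) ^ (n + 1) * sqrt (1 + e\<^sup>2) ^ (n + 2)))))"
  by (subst nn_integral_cmult, measurable, subst nn_integral_cmult, measurable)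
 also have "of_nat (n + 2) * ... = (II c. II e. (P (e / sqrt (1 + e\<^sup>2), c / (sqrt (1 + c\<^sup>2) * sqrt (1 + e\<^sup>2))) *
    ennreal (?K / (sqrt (1 + c\<^sup>2) ^ (n + 1) * sqrt (1 + e\<^sup>2) ^ (n + 2)))))"
 proof -
  have "of_nat N * inverse (of_nat N :: ennreal) = ennreal (real N * inverse (real N))" if "0 < N" for N
   using that by (simp add: ennreal_of_nat_eq_real_of_nat inverse_ennreal ennreal_mult[symmetric])
  from this[of "n + 2"] have "of_nat (n + 2) * inverse (of_nat (n + 2) :: ennreal) = 1"
   by (simp del: of_nat_add)
  then show ?thesis by (simp only: mult.assoc[symmetric] mult_1)
 qed
 also have "... = (II e. II c. P (e / sqrt (1 + e\<^sup>2), c / (sqrt (1 + c\<^sup>2) * sqrt (1 + e\<^sup>2))) *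
    ennreal (?K / (sqrt (1 + c\<^sup>2) ^ (n + 1) * sqrt (1 + e\<^sup>2) ^ (n + 2))))"
  by (rule lborel_pair.Fubini') measurable
 finally show ?thesis .
qed

section \<open>Factorization of the rotational average of the kernel\<close>

lemma nn_integral_even_square:
 fixes f :: "real => ennreal"
 assumes [measurable]: "f \<in> borel_measurable borel"
 shows "(II x. f (x\<^sup>2)) = (II u. f u * ennreal (1 / sqrt u) * indicator {0<..} u)"
proof -
 have pos: "(II x. f (x\<^sup>2) * indicator {0<..} x) =
   (II u. ennreal (1 / 2) * (f u * ennreal (1 / sqrt u) * indicator {0<..} u))"
 proof -
  have "bij_betw sqrt {0<..} {0<..}"
   by (rule bij_betw_byWitness[where f'="%x. x\<^sup>2"]) auto
  then have "(II x. f (x\<^sup>2) * indicator {0<..} x) =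
    (II u. f ((sqrt u)\<^sup>2) * ennreal \<bar>inverse (sqrt u) / 2\<bar> * indicator {0<..} u)"
   by (intro nn_integral_change_of_variables) (auto intro!: DERIV_real_sqrt)
  also have "... = (II u. ennreal (1 / 2) * (f u * ennreal (1 / sqrt u) * indicator {0<..} u))"
  proof (rule nn_integral_cong, goal_cases)
   case (1 u)
   show ?case
   proof (cases "0 < u")
    case True
    have "\<bar>inverse (sqrt u) / 2\<bar> = 1 / 2 * (1 / sqrt u)" using True by (simp add: field_simps)
    then have "ennreal \<bar>inverse (sqrt u) / 2\<bar> = ennreal (1 / 2) * ennreal (1 / sqrt u)"
     using True by (simp only: ennreal_mult' )
    then show ?thesis using True by (simp add: mult_ac)
   qed auto
  qed
  finally show ?thesis .
 qed
 have "(II x. f (x\<^sup>2) * indicator {..<0} x) = (II x. f (x\<^sup>2) * indicator {0<..} x)"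
  by (subst nn_integral_real_affine[where c="-1" and t=0]) (auto intro!: nn_integral_cong simp: indicator_def)
 moreover have "(II x. f (x\<^sup>2)) = (II x. f (x\<^sup>2) * indicator {0<..} x + f (x\<^sup>2) * indicator {..<0} x)"
  by (rule nn_integral_cong_AE, rule AE_mp[OF AE_lborel_singleton[of 0]]) (auto simp: indicator_def)
 ultimately have "(II x. f (x\<^sup>2)) = (II x. f (x\<^sup>2) * indicator {0<..} x) + (II x. f (x\<^sup>2) * indicator {0<..} x)"
  by (simp add: nn_integral_add)
 also have "... = (II u. ennreal (1/2) * (f u * ennreal (1 / sqrt u) * indicator {0<..} u) +
   ennreal (1/2) * (f u * ennreal (1 / sqrt u) * indicator {0<..} u))"
  unfolding pos by (rule nn_integral_add[symmetric]) auto
 also have "... = (II u. f u * ennreal (1 / sqrt u) * indicator {0<..} u)"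
 proof (rule nn_integral_cong)
  have "ennreal (1/2) + ennreal (1/2) = 1" by (subst ennreal_plus[symmetric]) auto
  then show "ennreal (1/2) * (f u * ennreal (1 / sqrt u) * indicator {0<..} u) +
   ennreal (1/2) * (f u * ennreal (1 / sqrt u) * indicator {0<..} u) = f u * ennreal (1 / sqrt u) * indicator {0<..} u" for u
   by (metis distrib_right mult_1)
 qed
 finally show ?thesis .
qed

text \<open>For c = sinh(tau) the map of the substitution is sinh(tau) - z cosh(tau). The first
  identity verifies an explicit inverse; the second evaluates the square root as cosh(tau) - z
  sinh(tau), the derivative of that map in tau.\<close>

lemma copson_substitution_aux:
 fixes z x c :: real
 assumes z: "0 <= z" "z < 1"
 shows "(x + z * sqrt (1 - z\<^sup>2 + x\<^sup>2)) / (1 - z\<^sup>2) - z * sqrt (1 + ((x + z * sqrt (1 - z\<^sup>2 + x\<^sup>2)) / (1 - z\<^sup>2))\<^sup>2) = x"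
  and "sqrt (1 - z\<^sup>2 + (c - z * sqrt (1 + c\<^sup>2))\<^sup>2) = sqrt (1 + c\<^sup>2) - z * c"
proof -
 have z2: "0 < 1 - z\<^sup>2" using z by (simp add: power_less_one_iff abs_square_less_1)
 define w where "w = sqrt (1 - z\<^sup>2 + x\<^sup>2)"
 have nn: "0 <= 1 - z\<^sup>2 + x\<^sup>2" using z2 zero_le_power2[of x] by linarith
 then have w2: "w\<^sup>2 = 1 - z\<^sup>2 + x\<^sup>2" by (simp add: w_def)
 have w0: "0 <= w" using nn by (simp add: w_def)
 have "x\<^sup>2 <= w\<^sup>2" using w2 z2 by simp
 then have "\<bar>x\<bar> <= w" using w0 by (metis abs_of_nonneg abs_le_square_iff)
 then have "\<bar>z * x\<bar> <= 1 * w" unfolding abs_mult by (intro mult_mono) (use z in auto)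
 then have pos: "0 <= w + z * x" by linarith
 have "1 + ((x + z * w) / (1 - z\<^sup>2))\<^sup>2 = ((w + z * x) / (1 - z\<^sup>2))\<^sup>2"
 proof -
  have "(1 - z\<^sup>2)\<^sup>2 + (x + z * w)\<^sup>2 = (w + z * x)\<^sup>2 + ((1 - z\<^sup>2)\<^sup>2 + x\<^sup>2 + z\<^sup>2 * w\<^sup>2 - w\<^sup>2 - z\<^sup>2 * x\<^sup>2)"
   by (simp add: power2_eq_square algebra_simps)
  also have "(1 - z\<^sup>2)\<^sup>2 + x\<^sup>2 + z\<^sup>2 * w\<^sup>2 - w\<^sup>2 - z\<^sup>2 * x\<^sup>2 = 0"
   unfolding w2 by (simp add: power2_eq_square algebra_simps)
  finally show ?thesis using z2 by (simp add: power_divide field_simps)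
 qed
 then have "sqrt (1 + ((x + z * w) / (1 - z\<^sup>2))\<^sup>2) = (w + z * x) / (1 - z\<^sup>2)"
  using pos z2 by simp
 moreover have "x + z * w - z * (w + z * x) = x * (1 - z\<^sup>2)"
  by (simp add: algebra_simps power2_eq_square)
 then have "(x + z * w) / (1 - z\<^sup>2) - z * ((w + z * x) / (1 - z\<^sup>2)) = x"
  using z2 unfolding times_divide_eq_right diff_divide_distrib[symmetric] by simp
 ultimately show "(x + z * sqrt (1 - z\<^sup>2 + x\<^sup>2)) / (1 - z\<^sup>2) - z * sqrt (1 + ((x + z * sqrt (1 - z\<^sup>2 + x\<^sup>2)) / (1 - z\<^sup>2))\<^sup>2) = x"
  by (simp add: w_def)
 define q where "q = sqrt (1 + c\<^sup>2)"
 have q2: "q\<^sup>2 = 1 + c\<^sup>2" and q0: "0 <= q" by (auto simp: q_def add_nonneg_nonneg)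
 have "c\<^sup>2 <= q\<^sup>2" using q2 by simp
 then have "\<bar>c\<bar> <= q" using q0 by (metis abs_of_nonneg abs_le_square_iff)
 then have "\<bar>z * c\<bar> <= 1 * q" unfolding abs_mult by (intro mult_mono) (use z in auto)
 then have pos: "0 <= q - z * c" by linarith
 have "(q - z * c)\<^sup>2 = 1 - z\<^sup>2 + (c - z * q)\<^sup>2 + (q\<^sup>2 - 1 - c\<^sup>2) * (1 - z\<^sup>2)"
  by (simp add: power2_eq_square algebra_simps)
 then have "1 - z\<^sup>2 + (c - z * q)\<^sup>2 = (q - z * c)\<^sup>2" using q2 by simp
 then show "sqrt (1 - z\<^sup>2 + (c - z * sqrt (1 + c\<^sup>2))\<^sup>2) = sqrt (1 + c\<^sup>2) - z * c"
  using pos by (simp add: q_def)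
qed

text \<open>The substitution x = c - z sqrt(1 + c^2) with z = b / a completes a square: 1 + c^2
  times the radicand on the left is a^2 (1 + x^2). The integrand becomes even in x.\<close>

lemma copson_substitution:
 fixes a b :: real
 assumes ab: "0 <= b" "b < a"
 shows "(II c. ennreal (1 / (sqrt (1 + c\<^sup>2) ^ (n + 1) * sqrt (a\<^sup>2 + b\<^sup>2 - 2 * a * b * (c / sqrt (1 + c\<^sup>2))) ^ n))) =
  (II x. ennreal (1 / (a ^ n * sqrt (1 + x\<^sup>2) ^ n * sqrt (1 - (b / a)\<^sup>2 + x\<^sup>2))))"
proof -
 define z where "z = b / a"
 have z: "0 <= z" "z < 1" and b: "b = z * a" using ab by (auto simp: z_def)
 have a: "0 < a" using ab by simp
 have z2: "0 < 1 - z\<^sup>2" using z by (simp add: power_less_one_iff abs_square_less_1)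
 let ?g = "%c::real. c - z * sqrt (1 + c\<^sup>2)"
 have q: "0 < sqrt (1 + c\<^sup>2)" for c :: real by (simp add: add_pos_nonneg)
 have bij: "bij_betw ?g UNIV UNIV"
 proof (rule bij_betw_byWitness[where f'="%x. (x + z * sqrt (1 - z\<^sup>2 + x\<^sup>2)) / (1 - z\<^sup>2)"])
  show "\<forall>c\<in>UNIV. (?g c + z * sqrt (1 - z\<^sup>2 + (?g c)\<^sup>2)) / (1 - z\<^sup>2) = c"
  proof
   fix c :: real
   have "?g c + z * (sqrt (1 + c\<^sup>2) - z * c) = c * (1 - z\<^sup>2)"
    by (simp add: algebra_simps power2_eq_square)
   then show "(?g c + z * sqrt (1 - z\<^sup>2 + (?g c)\<^sup>2)) / (1 - z\<^sup>2) = c"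
    using z2 by (simp only: copson_substitution_aux(2)[OF z]) simp
  qed
  show "\<forall>x\<in>UNIV. ?g ((x + z * sqrt (1 - z\<^sup>2 + x\<^sup>2)) / (1 - z\<^sup>2)) = x"
   by (simp add: copson_substitution_aux(1)[OF z])
 qed auto
 have der: "(?g has_real_derivative 1 - z * (c / sqrt (1 + c\<^sup>2))) (at c)" for c
 proof -
  have "(sqrt has_real_derivative inverse (sqrt (1 + c\<^sup>2)) / 2) (at (1 + c\<^sup>2))"
   by (rule DERIV_real_sqrt) (simp add: add_pos_nonneg)
  moreover have "((%c. 1 + c\<^sup>2) has_real_derivative 2 * c) (at c)"
   by (auto intro!: derivative_eq_intros)
  ultimately have "((%c. sqrt (1 + c\<^sup>2)) has_real_derivative inverse (sqrt (1 + c\<^sup>2)) / 2 * (2 * c)) (at c)"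
   by (rule DERIV_chain2)
  also have "inverse (sqrt (1 + c\<^sup>2)) / 2 * (2 * c) = c / sqrt (1 + c\<^sup>2)"
   by (simp only: inverse_eq_divide) simp
  finally show ?thesis
   by (intro DERIV_diff DERIV_ident DERIV_cmult)
 qed
 have "(II x. ennreal (1 / (a ^ n * sqrt (1 + x\<^sup>2) ^ n * sqrt (1 - z\<^sup>2 + x\<^sup>2))) * indicator UNIV x) =
   (II c. ennreal (1 / (a ^ n * sqrt (1 + (?g c)\<^sup>2) ^ n * sqrt (1 - z\<^sup>2 + (?g c)\<^sup>2))) *
     ennreal \<bar>1 - z * (c / sqrt (1 + c\<^sup>2))\<bar> * indicator UNIV c)"
  by (rule nn_integral_change_of_variables[OF _ _ _ _ _ der bij]) measurable
 also have "... = (II c. ennreal (1 / (sqrt (1 + c\<^sup>2) ^ (n + 1) * sqrt (a\<^sup>2 + b\<^sup>2 - 2 * a * b * (c / sqrt (1 + c\<^sup>2))) ^ n)))"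
 proof (rule nn_integral_cong, goal_cases)
  case (1 c)
  define Q where "Q = sqrt (1 + c\<^sup>2)"
  have Q: "0 < Q" "Q\<^sup>2 = 1 + c\<^sup>2" by (auto simp: Q_def add_pos_nonneg add_nonneg_nonneg)
  have w: "sqrt (1 - z\<^sup>2 + (?g c)\<^sup>2) = Q - z * c" by (simp add: copson_substitution_aux(2)[OF z] Q_def)
  have wpos: "0 < Q - z * c"
   unfolding w[symmetric] using z2 by (simp add: add_pos_nonneg)
  have "a\<^sup>2 * (1 + (?g c)\<^sup>2) = Q\<^sup>2 * (a\<^sup>2 + b\<^sup>2 - 2 * a * b * (c / Q)) + a\<^sup>2 * (1 + c\<^sup>2 - Q\<^sup>2)"
   unfolding b Q_def[symmetric] using Q(1) by (simp add: power2_eq_square field_simps)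
  then have "a\<^sup>2 * (1 + (?g c)\<^sup>2) = Q\<^sup>2 * (a\<^sup>2 + b\<^sup>2 - 2 * a * b * (c / Q))" using Q by simp
  then have "sqrt (a\<^sup>2 * (1 + (?g c)\<^sup>2)) = sqrt (Q\<^sup>2 * (a\<^sup>2 + b\<^sup>2 - 2 * a * b * (c / Q)))" by simp
  then have "a * sqrt (1 + (?g c)\<^sup>2) = Q * sqrt (a\<^sup>2 + b\<^sup>2 - 2 * a * b * (c / Q))"
   unfolding real_sqrt_mult using a Q(1) by simp
  then have pw: "a ^ n * sqrt (1 + (?g c)\<^sup>2) ^ n = Q ^ n * sqrt (a\<^sup>2 + b\<^sup>2 - 2 * a * b * (c / Q)) ^ n"
   by (metis power_mult_distrib)
  have "1 - z * (c / Q) = (Q - z * c) / Q" using Q by (simp add: field_simps)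
  then have "\<bar>1 - z * (c / Q)\<bar> = (Q - z * c) / Q" using Q wpos by simp
  then have "1 / (a ^ n * sqrt (1 + (?g c)\<^sup>2) ^ n * sqrt (1 - z\<^sup>2 + (?g c)\<^sup>2)) * \<bar>1 - z * (c / Q)\<bar> =
    1 / (Q ^ (n + 1) * sqrt (a\<^sup>2 + b\<^sup>2 - 2 * a * b * (c / Q)) ^ n)"
  proof -
   have "1 / (P * S * W) * (W / Q) = 1 / (Q * P * S)" if "0 < W" for P S W :: real
    using that by simp
   from this[OF wpos] show ?thesis unfolding w pw \<open>\<bar>1 - z * (c / Q)\<bar> = _\<close> by simp
  qed
  then show ?case
   by (subst ennreal_mult''[symmetric], simp) (simp add: Q_def ennreal_mult''[symmetric])
 qed
 finally show ?thesis by (simp add: z_def)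
qed

text \<open>In powers this is w^(n/2 - 1) (1 - w)^(-n/2) times the two Abel kernels (s - w)^(-1/2)
  and (t - w)^(-1/2): for fixed w the variables s and t are separated.\<close>

definition copson_kernel :: "nat => real => real => real => real" where
 "copson_kernel n s t w = sqrt (w / (1 - w)) ^ n / (w * sqrt (s - w) * sqrt (t - w))"

lemma borel_measurable_copson_kernel [measurable]:
 assumes [measurable]: "f \<in> borel_measurable M" "g \<in> borel_measurable M" "h \<in> borel_measurable M"
 shows "(%x. copson_kernel n (f x) (g x) (h x)) \<in> borel_measurable M"
 unfolding copson_kernel_def by measurable

lemma copson_kernel_commute: "copson_kernel n s t w = copson_kernel n t s w"
 by (simp add: copson_kernel_def mult_ac)

text \<open>After \<open>copson_substitution\<close> only u = x^2 occurs. The substitution u = (t -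
  w) / (w (1 - t)) is chosen because it makes both 1 + u and 1 - (b/a)^2 + u multiples of a linear
  factor over w, namely (1 - w) / w and (s - w) / w.\<close>

lemma copson_factorization_aux:
 fixes s t :: real
 assumes st: "0 < t" "t < s" "s <= 1" and n: "0 < n"
 shows "(II c. ennreal (1 / (sqrt (1 + c\<^sup>2) ^ (n + 1) *
   sqrt (s * (1 - t) + t * (1 - s) - 2 * sqrt (s * (1 - t)) * sqrt (t * (1 - s)) * (c / sqrt (1 + c\<^sup>2))) ^ n))) =
  ennreal (1 / sqrt (s * t) ^ (n - 1)) * (II w. ennreal (copson_kernel n s t w) * indicator {0<..<t} w)"
proof -
 let ?a = "sqrt (s * (1 - t))" and ?b = "sqrt (t * (1 - s))"
 have a2: "?a\<^sup>2 = s * (1 - t)" and b2: "?b\<^sup>2 = t * (1 - s)" using st by auto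
 have a: "0 < ?a" using st by simp
 have ba: "?b < ?a" using st by (simp add: algebra_simps)
 have z: "(?b / ?a)\<^sup>2 = t * (1 - s) / (s * (1 - t))" by (simp only: power_divide a2 b2)
 let ?f = "%u. ennreal (1 / (?a ^ n * sqrt (1 + u) ^ n * sqrt (1 - (?b / ?a)\<^sup>2 + u)))"
 let ?g = "%w. (t - w) / (w * (1 - t))"
 have "(II c. ennreal (1 / (sqrt (1 + c\<^sup>2) ^ (n + 1) *
   sqrt (s * (1 - t) + t * (1 - s) - 2 * ?a * ?b * (c / sqrt (1 + c\<^sup>2))) ^ n))) = (II x. ?f (x\<^sup>2))"
  using copson_substitution[of ?b ?a n] st ba unfolding a2 b2 by simp
 also have "... = (II u. ?f u * ennreal (1 / sqrt u) * indicator {0<..} u)"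
  by (rule nn_integral_even_square) measurable
 also have "... = (II w. ?f (?g w) * ennreal (1 / sqrt (?g w)) * ennreal \<bar>- t / ((1 - t) * w\<^sup>2)\<bar> * indicator {0<..<t} w)"
 proof (rule nn_integral_change_of_variables)
  show "bij_betw ?g {0<..<t} {0<..}"
  proof (rule bij_betw_byWitness[where f'="%u. t / (1 + u * (1 - t))"])
   show "\<forall>w\<in>{0<..<t}. t / (1 + ?g w * (1 - t)) = w"
    using st by (auto simp: field_simps)
   show "\<forall>u\<in>{0<..}. ?g (t / (1 + u * (1 - t))) = u"
   proof
    fix u :: real assume "u \<in> {0<..}"
    then have D: "0 < 1 + u * (1 - t)" using st by (intro add_pos_nonneg) auto
    have "(t - t / D) / (t / D * (1 - t)) = (D - 1) / (1 - t)" if "0 < D" for D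
     using st that by (simp add: field_simps)
    from this[OF D] show "?g (t / (1 + u * (1 - t))) = u" using st by simp
   qed
   show "?g ` {0<..<t} \<subseteq> {0<..}" using st by auto
   show "(%u. t / (1 + u * (1 - t))) ` {0<..} \<subseteq> {0<..<t}"
   proof (clarsimp, intro conjI)
    fix u :: real assume "0 < u"
    then have *: "0 < u * (1 - t)" using st by simp
    then show "0 < t / (1 + u * (1 - t))" "t / (1 + u * (1 - t)) < t" using st
     by (auto simp: field_simps)
   qed
  qed
  have "((%w. (t - w) / (w * v)) has_real_derivative - t / (v * w\<^sup>2)) (at w)" if "0 < w" "0 < v" for w v
   using that by (auto intro!: derivative_eq_intros simp: field_simps power2_eq_square)
  then show "(?g has_real_derivative - t / ((1 - t) * w\<^sup>2)) (at w)" if "w \<in> {0<..<t}" for w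
   using that st by simp
 qed measurable
 also have "... = (II w. ennreal (1 / sqrt (s * t) ^ (n - 1)) * (ennreal (copson_kernel n s t w) * indicator {0<..<t} w))"
 proof (rule nn_integral_cong, goal_cases)
  case (1 w)
  show ?case
  proof (cases "w \<in> {0<..<t}")
   case True
   then have w: "0 < w" "w < t" by auto
   define S where "S = sqrt (s * t)"
   have S: "0 < S" "S\<^sup>2 = s * t" using st by (auto simp: S_def)
   have "s * (1 - t) * (1 + ?g w) = s * t * ((1 - w) / w)" using w st by (simp add: field_simps)
   then have "?a * sqrt (1 + ?g w) = S * sqrt ((1 - w) / w)"
    unfolding S_def real_sqrt_mult[symmetric] by simp
   also have "sqrt ((1 - w) / w) = 1 / sqrt (w / (1 - w))" by (simp add: real_sqrt_divide)
   finally have "(?a * sqrt (1 + ?g w)) ^ n = (S * (1 / sqrt (w / (1 - w)))) ^ n" by simp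
   then have e1: "?a ^ n * sqrt (1 + ?g w) ^ n = S ^ n / sqrt (w / (1 - w)) ^ n"
    by (simp add: power_mult_distrib power_divide)
   have "(1 - (?b / ?a)\<^sup>2 + ?g w) * ?g w = (t / (S * (w * (1 - t))))\<^sup>2 * ((s - w) * (t - w))"
   proof -
    define v where "v = 1 - t"
    have v: "0 < v" using st by (simp add: v_def)
    have "1 - t * (1 - s) / (s * v) + (t - w) / (w * v) = t * (s - w) / (w * s * v)"
     using w st v by (simp add: field_simps) (simp add: v_def algebra_simps)
    then have "(1 - t * (1 - s) / (s * v) + (t - w) / (w * v)) * ((t - w) / (w * v)) =
      t * (s - w) / (w * s * v) * ((t - w) / (w * v))" by simp
    also have "... = t\<^sup>2 / (s * t * (w\<^sup>2 * v\<^sup>2)) * ((s - w) * (t - w))"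
     using w st v by (simp add: divide_simps power2_eq_square)
    finally show ?thesis unfolding z unfolding power_divide power_mult_distrib S v_def .
   qed
   then have "sqrt (1 - (?b / ?a)\<^sup>2 + ?g w) * sqrt (?g w) = sqrt ((t / (S * (w * (1 - t))))\<^sup>2 * ((s - w) * (t - w)))"
    unfolding real_sqrt_mult[symmetric] by simp
   also have "... = t / (S * (w * (1 - t))) * (sqrt (s - w) * sqrt (t - w))"
    unfolding real_sqrt_mult using w st S by simp
   finally have e2: "sqrt (1 - (?b / ?a)\<^sup>2 + ?g w) * sqrt (?g w) = t / (S * (w * (1 - t))) * (sqrt (s - w) * sqrt (t - w))" .
   have e3: "\<bar>- t / ((1 - t) * w\<^sup>2)\<bar> = t / ((1 - t) * w\<^sup>2)" using st by simp
   have alg: "1 / X1 * (t / (v * w\<^sup>2)) / (t / (S * (w * v)) * (U * V)) = S / X1 / (w * U * V)"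
    if "0 < v" "0 < U" "0 < V" for X1 U V v
    using that w st S by (cases "X1 = 0") (simp_all add: field_simps power2_eq_square)
   obtain m where m: "n = Suc m" using n by (cases n) auto
   have "1 / (?a ^ n * sqrt (1 + ?g w) ^ n * sqrt (1 - (?b / ?a)\<^sup>2 + ?g w)) * (1 / sqrt (?g w)) * \<bar>- t / ((1 - t) * w\<^sup>2)\<bar>
    = 1 / (?a ^ n * sqrt (1 + ?g w) ^ n) * \<bar>- t / ((1 - t) * w\<^sup>2)\<bar> / (sqrt (1 - (?b / ?a)\<^sup>2 + ?g w) * sqrt (?g w))"
    by simp
   also have "... = S / (S ^ n / sqrt (w / (1 - w)) ^ n) / (w * sqrt (s - w) * sqrt (t - w))"
    unfolding e1 e2 e3 using w st by (intro alg) auto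
   also have "... = 1 / S ^ (n - 1) * copson_kernel n s t w"
    unfolding copson_kernel_def m using S by simp
   finally have "1 / (?a ^ n * sqrt (1 + ?g w) ^ n * sqrt (1 - (?b / ?a)\<^sup>2 + ?g w)) * (1 / sqrt (?g w)) * \<bar>- t / ((1 - t) * w\<^sup>2)\<bar> =
    1 / sqrt (s * t) ^ (n - 1) * copson_kernel n s t w" by (simp add: S_def)
   moreover have "0 <= 1 / sqrt (s * t) ^ (n - 1)" using st by simp
   moreover have "0 <= 1 / sqrt (?g w)" using st w by simp
   ultimately show ?thesis using True
    by (simp only: indicator_simps mult_1_right if_True ennreal_mult'[symmetric] ennreal_mult''[symmetric] abs_ge_zero)
  qed auto
 qed
 also have "... = ennreal (1 / sqrt (s * t) ^ (n - 1)) * (II w. ennreal (copson_kernel n s t w) * indicator {0<..<t} w)"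
  by (rule nn_integral_cmult) measurable
 finally show ?thesis .
qed

text \<open>The rotational average of the kernel factors through Abel kernels: this is what makes the
 integral equation of the problem solvable in closed form.\<close>

lemma copson_factorization:
 fixes s t :: real
 assumes st: "0 < t" "t <= 1" "0 < s" "s <= 1" "s ~= t" and n: "0 < n"
 shows "(II c. ennreal (1 / (sqrt (1 + c\<^sup>2) ^ (n + 1) *
   sqrt (s * (1 - t) + t * (1 - s) - 2 * sqrt (s * (1 - t)) * sqrt (t * (1 - s)) * (c / sqrt (1 + c\<^sup>2))) ^ n))) =
  ennreal (1 / sqrt (s * t) ^ (n - 1)) * (II w. ennreal (copson_kernel n s t w) * indicator {0<..<min s t} w)"
proof (cases "t < s")
 case True
 then have "min s t = t" by simp
 then show ?thesis using copson_factorization_aux[of t s n] st n True by (simp only:)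
next
 case False
 have eq: "s * (1 - t) + t * (1 - s) - 2 * sqrt (s * (1 - t)) * sqrt (t * (1 - s)) * x =
  t * (1 - s) + s * (1 - t) - 2 * sqrt (t * (1 - s)) * sqrt (s * (1 - t)) * x" for x
  by (simp add: mult_ac)
 have min: "min s t = s" using False by simp
 have "s < t" using False st by simp
 then show ?thesis unfolding eq min copson_kernel_commute[of n s t] mult.commute[of s t]
  using st n by (intro copson_factorization_aux) auto
qed

text \<open>Passes from e = cot theta to s = (1 - cos theta) / 2, the latitude variable of
  everything that follows. The root of s (1 - s) is half of sin theta.\<close>

lemma nn_integral_polar_substitution:
 fixes f :: "real => ennreal"
 assumes [measurable]: "f \<in> borel_measurable borel" and n: "0 < n"
 shows "(II e. f (e / sqrt (1 + e\<^sup>2)) * ennreal (1 / sqrt (1 + e\<^sup>2) ^ (n + 2))) =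
  (II s. f (1 - 2 * s) * ennreal (2 ^ n * sqrt (s * (1 - s)) ^ (n - 1)) * indicator {0<..<1} s)"
proof -
 let ?r = "%s::real. sqrt (s * (1 - s))"
 let ?g = "%s. (1 - 2 * s) / (2 * ?r s)"
 have E: "sqrt (1 + (?g s)\<^sup>2) = 1 / (2 * ?r s)" "?g s / sqrt (1 + (?g s)\<^sup>2) = 1 - 2 * s"
  if "0 < s" "s < 1" for s
 proof -
  have r: "0 < ?r s" "(?r s)\<^sup>2 = s * (1 - s)" using that by auto
  have "1 + (u / (2 * r))\<^sup>2 = (4 * r\<^sup>2 + u\<^sup>2) / (2 * r)\<^sup>2" if "0 < r" for u r :: real
   using that by (simp add: power_divide power_mult_distrib field_simps)
  from this[OF r(1)] have "1 + (?g s)\<^sup>2 = (4 * (?r s)\<^sup>2 + (1 - 2 * s)\<^sup>2) / (2 * ?r s)\<^sup>2" .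
  also have "4 * (?r s)\<^sup>2 + (1 - 2 * s)\<^sup>2 = 1"
   unfolding r by (simp add: power2_eq_square algebra_simps)
  finally show "sqrt (1 + (?g s)\<^sup>2) = 1 / (2 * ?r s)"
   using r(1) by (simp only: real_sqrt_divide real_sqrt_abs real_sqrt_one)
  then show "?g s / sqrt (1 + (?g s)\<^sup>2) = 1 - 2 * s" using that by simp
 qed
 have "(II e. f (e / sqrt (1 + e\<^sup>2)) * ennreal (1 / sqrt (1 + e\<^sup>2) ^ (n + 2)) * indicator UNIV e) =
   (II s. f (?g s / sqrt (1 + (?g s)\<^sup>2)) * ennreal (1 / sqrt (1 + (?g s)\<^sup>2) ^ (n + 2)) * ennreal \<bar>- 1 / (4 * ?r s ^ 3)\<bar> * indicator {0<..<1} s)"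
 proof (rule nn_integral_change_of_variables)
  show "bij_betw ?g {0<..<1} UNIV"
  proof (rule bij_betw_byWitness[where f'="%e. (1 - e / sqrt (1 + e\<^sup>2)) / 2"])
   show "\<forall>s\<in>{0<..<1}. (1 - ?g s / sqrt (1 + (?g s)\<^sup>2)) / 2 = s"
    using E(2) by simp
   have lt: "\<bar>e\<bar> < sqrt (1 + e\<^sup>2)" for e :: real
    by (rule real_less_rsqrt) simp
   show "(%e. (1 - e / sqrt (1 + e\<^sup>2)) / 2) ` UNIV \<subseteq> {0<..<1}"
   proof clarsimp
    fix e :: real
    have q: "0 < sqrt (1 + e\<^sup>2)" by (simp add: add_pos_nonneg)
    have "e < sqrt (1 + e\<^sup>2)" "- sqrt (1 + e\<^sup>2) < e" using lt[of e] by linarith+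
    then show "e / sqrt (1 + e\<^sup>2) < 1 \<and> - 1 < e / sqrt (1 + e\<^sup>2)"
     using q by (simp only: pos_divide_less_eq pos_less_divide_eq) simp
   qed
   show "\<forall>e\<in>UNIV. ?g ((1 - e / sqrt (1 + e\<^sup>2)) / 2) = e"
   proof
    fix e :: real
    define Q where "Q = sqrt (1 + e\<^sup>2)"
    have Q: "0 < Q" "Q\<^sup>2 = 1 + e\<^sup>2" by (auto simp: Q_def add_pos_nonneg add_nonneg_nonneg)
    have "(1 - u) / 2 * (1 - (1 - u) / 2) = (1 - u\<^sup>2) / 4" for u :: real
     by (simp add: power2_eq_square field_simps)
    note this[of "e / Q"]
    also have "1 - (e / Q)\<^sup>2 = (Q\<^sup>2 - e\<^sup>2) / Q\<^sup>2"
     using Q(1) by (simp add: power_divide diff_divide_distrib)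
    also have "Q\<^sup>2 - e\<^sup>2 = 1" using Q(2) by simp
    also have "1 / Q\<^sup>2 = (1 / Q)\<^sup>2" by (simp add: power_divide)
    also have "(1 / Q)\<^sup>2 / 4 = (1 / Q / 2)\<^sup>2" by (simp add: power_divide)
    finally have "sqrt ((1 - e / Q) / 2 * (1 - (1 - e / Q) / 2)) = (1 / Q) / 2"
     using Q(1) by (simp only: real_sqrt_abs) simp
    moreover have "1 - 2 * ((1 - u) / 2) = u" for u :: real by (simp add: field_simps)
    ultimately show "?g ((1 - e / sqrt (1 + e\<^sup>2)) / 2) = e"
     using Q(1) by (simp only: Q_def[symmetric]) simp
   qed
  qed simp
  show "(?g has_real_derivative - 1 / (4 * ?r s ^ 3)) (at s)" if "s \<in> {0<..<1}" for s
  proof -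
   have r: "0 < ?r s" "(?r s)\<^sup>2 = s * (1 - s)" using that by auto
   have "(sqrt has_real_derivative inverse (?r s) / 2) (at (s * (1 - s)))"
    using that by (intro DERIV_real_sqrt) simp
   moreover have "((%s::real. s * (1 - s)) has_real_derivative 1 - 2 * s) (at s)"
    by (auto intro!: derivative_eq_intros)
   ultimately have "(?r has_real_derivative inverse (?r s) / 2 * (1 - 2 * s)) (at s)"
    by (rule DERIV_chain2)
   then have "((%s. 2 * ?r s) has_real_derivative 2 * (inverse (?r s) / 2 * (1 - 2 * s))) (at s)"
    by (rule DERIV_cmult)
   moreover have "((%s::real. 1 - 2 * s) has_real_derivative - 2) (at s)"
    by (auto intro!: derivative_eq_intros)
   ultimately have "(?g has_real_derivative (- 2 * (2 * ?r s) - (1 - 2 * s) * (2 * (inverse (?r s) / 2 * (1 - 2 * s)))) / (2 * ?r s * (2 * ?r s))) (at s)"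
    using r by (intro DERIV_divide) auto
   also have "(- 2 * (2 * ?r s) - (1 - 2 * s) * (2 * (inverse (?r s) / 2 * (1 - 2 * s)))) / (2 * ?r s * (2 * ?r s))
    = - (4 * (?r s)\<^sup>2 + (1 - 2 * s)\<^sup>2) / (4 * ?r s ^ 3)"
   proof -
    have "(- 2 * (2 * r) - u * (2 * (inverse r / 2 * u))) / (2 * r * (2 * r)) = - (4 * r\<^sup>2 + u\<^sup>2) / (4 * r ^ 3)"
     if "0 < r" for r u :: real
     using that by (simp add: field_simps power2_eq_square power3_eq_cube)
    from this[OF r(1)] show ?thesis .
   qed
   also have "4 * (?r s)\<^sup>2 + (1 - 2 * s)\<^sup>2 = 1"
    unfolding r by (simp add: power2_eq_square algebra_simps)
   finally show ?thesis .
  qed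
 qed measurable
 also have "... = (II s. f (1 - 2 * s) * ennreal (2 ^ n * ?r s ^ (n - 1)) * indicator {0<..<1} s)"
 proof (rule nn_integral_cong, goal_cases)
  case (1 s)
  show ?case
  proof (cases "s \<in> {0<..<1}")
   case True
   then have s: "0 < s" "s < 1" by auto
   have r: "0 < ?r s" using s by auto
   obtain m where m: "n = Suc m" using n by (cases n) auto
   have "1 / (1 / (2 * r)) ^ (n + 2) * \<bar>- 1 / (4 * r ^ 3)\<bar> = 2 ^ n * r ^ (n - 1)" if "0 < r" for r :: real
    unfolding m using that by (simp add: power_mult_distrib power_divide power3_eq_cube field_simps)
   from this[OF r] have "ennreal (1 / (1 / (2 * ?r s)) ^ (n + 2)) * ennreal \<bar>- 1 / (4 * ?r s ^ 3)\<bar> = ennreal (2 ^ n * ?r s ^ (n - 1))"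
    by (simp only: ennreal_mult''[symmetric] abs_ge_zero)
   then show ?thesis using True unfolding E(2)[OF s] unfolding E(1)[OF s] mult.assoc by simp
  qed simp
 qed
 finally show ?thesis by simp
qed

section \<open>Latitude distribution of surface measure and potentials of zonal densities\<close>

definition kern :: "real ^ 'n::finite => real ^ 'n => ennreal" where
 "kern x y = inverse (ennreal (norm (x - y) ^ (CARD('n) - 2)))"

lemma borel_measurable_kern [measurable]:
 assumes [measurable]: "f \<in> borel_measurable M" "g \<in> borel_measurable M"
 shows "(%x. kern (f x) (g x)) \<in> borel_measurable M"
 unfolding kern_def by measurable

lemma kern_commute: "kern x y = kern y x"
 by (simp add: kern_def norm_minus_commute)

lemma sets_surface_measure [measurable_cong]: "sets surface_measure = sets sphere_borel"
 by (simp add: surface_measure_def)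

lemma AE_surface_norm: "AE x in surface_measure. norm x = 1"
 by (rule AE_I2) (auto simp: surface_measure_def space_scale_measure space_restrict_space)

lemma nn_integral_surface_isometry:
 fixes f :: "real ^ 'n::finite => ennreal" and T :: "real ^ 'n => real ^ 'n"
 assumes [measurable]: "f \<in> borel_measurable borel"
  and T: "linear T" "!!x. norm (T x) = norm x"
 shows "(\<integral>\<^sup>+x. f (T x) \<partial>surface_measure) = (\<integral>\<^sup>+x. f x \<partial>surface_measure)"
proof -
 have [measurable]: "T \<in> borel_measurable borel"
  by (intro borel_measurable_continuous_onI linear_continuous_on linear_conv_bounded_linear[THEN iffD1] T)
 have sgnT: "T (sgn z) = sgn (T z)" for z
  by (simp add: sgn_div_norm T linear_cmul)
 have [measurable]: "ball 0 1 - {0} \<in> sets (borel :: (real^'n) measure)" by simp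
 have "(II z. f (T (sgn z)) * indicator (ball 0 1 - {0}) z) =
  (II z. f (sgn (T z)) * indicator (ball 0 1 - {0}) (T z))"
  by (intro nn_integral_cong) (auto simp: sgnT indicator_def T norm_eq_zero[of "T _", symmetric] simp del: norm_eq_zero, (simp add: T)+)
 also have "... = (\<integral>\<^sup>+z. f (sgn z) * indicator (ball 0 1 - {0}) z \<partial>distr lborel borel T)"
  by (subst nn_integral_distr) measurable
 also have "distr lborel borel T = lborel"
  using T by (rule lborel_distr_linear_isometry)
 finally show ?thesis
  by (subst (1 2) nn_integral_surface_measure) auto
qed

text \<open>The reflection in the hyperplane orthogonal to x - y exchanges two vectors of equal
  length, and it fixes coordinate k because x - y has a zero there.\<close>

lemma exists_isometry_fixing_coordinate:
 fixes x y :: "real ^ 'n::finite"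
 assumes "norm x = norm y" "x $ k = y $ k"
 obtains T where "linear T" "!!v. norm (T v) = norm v" "!!v. T v $ k = v $ k" "T x = y"
proof -
 define w where "w = x - y"
 define T where "T = (%v. v - (2 * (v \<bullet> w) / (w \<bullet> w)) *\<^sub>R w)"
 have "linear T"
  by (rule linearI) (simp_all add: T_def inner_add_left algebra_simps add_divide_distrib)
 moreover have "norm (T v) = norm v" for v
 proof (cases "w = 0")
  case False
  then have "w \<bullet> w ~= 0" by simp
  then have "T v \<bullet> T v = v \<bullet> v"
   by (simp add: T_def inner_diff_left inner_diff_right inner_commute field_simps power2_eq_square)
  then show ?thesis by (simp add: norm_eq_sqrt_inner)
 qed (simp add: T_def)
 moreover have "T v $ k = v $ k" for v
  using assms(2) by (simp add: T_def w_def)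
 moreover have "T x = y"
 proof (cases "w = 0")
  case False
  then have nz: "w \<bullet> w ~= 0" by simp
  have "x \<bullet> x = y \<bullet> y" using assms(1) by (simp add: norm_eq_sqrt_inner)
  then have "2 * (x \<bullet> w) = w \<bullet> w"
   by (simp add: w_def inner_diff_left inner_diff_right inner_commute)
  then show ?thesis using nz by (simp add: T_def w_def)
 qed (simp add: T_def w_def)
 ultimately show thesis by (rule that)
qed

lemma nn_integral_Beta:
 fixes a b l r :: real
 assumes ab: "0 < a" "0 < b" and lr: "l < r"
 shows "(II t. ennreal ((t - l) powr (a - 1) * (r - t) powr (b - 1)) * indicator {l<..<r} t) =
  ennreal ((r - l) powr (a + b - 1) * Beta a b)"
proof -
 let ?d = "r - l"
 have d: "0 < ?d" using lr by simp
 have "((%t. t powr (a - 1) * (1 - t) powr (b - 1)) has_integral Beta a b) {0<..<1}"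
  using has_integral_Beta_real[of a b] ab by (simp add: has_integral_Icc_iff_Ioo)
 from nn_integral_has_integral_lebesgue'[OF _ this]
 have beta: "(II t. ennreal (t powr (a - 1) * (1 - t) powr (b - 1)) * indicator {0<..<1} t) = ennreal (Beta a b)"
  by simp
 have "(II t. ennreal ((t - l) powr (a - 1) * (r - t) powr (b - 1)) * indicator {l<..<r} t) =
  ennreal ?d * (II t. ennreal ((?d * t) powr (a - 1) * (?d - ?d * t) powr (b - 1)) * indicator {l<..<r} (l + ?d * t))"
  using d by (subst nn_integral_real_affine[where c="?d" and t=l]) (auto simp: algebra_simps)
 also have "... = ennreal ?d * (II t. ennreal (?d powr (a + b - 2)) * (ennreal (t powr (a - 1) * (1 - t) powr (b - 1)) * indicator {0<..<1} t))"
 proof (rule arg_cong2[where f="(*)", OF refl], rule nn_integral_cong)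
  fix t :: real
  have ind: "l + ?d * t \<in> {l<..<r} \<longleftrightarrow> t \<in> {0<..<1}"
  proof -
   have "l + ?d * t < r \<longleftrightarrow> ?d * t < ?d * 1"
    by (simp only: mult_1_right less_diff_eq add.commute)
   then show ?thesis using d by (simp only: greaterThanLessThan_iff mult_less_cancel_left_pos) (simp add: zero_less_mult_iff)
  qed
  have "(?d * t) powr (a - 1) * (?d - ?d * t) powr (b - 1) = ?d powr (a + b - 2) * (t powr (a - 1) * (1 - t) powr (b - 1))" if "t \<in> {0<..<1}"
  proof -
   have "?d - ?d * t = ?d * (1 - t)" by (simp add: algebra_simps)
   then have "(?d * t) powr (a - 1) * (?d - ?d * t) powr (b - 1) = (?d powr (a - 1) * ?d powr (b - 1)) * (t powr (a - 1) * (1 - t) powr (b - 1))"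
    using that d by (simp only: powr_mult) (simp add: powr_mult mult_ac)
   also have "?d powr (a - 1) * ?d powr (b - 1) = ?d powr (a + b - 2)"
    by (simp add: powr_add[symmetric])
   finally show ?thesis .
  qed
  then show "ennreal ((?d * t) powr (a - 1) * (?d - ?d * t) powr (b - 1)) * indicator {l<..<r} (l + ?d * t) =
   ennreal (?d powr (a + b - 2)) * (ennreal (t powr (a - 1) * (1 - t) powr (b - 1)) * indicator {0<..<1} t)"
   using ind by (auto simp: indicator_def ennreal_mult[symmetric])
 qed
 also have "... = ennreal ?d * (ennreal (?d powr (a + b - 2)) * ennreal (Beta a b))"
  by (subst nn_integral_cmult) (simp_all add: beta)
 also have "... = ennreal (?d powr (a + b - 1) * Beta a b)"
 proof -
  have "D * D powr (a + b - 2) = D powr (a + b - 1)" if "0 < D" for D :: real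
   using that powr_add[of D 1 "a + b - 2"] by simp
  note E = this[OF d]
  have "ennreal ?d * (ennreal (?d powr (a + b - 2)) * ennreal (Beta a b)) = ennreal (?d * ?d powr (a + b - 2) * Beta a b)"
   using d by (simp add: ennreal_mult' mult.assoc)
  then show ?thesis unfolding E .
 qed
 finally show ?thesis .
qed

lemma powr_half_nat: "0 <= x ==> 0 < n ==> x powr (real n / 2) = sqrt x ^ n"
 by (cases "x = 0") (simp_all add: zero_power powr_half_sqrt[symmetric] powr_power)

text \<open>With c = cot phi this is the integral of sin^(n-1)(phi) over (0, pi), the total
  azimuthal mass.\<close>

lemma nn_integral_cauchy_power:
 assumes n: "0 < n"
 shows "(II c. ennreal (1 / sqrt (1 + c\<^sup>2) ^ (n + 1))) = ennreal (Beta (real n / 2) (1 / 2))"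
proof -
 let ?f = "%u. ennreal (1 / sqrt (1 + u) ^ (n + 1))"
 let ?g = "%v::real. 1 / v - 1"
 have "(II c. ?f (c\<^sup>2)) = (II u. ?f u * ennreal (1 / sqrt u) * indicator {0<..} u)"
  by (rule nn_integral_even_square) measurable
 also have "... = (II v. ?f (?g v) * ennreal (1 / sqrt (?g v)) * ennreal \<bar>- 1 / v\<^sup>2\<bar> * indicator {0<..<1} v)"
 proof (rule nn_integral_change_of_variables)
  show "bij_betw ?g {0<..<1} {0<..}"
   by (rule bij_betw_byWitness[where f'="%u. 1 / (1 + u)"]) (auto simp: field_simps)
  show "(?g has_real_derivative - 1 / v\<^sup>2) (at v)" if "v \<in> {0<..<1}" for v
   using that by (auto intro!: derivative_eq_intros simp: field_simps power2_eq_square)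
 qed measurable
 also have "... = (II v. ennreal ((v - 0) powr (real n / 2 - 1) * (1 - v) powr (1 / 2 - 1)) * indicator {0<..<1} v)"
 proof (rule nn_integral_cong, goal_cases)
  case (1 v)
  show ?case
  proof (cases "v \<in> {0<..<1}")
   case True
   then have v: "0 < v" "v < 1" by auto
   have "?g v = (1 - v) / v" using v by (simp add: field_simps)
   then have e1: "1 / sqrt (?g v) = sqrt v / sqrt (1 - v)" by (simp add: real_sqrt_divide)
   have "1 + ?g v = 1 / v" by simp
   then have e2: "1 / sqrt (1 + ?g v) ^ (n + 1) = sqrt v ^ n * sqrt v"
    using v by (simp add: real_sqrt_divide power_divide)
   have e3: "\<bar>- 1 / v\<^sup>2\<bar> = 1 / (v * v)" using v by (simp add: power2_eq_square)
   have "1 / sqrt (1 + ?g v) ^ (n + 1) * (1 / sqrt (?g v)) * \<bar>- 1 / v\<^sup>2\<bar> =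
     (sqrt v ^ n / v) * (sqrt v * sqrt v / v) * (1 / sqrt (1 - v))"
    unfolding e1 e2 e3 by (simp add: mult_ac del: real_sqrt_mult_self)
   also have "sqrt v * sqrt v / v = 1" using v by simp
   also have "sqrt v ^ n / v = v powr (real n / 2 - 1)"
    using v n by (simp add: powr_diff powr_half_nat)
   also have "1 / sqrt (1 - v) = (1 - v) powr (1 / 2 - 1)"
    using v by (simp add: powr_minus_divide powr_half_sqrt)
   finally have "1 / sqrt (1 + ?g v) ^ (n + 1) * (1 / sqrt (?g v)) * \<bar>- 1 / v\<^sup>2\<bar> =
    (v - 0) powr (real n / 2 - 1) * (1 - v) powr (1 / 2 - 1)" by simp
   moreover have "0 <= 1 / sqrt (?g v)" using v by simp
   ultimately show ?thesis using True
    by (simp only: indicator_simps mult_1_right if_True ennreal_mult'[symmetric] ennreal_mult''[symmetric] abs_ge_zero)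
  qed simp
 qed
 also have "... = ennreal ((1 - 0) powr (real n / 2 + 1 / 2 - 1) * Beta (real n / 2) (1 / 2))"
  using n by (intro nn_integral_Beta) auto
 finally show ?thesis by simp
qed

lemma exists_other_index:
 fixes k :: "'n::finite"
 assumes "3 <= CARD('n)"
 obtains j where "k ~= j"
proof -
 have "\<exists>j::'n. k ~= j"
 proof (rule ccontr)
  assume "\<not> (\<exists>j. k ~= j)"
  then have "(UNIV :: 'n set) = {k}" by auto
  then have "CARD('n) = card {k}" by simp
  with assms show False by simp
 qed
 with that show thesis by blast
qed

text \<open>For a function of latitude the azimuth integrates out to a Beta value, and the latitude
  density is proportional to (s (1 - s))^((n-1)/2).\<close>

lemma nn_integral_surface_profile:
 fixes k :: "'n::finite" and h :: "real => ennreal"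
 assumes n: "CARD('n) = n + 2" "0 < n"
  and [measurable]: "h \<in> borel_measurable borel"
 shows "(\<integral>\<^sup>+x. h ((1 - x $ k) / 2) \<partial>(surface_measure :: (real ^ 'n) measure)) =
  (II s. h s * ennreal (real n * unit_ball_vol n * Beta (real n / 2) (1 / 2) * 2 ^ n * sqrt (s * (1 - s)) ^ (n - 1)) *
   indicator {0<..<1} s)"
proof -
 let ?K = "real n * unit_ball_vol n" and ?B = "Beta (real n / 2) (1 / 2)"
 have K: "0 <= ?K" by simp
 have B: "0 <= ?B" using n by (simp add: Beta_def Gamma_real_pos less_imp_le)
 have "3 <= CARD('n)" using n by simp
 then obtain j where kj: "k ~= j" by (rule exists_other_index)
 have "(\<integral>\<^sup>+x. h ((1 - x $ k) / 2) \<partial>(surface_measure :: (real ^ 'n) measure)) =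
  (\<integral>\<^sup>+x. (%p. h ((1 - fst p) / 2)) (x $ k, x $ j) \<partial>(surface_measure :: (real ^ 'n) measure))"
  by simp
 also have "... = (II e. II c. (%p. h ((1 - fst p) / 2)) (e / sqrt (1 + e\<^sup>2), c / (sqrt (1 + c\<^sup>2) * sqrt (1 + e\<^sup>2))) *
    ennreal (?K / (sqrt (1 + c\<^sup>2) ^ (n + 1) * sqrt (1 + e\<^sup>2) ^ (n + 2))))"
  by (rule nn_integral_surface_two_coords[OF kj n]) (unfold borel_prod[symmetric], measurable)
 also have "... = (II e. II c. h ((1 - e / sqrt (1 + e\<^sup>2)) / 2) * ennreal (?K / sqrt (1 + e\<^sup>2) ^ (n + 2)) *
    ennreal (1 / sqrt (1 + c\<^sup>2) ^ (n + 1)))"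
 proof (rule nn_integral_cong, rule nn_integral_cong)
  fix e c :: real
  have "ennreal (?K / (sqrt (1 + c\<^sup>2) ^ (n + 1) * sqrt (1 + e\<^sup>2) ^ (n + 2))) =
    ennreal (?K / sqrt (1 + e\<^sup>2) ^ (n + 2)) * ennreal (1 / sqrt (1 + c\<^sup>2) ^ (n + 1))"
   by (subst ennreal_mult''[symmetric]) auto
  then show "(%p. h ((1 - fst p) / 2)) (e / sqrt (1 + e\<^sup>2), c / (sqrt (1 + c\<^sup>2) * sqrt (1 + e\<^sup>2))) *
    ennreal (?K / (sqrt (1 + c\<^sup>2) ^ (n + 1) * sqrt (1 + e\<^sup>2) ^ (n + 2))) =
   h ((1 - e / sqrt (1 + e\<^sup>2)) / 2) * ennreal (?K / sqrt (1 + e\<^sup>2) ^ (n + 2)) * ennreal (1 / sqrt (1 + c\<^sup>2) ^ (n + 1))"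
   by (simp only: fst_conv mult.assoc)
 qed
 also have "... = (II e. h ((1 - e / sqrt (1 + e\<^sup>2)) / 2) * ennreal (?K / sqrt (1 + e\<^sup>2) ^ (n + 2)) * ennreal ?B)"
  by (subst nn_integral_cmult, measurable, subst nn_integral_cauchy_power[OF n(2)]) simp
 also have "... = (II e. (h ((1 - e / sqrt (1 + e\<^sup>2)) / 2) * ennreal (?K * ?B)) * ennreal (1 / sqrt (1 + e\<^sup>2) ^ (n + 2)))"
 proof (rule nn_integral_cong, goal_cases)
  case (1 e)
  have "?K / X * ?B = ?K * ?B * (1 / X)" for X by simp
  then have "ennreal (?K / sqrt (1 + e\<^sup>2) ^ (n + 2)) * ennreal ?B = ennreal (?K * ?B) * ennreal (1 / sqrt (1 + e\<^sup>2) ^ (n + 2))"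
   using B K by (simp only: ennreal_mult''[symmetric] ennreal_mult'[symmetric] mult_nonneg_nonneg)
  then show ?case
   by (simp only: mult.assoc)
 qed
 also have "... = (II s. (h ((1 - (1 - 2 * s)) / 2) * ennreal (?K * ?B)) * ennreal (2 ^ n * sqrt (s * (1 - s)) ^ (n - 1)) * indicator {0<..<1} s)"
  by (rule nn_integral_polar_substitution[where f="%u. h ((1 - u) / 2) * ennreal (?K * ?B)"]) (use n in measurable)
 also have "... = (II s. h s * ennreal (?K * ?B * 2 ^ n * sqrt (s * (1 - s)) ^ (n - 1)) * indicator {0<..<1} s)"
 proof (rule nn_integral_cong, goal_cases)
  case (1 s)
  have "ennreal (?K * ?B) * ennreal (2 ^ n * sqrt (s * (1 - s)) ^ (n - 1)) = ennreal (?K * ?B * 2 ^ n * sqrt (s * (1 - s)) ^ (n - 1))"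
   using B K by (subst ennreal_mult'[symmetric]) (auto simp: mult_ac)
  then show ?case
   by (simp add: mult.assoc)
 qed
 finally show ?thesis .
qed

text \<open>If y lies in the plane of the axes k and j, then x . y involves two coordinates of x
  only and the two-coordinate formula applies. Its inner integral over c is the average of the
  kernel over a parallel, evaluated by \<open>copson_factorization\<close>.\<close>

lemma surface_potential_plane:
 fixes k j :: "'n::finite" and h :: "real => ennreal" and y :: "real ^ 'n"
 assumes n: "CARD('n) = n + 2" "0 < n" and kj: "k ~= j"
  and [measurable]: "h \<in> borel_measurable borel"
  and t: "0 < t" "t < 1"
  and y: "y = axis k (1 - 2 * t) + axis j (2 * sqrt (t * (1 - t)))"
 shows "(\<integral>\<^sup>+x. h ((1 - x $ k) / 2) * kern x y \<partial>surface_measure) =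
  (II s. h s * ennreal (real n * unit_ball_vol n * sqrt (s * (1 - s)) ^ (n - 1) / sqrt (s * t) ^ (n - 1)) *
   (II w. ennreal (copson_kernel n s t w) * indicator {0<..<min s t} w) * indicator {0<..<1} s)"
proof -
 let ?K = "real n * unit_ball_vol n"
 have K: "0 <= ?K" by simp
 let ?y2 = "2 * sqrt (t * (1 - t))"
 have inner: "x \<bullet> y = x $ k * (1 - 2 * t) + x $ j * ?y2" for x
  unfolding y by (simp add: inner_add_right inner_axis)
 have yy: "y \<bullet> y = 1"
 proof -
  have "y $ k = 1 - 2 * t" "y $ j = ?y2" unfolding y using kj by (auto simp: axis_def)
  then have "y \<bullet> y = (1 - 2 * t)\<^sup>2 + ?y2\<^sup>2" unfolding inner by (simp add: power2_eq_square)
  also have "... = 1" using t by (simp add: power_mult_distrib) (simp add: power2_eq_square algebra_simps)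
  finally show ?thesis .
 qed
 define D where "D = (%u v::real. 1 / sqrt (2 - 2 * (u * (1 - 2 * t) + v * ?y2)) ^ n)"
 define P where "P = (%p::real \<times> real. h ((1 - fst p) / 2) * inverse (ennreal (sqrt (2 - 2 * (fst p * (1 - 2 * t) + snd p * ?y2)) ^ n)))"
 have [measurable]: "P \<in> borel_measurable borel"
  unfolding P_def borel_prod[symmetric] by measurable
 have "(\<integral>\<^sup>+x. h ((1 - x $ k) / 2) * kern x y \<partial>surface_measure) =
  (\<integral>\<^sup>+x. P (x $ k, x $ j) \<partial>surface_measure)"
 proof (rule nn_integral_cong_AE, goal_cases)
  case 1
  show ?case
   using AE_surface_norm
  proof eventually_elim
   case (elim x)
   have "norm (x - y) = sqrt (2 - 2 * (x \<bullet> y))"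
    using elim yy by (simp add: norm_eq_sqrt_inner inner_diff_left inner_diff_right inner_commute)
   then show ?case by (simp add: P_def kern_def n inner)
  qed
 qed
 also have "... = (II e. II c. P (e / sqrt (1 + e\<^sup>2), c / (sqrt (1 + c\<^sup>2) * sqrt (1 + e\<^sup>2))) *
    ennreal (?K / (sqrt (1 + c\<^sup>2) ^ (n + 1) * sqrt (1 + e\<^sup>2) ^ (n + 2))))"
  by (rule nn_integral_surface_two_coords[OF kj n]) measurable
 also have "... = (II e. (%u. II c. P (u, c / sqrt (1 + c\<^sup>2) * sqrt (1 - u\<^sup>2)) *
    ennreal (?K / sqrt (1 + c\<^sup>2) ^ (n + 1))) (e / sqrt (1 + e\<^sup>2)) * ennreal (1 / sqrt (1 + e\<^sup>2) ^ (n + 2)))"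
 proof (rule nn_integral_cong, goal_cases)
  case (1 e)
  have E: "0 < sqrt (1 + e\<^sup>2)" "1 + e\<^sup>2 ~= 0" by (auto simp: add_pos_nonneg add_nonneg_eq_0_iff)
  have "1 - (e / sqrt (1 + e\<^sup>2))\<^sup>2 = 1 / (1 + e\<^sup>2)"
   using E by (simp add: power_divide field_simps)
  then have "sqrt (1 - (e / sqrt (1 + e\<^sup>2))\<^sup>2) = 1 / sqrt (1 + e\<^sup>2)"
   by (simp add: real_sqrt_divide)
  then have 1: "c / (sqrt (1 + c\<^sup>2) * sqrt (1 + e\<^sup>2)) = c / sqrt (1 + c\<^sup>2) * sqrt (1 - (e / sqrt (1 + e\<^sup>2))\<^sup>2)" for c
   by simp
  have 2: "ennreal (?K / (sqrt (1 + c\<^sup>2) ^ (n + 1) * sqrt (1 + e\<^sup>2) ^ (n + 2))) =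
    ennreal (?K / sqrt (1 + c\<^sup>2) ^ (n + 1)) * ennreal (1 / sqrt (1 + e\<^sup>2) ^ (n + 2))" for c
   by (subst ennreal_mult''[symmetric]) auto
  show ?case
   unfolding 2 1 mult.assoc[symmetric]
   by (rule nn_integral_multc) measurable
 qed
 also have "... = (II s. (%u. II c. P (u, c / sqrt (1 + c\<^sup>2) * sqrt (1 - u\<^sup>2)) *
    ennreal (?K / sqrt (1 + c\<^sup>2) ^ (n + 1))) (1 - 2 * s) * ennreal (2 ^ n * sqrt (s * (1 - s)) ^ (n - 1)) * indicator {0<..<1} s)"
  by (rule nn_integral_polar_substitution) (use n in measurable)
 also have "... = (II s. h s * ennreal (?K * sqrt (s * (1 - s)) ^ (n - 1) / sqrt (s * t) ^ (n - 1)) *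
   (II w. ennreal (copson_kernel n s t w) * indicator {0<..<min s t} w) * indicator {0<..<1} s)"
 proof (rule nn_integral_cong_AE, rule AE_mp[OF AE_lborel_singleton[of t]], rule AE_I2, rule impI)
  fix s :: real assume "s ~= t"
  let ?L = "\<integral>\<^sup>+c. P (1 - 2 * s, c / sqrt (1 + c\<^sup>2) * sqrt (1 - (1 - 2 * s)\<^sup>2)) *
    ennreal (?K / sqrt (1 + c\<^sup>2) ^ (n + 1)) \<partial>lborel"
  let ?J = "\<integral>\<^sup>+w. ennreal (copson_kernel n s t w) * indicator {0<..<min s t} w \<partial>lborel"
  show "(%u. II c. P (u, c / sqrt (1 + c\<^sup>2) * sqrt (1 - u\<^sup>2)) *
    ennreal (?K / sqrt (1 + c\<^sup>2) ^ (n + 1))) (1 - 2 * s) * ennreal (2 ^ n * sqrt (s * (1 - s)) ^ (n - 1)) * indicator {0<..<1} s =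
   h s * ennreal (?K * sqrt (s * (1 - s)) ^ (n - 1) / sqrt (s * t) ^ (n - 1)) * ?J * indicator {0<..<1} s"
  proof (cases "s \<in> {0<..<1}")
   case True
   then have s: "0 < s" "s < 1" by auto
   let ?R = "%c. s * (1 - t) + t * (1 - s) - 2 * sqrt (s * (1 - t)) * sqrt (t * (1 - s)) * (c / sqrt (1 + c\<^sup>2))"
   \<comment> \<open>Off the parallel of y the distance to y is positive, by Cauchy-Schwarz made
     strict by s different from t.\<close>
   have Rpos: "0 < ?R c" for c
   proof -
    have "\<bar>c\<bar> < sqrt (1 + c\<^sup>2)" by (rule real_less_rsqrt) simp
    then have "c / sqrt (1 + c\<^sup>2) <= 1" by (subst pos_divide_le_eq) (auto simp: add_pos_nonneg)
    then have "2 * sqrt (s * (1 - t)) * sqrt (t * (1 - s)) * (c / sqrt (1 + c\<^sup>2)) <= 2 * sqrt (s * (1 - t)) * sqrt (t * (1 - s)) * 1"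
     using s t by (intro mult_left_mono) auto
    moreover have "sqrt (s * (1 - t)) ~= sqrt (t * (1 - s))"
     using \<open>s ~= t\<close> by (simp add: algebra_simps)
    then have "0 < (sqrt (s * (1 - t)) - sqrt (t * (1 - s)))\<^sup>2" by simp
    then have "0 < s * (1 - t) + t * (1 - s) - 2 * sqrt (s * (1 - t)) * sqrt (t * (1 - s)) * 1"
     using s t by (simp add: power2_diff)
    ultimately show ?thesis by linarith
   qed
   have R: "2 - 2 * ((1 - 2 * s) * (1 - 2 * t) + c / sqrt (1 + c\<^sup>2) * sqrt (1 - (1 - 2 * s)\<^sup>2) * ?y2) = 2\<^sup>2 * ?R c" for c
   proof -
    have "1 - (1 - 2 * s)\<^sup>2 = 2\<^sup>2 * (s * (1 - s))" by (simp add: power2_eq_square algebra_simps)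
    then have "sqrt (1 - (1 - 2 * s)\<^sup>2) = 2 * sqrt (s * (1 - s))"
     using s by (simp only: real_sqrt_mult real_sqrt_abs)
    moreover have "sqrt (s * (1 - t)) * sqrt (t * (1 - s)) = sqrt (s * (1 - s)) * sqrt (t * (1 - t))"
     by (simp add: real_sqrt_mult)
    then have "2 * sqrt (s * (1 - t)) * sqrt (t * (1 - s)) * X = 2 * (sqrt (s * (1 - s)) * sqrt (t * (1 - t))) * X" for X
     by simp
    ultimately show ?thesis by (simp only:) (simp add: algebra_simps)
   qed
   have "?L = (II c. (h s * ennreal (?K / 2 ^ n)) * ennreal (1 / (sqrt (1 + c\<^sup>2) ^ (n + 1) * sqrt (?R c) ^ n)))"
   proof (rule nn_integral_cong)
    fix c :: real
    have "sqrt (2\<^sup>2 * ?R c) ^ n = 2 ^ n * sqrt (?R c) ^ n"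
     by (simp only: real_sqrt_mult real_sqrt_abs power_mult_distrib)
    moreover have "inverse (ennreal (2 ^ n * sqrt (?R c) ^ n)) = ennreal (1 / (2 ^ n * sqrt (?R c) ^ n))"
     using Rpos[of c] by (subst inverse_ennreal) (auto simp: inverse_eq_divide)
    ultimately have "P (1 - 2 * s, c / sqrt (1 + c\<^sup>2) * sqrt (1 - (1 - 2 * s)\<^sup>2)) = h s * ennreal (1 / (2 ^ n * sqrt (?R c) ^ n))"
     unfolding P_def fst_conv snd_conv R by simp
    moreover have "1 / (2 ^ n * X) * (?K / Y) = ?K / 2 ^ n * (1 / (Y * X))" for X Y :: real by simp
    from this[of "sqrt (?R c) ^ n" "sqrt (1 + c\<^sup>2) ^ (n + 1)"]
    have "ennreal (1 / (2 ^ n * sqrt (?R c) ^ n)) * ennreal (?K / sqrt (1 + c\<^sup>2) ^ (n + 1)) =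
      ennreal (?K / 2 ^ n) * ennreal (1 / (sqrt (1 + c\<^sup>2) ^ (n + 1) * sqrt (?R c) ^ n))"
     using K Rpos[of c] by (subst (1 2) ennreal_mult[symmetric]) auto
    ultimately show "P (1 - 2 * s, c / sqrt (1 + c\<^sup>2) * sqrt (1 - (1 - 2 * s)\<^sup>2)) * ennreal (?K / sqrt (1 + c\<^sup>2) ^ (n + 1)) =
     (h s * ennreal (?K / 2 ^ n)) * ennreal (1 / (sqrt (1 + c\<^sup>2) ^ (n + 1) * sqrt (?R c) ^ n))"
     by (simp only: mult.assoc)
   qed
   also have "... = (h s * ennreal (?K / 2 ^ n)) * (II c. ennreal (1 / (sqrt (1 + c\<^sup>2) ^ (n + 1) * sqrt (?R c) ^ n)))"
    by (rule nn_integral_cmult) measurable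
   also have "(II c. ennreal (1 / (sqrt (1 + c\<^sup>2) ^ (n + 1) * sqrt (?R c) ^ n))) = ennreal (1 / sqrt (s * t) ^ (n - 1)) * ?J"
    using s t n \<open>s ~= t\<close> by (intro copson_factorization) auto
   finally have L: "?L = (h s * ennreal (?K / 2 ^ n)) * (ennreal (1 / sqrt (s * t) ^ (n - 1)) * ?J)" .
   have "?K / 2 ^ n * (1 / X) * (2 ^ n * Y) = ?K * Y / X" for X Y :: real by simp
   from this[of "sqrt (s * t) ^ (n - 1)" "sqrt (s * (1 - s)) ^ (n - 1)"]
   have W: "ennreal (?K * sqrt (s * (1 - s)) ^ (n - 1) / sqrt (s * t) ^ (n - 1)) =
    ennreal (?K / 2 ^ n) * ennreal (1 / sqrt (s * t) ^ (n - 1)) * ennreal (2 ^ n * sqrt (s * (1 - s)) ^ (n - 1))"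
    using K s t by (subst ennreal_mult[symmetric], simp, simp, subst ennreal_mult[symmetric]) auto
   show ?thesis unfolding L W by (simp only: mult_ac)
  qed simp
 qed
 finally show ?thesis .
qed

text \<open>An isometry preserving latitudes moves y into the plane of two coordinate axes.\<close>

lemma surface_potential:
 fixes k :: "'n::finite" and h :: "real => ennreal" and y :: "real ^ 'n"
 assumes n: "CARD('n) = n + 2" "0 < n"
  and [measurable]: "h \<in> borel_measurable borel"
  and t: "0 < t" "t < 1" and y: "norm y = 1" "y $ k = 1 - 2 * t"
 shows "(\<integral>\<^sup>+x. h ((1 - x $ k) / 2) * kern x y \<partial>surface_measure) =
  (II s. h s * ennreal (real n * unit_ball_vol n * sqrt (s * (1 - s)) ^ (n - 1) / sqrt (s * t) ^ (n - 1)) *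
   (II w. ennreal (copson_kernel n s t w) * indicator {0<..<min s t} w) * indicator {0<..<1} s)"
proof -
 have "3 <= CARD('n)" using n by simp
 then obtain j where kj: "k ~= j" by (rule exists_other_index)
 let ?y2 = "2 * sqrt (t * (1 - t))"
 define z :: "real ^ 'n" where "z = axis k (1 - 2 * t) + axis j ?y2"
 have zk: "z $ k = 1 - 2 * t" "z $ j = ?y2" unfolding z_def using kj by (auto simp: axis_def)
 have "z \<bullet> z = (1 - 2 * t)\<^sup>2 + ?y2\<^sup>2"
  by (subst (2) z_def) (simp add: inner_add_right inner_axis zk power2_eq_square)
 also have "... = 1" using t by (simp add: power_mult_distrib) (simp add: power2_eq_square algebra_simps)
 finally have "norm y = norm z" using y by (simp add: norm_eq_sqrt_inner)
 moreover have "y $ k = z $ k" using y zk by simp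
 ultimately obtain T where T: "linear T" "!!v. norm (T v) = norm v" "!!v. T v $ k = v $ k" "T y = z"
  using exists_isometry_fixing_coordinate[of y z k] by blast
 have "(\<integral>\<^sup>+x. h ((1 - x $ k) / 2) * kern x y \<partial>surface_measure) = (\<integral>\<^sup>+x. h ((1 - T x $ k) / 2) * kern (T x) z \<partial>surface_measure)"
  by (rule nn_integral_cong) (simp add: T kern_def flip: T(4) linear_diff[OF T(1)])
 also have "... = (\<integral>\<^sup>+x. h ((1 - x $ k) / 2) * kern x z \<partial>surface_measure)"
  by (rule nn_integral_surface_isometry[where f="%x. h ((1 - x $ k) / 2) * kern x z", OF _ T(1,2)]) measurable
 also note surface_potential_plane[OF n kj _ t z_def]
 finally show ?thesis by simp
qed

section \<open>Moments and energies determine a measure on the sphere\<close>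

lemma integrable_continuous_sphere:
 fixes f :: "'a::euclidean_space => real"
 assumes M: "finite_measure M" "sets M = sets borel" "AE x in M. norm x = 1"
  and f: "continuous_on UNIV f"
 shows "integrable M f"
proof -
 interpret finite_measure M by fact
 have "compact (f ` sphere 0 1)"
  using f by (intro compact_continuous_image) (auto intro: continuous_on_subset)
 then obtain B where B: "!!x. norm x = 1 ==> norm (f x) <= B"
  using compact_imp_bounded bounded_iff by (metis image_eqI mem_sphere_0)
 have "f \<in> borel_measurable M"
  using borel_measurable_continuous_onI[OF f] M(2) by (simp cong: measurable_cong_sets)
 then show ?thesis
  using B M(3) by (intro integrable_const_bound[where B=B]) auto
qed

text \<open>The closed sets generate the Borel sets and are stable under intersection, and the
  indicator of a closed C is the limit of the tents max(0, 1 - i dist(x, C)).\<close>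

lemma measure_eqI_continuous_integrals:
 fixes M N :: "'a::euclidean_space measure"
 assumes M: "finite_measure M" "sets M = sets borel" and N: "finite_measure N" "sets N = sets borel"
  and eq: "!!f :: 'a => real. continuous_on UNIV f ==> (\<integral>x. f x \<partial>M) = (\<integral>x. f x \<partial>N)"
 shows "M = N"
proof (rule measure_eqI_generator_eq[where E="Collect closed" and \<Omega>=UNIV and A="%_. UNIV"])
 show "Int_stable (Collect closed :: 'a set set)"
  by (auto simp: Int_stable_def)
 have "sets (borel :: 'a measure) = sigma_sets UNIV (Collect closed)"
  by (subst borel_eq_closed) auto
 then show "sets M = sigma_sets UNIV (Collect closed)" "sets N = sigma_sets UNIV (Collect closed)"
  using M N by auto
 have sp: "space M = UNIV" using sets_eq_imp_space_eq[OF M(2)] by simp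
 interpret M: finite_measure M by fact
 interpret N: finite_measure N by fact
 show "emeasure M UNIV ~= \<infinity>" using M.emeasure_finite by simp
 show "emeasure M C = emeasure N C" if "C \<in> Collect closed" for C
 \<comment> \<open>By convention \<open>infdist\<close> to the empty set is 0, so the tents would
   not converge to its indicator.\<close>
 proof (cases "C = {}")
  case False
  define f where "f = (%(i::nat) x. max 0 (1 - real i * infdist x C))"
  have cont: "continuous_on UNIV (f i)" for i
   unfolding f_def by (intro continuous_intros)
  have lim: "(%i. f i x) \<longlonglongrightarrow> indicator C x" for x
  proof (cases "x \<in> C")
   case True
   then show ?thesis using False by (simp add: f_def in_closed_iff_infdist_zero)
  next
   case nin: False
   then have pos: "0 < infdist x C"
    using False that infdist_nonneg[of x C] in_closed_iff_infdist_zero[of C x] by auto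
   then obtain n where n: "1 < real n * infdist x C" using reals_Archimedean3 by blast
   have "f i x = 0" if "n <= i" for i
   proof -
    have "real n * infdist x C <= real i * infdist x C"
     using that pos by (intro mult_right_mono) auto
    then show ?thesis using n by (simp add: f_def)
   qed
   then have "eventually (%i. f i x = indicator C x) sequentially"
    using nin by (auto simp: eventually_sequentially intro!: exI[of _ n])
   then show ?thesis by (rule tendsto_eventually)
  qed
  have *: "(%i. \<integral>x. f i x \<partial>P) \<longlonglongrightarrow> measure P C" if P: "finite_measure P" "sets P = sets borel" for P
  proof -
   interpret P: finite_measure P by fact
   have C: "C \<in> sets P" using that P \<open>C \<in> Collect closed\<close> by simp
   have m: "f i \<in> borel_measurable P" for i
    using borel_measurable_continuous_onI[OF cont] P(2) by (simp cong: measurable_cong_sets)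
   have "(%i. \<integral>x. f i x \<partial>P) \<longlonglongrightarrow> (\<integral>x. indicator C x \<partial>P)"
    by (rule integral_dominated_convergence[where w="%_. 1"])
      (use lim C m in \<open>auto simp: f_def infdist_nonneg\<close>)
   then show ?thesis using C by simp
  qed
  have "measure M C = measure N C"
   using *[OF M] *[OF N] eq[OF cont] LIMSEQ_unique by simp
  then show ?thesis by (simp add: M.emeasure_eq_measure N.emeasure_eq_measure)
 qed simp
qed auto

text \<open>A monomial is a word of basis vectors and not an exponent vector. Expanding a power of
  an inner product then produces every word exactly once, without multinomial coefficients.\<close>

definition monomial_fun :: "'a::euclidean_space list => 'a => real" where
 "monomial_fun l x = (\<Prod>b\<leftarrow>l. x \<bullet> b)"

lemma continuous_monomial_fun [continuous_intros]: "continuous_on S (monomial_fun l)"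
 unfolding monomial_fun_def by (induction l) (auto intro!: continuous_intros)

text \<open>By Stone-Weierstrass the polynomials are uniformly dense in the continuous functions on
  the sphere, so moments determine the integrals of all continuous functions.\<close>

lemma measure_eqI_moments:
 fixes M N :: "'a::euclidean_space measure"
 assumes M: "finite_measure M" "sets M = sets borel" "AE x in M. norm x = 1"
  and N: "finite_measure N" "sets N = sets borel" "AE x in N. norm x = 1"
  and eq: "!!l. set l \<subseteq> Basis ==> (\<integral>x. monomial_fun l x \<partial>M) = (\<integral>x. monomial_fun l x \<partial>N)"
 shows "M = N"
proof (rule measure_eqI_continuous_integrals[OF M(1,2) N(1,2)])
 interpret M: finite_measure M by fact
 interpret N: finite_measure N by fact
 note intM = integrable_continuous_sphere[OF M.finite_measure_axioms M(2,3)]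
 note intN = integrable_continuous_sphere[OF N.finite_measure_axioms N(2,3)]
 \<comment> \<open>A itself need not be closed under products, but the multipliers P of A form an
   algebra. The coordinates belong to P by the use of all monomials in the definition of A, and P is
   contained in A because A contains 1.\<close>
 define A :: "('a => real) set" where
  "A = {q. continuous_on UNIV q \<and>
    (\<forall>l. set l \<subseteq> Basis \<longrightarrow> (\<integral>x. q x * monomial_fun l x \<partial>M) = (\<integral>x. q x * monomial_fun l x \<partial>N))}"
 define P where "P = (%p :: 'a => real. continuous_on UNIV p \<and> (\<forall>q\<in>A. (%x. p x * q x) \<in> A))"
 have A_cont: "continuous_on UNIV q" if "q \<in> A" for q using that by (simp add: A_def)
 have A_add: "(%x. p x + q x) \<in> A" if p: "p \<in> A" and q: "q \<in> A" for p q
 proof -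
  have [continuous_intros]: "continuous_on UNIV p" "continuous_on UNIV q" using p q A_cont by auto
  have "(\<integral>x. (p x + q x) * monomial_fun l x \<partial>M) = (\<integral>x. (p x + q x) * monomial_fun l x \<partial>N)" if "set l \<subseteq> Basis" for l
   using p q that unfolding distrib_right
   by (subst (1 2) Bochner_Integration.integral_add) (auto intro!: intM intN continuous_intros simp: A_def)
  then show ?thesis by (auto simp: A_def intro!: continuous_intros)
 qed
 have A_cmult: "(%x. c * q x) \<in> A" if q: "q \<in> A" for c q
  using q by (auto simp: A_def mult.assoc intro!: continuous_intros)
 have A_sum: "(%x. \<Sum>i\<in>I. q i x) \<in> A" if "finite I" "!!i. i \<in> I ==> q i \<in> A" for I :: "'a set" and q
  using that
 proof (induction I rule: finite_induct)
  case empty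
  show ?case by (simp add: A_def)
 next
  case (insert i I)
  then show ?case using A_add[of "q i" "%x. \<Sum>i\<in>I. q i x"] by simp
 qed
 have P_coord: "P (%x. x \<bullet> b)" if b: "b \<in> Basis" for b
  unfolding P_def
 proof (intro conjI ballI)
  fix q assume q: "q \<in> A"
  have "(\<integral>x. (x \<bullet> b * q x) * monomial_fun l x \<partial>M) = (\<integral>x. (x \<bullet> b * q x) * monomial_fun l x \<partial>N)" if "set l \<subseteq> Basis" for l
  proof -
   have *: "(%x. (x \<bullet> b * q x) * monomial_fun l x) = (%x. q x * monomial_fun (b # l) x)"
    by (simp add: monomial_fun_def fun_eq_iff)
   have "set (b # l) \<subseteq> Basis" using that b by simp
   then show ?thesis using q unfolding A_def * by blast
  qed
  then show "(%x. x \<bullet> b * q x) \<in> A"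
   using A_cont[OF q] by (auto simp: A_def intro!: continuous_intros)
 qed (intro continuous_intros)
 have one: "(%_. 1) \<in> A" using eq by (simp add: A_def)
 fix f :: "'a => real" assume f: "continuous_on UNIV f"
 have approx: "\<exists>g. P g \<and> (\<forall>x\<in>sphere 0 1. \<bar>f x - g x\<bar> < e)" if "0 < e" for e
 proof (rule Stone_Weierstrass_HOL[where P=P])
  show "P (%x. c)" for c using A_cmult by (simp add: P_def)
  show "P (%x. p x + q x)" if "P p \<and> P q" for p q
   using that unfolding P_def distrib_right by (auto intro!: A_add continuous_intros)
  show "P (%x. p x * q x)" if "P p \<and> P q" for p q
   using that unfolding P_def mult.assoc by (auto intro!: continuous_intros)
  show "continuous_on (sphere 0 1) p" if "P p" for p
   using that by (auto simp: P_def intro: continuous_on_subset)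
  show "\<exists>p. P p \<and> p x ~= p y" if "x \<in> sphere 0 1 \<and> y \<in> sphere 0 1 \<and> x ~= y" for x y
  proof -
   from that obtain b where "b \<in> Basis" "x \<bullet> b ~= y \<bullet> b" using euclidean_eqI[of x y] by blast
   then show ?thesis using P_coord by (intro exI[of _ "%x. x \<bullet> b"]) simp
  qed
  show "continuous_on (sphere 0 1) f" using f by (rule continuous_on_subset) auto
 qed (use that in auto)
 have small: "\<bar>(\<integral>x. f x \<partial>M) - (\<integral>x. f x \<partial>N)\<bar> <= e" if "0 < e" for e
 proof -
  define d where "d = e / (1 + measure M (space M) + measure N (space N))"
  have tot: "0 < 1 + measure M (space M) + measure N (space N)" by (simp add: add_pos_nonneg)
  have d: "0 < d" using that tot by (simp add: d_def)
  from approx[OF d] obtain g where g: "P g" "!!x. norm x = 1 ==> \<bar>f x - g x\<bar> < d" by auto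
  then have gc: "continuous_on UNIV g" by (simp add: P_def)
  have "g \<in> A" using conjunct2[OF g(1)[unfolded P_def], THEN bspec, OF one] by simp
  then have eqg: "(\<integral>x. g x \<partial>M) = (\<integral>x. g x \<partial>N)"
   unfolding A_def by (auto dest!: spec[of _ "[]"] simp: monomial_fun_def)
  have diff: "\<bar>(\<integral>x. f x \<partial>K) - (\<integral>x. g x \<partial>K)\<bar> <= d * measure K (space K)"
   if K: "finite_measure K" "sets K = sets borel" "AE x in K. norm x = 1" for K
  proof -
   interpret K: finite_measure K by fact
   note intK = integrable_continuous_sphere[OF K.finite_measure_axioms K(2,3)]
   have "\<bar>(\<integral>x. f x \<partial>K) - (\<integral>x. g x \<partial>K)\<bar> = \<bar>\<integral>x. f x - g x \<partial>K\<bar>"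
    using f gc by (subst Bochner_Integration.integral_diff) (auto intro: intK)
   also have "... <= (\<integral>x. \<bar>f x - g x\<bar> \<partial>K)" by (rule integral_abs_bound)
   also have "... <= (\<integral>x. d \<partial>K)"
   proof (rule integral_mono_AE)
    show "integrable K (%x. \<bar>f x - g x\<bar>)" using f gc by (intro intK continuous_intros)
    show "AE x in K. \<bar>f x - g x\<bar> <= d" using K(3) g(2) by (auto intro: less_imp_le)
   qed simp
   finally show ?thesis by (simp add: mult.commute)
  qed
  have "d * measure M (space M) + d * measure N (space N) <= d * (1 + measure M (space M) + measure N (space N))"
   using d by (simp add: distrib_left)
  also have "... = e" using tot by (simp add: d_def)
  finally show ?thesis using diff[OF M] diff[OF N] eqg by linarith
 qed
 have "\<bar>(\<integral>x. f x \<partial>M) - (\<integral>x. f x \<partial>N)\<bar> <= 0"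
  by (rule field_le_epsilon) (simp only: add_0_left small)
 then show "(\<integral>x. f x \<partial>M) = (\<integral>x. f x \<partial>N)" by simp
qed

text \<open>This exhibits a power of the inner product as a positive definite kernel with the
  monomials as features, and so turns energies into sums of products of moments.\<close>

lemma inner_power_monomials:
 fixes x y :: "'a::euclidean_space"
 shows "(x \<bullet> y) ^ m = (\<Sum>l | set l \<subseteq> Basis \<and> length l = m. monomial_fun l x * monomial_fun l y)"
proof (induction m)
 case 0
 have "{l :: 'a list. set l \<subseteq> Basis \<and> length l = 0} = {[]}" by auto
 then show ?case by (simp add: monomial_fun_def)
next
 case (Suc m)
 let ?L = "%m. {l :: 'a list. set l \<subseteq> Basis \<and> length l = m}"
 have fin: "finite (?L m)" for m by (rule finite_lists_length_eq) simp
 have "?L (Suc m) = (%(b, l). b # l) ` (Basis \<times> ?L m)"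
  by (auto simp: length_Suc_conv image_iff)
 moreover have "inj_on (%(b, l). b # l) (Basis \<times> ?L m)" by (auto simp: inj_on_def)
 ultimately have "(\<Sum>l\<in>?L (Suc m). monomial_fun l x * monomial_fun l y) =
   (\<Sum>(b, l)\<in>Basis \<times> ?L m. monomial_fun (b # l) x * monomial_fun (b # l) y)"
  by (simp add: sum.reindex split_beta')
 also have "... = (\<Sum>b\<in>Basis. \<Sum>l\<in>?L m. (x \<bullet> b) * (y \<bullet> b) * (monomial_fun l x * monomial_fun l y))"
  by (subst sum.cartesian_product[symmetric]) (simp add: monomial_fun_def mult_ac)
 also have "... = (\<Sum>b\<in>Basis. (x \<bullet> b) * (y \<bullet> b)) * (\<Sum>l\<in>?L m. monomial_fun l x * monomial_fun l y)"
  by (simp add: sum_product)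
 also have "... = (x \<bullet> y) ^ Suc m"
  by (simp only: Suc.IH[symmetric] euclidean_inner[of x y, symmetric] power_Suc)
 finally show ?case by simp
qed

text \<open>The Pochhammer form of the binomial series makes the positivity of all coefficients for
  p > 0 visible.\<close>

lemma binomial_kernel_sums:
 fixes u p :: real
 assumes "\<bar>u\<bar> < 1"
 shows "(%m. pochhammer p m / fact m * u ^ m) sums (1 - u) powr (- p)"
proof -
 have "(%m. (- p gchoose m) * (- u) ^ m) sums (1 + - u) powr (- p)"
  using assms by (intro gen_binomial_real) simp
 moreover have "(- p gchoose m) * (- u) ^ m = pochhammer p m / fact m * u ^ m" for m
 proof -
  have "(- u) ^ m = (- 1) ^ m * u ^ m" by (metis mult_minus1 power_mult_distrib)
  then have "(- p gchoose m) * (- u) ^ m = ((- 1) ^ m * (- 1) ^ m) * (pochhammer p m / fact m * u ^ m)"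
   by (simp add: gbinomial_pochhammer)
  also have "(- 1) ^ m * (- 1) ^ m = (1 :: real)" by (simp add: power_add[symmetric])
  finally show ?thesis by simp
 qed
 ultimately show ?thesis by simp
qed

lemma continuous_pair_integrable:
 fixes f :: "'a::euclidean_space \<times> 'a => real"
 assumes P: "finite_measure P" "sets P = sets borel" "AE x in P. norm x = 1"
  and Q: "finite_measure Q" "sets Q = sets borel" "AE x in Q. norm x = 1"
  and f: "continuous_on (sphere 0 1 \<times> sphere 0 1) f" "f \<in> borel_measurable borel"
 shows "integrable (P \<Otimes>\<^sub>M Q) f"
proof -
 interpret P: finite_measure P by fact
 interpret Q: finite_measure Q by fact
 interpret PQ: pair_sigma_finite P Q ..
 interpret F: finite_measure "P \<Otimes>\<^sub>M Q"
  by (rule finite_measure_pair_measure) fact+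
 have "compact (f ` (sphere 0 1 \<times> sphere 0 1))"
  by (intro compact_continuous_image f compact_Times) auto
 then obtain B where B0: "\<forall>v\<in>f ` (sphere 0 1 \<times> sphere 0 1). norm v <= B"
  using compact_imp_bounded bounded_iff by blast
 have B: "norm (f z) <= B" if "norm (fst z) = 1" "norm (snd z) = 1" for z
  using B0 that by (cases z) auto
 have s: "sets (P \<Otimes>\<^sub>M Q) = sets borel"
  using sets_pair_measure_cong[OF P(2) Q(2)] by (simp only: borel_prod)
 then have sp: "space (P \<Otimes>\<^sub>M Q) = UNIV" using sets_eq_imp_space_eq[OF s] by simp
 have "AE z in P \<Otimes>\<^sub>M Q. norm (fst z) = 1 \<and> norm (snd z) = 1"
 proof (rule PQ.AE_pair_measure)
  have "{z :: 'a \<times> 'a. norm (fst z) = 1 \<and> norm (snd z) = 1} = sphere 0 1 \<times> sphere 0 1" by auto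
  moreover have "closed (sphere (0::'a) 1 \<times> sphere (0::'a) 1)" by (intro closed_Times) auto
  ultimately show "{z \<in> space (P \<Otimes>\<^sub>M Q). norm (fst z) = 1 \<and> norm (snd z) = 1} \<in> sets (P \<Otimes>\<^sub>M Q)"
   using sp s by simp
  show "AE x in P. AE y in Q. norm (fst (x, y)) = 1 \<and> norm (snd (x, y)) = 1"
   using P(3)
  proof eventually_elim
   case (elim x)
   then show ?case using Q(3) by simp
  qed
 qed
 then have "AE z in P \<Otimes>\<^sub>M Q. norm (f z) <= B"
  by eventually_elim (use B in auto)
 moreover have "f \<in> borel_measurable (P \<Otimes>\<^sub>M Q)"
  using f(2) s by (simp cong: measurable_cong_sets)
 ultimately show ?thesis by (intro F.integrable_const_bound)
qed

lemma integral_pair_inner_power: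
 fixes P Q :: "'a::euclidean_space measure"
 assumes P: "finite_measure P" "sets P = sets borel" "AE x in P. norm x = 1"
  and Q: "finite_measure Q" "sets Q = sets borel" "AE x in Q. norm x = 1"
 shows "(\<integral>z. (fst z \<bullet> snd z) ^ m \<partial>(P \<Otimes>\<^sub>M Q)) =
  (\<Sum>l | set l \<subseteq> Basis \<and> length l = m. (\<integral>x. monomial_fun l x \<partial>P) * (\<integral>x. monomial_fun l x \<partial>Q))"
proof -
 interpret P: finite_measure P by fact
 interpret Q: finite_measure Q by fact
 interpret PQ: pair_sigma_finite P Q ..
 have cont: "continuous_on UNIV (%z :: 'a \<times> 'a. monomial_fun l (fst z) * monomial_fun l (snd z))" for l
  by (intro continuous_intros continuous_on_compose2[OF continuous_monomial_fun[of UNIV]]) auto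
 have int: "integrable (P \<Otimes>\<^sub>M Q) (%z. monomial_fun l (fst z) * monomial_fun l (snd z))" for l
  by (rule continuous_pair_integrable[OF P Q])
    (use cont in \<open>auto intro: continuous_on_subset borel_measurable_continuous_onI\<close>)
 have "(\<integral>z. (fst z \<bullet> snd z) ^ m \<partial>(P \<Otimes>\<^sub>M Q)) =
  (\<Sum>l | set l \<subseteq> Basis \<and> length l = m. \<integral>z. monomial_fun l (fst z) * monomial_fun l (snd z) \<partial>(P \<Otimes>\<^sub>M Q))"
  unfolding inner_power_monomials by (rule Bochner_Integration.integral_sum) (rule int)
 moreover have "(\<integral>z. monomial_fun l (fst z) * monomial_fun l (snd z) \<partial>(P \<Otimes>\<^sub>M Q)) =
   (\<integral>x. monomial_fun l x \<partial>P) * (\<integral>x. monomial_fun l x \<partial>Q)" for l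
  by (subst PQ.integral_fst'[symmetric, OF int]) simp
 ultimately show ?thesis by simp
qed

text \<open>Expanding the regularised kernel \<open>(1 - r x \<bullet> y) powr (- p)\<close> into powers of \<open>x \<bullet> y\<close>, whose
 coefficients are positive, turns the energy of \<open>M - N\<close> into a weighted sum of squared moments.\<close>

lemma measure_eqI_energy:
 fixes M N :: "'a::euclidean_space measure"
 assumes M: "finite_measure M" "sets M = sets borel" "AE x in M. norm x = 1"
  and N: "finite_measure N" "sets N = sets borel" "AE x in N. norm x = 1"
  and p: "0 < p"
  and I: "!!P Q. P \<in> {M, N} ==> Q \<in> {M, N} ==>
   (\<integral>\<^sup>+x. \<integral>\<^sup>+y. (if x \<bullet> y = 1 then \<infinity> else ennreal ((1 - x \<bullet> y) powr (- p))) \<partial>Q \<partial>P) = ennreal c"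
 shows "M = N"
proof (rule measure_eqI_moments[OF M N])
 define K where "K = (%z :: 'a \<times> 'a. (1 - fst z \<bullet> snd z) powr (- p))"
 define Kr where "Kr = (%r (z :: 'a \<times> 'a). (1 - r * (fst z \<bullet> snd z)) powr (- p))"
 define a where "a = (%m. pochhammer p m / fact m)"
 have a: "0 < a m" for m using p by (simp add: a_def pochhammer_pos)
 define mom :: "'a measure => 'a list => real" where "mom = (%P l. \<integral>x. monomial_fun l x \<partial>P)"
 define S where "S = (%m P Q. (\<Sum>l | set l \<subseteq> Basis \<and> length l = m. mom P l * mom Q l) :: real)"
 \<comment> \<open>Damping x . y by a factor r < 1 gives a series that converges uniformly on the
   sphere; r tends to 1 at the end.\<close>
 define r where "r = (%i. 1 - 1 / (real i + 2))"
 have r: "0 < r i" "r i < 1" for i by (auto simp: r_def field_simps)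
 have rlim: "r \<longlonglongrightarrow> 1" unfolding r_def by real_asymp
 have inner_le: "\<bar>fst z \<bullet> snd z\<bar> <= 1" if "norm (fst z) = 1" "norm (snd z) = 1" for z :: "'a \<times> 'a"
  using Cauchy_Schwarz_ineq2[of "fst z" "snd z"] that by simp
 have main: "(%m. a m * r i ^ m * S m P Q) sums (\<integral>z. Kr (r i) z \<partial>(P \<Otimes>\<^sub>M Q))"
  "(%i. \<integral>z. Kr (r i) z \<partial>(P \<Otimes>\<^sub>M Q)) \<longlonglongrightarrow> enn2real (ennreal c)"
  if PQ: "P \<in> {M, N}" "Q \<in> {M, N}" for P Q i
 proof -
  have P: "finite_measure P" "sets P = sets borel" "AE x in P. norm x = 1"
   and Q: "finite_measure Q" "sets Q = sets borel" "AE x in Q. norm x = 1"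
   using PQ M N by auto
  interpret P: finite_measure P by fact
  interpret Q: finite_measure Q by fact
  interpret PQ: pair_sigma_finite P Q ..
  interpret F: finite_measure "P \<Otimes>\<^sub>M Q"
   by (rule finite_measure_pair_measure) fact+
  have s: "sets (P \<Otimes>\<^sub>M Q) = sets borel"
   using sets_pair_measure_cong[OF P(2) Q(2)] by (simp only: borel_prod)
  have meas: "f \<in> borel_measurable (P \<Otimes>\<^sub>M Q)" if "f \<in> borel_measurable (borel \<Otimes>\<^sub>M borel)" for f :: "'a \<times> 'a => 'b::topological_space"
   using that unfolding measurable_cong_sets[OF s refl] borel_prod .
  have [measurable]: "K \<in> borel_measurable (P \<Otimes>\<^sub>M Q)"
   by (rule meas) (unfold K_def, measurable)
  have [measurable]: "Kr \<rho> \<in> borel_measurable (P \<Otimes>\<^sub>M Q)" for \<rho>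
   by (rule meas) (unfold Kr_def, measurable)
  have [measurable]: "(%z. (fst z \<bullet> snd z) ^ m) \<in> borel_measurable (P \<Otimes>\<^sub>M Q)" for m
   by (rule meas) measurable
  have [measurable]: "(%z. if fst z \<bullet> snd z = 1 then \<infinity> else ennreal (K z)) \<in> borel_measurable (P \<Otimes>\<^sub>M Q)"
   by (rule meas) (unfold K_def, measurable)
  have sph: "AE z in P \<Otimes>\<^sub>M Q. norm (fst z) = 1 \<and> norm (snd z) = 1"
  proof (rule PQ.AE_pair_measure)
   have "{z :: 'a \<times> 'a. norm (fst z) = 1 \<and> norm (snd z) = 1} = sphere 0 1 \<times> sphere 0 1" by auto
   moreover have "closed (sphere (0::'a) 1 \<times> sphere (0::'a) 1)" by (intro closed_Times) auto
   ultimately show "{z \<in> space (P \<Otimes>\<^sub>M Q). norm (fst z) = 1 \<and> norm (snd z) = 1} \<in> sets (P \<Otimes>\<^sub>M Q)"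
    using sets_eq_imp_space_eq[OF s] s by simp
   show "AE x in P. AE y in Q. norm (fst (x, y)) = 1 \<and> norm (snd (x, y)) = 1"
    using P(3)
   proof eventually_elim
    case (elim x)
    then show ?case using Q(3) by simp
   qed
  qed
  have bnd: "AE z in P \<Otimes>\<^sub>M Q. \<bar>fst z \<bullet> snd z\<bar> <= 1"
   using sph by eventually_elim (use inner_le in blast)
  have "(\<integral>\<^sup>+z. (if fst z \<bullet> snd z = 1 then \<infinity> else ennreal (K z)) \<partial>(P \<Otimes>\<^sub>M Q)) = ennreal c"
  proof -
   have "(\<integral>\<^sup>+z. (if fst z \<bullet> snd z = 1 then \<infinity> else ennreal (K z)) \<partial>(P \<Otimes>\<^sub>M Q)) =
    (\<integral>\<^sup>+x. \<integral>\<^sup>+y. (if fst (x, y) \<bullet> snd (x, y) = 1 then \<infinity> else ennreal (K (x, y))) \<partial>Q \<partial>P)"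
    by (rule Q.nn_integral_fst[symmetric]) measurable
   also have "... = ennreal c" using I[OF PQ] by (simp only: K_def fst_conv snd_conv)
   finally show ?thesis .
  qed
  note EK = this
  \<comment> \<open>Finite energy forces the diagonal to be a null set of the product measure, so
    the infinite value there has no effect on integrals.\<close>
  have "AE z in P \<Otimes>\<^sub>M Q. (if fst z \<bullet> snd z = 1 then \<infinity> else ennreal (K z)) ~= \<infinity>"
  proof (rule nn_integral_PInf_AE)
   show "(\<integral>\<^sup>+z. (if fst z \<bullet> snd z = 1 then \<infinity> else ennreal (K z)) \<partial>(P \<Otimes>\<^sub>M Q)) ~= \<infinity>"
    unfolding EK by simp
  qed measurable
  then have ne1: "AE z in P \<Otimes>\<^sub>M Q. fst z \<bullet> snd z ~= 1"
   by eventually_elim (auto split: if_splits)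
  have "(\<integral>\<^sup>+z. ennreal (K z) \<partial>(P \<Otimes>\<^sub>M Q)) = (\<integral>\<^sup>+z. (if fst z \<bullet> snd z = 1 then \<infinity> else ennreal (K z)) \<partial>(P \<Otimes>\<^sub>M Q))"
   by (rule nn_integral_cong_AE) (use ne1 in eventually_elim, simp)
  then have EK': "(\<integral>\<^sup>+z. ennreal (K z) \<partial>(P \<Otimes>\<^sub>M Q)) = ennreal c" unfolding EK .
  have Km: "K \<in> borel_measurable (P \<Otimes>\<^sub>M Q)" by measurable
  have Knn: "0 <= K z" for z by (simp add: K_def)
  have Kint: "integrable (P \<Otimes>\<^sub>M Q) K"
   by (rule integrableI_nonneg[OF Km]) (simp_all add: Knn EK')
  have IK: "(\<integral>z. K z \<partial>(P \<Otimes>\<^sub>M Q)) = enn2real (ennreal c)"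
   by (subst integral_eq_nn_integral[OF Km]) (simp_all only: Knn EK' AE_I2)
  show "(%i. \<integral>z. Kr (r i) z \<partial>(P \<Otimes>\<^sub>M Q)) \<longlonglongrightarrow> enn2real (ennreal c)"
   unfolding IK[symmetric]
  \<comment> \<open>The damped kernel is at most K where x . y is nonnegative and at most 1
    elsewhere.\<close>
  proof (rule integral_dominated_convergence[where w="%z. K z + 1"])
   show "integrable (P \<Otimes>\<^sub>M Q) (%z. K z + 1)" using Kint by simp
   show "AE z in P \<Otimes>\<^sub>M Q. (%i. Kr (r i) z) \<longlonglongrightarrow> K z"
    using bnd ne1
   proof eventually_elim
    case (elim z)
    then have "1 - 1 * (fst z \<bullet> snd z) ~= 0" by auto
    then have "(%i. (1 - r i * (fst z \<bullet> snd z)) powr (- p)) \<longlonglongrightarrow> (1 - 1 * (fst z \<bullet> snd z)) powr (- p)"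
     by (intro tendsto_powr tendsto_intros rlim) auto
    then show ?case by (simp add: Kr_def K_def)
   qed
   show "AE z in P \<Otimes>\<^sub>M Q. norm (Kr (r i) z) <= K z + 1" for i
    using bnd ne1
   proof eventually_elim
    case (elim z)
    let ?u = "fst z \<bullet> snd z"
    have u: "-1 <= ?u" "?u < 1" using elim by auto
    show ?case
    proof (cases "0 <= ?u")
     case True
     have "r i * ?u <= 1 * ?u" using True r[of i] by (intro mult_right_mono) auto
     then have "(1 - r i * ?u) powr (- p) <= (1 - ?u) powr (- p)"
      using u p by (intro powr_mono2') auto
     then show ?thesis by (simp add: Kr_def K_def)
    next
     case False
     then have "1 <= 1 - r i * ?u" using r[of i] by (simp add: mult_pos_neg less_imp_le mult_le_0_iff)
     then have "(1 - r i * ?u) powr (- p) <= 1 powr (- p)"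
      using p by (intro powr_mono2') auto
     then show ?thesis by (simp add: Kr_def K_def add_increasing)
    qed
   qed
  qed measurable
  show "(%m. a m * r i ^ m * S m P Q) sums (\<integral>z. Kr (r i) z \<partial>(P \<Otimes>\<^sub>M Q))"
  proof -
   let ?f = "%m z. a m * r i ^ m * (fst z \<bullet> snd z :: real) ^ m"
   have pint: "integrable (P \<Otimes>\<^sub>M Q) (%z. (fst z \<bullet> snd z) ^ m)" for m
   proof (rule F.integrable_const_bound[where B=1])
    show "AE z in P \<Otimes>\<^sub>M Q. norm ((fst z \<bullet> snd z) ^ m) <= 1"
     using bnd by eventually_elim (simp add: power_le_one power_abs)
   qed measurable
   have asum: "(%m. a m * r i ^ m) sums (1 - r i) powr (- p)"
    unfolding a_def using r[of i] by (intro binomial_kernel_sums) auto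
   have le: "AE z in P \<Otimes>\<^sub>M Q. \<forall>m. norm (?f m z) <= a m * r i ^ m"
    using bnd
   proof eventually_elim
    case (elim z)
    show ?case
    proof
     fix m
     have nn: "0 <= a m * r i ^ m" using a[of m] r[of i] by (simp add: less_imp_le)
     have "norm (?f m z) = (a m * r i ^ m) * \<bar>fst z \<bullet> snd z\<bar> ^ m"
      unfolding real_norm_def abs_mult[of "a m * r i ^ m"] power_abs using nn by simp
     also have "... <= (a m * r i ^ m) * 1"
      using elim nn by (intro mult_left_mono power_le_one) auto
     finally show "norm (?f m z) <= a m * r i ^ m" by simp
    qed
   qed
   have "(%m. \<integral>z. ?f m z \<partial>(P \<Otimes>\<^sub>M Q)) sums (\<integral>z. (\<Sum>m. ?f m z) \<partial>(P \<Otimes>\<^sub>M Q))"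
   proof (rule sums_integral)
    show "integrable (P \<Otimes>\<^sub>M Q) (?f m)" for m using pint by simp
    show "AE z in P \<Otimes>\<^sub>M Q. summable (%m. norm (?f m z))"
     using le
    proof eventually_elim
     case (elim z)
     show ?case
     proof (rule summable_comparison_test'[OF sums_summable[OF asum], of 0])
      show "norm (norm (?f m z)) <= a m * r i ^ m" for m
       using elim by (simp only: real_norm_def abs_idempotent)
     qed
    qed
    show "summable (%m. \<integral>z. norm (?f m z) \<partial>(P \<Otimes>\<^sub>M Q))"
    proof (rule summable_comparison_test'[of "%m. a m * r i ^ m * measure (P \<Otimes>\<^sub>M Q) (space (P \<Otimes>\<^sub>M Q))" 0])
     show "summable (%m. a m * r i ^ m * measure (P \<Otimes>\<^sub>M Q) (space (P \<Otimes>\<^sub>M Q)))"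
      by (rule summable_mult2[OF sums_summable[OF asum]])
     fix m
     have "(\<integral>z. norm (?f m z) \<partial>(P \<Otimes>\<^sub>M Q)) <= (\<integral>z. a m * r i ^ m \<partial>(P \<Otimes>\<^sub>M Q))"
     proof (rule integral_mono_AE)
      show "integrable (P \<Otimes>\<^sub>M Q) (%z. norm (?f m z))"
       by (intro integrable_norm integrable_mult_right pint)
      show "AE z in P \<Otimes>\<^sub>M Q. norm (?f m z) <= a m * r i ^ m"
       using le by eventually_elim blast
     qed simp
     also have "... = a m * r i ^ m * measure (P \<Otimes>\<^sub>M Q) (space (P \<Otimes>\<^sub>M Q))"
      by (simp only: lebesgue_integral_const real_scaleR_def mult.commute)
     finally have "(\<integral>z. norm (?f m z) \<partial>(P \<Otimes>\<^sub>M Q)) <= a m * r i ^ m * measure (P \<Otimes>\<^sub>M Q) (space (P \<Otimes>\<^sub>M Q))" .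
     moreover have "0 <= (\<integral>z. norm (?f m z) \<partial>(P \<Otimes>\<^sub>M Q))"
      by (rule integral_nonneg_AE) simp
     ultimately show "norm (\<integral>z. norm (?f m z) \<partial>(P \<Otimes>\<^sub>M Q)) <= a m * r i ^ m * measure (P \<Otimes>\<^sub>M Q) (space (P \<Otimes>\<^sub>M Q))"
      by (simp only: real_norm_def abs_of_nonneg)
    qed
   qed
   also have "(\<integral>z. (\<Sum>m. ?f m z) \<partial>(P \<Otimes>\<^sub>M Q)) = (\<integral>z. Kr (r i) z \<partial>(P \<Otimes>\<^sub>M Q))"
   proof (rule integral_cong_AE)
    show "AE z in P \<Otimes>\<^sub>M Q. (\<Sum>m. ?f m z) = Kr (r i) z"
     using bnd
    proof eventually_elim
     case (elim z)
     have "\<bar>r i * (fst z \<bullet> snd z)\<bar> <= r i * 1"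
      using elim r[of i] by (simp add: abs_mult)
     then have "\<bar>r i * (fst z \<bullet> snd z)\<bar> < 1" using r[of i] by linarith
     from binomial_kernel_sums[OF this, of p] show ?case
      by (simp add: a_def Kr_def sums_iff power_mult_distrib mult.assoc)
    qed
   qed measurable
   also have "(%m. \<integral>z. ?f m z \<partial>(P \<Otimes>\<^sub>M Q)) = (%m. a m * r i ^ m * S m P Q)"
    by (simp add: integral_pair_inner_power[OF P Q] S_def mom_def)
   finally show ?thesis .
  qed
 qed
 fix l :: "'a list" assume l: "set l \<subseteq> Basis"
 \<comment> \<open>The degree m part of the energy of M - N. It is a sum of squared moment
   differences, hence nonnegative.\<close>
 define T where "T = (%m. S m M M - 2 * S m M N + S m N N)"
 have T: "T m = (\<Sum>l | set l \<subseteq> Basis \<and> length l = m. (mom M l - mom N l)\<^sup>2)" for m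
  unfolding T_def S_def
  by (simp add: sum_distrib_left sum_subtractf[symmetric] sum.distrib[symmetric] power2_eq_square algebra_simps)
 then have Tnn: "0 <= T m" for m by (simp add: sum_nonneg)
 define D where "D = (%i. (\<integral>z. Kr (r i) z \<partial>(M \<Otimes>\<^sub>M M)) - 2 * (\<integral>z. Kr (r i) z \<partial>(M \<Otimes>\<^sub>M N)) + (\<integral>z. Kr (r i) z \<partial>(N \<Otimes>\<^sub>M N)))"
 have sumsD: "(%m. a m * r i ^ m * T m) sums D i" for i
 proof -
  have "(%m. a m * r i ^ m * S m M M - 2 * (a m * r i ^ m * S m M N) + a m * r i ^ m * S m N N) sums D i"
   unfolding D_def by (intro sums_add sums_diff sums_mult main(1)) auto
  then show ?thesis by (simp add: T_def algebra_simps)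
 qed
 let ?m = "length l"
 \<comment> \<open>One nonnegative term is at most the whole damped energy D, which tends to c - 2c
   + c = 0.\<close>
 have "a ?m * r i ^ ?m * T ?m <= D i" for i
 proof -
  have "sum (%m. a m * r i ^ m * T m) {?m} <= (\<Sum>m. a m * r i ^ m * T m)"
   using sumsD[of i] a r[of i] Tnn by (intro sum_le_suminf) (auto simp: sums_iff less_imp_le)
  then show ?thesis using sumsD[of i] by (simp add: sums_iff)
 qed
 moreover have "(%i. a ?m * r i ^ ?m * T ?m) \<longlonglongrightarrow> a ?m * 1 ^ ?m * T ?m"
  by (intro tendsto_intros rlim)
 moreover have "D \<longlonglongrightarrow> enn2real (ennreal c) - 2 * enn2real (ennreal c) + enn2real (ennreal c)"
  unfolding D_def by (intro tendsto_intros main(2)) auto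
 ultimately have "a ?m * 1 ^ ?m * T ?m <= enn2real (ennreal c) - 2 * enn2real (ennreal c) + enn2real (ennreal c)"
  by (intro LIMSEQ_le) blast+
 then have "a ?m * T ?m <= 0" by simp
 then have "T ?m = 0" using a[of ?m] Tnn[of ?m] by (simp add: mult_le_0_iff)
 moreover have "finite {l :: 'a list. set l \<subseteq> Basis \<and> length l = ?m}" by (rule finite_lists_length_eq) simp
 ultimately have "(mom M l - mom N l)\<^sup>2 = 0"
  unfolding T using l by (subst (asm) sum_nonneg_eq_0_iff) auto
 then show "(\<integral>x. monomial_fun l x \<partial>M) = (\<integral>x. monomial_fun l x \<partial>N)" by (simp add: mom_def)
qed

section \<open>The variational characterization of the equilibrium measure\<close>

lemma measurable_sphereI:
 fixes M :: "(real ^ 'n::finite) measure"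
 assumes "f \<in> measurable borel N" "sets M = sets sphere_borel"
 shows "f \<in> measurable M N"
 using measurable_restrict_space1[OF assms(1)] measurable_cong_sets[OF assms(2) refl] by blast

lemma measurable_kern_pair:
 fixes M N :: "(real ^ 'n::finite) measure"
 assumes M: "(%x. x) \<in> borel_measurable M" and N: "(%x. x) \<in> borel_measurable N"
 shows "(%z. kern (fst z) (snd z)) \<in> borel_measurable (M \<Otimes>\<^sub>M N)"
 by (rule borel_measurable_kern[OF measurable_compose[OF measurable_fst M] measurable_compose[OF measurable_snd N]])

definition potential :: "(real ^ 'n::finite) measure => real ^ 'n => ennreal" where
 "potential \<mu> x = (\<integral>\<^sup>+y. kern x y \<partial>\<mu>)"

lemma borel_measurable_potential:
 fixes M N :: "(real ^ 'n::finite) measure"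
 assumes "sigma_finite_measure N" "(%x. x) \<in> borel_measurable M" "(%x. x) \<in> borel_measurable N"
 shows "potential N \<in> borel_measurable M"
 using sigma_finite_measure.borel_measurable_nn_integral_fst[OF assms(1) measurable_kern_pair[OF assms(2,3)]]
 by (simp add: potential_def[abs_def])

lemma energy_eq_potential: "energy \<mu> = (\<integral>\<^sup>+x. potential \<mu> x \<partial>\<mu>)"
 by (simp add: energy_def potential_def kern_def)

lemma nn_integral_potential_commute:
 fixes M N :: "(real ^ 'n::finite) measure"
 assumes "sigma_finite_measure M" "sigma_finite_measure N"
  and "(%x. x) \<in> borel_measurable M" "(%x. x) \<in> borel_measurable N"
 shows "(\<integral>\<^sup>+x. potential M x \<partial>N) = (\<integral>\<^sup>+x. potential N x \<partial>M)"
proof -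
 interpret M: sigma_finite_measure M by fact
 interpret N: sigma_finite_measure N by fact
 interpret P: pair_sigma_finite M N ..
 have "(\<integral>\<^sup>+y. \<integral>\<^sup>+x. kern x y \<partial>M \<partial>N) = (\<integral>\<^sup>+x. \<integral>\<^sup>+y. kern x y \<partial>N \<partial>M)"
  using measurable_kern_pair[OF assms(3,4)] by (intro P.Fubini') (simp add: split_beta')
 moreover have "potential M y = (\<integral>\<^sup>+x. kern x y \<partial>M)" for y
  unfolding potential_def by (subst kern_commute) simp
 ultimately show ?thesis unfolding potential_def[of N] by simp
qed

text \<open>For 0 <= t <= 1 this is the convex combination (1 - t) M + t N; outside that range
  \<open>ennreal\<close> truncates a coefficient.\<close>

definition mixture :: "real => 'a measure => 'a measure => 'a measure" where
 "mixture t M N = measure_of (space M) (sets M) (%A. ennreal (1 - t) * emeasure M A + ennreal t * emeasure N A)"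

lemma sets_mixture [simp]: "sets (mixture t M N) = sets M"
 unfolding mixture_def by (simp add: sets_measure_of[OF sets.space_closed] sets.sigma_sets_eq)

lemma space_mixture [simp]: "space (mixture t M N) = space M"
 unfolding mixture_def by (simp add: space_measure_of[OF sets.space_closed])

lemma emeasure_mixture:
 assumes N: "sets N = sets M" and A: "A \<in> sets M"
 shows "emeasure (mixture t M N) A = ennreal (1 - t) * emeasure M A + ennreal t * emeasure N A"
proof (rule emeasure_measure_of[OF mixture_def])
 show "sets M \<subseteq> Pow (space M)" by (rule sets.space_closed)
 show "positive (sets (mixture t M N)) (%A. ennreal (1 - t) * emeasure M A + ennreal t * emeasure N A)"
  by (simp add: positive_def)
 show "countably_additive (sets (mixture t M N)) (%A. ennreal (1 - t) * emeasure M A + ennreal t * emeasure N A)"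
 proof (rule countably_additiveI)
  fix A :: "nat => _" assume A: "range A \<subseteq> sets (mixture t M N)" "disjoint_family A"
  have "(\<Sum>i. ennreal (1 - t) * emeasure M (A i) + ennreal t * emeasure N (A i)) =
   (\<Sum>i. ennreal (1 - t) * emeasure M (A i)) + (\<Sum>i. ennreal t * emeasure N (A i))"
   by (rule suminf_add[symmetric]) auto
  also have "... = ennreal (1 - t) * (\<Sum>i. emeasure M (A i)) + ennreal t * (\<Sum>i. emeasure N (A i))"
   by simp
  also have "(\<Sum>i. emeasure M (A i)) = emeasure M (\<Union>(range A))"
   using A by (intro suminf_emeasure) auto
  also have "(\<Sum>i. emeasure N (A i)) = emeasure N (\<Union>(range A))"
   using A N by (intro suminf_emeasure) auto
  finally show "(\<Sum>i. ennreal (1 - t) * emeasure M (A i) + ennreal t * emeasure N (A i)) =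
   ennreal (1 - t) * emeasure M (\<Union>(range A)) + ennreal t * emeasure N (\<Union>(range A))" .
 qed
qed (use A in simp)

lemma nn_integral_mixture:
 assumes N: "sets N = sets M" and f: "f \<in> borel_measurable M"
 shows "(\<integral>\<^sup>+x. f x \<partial>mixture t M N) = ennreal (1 - t) * (\<integral>\<^sup>+x. f x \<partial>M) + ennreal t * (\<integral>\<^sup>+x. f x \<partial>N)"
proof -
 have mM: "g \<in> borel_measurable (mixture t M N) \<longleftrightarrow> g \<in> borel_measurable M"
  and mN: "g \<in> borel_measurable N \<longleftrightarrow> g \<in> borel_measurable M" for g :: "_ => ennreal"
  using N by (auto cong: measurable_cong_sets)
 have sp: "space N = space M" by (rule sets_eq_imp_space_eq[OF N])
 show ?thesis using f
 proof (induction rule: borel_measurable_induct)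
  case (cong f g)
  have "(\<integral>\<^sup>+x. f x \<partial>mixture t M N) = (\<integral>\<^sup>+x. g x \<partial>mixture t M N)" "(\<integral>\<^sup>+x. f x \<partial>M) = (\<integral>\<^sup>+x. g x \<partial>M)"
   "(\<integral>\<^sup>+x. f x \<partial>N) = (\<integral>\<^sup>+x. g x \<partial>N)"
   using cong(3) sp by (auto intro!: nn_integral_cong)
  then show ?case using cong(4) by simp
 next
  case (set A)
  then show ?case using N by (simp add: emeasure_mixture)
 next
  case (mult u c)
  have "(\<integral>\<^sup>+x. c * u x \<partial>K) = c * (\<integral>\<^sup>+x. u x \<partial>K)" if "u \<in> borel_measurable K" for K
   using that by (rule nn_integral_cmult)
  then show ?case using mult mM mN by (simp add: distrib_left mult.left_commute)
 next
  case (add u v)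
  have "(\<integral>\<^sup>+x. v x + u x \<partial>K) = (\<integral>\<^sup>+x. v x \<partial>K) + (\<integral>\<^sup>+x. u x \<partial>K)"
   if "u \<in> borel_measurable K" "v \<in> borel_measurable K" for K
   using that by (intro nn_integral_add)
  then show ?case using add mM mN by (simp add: distrib_left add_ac)
 next
  case (seq U)
  have *: "(\<integral>\<^sup>+x. (SUP i. U i) x \<partial>K) = (SUP i. \<integral>\<^sup>+x. U i x \<partial>K)" if "!!i. U i \<in> borel_measurable K" for K
  proof -
   have "(SUP i. U i) = (%x. SUP i. U i x)" by (auto simp: fun_eq_iff image_comp)
   then show ?thesis using nn_integral_monotone_convergence_SUP[OF seq(3) that] by simp
  qed
  have inc: "incseq (%i. c * (\<integral>\<^sup>+x. U i x \<partial>K))" for K and c :: ennreal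
   using seq(3) by (auto simp: incseq_def le_fun_def intro!: mult_left_mono nn_integral_mono)
  have "(\<integral>\<^sup>+x. (SUP i. U i) x \<partial>mixture t M N) = (SUP i. ennreal (1 - t) * (\<integral>\<^sup>+x. U i x \<partial>M) + ennreal t * (\<integral>\<^sup>+x. U i x \<partial>N))"
   using seq mM by (subst *) simp_all
  also have "... = (SUP i. ennreal (1 - t) * (\<integral>\<^sup>+x. U i x \<partial>M)) + (SUP i. ennreal t * (\<integral>\<^sup>+x. U i x \<partial>N))"
   by (rule ennreal_SUP_add[OF inc inc])
  also have "... = ennreal (1 - t) * (\<integral>\<^sup>+x. (SUP i. U i) x \<partial>M) + ennreal t * (\<integral>\<^sup>+x. (SUP i. U i) x \<partial>N)"
  proof -
   have UN: "U i \<in> borel_measurable N" for i using seq(1) mN by simp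
   show ?thesis by (simp only: *[OF seq(1)] *[OF UN] SUP_mult_left_ennreal)
  qed
  finally show ?case .
 qed
qed

lemma unit_sphere_measureD:
 assumes "unit_sphere_measure \<mu>"
 shows "sets \<mu> = sets sphere_borel" "space \<mu> = sphere 0 1" "emeasure \<mu> (space \<mu>) = 1"
  "finite_measure \<mu>" "(%x. x) \<in> borel_measurable \<mu>"
proof -
 show s: "sets \<mu> = sets sphere_borel" and 1: "emeasure \<mu> (space \<mu>) = 1"
  using assms by (auto simp: unit_sphere_measure_def)
 show "space \<mu> = sphere 0 1"
  using sets_eq_imp_space_eq[OF s] by (simp add: space_restrict_space)
 show "finite_measure \<mu>" by (rule finite_measureI) (simp add: 1)
 show "(%x. x) \<in> borel_measurable \<mu>" by (rule measurable_sphereI[OF _ s]) simp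
qed

lemma unit_sphere_measure_mixture:
 assumes M: "unit_sphere_measure M" and N: "unit_sphere_measure N" and t: "0 <= t" "t <= 1"
 shows "unit_sphere_measure (mixture t M N)"
proof -
 note M = unit_sphere_measureD[OF M] and N = unit_sphere_measureD[OF N]
 have "emeasure (mixture t M N) (space M) = ennreal (1 - t) * emeasure M (space M) + ennreal t * emeasure N (space M)"
  using M(1) N(1) by (intro emeasure_mixture) auto
 also have "... = ennreal (1 - t) + ennreal t" using M(2,3) N(2,3) by simp
 also have "... = 1" using t by (subst ennreal_plus[symmetric]) auto
 finally show ?thesis using M(1) by (simp add: unit_sphere_measure_def)
qed

text \<open>Compare mu with (1 - t) mu + t la. The weighted energy of the mixture is a quadratic
  polynomial in t, minimal at t = 0, so its derivative there is nonnegative; that derivative is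
  twice the right side minus the left side.\<close>

lemma equilibrium_variational_inequality:
 fixes Q :: "real ^ 'n::finite => ennreal"
 assumes eq: "equilibrium_measure Q \<mu>" and fin: "weighted_energy Q \<mu> < \<infinity>"
  and Q: "Q \<in> borel_measurable sphere_borel"
  and la: "unit_sphere_measure la" and E: "energy la < \<infinity>"
 shows "energy \<mu> + (\<integral>\<^sup>+x. Q x \<partial>\<mu>) <= (\<integral>\<^sup>+x. potential \<mu> x + Q x \<partial>la)"
proof -
 have \<mu>: "unit_sphere_measure \<mu>" using eq by (simp add: equilibrium_measure_def)
 note M = unit_sphere_measureD[OF \<mu>] and L = unit_sphere_measureD[OF la]
 interpret M: finite_measure \<mu> by fact
 interpret L: finite_measure la by fact
 have sl: "sets la = sets \<mu>" using M(1) L(1) by simp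
 have Qm: "Q \<in> borel_measurable \<mu>" "Q \<in> borel_measurable la"
  using Q M(1) L(1) by (auto cong: measurable_cong_sets)
 have pm: "potential \<rho> \<in> borel_measurable \<mu>" "potential \<rho> \<in> borel_measurable la" if "\<rho> \<in> {\<mu>, la}" for \<rho>
  using that M(5) L(5) M.sigma_finite_measure_axioms L.sigma_finite_measure_axioms
  by (auto intro!: borel_measurable_potential)
 have km: "(%y. kern x y) \<in> borel_measurable \<mu>" for x
  by (rule borel_measurable_kern[OF _ M(5)]) simp
 define X where "X = energy \<mu>"
 define Y where "Y = (\<integral>\<^sup>+x. potential \<mu> x \<partial>la)"
 define Z where "Z = energy la"
 define q where "q = (\<integral>\<^sup>+x. Q x \<partial>\<mu>)"
 define r where "r = (\<integral>\<^sup>+x. Q x \<partial>la)"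
 have Y': "Y = (\<integral>\<^sup>+x. potential la x \<partial>\<mu>)"
  unfolding Y_def using M(5) L(5) M.sigma_finite_measure_axioms L.sigma_finite_measure_axioms
  by (intro nn_integral_potential_commute)
 have finX: "X < \<infinity>" "q < \<infinity>" "Z < \<infinity>"
  using fin E by (auto simp: X_def q_def Z_def weighted_energy_def ennreal_mult_eq_top_iff less_top[symmetric] top_unique)
 have ineq: "X + 2 * q <= ennreal (1 - t) * (ennreal (1 - t) * X + ennreal t * Y) + ennreal t * (ennreal (1 - t) * Y + ennreal t * Z)
   + 2 * (ennreal (1 - t) * q + ennreal t * r)" if t: "0 <= t" "t <= 1" for t
 proof -
  define \<nu> where "\<nu> = mixture t \<mu> la"
  have \<nu>: "unit_sphere_measure \<nu>" unfolding \<nu>_def by (rule unit_sphere_measure_mixture[OF \<mu> la t])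
  have "X + 2 * q = min_energy Q" using eq by (simp add: equilibrium_measure_def weighted_energy_def X_def q_def)
  also have "... <= weighted_energy Q \<nu>" unfolding min_energy_def using \<nu> by (intro INF_lower) simp
  also have "weighted_energy Q \<nu> = energy \<nu> + 2 * (ennreal (1 - t) * q + ennreal t * r)"
   unfolding weighted_energy_def \<nu>_def nn_integral_mixture[OF sl Qm(1)] q_def r_def by simp
  also have "energy \<nu> = (\<integral>\<^sup>+x. potential \<nu> x \<partial>\<nu>)" by (rule energy_eq_potential)
  also have "potential \<nu> = (%x. ennreal (1 - t) * potential \<mu> x + ennreal t * potential la x)"
   by (simp add: fun_eq_iff potential_def \<nu>_def nn_integral_mixture[OF sl km])
  also have "(\<integral>\<^sup>+x. ennreal (1 - t) * potential \<mu> x + ennreal t * potential la x \<partial>\<nu>) = ennreal (1 - t) * (ennreal (1 - t) * X + ennreal t * Y) + ennreal t * (ennreal (1 - t) * Y + ennreal t * Z)"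
  proof -
   have pot: "(\<integral>\<^sup>+x. ennreal (1 - t) * potential \<mu> x + ennreal t * potential la x \<partial>\<rho>) =
     ennreal (1 - t) * (\<integral>\<^sup>+x. potential \<mu> x \<partial>\<rho>) + ennreal t * (\<integral>\<^sup>+x. potential la x \<partial>\<rho>)" if "\<rho> \<in> {\<mu>, la}" for \<rho>
   proof -
    have [measurable]: "potential \<mu> \<in> borel_measurable \<rho>" "potential la \<in> borel_measurable \<rho>" using pm that by auto
    show ?thesis by (subst nn_integral_add, measurable, subst (1 2) nn_integral_cmult, measurable)
   qed
   have "(%x. ennreal (1 - t) * potential \<mu> x + ennreal t * potential la x) \<in> borel_measurable \<mu>"
    using pm by (intro borel_measurable_add borel_measurable_times_ennreal) auto
   note nn_integral_mixture[OF sl this, of t]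
   then show ?thesis unfolding \<nu>_def using pot[of \<mu>] pot[of la]
    by (simp add: X_def Y_def[symmetric] Y'[symmetric] Z_def energy_eq_potential[symmetric])
  qed
  finally show ?thesis by (simp add: add.assoc)
 qed
 have "X + q <= Y + r"
 proof (cases "Y = \<infinity> \<or> r = \<infinity>")
  case False
  then obtain x y z q' r' where *: "X = ennreal x" "Y = ennreal y" "Z = ennreal z" "q = ennreal q'" "r = ennreal r'"
   "0 <= x" "0 <= y" "0 <= z" "0 <= q'" "0 <= r'"
   using finX by (cases X; cases Y; cases Z; cases q; cases r) auto
  have real: "x + 2 * q' <= (1 - t) * ((1 - t) * x + t * y) + t * ((1 - t) * y + t * z) + 2 * ((1 - t) * q' + t * r')"
   if "0 < t" "t < 1" for t
  proof -
   have "ennreal (x + 2 * q') <= ennreal ((1 - t) * ((1 - t) * x + t * y) + t * ((1 - t) * y + t * z) + 2 * ((1 - t) * q' + t * r'))"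
    using ineq[of t] that unfolding * using *(6-)
    by (simp add: ennreal_mult[symmetric] ennreal_plus[symmetric] del: ennreal_plus flip: ennreal_numeral)
   then show ?thesis using * that by (subst (asm) ennreal_le_iff) auto
  qed
  have eps: "x + q' <= y + r' + e" if e: "0 < e" for e
  proof -
   \<comment> \<open>The second-order term t (x + z - 2 y) is at most t W, and t is taken so small
     that t W <= 2 e.\<close>
   define W where "W = \<bar>x + z - 2 * y\<bar> + 1"
   define t where "t = min (1 / 2) (2 * e / W)"
   have W: "0 < W" by (simp add: W_def add_nonneg_pos)
   have t: "0 < t" "t < 1" "t * W <= 2 * e"
    using e W by (auto simp: t_def min_def field_simps)
   from real[OF t(1,2)] have "0 <= t * (2 * (y + r' - x - q') + t * (x + z - 2 * y))"
    by (simp add: algebra_simps power2_eq_square)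
   then have "0 <= 2 * (y + r' - x - q') + t * (x + z - 2 * y)"
    using t(1) by (simp add: zero_le_mult_iff)
   moreover have "t * (x + z - 2 * y) <= t * W" using t(1) by (intro mult_left_mono) (auto simp: W_def)
   moreover have "- D <= e" if "0 <= 2 * D + T" "T <= V" "V <= 2 * e" for D T V :: real
    using that by linarith
   ultimately have "- (y + r' - x - q') <= e" using t(3) by blast
   then show ?thesis by simp
  qed
  have "x + q' <= y + r'" by (rule field_le_epsilon[OF eps])
  then show ?thesis unfolding * using *(6-) by (simp add: ennreal_plus[symmetric] del: ennreal_plus)
 qed auto
 also have "Y + r = (\<integral>\<^sup>+x. potential \<mu> x + Q x \<partial>la)"
  unfolding Y_def r_def using pm Qm by (intro nn_integral_add[symmetric]) auto
 finally show ?thesis by (simp add: X_def q_def)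
qed

text \<open>If f < c held on a set of positive measure, that set would itself violate the test.
  Finiteness of c and of M keeps the resulting inequality of integrals strict.\<close>

lemma AE_ge_by_tests:
 fixes f :: "'a => ennreal"
 assumes M: "finite_measure M" and f[measurable]: "f \<in> borel_measurable M" and c: "c < \<infinity>"
  and test: "!!E. E \<in> sets M ==> 0 < emeasure M E ==> c * emeasure M E <= (\<integral>\<^sup>+x. f x * indicator E x \<partial>M)"
 shows "AE x in M. c <= f x"
proof (rule ccontr)
 interpret finite_measure M by fact
 assume neg: "\<not> (AE x in M. c <= f x)"
 define E where "E = {x \<in> space M. f x < c}"
 have E[measurable]: "E \<in> sets M" unfolding E_def by measurable
 have pos: "0 < emeasure M E"
 proof (rule ccontr)
  assume "\<not> 0 < emeasure M E"
  then have "E \<in> null_sets M" using E by (simp add: null_sets_def)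
  then have "AE x in M. x \<notin> E" by (rule AE_not_in)
  then have "AE x in M. c <= f x" by (rule AE_mp) (auto simp: E_def not_less)
  with neg show False by simp
 qed
 have cE: "(\<integral>\<^sup>+x. c * indicator E x \<partial>M) = c * emeasure M E" by (simp add: nn_integral_cmult)
 have le: "AE x in M. f x * indicator E x <= c * indicator E x"
  by (rule AE_I2) (auto simp: E_def indicator_def less_imp_le)
 have "(\<integral>\<^sup>+x. f x * indicator E x \<partial>M) <= c * emeasure M E"
  unfolding cE[symmetric] by (rule nn_integral_mono_AE[OF le])
 also have "... < \<infinity>" using c emeasure_finite[of E]
  unfolding infinity_ennreal_def less_top ennreal_mult_less_top by blast
 finally have fin: "(\<integral>\<^sup>+x. f x * indicator E x \<partial>M) ~= \<infinity>" by simp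
 have "(\<integral>\<^sup>+x. f x * indicator E x \<partial>M) < (\<integral>\<^sup>+x. c * indicator E x \<partial>M)"
 proof (rule nn_integral_less[OF _ _ fin le])
  show "\<not> (AE x in M. c * indicator E x <= f x * indicator E x)"
  proof
   assume "AE x in M. c * indicator E x <= f x * indicator E x"
   then have "AE x in M. c <= f x"
    by (rule AE_mp) (rule AE_I2, auto simp: E_def indicator_def not_less split: if_splits)
   with neg show False by simp
  qed
 qed measurable
 with test[OF E pos] show False unfolding cE by simp
qed

lemma AE_eq_const:
 fixes f :: "'a => ennreal"
 assumes f[measurable]: "f \<in> borel_measurable M" and c: "c < \<infinity>" and M: "emeasure M (space M) = 1"
  and ge: "AE x in M. c <= f x" and I: "(\<integral>\<^sup>+x. f x \<partial>M) = c"
 shows "AE x in M. f x = c"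
proof -
 have "AE x in M. f x <= c"
 proof (rule ccontr)
  assume "\<not> (AE x in M. f x <= c)"
  then have "(\<integral>\<^sup>+x. c \<partial>M) < (\<integral>\<^sup>+x. f x \<partial>M)"
   using c M ge by (intro nn_integral_less) auto
  then show False using I M by simp
 qed
 with ge show ?thesis by eventually_elim (rule antisym)
qed

text \<open>A source of test measures: restricting M to E and normalizing multiplies the energy by
  at most M(E)^(-2), so it stays finite.\<close>

lemma normalized_restriction:
 fixes M :: "(real ^ 'n::finite) measure"
 assumes M: "finite_measure M" "sets M = sets sphere_borel" and E: "E \<in> sets M" "0 < emeasure M E"
  and fin: "energy M < \<infinity>"
 obtains L where "unit_sphere_measure L" "energy L < \<infinity>"
  "!!f. f \<in> borel_measurable M ==> (\<integral>\<^sup>+x. f x \<partial>L) * emeasure M E = (\<integral>\<^sup>+x. f x * indicator E x \<partial>M)"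
proof -
 interpret finite_measure M by fact
 note [measurable] = E(1)
 have id: "(%x. x) \<in> borel_measurable M" by (rule measurable_sphereI[OF _ M(2)]) simp
 have km[measurable]: "(%y. kern x y) \<in> borel_measurable M" for x
  by (rule borel_measurable_kern[OF _ id]) simp
 have pm[measurable]: "potential M \<in> borel_measurable M"
  by (rule borel_measurable_potential[OF sigma_finite_measure_axioms id id])
 define w where "w = inverse (emeasure M E)"
 have w: "w < \<infinity>" "w * emeasure M E = 1"
 proof -
  have "emeasure M E ~= 0" "emeasure M E ~= \<infinity>" using E by auto
  then obtain r where r: "emeasure M E = ennreal r" "0 < r"
   by (cases "emeasure M E") (auto simp: less_le)
  then show "w < \<infinity>" "w * emeasure M E = 1"
   by (auto simp: w_def inverse_ennreal ennreal_mult[symmetric])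
 qed
 define L where "L = density M (%x. w * indicator E x)"
 have int: "(\<integral>\<^sup>+x. f x \<partial>L) = w * (\<integral>\<^sup>+x. f x * indicator E x \<partial>M)" if [measurable]: "f \<in> borel_measurable M" for f
  unfolding L_def by (subst nn_integral_density) (auto simp: mult_ac nn_integral_cmult[symmetric])
 have 3: "(\<integral>\<^sup>+x. f x \<partial>L) * emeasure M E = (\<integral>\<^sup>+x. f x * indicator E x \<partial>M)" if "f \<in> borel_measurable M" for f
  unfolding int[OF that] using w(2) by (simp add: mult_ac) (metis mult.assoc mult.commute mult_1)
 have "emeasure L (space L) = (\<integral>\<^sup>+x. 1 \<partial>L)" by simp
 also have "... = w * emeasure M E" by (subst int) auto
 finally have 1: "unit_sphere_measure L"
  using w(2) M(2) by (simp add: unit_sphere_measure_def L_def)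
 have potL: "potential L x <= w * potential M x" for x
  unfolding potential_def int[OF km] by (intro mult_left_mono nn_integral_mono) (auto simp: indicator_def)
 have "energy L <= (\<integral>\<^sup>+x. w * potential M x \<partial>L)"
  unfolding energy_eq_potential by (intro nn_integral_mono potL)
 also have "... = w * (\<integral>\<^sup>+x. w * potential M x * indicator E x \<partial>M)"
  by (rule int) measurable
 also have "... <= w * (\<integral>\<^sup>+x. w * potential M x \<partial>M)"
  by (intro mult_left_mono nn_integral_mono) (auto simp: indicator_def)
 also have "... = w * (w * energy M)" unfolding energy_eq_potential by (subst nn_integral_cmult) auto
 also have "... < \<infinity>" using w fin by (simp add: ennreal_mult_less_top)
 finally have 2: "energy L < \<infinity>" .
 from 1 2 3 show thesis by (rule that)
qed

lemma weighted_energy_finiteD: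
 assumes "weighted_energy Q \<mu> < \<infinity>"
 shows "energy \<mu> < \<infinity>" "(\<integral>\<^sup>+x. Q x \<partial>\<mu>) < \<infinity>"
 using assms by (auto simp: weighted_energy_def ennreal_mult_less_top)

text \<open>All normalized restrictions of M are admissible in the variational inequality. The case
  of interest is surface measure, which sees the whole cap whatever mu looks like.\<close>

lemma equilibrium_AE_ge:
 fixes Q :: "real ^ 'n::finite => ennreal"
 assumes eq: "equilibrium_measure Q \<mu>" and fin: "weighted_energy Q \<mu> < \<infinity>"
  and Q: "Q \<in> borel_measurable sphere_borel"
  and M: "finite_measure M" "sets M = sets sphere_borel" "energy M < \<infinity>"
 shows "AE x in M. energy \<mu> + (\<integral>\<^sup>+x. Q x \<partial>\<mu>) <= potential \<mu> x + Q x"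
proof (rule AE_ge_by_tests[OF M(1)])
 have \<mu>: "unit_sphere_measure \<mu>" using eq by (simp add: equilibrium_measure_def)
 note U = unit_sphere_measureD[OF \<mu>]
 interpret U: finite_measure \<mu> by (rule U(4))
 have id: "(%x. x) \<in> borel_measurable M" by (rule measurable_sphereI[OF _ M(2)]) simp
 have "Q \<in> borel_measurable M" using Q measurable_cong_sets[OF M(2) refl] by blast
 then show m: "(%x. potential \<mu> x + Q x) \<in> borel_measurable M"
  using borel_measurable_potential[OF U.sigma_finite_measure_axioms id U(5)] by (intro borel_measurable_add)
 show "energy \<mu> + (\<integral>\<^sup>+x. Q x \<partial>\<mu>) < \<infinity>"
  using weighted_energy_finiteD[OF fin] by (auto simp: less_top)
 fix E assume E: "E \<in> sets M" "0 < emeasure M E"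
 obtain L where L: "unit_sphere_measure L" "energy L < \<infinity>"
  and int: "!!f. f \<in> borel_measurable M ==> (\<integral>\<^sup>+x. f x \<partial>L) * emeasure M E = (\<integral>\<^sup>+x. f x * indicator E x \<partial>M)"
  using normalized_restriction[OF M(1,2) E M(3)] by metis
 have "(energy \<mu> + (\<integral>\<^sup>+x. Q x \<partial>\<mu>)) * emeasure M E <= (\<integral>\<^sup>+x. potential \<mu> x + Q x \<partial>L) * emeasure M E"
  by (intro mult_right_mono equilibrium_variational_inequality[OF eq fin Q L]) simp
 also have "... = (\<integral>\<^sup>+x. (potential \<mu> x + Q x) * indicator E x \<partial>M)" by (rule int[OF m])
 finally show "(energy \<mu> + (\<integral>\<^sup>+x. Q x \<partial>\<mu>)) * emeasure M E <= (\<integral>\<^sup>+x. (potential \<mu> x + Q x) * indicator E x \<partial>M)" .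
qed

text \<open>The measure mu is admissible too, and the mean of U^mu + Q under mu equals the lower
  bound; a function that is at least its own mean is constant almost everywhere.\<close>

lemma equilibrium_AE_eq:
 fixes Q :: "real ^ 'n::finite => ennreal"
 assumes eq: "equilibrium_measure Q \<mu>" and fin: "weighted_energy Q \<mu> < \<infinity>"
  and Q: "Q \<in> borel_measurable sphere_borel"
 shows "AE x in \<mu>. potential \<mu> x + Q x = energy \<mu> + (\<integral>\<^sup>+x. Q x \<partial>\<mu>)"
proof -
 have \<mu>: "unit_sphere_measure \<mu>" using eq by (simp add: equilibrium_measure_def)
 note U = unit_sphere_measureD[OF \<mu>]
 interpret U: finite_measure \<mu> by (rule U(4))
 have c: "energy \<mu> + (\<integral>\<^sup>+x. Q x \<partial>\<mu>) < \<infinity>" "energy \<mu> < \<infinity>"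
  using weighted_energy_finiteD[OF fin] by (auto simp: less_top)
 have Qm: "Q \<in> borel_measurable \<mu>" using Q measurable_cong_sets[OF U(1) refl] by blast
 have pm: "potential \<mu> \<in> borel_measurable \<mu>"
  by (rule borel_measurable_potential[OF U.sigma_finite_measure_axioms U(5) U(5)])
 show ?thesis
 proof (rule AE_eq_const[OF _ c(1) U(3)])
  show "(%x. potential \<mu> x + Q x) \<in> borel_measurable \<mu>" using Qm pm by (rule borel_measurable_add[rotated])
  show "AE x in \<mu>. energy \<mu> + (\<integral>\<^sup>+x. Q x \<partial>\<mu>) <= potential \<mu> x + Q x"
   by (rule equilibrium_AE_ge[OF eq fin Q U(4) U(1) c(2)])
  show "(\<integral>\<^sup>+x. potential \<mu> x + Q x \<partial>\<mu>) = energy \<mu> + (\<integral>\<^sup>+x. Q x \<partial>\<mu>)"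
   unfolding energy_eq_potential by (rule nn_integral_add[OF pm Qm])
 qed
qed

lemma kern_tendsto:
 assumes "(f \<longlongrightarrow> x) F"
 shows "((%i. kern (f i) y) \<longlongrightarrow> kern x y) F"
proof -
 have "continuous_on UNIV (%x. kern x y)"
  unfolding kern_def by (intro continuous_on_inverse_ennreal continuous_on_ennreal continuous_intros)
 from continuous_on_tendsto_compose[OF this assms] show ?thesis by simp
qed

text \<open>Fatou's lemma makes the potential lower semicontinuous, so an upper bound that holds almost
 everywhere extends to the support.\<close>

lemma potential_le_on_supp:
 fixes Q :: "real ^ 'n::finite => ennreal"
 assumes \<mu>: "unit_sphere_measure \<mu>" and ae: "AE x in \<mu>. potential \<mu> x + Q x <= c"
  and x: "x \<in> supp \<mu>" and Q: "(Q \<longlongrightarrow> Q x) (at x within sphere 0 1)"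
 shows "potential \<mu> x + Q x <= c"
proof -
 note U = unit_sphere_measureD[OF \<mu>]
 interpret U: finite_measure \<mu> by (rule U(4))
 have km: "(%y. kern x y) \<in> borel_measurable \<mu>" for x
  by (rule borel_measurable_kern[OF _ U(5)]) simp
 \<comment> \<open>Neighbourhoods of a point of the support have positive mass, so they contain
   points where the almost everywhere bound holds.\<close>
 have ex: "\<exists>y. y \<in> ball x (1 / real (Suc i)) \<inter> sphere 0 1 \<and> potential \<mu> y + Q y <= c" for i
 proof (rule ccontr)
  assume *: "\<not> ?thesis"
  let ?B = "ball x (1 / real (Suc i)) \<inter> space \<mu>"
  have "AE y in \<mu>. y \<notin> ?B"
   using ae by eventually_elim (use * U(2) in auto)
  moreover have "?B \<in> sets \<mu>"
   unfolding U(1,2) by (subst sets_restrict_space) (auto intro!: image_eqI[of _ _ "ball x (1 / real (Suc i))"])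
  ultimately have "emeasure \<mu> ?B = 0"
   by (subst AE_iff_measurable[of ?B, symmetric]) (use sets.sets_into_space in auto)
  moreover have "0 < emeasure \<mu> ?B"
   using x unfolding supp_def by auto
  ultimately show False by simp
 qed
 then obtain y where y: "!!i. y i \<in> ball x (1 / real (Suc i)) \<inter> sphere 0 1" "!!i. potential \<mu> (y i) + Q (y i) <= c"
  by metis
 have lim: "y \<longlonglongrightarrow> x"
 proof (rule metric_tendsto_imp_tendsto[OF LIMSEQ_inverse_real_of_nat])
  show "eventually (%i. dist (y i) x <= dist (inverse (real (Suc i))) 0) sequentially"
   using y(1) by (intro always_eventually) (auto simp: dist_commute inverse_eq_divide less_imp_le)
 qed
 have Ql: "(%i. Q (y i)) \<longlonglongrightarrow> Q x"
  unfolding tendsto_def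
 proof (intro allI impI)
  fix S assume S: "open S" "Q x \<in> S"
  then have "eventually (%z. Q z \<in> S) (at x within sphere 0 1)" using Q by (simp add: tendsto_def)
  then obtain d where d: "0 < d" "!!z. z \<in> sphere 0 1 ==> z ~= x ==> dist z x < d ==> Q z \<in> S"
   unfolding eventually_at by auto
  have "eventually (%i. dist (y i) x < d) sequentially" using lim d(1) by (rule tendstoD)
  then show "eventually (%i. Q (y i) \<in> S) sequentially"
  proof eventually_elim
   case (elim i)
   then show ?case using d(2)[of "y i"] y(1)[of i] S(2) by (cases "y i = x") auto
  qed
 qed
 have pq: "(\<integral>\<^sup>+z. kern w z + q \<partial>\<mu>) = potential \<mu> w + q" for w q
  unfolding potential_def using U(3) by (subst nn_integral_add[OF km]) auto
 have "potential \<mu> x + Q x = (\<integral>\<^sup>+z. kern x z + Q x \<partial>\<mu>)" by (simp add: pq)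
 also have "... = (\<integral>\<^sup>+z. liminf (%i. kern (y i) z + Q (y i)) \<partial>\<mu>)"
 proof (rule nn_integral_cong, goal_cases)
  case (1 z)
  have "(%i. kern (y i) z + Q (y i)) \<longlonglongrightarrow> kern x z + Q x"
   by (intro tendsto_add kern_tendsto lim Ql)
  then show ?case
   by (intro lim_imp_Liminf[symmetric]) auto
 qed
 also have "... <= liminf (%i. \<integral>\<^sup>+z. kern (y i) z + Q (y i) \<partial>\<mu>)"
  by (rule nn_integral_liminf) (intro borel_measurable_add km borel_measurable_const)
 also have "... <= c"
  unfolding pq by (intro Liminf_le) (auto simp: y(2))
 finally show ?thesis .
qed

section \<open>Abel integrals of differentiable functions\<close>

definition beta_weight :: "real => real => real => real" where
 "beta_weight a b u = indicator {0<..<1} u * (u powr (a - 1) * (1 - u) powr (b - 1))"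

definition beta_measure :: "real => real => real measure" where
 "beta_measure a b = density lborel (%u. ennreal (beta_weight a b u))"

lemma beta_weight_measurable [measurable]: "beta_weight a b \<in> borel_measurable borel"
 unfolding beta_weight_def by measurable

lemma beta_weight_nonneg: "0 <= beta_weight a b u"
 by (simp add: beta_weight_def)

lemma sets_beta_measure [simp, measurable_cong]: "sets (beta_measure a b) = sets borel"
 by (simp add: beta_measure_def)

lemma space_beta_measure [simp]: "space (beta_measure a b) = UNIV"
 by (simp add: beta_measure_def)

lemma nn_integral_beta_measure:
 assumes [measurable]: "f \<in> borel_measurable borel"
 shows "(\<integral>\<^sup>+u. f u \<partial>beta_measure a b) = (II u. ennreal (beta_weight a b u) * f u)"
 unfolding beta_measure_def by (subst nn_integral_density) auto

lemma AE_beta_measure: "AE u in beta_measure a b. 0 < u \<and> u < 1"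
 unfolding beta_measure_def by (subst AE_density) (auto simp: beta_weight_def indicator_def)

text \<open>Rescaling to (0, 1) puts the singular kernel into a fixed measure and the moving end
  point into the integrand, where it can be differentiated.\<close>

lemma nn_integral_beta_affine:
 assumes [measurable]: "f \<in> borel_measurable borel" and lr: "l < r"
 shows "(II s. f s * (ennreal ((s - l) powr (a - 1) * (r - s) powr (b - 1)) * indicator {l<..<r} s)) =
  ennreal ((r - l) powr (a + b - 1)) * (\<integral>\<^sup>+u. f (l + (r - l) * u) \<partial>beta_measure a b)"
proof -
 let ?d = "r - l"
 have d: "0 < ?d" using lr by simp
 have "(II s. f s * (ennreal ((s - l) powr (a - 1) * (r - s) powr (b - 1)) * indicator {l<..<r} s)) =
  ennreal ?d * (II u. f (l + ?d * u) * (ennreal ((l + ?d * u - l) powr (a - 1) * (r - (l + ?d * u)) powr (b - 1)) * indicator {l<..<r} (l + ?d * u)))"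
  using d by (subst nn_integral_real_affine[where c="?d" and t=l]) auto
 also have "... = ennreal ?d * (II u. ennreal (?d powr (a + b - 2)) * (ennreal (beta_weight a b u) * f (l + ?d * u)))"
 proof (rule arg_cong2[where f="(*)", OF refl], rule nn_integral_cong)
  fix u :: real
  have ind: "l + ?d * u \<in> {l<..<r} \<longleftrightarrow> u \<in> {0<..<1}"
  proof -
   have "l + ?d * u < r \<longleftrightarrow> ?d * u < ?d * 1"
    by (simp only: mult_1_right less_diff_eq add.commute)
   then show ?thesis using d by (simp only: greaterThanLessThan_iff mult_less_cancel_left_pos) (simp add: zero_less_mult_iff)
  qed
  have "(l + ?d * u - l) powr (a - 1) * (r - (l + ?d * u)) powr (b - 1) = ?d powr (a + b - 2) * (u powr (a - 1) * (1 - u) powr (b - 1))" if "u \<in> {0<..<1}"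
  proof -
   have "r - (l + ?d * u) = ?d * (1 - u)" "l + ?d * u - l = ?d * u" by (simp_all add: algebra_simps)
   then have "(l + ?d * u - l) powr (a - 1) * (r - (l + ?d * u)) powr (b - 1) = (?d powr (a - 1) * ?d powr (b - 1)) * (u powr (a - 1) * (1 - u) powr (b - 1))"
    using that d by (simp only: powr_mult) (simp add: powr_mult mult_ac)
   also have "?d powr (a - 1) * ?d powr (b - 1) = ?d powr (a + b - 2)"
    by (simp add: powr_add[symmetric])
   finally show ?thesis .
  qed
  then show "f (l + ?d * u) * (ennreal ((l + ?d * u - l) powr (a - 1) * (r - (l + ?d * u)) powr (b - 1)) * indicator {l<..<r} (l + ?d * u)) =
   ennreal (?d powr (a + b - 2)) * (ennreal (beta_weight a b u) * f (l + ?d * u))"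
   using ind by (cases "u \<in> {0<..<1}") (simp_all add: beta_weight_def ennreal_mult mult_ac)
 qed
 also have "... = ennreal ?d * (ennreal (?d powr (a + b - 2)) * (\<integral>\<^sup>+u. f (l + ?d * u) \<partial>beta_measure a b))"
  by (subst nn_integral_cmult) (simp_all add: nn_integral_beta_measure)
 also have "... = ennreal (?d powr (a + b - 1)) * (\<integral>\<^sup>+u. f (l + ?d * u) \<partial>beta_measure a b)"
 proof -
  have "D * D powr (a + b - 2) = D powr (a + b - 1)" if "0 < D" for D :: real
   using that powr_add[of D 1 "a + b - 2"] by simp
  from this[OF d] have "ennreal ?d * ennreal (?d powr (a + b - 2)) = ennreal (?d powr (a + b - 1))"
   using d by (simp add: ennreal_mult[symmetric])
  then show ?thesis by (simp only: mult.assoc[symmetric])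
 qed
 finally show ?thesis .
qed

lemma emeasure_beta_measure:
 assumes "0 < a" "0 < b"
 shows "emeasure (beta_measure a b) UNIV = ennreal (Beta a b)"
proof -
 have "emeasure (beta_measure a b) UNIV = (\<integral>\<^sup>+u. 1 \<partial>beta_measure a b)" by simp
 also have "... = (II t. ennreal ((t - 0) powr (a - 1) * (1 - t) powr (b - 1)) * indicator {0<..<1} t)"
  by (subst nn_integral_beta_measure) (auto intro!: nn_integral_cong simp: beta_weight_def indicator_def)
 also have "... = ennreal (Beta a b)" using assms by (subst nn_integral_Beta) auto
 finally show ?thesis .
qed

lemma finite_measure_beta_measure:
 assumes "0 < a" "0 < b"
 shows "finite_measure (beta_measure a b)"
 by (rule finite_measureI) (simp add: emeasure_beta_measure[OF assms])

text \<open>The mean value inequality bounds the difference quotients by D, and dominated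
  convergence applies. Since \<open>f'\<close> is only given pointwise almost everywhere and may
  fail to be measurable, the result is stated with a measurable version g of it.\<close>

lemma DERIV_integral_dominated:
 fixes f f' :: "real => 'a => real"
 assumes x0: "l < x0" "x0 < r"
  and int: "!!x. l < x ==> x < r ==> integrable M (f x)"
  and D: "integrable M D"
  and der: "AE u in M. \<forall>x. l < x \<and> x < r \<longrightarrow> ((%x. f x u) has_real_derivative f' x u) (at x) \<and> \<bar>f' x u\<bar> <= D u"
 obtains g where "integrable M g" "AE u in M. g u = f' x0 u" "((%x. \<integral>u. f x u \<partial>M) has_real_derivative (\<integral>u. g u \<partial>M)) (at x0)"
proof -
 define e where "e = (%i::nat. (r - x0) / (real i + 2))"
 have e: "0 < e i" "x0 + e i < r" for i
 proof -
  show "0 < e i" using x0 by (simp add: e_def)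
  have "e i < (r - x0) / 1" unfolding e_def using x0 by (intro divide_strict_left_mono) auto
  then show "x0 + e i < r" by simp
 qed
 have elim0: "e \<longlonglongrightarrow> 0" unfolding e_def by real_asymp
 have fm[measurable]: "f x \<in> borel_measurable M" if "l < x" "x < r" for x
  using int[OF that] by simp
 define g where "g = (%u. lim (%i. (f (x0 + e i) u - f x0 u) / e i))"
 have quot: "(%i. (f (x0 + s i) u - f x0 u) / s i) \<longlonglongrightarrow> f' x0 u"
  if "((%x. f x u) has_real_derivative f' x0 u) (at x0)" "s \<longlonglongrightarrow> 0" "!!i. s i ~= 0" for u and s :: "nat => real"
 proof -
  have "((%h. (f (x0 + h) u - f x0 u) / h) \<longlongrightarrow> f' x0 u) (at 0)"
   using that(1) by (simp add: DERIV_def)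
  moreover have "filterlim s (at 0) sequentially"
   using that(2,3) by (simp add: filterlim_at)
  ultimately show ?thesis by (rule filterlim_compose)
 qed
 have gae: "AE u in M. g u = f' x0 u"
  using der
 proof eventually_elim
  case (elim u)
  then have "((%x. f x u) has_real_derivative f' x0 u) (at x0)" using x0 by blast
  from quot[OF this elim0] e show ?case unfolding g_def by (metis limI less_irrefl)
 qed
 have gm[measurable]: "g \<in> borel_measurable M"
  unfolding g_def
 proof (rule borel_measurable_lim_metric)
  fix i
  have "f (x0 + e i) \<in> borel_measurable M" "f x0 \<in> borel_measurable M"
   using e[of i] x0 by (intro fm; simp)+
  then show "(%u. (f (x0 + e i) u - f x0 u) / e i) \<in> borel_measurable M" by simp
 qed
 have gD: "AE u in M. \<bar>g u\<bar> <= D u"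
  using gae der by eventually_elim (use x0 in auto)
 have gint: "integrable M g"
  using gD by (intro Bochner_Integration.integrable_bound[OF D gm]) auto
 have "((%h. ((\<integral>u. f (x0 + h) u \<partial>M) - (\<integral>u. f x0 u \<partial>M)) / h) \<longlongrightarrow> (\<integral>u. g u \<partial>M)) (at 0)"
  unfolding tendsto_at_iff_sequentially
 proof (intro allI impI)
  fix s :: "nat => real" assume s: "\<forall>i. s i \<in> UNIV - {0}" "s \<longlonglongrightarrow> 0"
  \<comment> \<open>From some index on, the steps stay inside (l, r), the only place where the
    domination is assumed.\<close>
  define d where "d = min (x0 - l) (r - x0)"
  have d: "0 < d" using x0 by (simp add: d_def)
  have "eventually (%i. dist (s i) 0 < d) sequentially" using s(2) d by (rule tendstoD)
  then obtain N where N: "!!i. N <= i ==> \<bar>s i\<bar> < d"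
   unfolding eventually_sequentially by (auto simp: dist_real_def)
  have rng: "l < x0 + s (i + N)" "x0 + s (i + N) < r" for i
   using N[of "i + N"] by (auto simp: d_def abs_less_iff)
  let ?t = "%i. s (i + N)"
  have tlim: "?t \<longlonglongrightarrow> 0" using s(2) by (rule LIMSEQ_ignore_initial_segment)
  have tnz: "?t i ~= 0" for i using s(1) by simp
  have "(%i. \<integral>u. (f (x0 + ?t i) u - f x0 u) / ?t i \<partial>M) \<longlonglongrightarrow> (\<integral>u. g u \<partial>M)"
  proof (rule integral_dominated_convergence[OF gm _ D])
   show "(%u. (f (x0 + ?t i) u - f x0 u) / ?t i) \<in> borel_measurable M" for i
   proof -
    have "f (x0 + ?t i) \<in> borel_measurable M" "f x0 \<in> borel_measurable M"
     using rng[of i] x0 by (intro fm; simp)+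
    then show ?thesis by simp
   qed
   show "AE u in M. (%i. (f (x0 + ?t i) u - f x0 u) / ?t i) \<longlonglongrightarrow> g u"
    using der gae
   proof eventually_elim
    case (elim u)
    then have "((%x. f x u) has_real_derivative f' x0 u) (at x0)" using x0 by blast
    from quot[OF this tlim tnz] elim(2) show ?case by simp
   qed
   show "AE u in M. norm ((f (x0 + ?t i) u - f x0 u) / ?t i) <= D u" for i
    using der
   proof eventually_elim
    case (elim u)
    have "norm (f (x0 + ?t i) u - f x0 u) <= D u * norm (x0 + ?t i - x0)"
    proof (rule field_differentiable_bound[of "{l<..<r}"])
     show "((%x. f x u) has_field_derivative f' x u) (at x within {l<..<r})" if "x \<in> {l<..<r}" for x
     proof -
      have "((%x. f x u) has_real_derivative f' x u) (at x)" using elim that unfolding greaterThanLessThan_iff by blast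
      then show ?thesis by (rule has_field_derivative_at_within)
     qed
     show "norm (f' x u) <= D u" if "x \<in> {l<..<r}" for x
      using elim that unfolding greaterThanLessThan_iff real_norm_def by blast
    qed (use x0 rng[of i] in auto)
    then show ?case using tnz[of i] unfolding norm_divide by (subst pos_divide_le_eq) simp_all
   qed
  qed
  also have "(%i. \<integral>u. (f (x0 + ?t i) u - f x0 u) / ?t i \<partial>M) = (%i. ((\<integral>u. f (x0 + ?t i) u \<partial>M) - (\<integral>u. f x0 u \<partial>M)) / ?t i)"
  proof
   fix i
   have "integrable M (f (x0 + ?t i))" "integrable M (f x0)" using rng[of i] x0 by (intro int; simp)+
   then show "(\<integral>u. (f (x0 + ?t i) u - f x0 u) / ?t i \<partial>M) = ((\<integral>u. f (x0 + ?t i) u \<partial>M) - (\<integral>u. f x0 u \<partial>M)) / ?t i"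
    by simp
  qed
  finally have "(%i. ((%h. ((\<integral>u. f (x0 + h) u \<partial>M) - (\<integral>u. f x0 u \<partial>M)) / h) \<circ> s) (i + N)) \<longlonglongrightarrow> (\<integral>u. g u \<partial>M)"
   by (simp add: o_def)
  then show "((%h. ((\<integral>u. f (x0 + h) u \<partial>M) - (\<integral>u. f x0 u \<partial>M)) / h) \<circ> s) \<longlonglongrightarrow> (\<integral>u. g u \<partial>M)"
   by (rule LIMSEQ_offset)
 qed
 then have "((%x. \<integral>u. f x u \<partial>M) has_real_derivative (\<integral>u. g u \<partial>M)) (at x0)"
  by (simp add: DERIV_def)
 with gint gae show thesis by (rule that)
qed

text \<open>By t = z u this is the Abel integral of q(t) t^((n-1)/2) (z - t)^(-1/2) over 0 < t <
  z.\<close>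

definition abel_G :: "nat => (real => real) => real => real" where
 "abel_G n q z = z powr (real n / 2) * (\<integral>u. q (z * u) \<partial>beta_measure ((real n + 1) / 2) (1 / 2))"

text \<open>Up to a factor sqrt 2 this is the function g of the formula for F, in the variable w =
  sin^2(zeta/2); see \<open>g_fun_eq\<close>.\<close>

definition abel_gamma :: "nat => (real => real) => real => real" where
 "abel_gamma n q w = deriv (abel_G n q) w * (w powr (1 - real n / 2) * (1 - w) powr (real n / 2))"

text \<open>By w = z + (a - z) v this is the integral of g(w) (w - z)^(-1/2) over z < w < a. The
  indicator restricts the arguments of g to (z, a), where g is under control.\<close>

definition abel_Phi :: "(real => real) => real => real => real" where
 "abel_Phi g a z = sqrt (a - z) * (\<integral>v. g (z + (a - z) * v) * indicator {0<..<1} v \<partial>beta_measure (1 / 2) 1)"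

lemma (in finite_measure) abs_integral_le:
 fixes f :: "'a => real"
 assumes m: "f \<in> borel_measurable M" and b: "AE x in M. \<bar>f x\<bar> <= B"
 shows "\<bar>\<integral>x. f x \<partial>M\<bar> <= B * measure M (space M)"
proof -
 have int: "integrable M f" using integrable_const_bound[of f B] m b by simp
 have "\<bar>\<integral>x. f x \<partial>M\<bar> <= (\<integral>x. \<bar>f x\<bar> \<partial>M)" by (rule integral_abs_bound)
 also have "... <= (\<integral>x. B \<partial>M)" using int b by (intro integral_mono_AE) auto
 also have "... = B * measure M (space M)" by simp
 finally show ?thesis .
qed

text \<open>Differentiation in z under the integral produces g'(w) (1 - v), where a - w = (a - z)(1
  - v). The factor 1 - v thus absorbs a growth of g' like 1/(a - w). The root in front gives the
  limit 0 at a.\<close>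

lemma abel_Phi_regular:
 fixes g g' :: "real => real"
 assumes a: "0 < a"
  and der: "!!w. 0 < w ==> w < a ==> (g has_real_derivative g' w) (at w)"
  and b0: "!!w. 0 < w ==> w < a ==> \<bar>g w\<bar> <= C"
  and b1: "!!w. 0 < w ==> w < a ==> \<bar>g' w\<bar> <= C' / (a - w)"
 shows abel_Phi_integrable: "!!z. 0 <= z ==> z < a ==> integrable (beta_measure (1 / 2) 1) (%v. g (z + (a - z) * v) * indicator {0<..<1} v)"
  and abel_Phi_differentiable: "!!z. 0 < z ==> z < a ==> \<exists>D. (abel_Phi g a has_real_derivative D) (at z)"
  and abel_Phi_tendsto_0: "(abel_Phi g a \<longlongrightarrow> 0) (at_left a)"
proof -
 let ?M = "beta_measure (1 / 2) 1"
 interpret finite_measure ?M by (rule finite_measure_beta_measure) auto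
 have C: "0 <= C" using b0[of "a / 2"] a by linarith
 have C': "0 <= C'"
 proof -
  have "0 <= C' / (a - a / 2)" using b1[of "a / 2"] a by linarith
  then show ?thesis using a by (simp add: zero_le_divide_iff)
 qed
 have rng: "0 < z + (a - z) * v" "z + (a - z) * v < a" if "0 <= z" "z < a" "0 < v" "v < 1" for z v
 proof -
  have "0 < (a - z) * v" using that by simp
  then show "0 < z + (a - z) * v" using that by linarith
  have "(a - z) * v < (a - z) * 1" using that by (intro mult_strict_left_mono) auto
  then show "z + (a - z) * v < a" by simp
 qed
 have contg: "continuous_on {0<..<a} g"
  using der by (intro DERIV_continuous_on[of _ _ g']) (auto intro: has_field_derivative_at_within)
 have m: "(%v. g (z + (a - z) * v) * indicator {0<..<1} v) \<in> borel_measurable ?M" if "0 <= z" "z < a" for z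
 proof -
  have "continuous_on {0<..<1} (%v. g (z + (a - z) * v))"
   by (intro continuous_on_compose2[OF contg] continuous_intros) (use rng[OF that] in auto)
  then have "(%v. indicator {0<..<1} v *\<^sub>R g (z + (a - z) * v)) \<in> borel_measurable borel"
   by (intro borel_measurable_continuous_on_indicator) auto
  moreover have "(%v. indicator {0<..<1} v *\<^sub>R g (z + (a - z) * v)) = (%v. g (z + (a - z) * v) * indicator {0<..<1} v)"
   by (simp add: mult.commute)
  ultimately show ?thesis by (simp add: measurable_cong_sets[OF sets_beta_measure refl])
 qed
 have bnd: "\<bar>g (z + (a - z) * v) * indicator {0<..<1} v\<bar> <= C" if "0 <= z" "z < a" for z v
  using b0[OF rng[OF that]] C by (simp add: indicator_def)
 show int: "integrable ?M (%v. g (z + (a - z) * v) * indicator {0<..<1} v)" if "0 <= z" "z < a" for z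
  by (rule integrable_const_bound[of _ C, OF _ m[OF that]]) (use bnd[OF that] in auto)
 show "\<exists>D. (abel_Phi g a has_real_derivative D) (at z)" if z: "0 < z" "z < a" for z
 proof -
  obtain h where "((%x. \<integral>v. g (x + (a - x) * v) * indicator {0<..<1} v \<partial>?M) has_real_derivative (\<integral>v. h v \<partial>?M)) (at z)"
  proof (rule DERIV_integral_dominated[where l=0 and r="(z + a) / 2" and M="?M" and f="%x v. g (x + (a - x) * v) * indicator {0<..<1} v"
     and f'="%x v. g' (x + (a - x) * v) * (1 - v)" and D="%v. C' / ((a - z) / 2)" and ?x0.0=z])
   show "integrable ?M (%v. g (x + (a - x) * v) * indicator {0<..<1} v)" if "0 < x" "x < (z + a) / 2" for x
    using that z by (intro int) auto
   show "AE v in ?M. \<forall>x. 0 < x \<and> x < (z + a) / 2 \<longrightarrow>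
    ((%x. g (x + (a - x) * v) * indicator {0<..<1} v) has_real_derivative g' (x + (a - x) * v) * (1 - v)) (at x) \<and>
    \<bar>g' (x + (a - x) * v) * (1 - v)\<bar> <= C' / ((a - z) / 2)"
    using AE_beta_measure[of "1 / 2" 1]
   proof eventually_elim
    case (elim v)
    show ?case
    proof (intro allI impI conjI)
     fix x assume "0 < x \<and> x < (z + a) / 2"
     then have x: "0 < x" "x < a" "(a - z) / 2 < a - x" using z by (auto simp: field_simps)
     have r: "0 < x + (a - x) * v" "x + (a - x) * v < a" using rng[of x v] x elim by auto
     have "((%x. x + (a - x) * v) has_real_derivative 1 - v) (at x)"
      by (auto intro!: derivative_eq_intros)
     from DERIV_chain2[OF der[OF r] this]
     show "((%x. g (x + (a - x) * v) * indicator {0<..<1} v) has_real_derivative g' (x + (a - x) * v) * (1 - v)) (at x)"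
      using elim by simp
     have "\<bar>g' (x + (a - x) * v) * (1 - v)\<bar> <= C' / (a - (x + (a - x) * v)) * (1 - v)"
     proof -
      have "\<bar>1 - v\<bar> = 1 - v" using elim by simp
      moreover have "\<bar>g' (x + (a - x) * v)\<bar> * (1 - v) <= C' / (a - (x + (a - x) * v)) * (1 - v)"
       by (rule mult_right_mono[OF b1[OF r]]) (use elim in simp)
      ultimately show ?thesis by (simp only: abs_mult)
     qed
     also have "a - (x + (a - x) * v) = (a - x) * (1 - v)" by (simp add: algebra_simps)
     also have "C' / ((a - x) * (1 - v)) * (1 - v) = C' / (a - x)" using elim by simp
     also have "... <= C' / ((a - z) / 2)" using x z C' by (intro divide_left_mono) auto
     finally show "\<bar>g' (x + (a - x) * v) * (1 - v)\<bar> <= C' / ((a - z) / 2)" .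
    qed
   qed
  qed (use z in auto)
  moreover have "((%z. sqrt (a - z)) has_real_derivative inverse (sqrt (a - z)) / 2 * (- 1)) (at z)"
  proof -
   have "((%z. a - z) has_real_derivative - 1) (at z)" by (auto intro!: derivative_eq_intros)
   moreover have "(sqrt has_real_derivative inverse (sqrt (a - z)) / 2) (at (a - z))"
    using z by (intro DERIV_real_sqrt) auto
   ultimately show ?thesis by (rule DERIV_chain2[rotated])
  qed
  ultimately have "\<exists>D. ((%z. sqrt (a - z) * (\<integral>v. g (z + (a - z) * v) * indicator {0<..<1} v \<partial>?M)) has_real_derivative D) (at z)"
   by (intro exI) (rule DERIV_mult)
  then show ?thesis unfolding abel_Phi_def[abs_def] .
 qed
 show "(abel_Phi g a \<longlongrightarrow> 0) (at_left a)"
 proof (rule Lim_null_comparison)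
  show "eventually (%z. norm (abel_Phi g a z) <= sqrt (a - z) * (C * measure ?M (space ?M))) (at_left a)"
  proof -
   have "eventually (%z. z \<in> {0<..<a}) (at_left a)" using a by (intro eventually_at_leftI[of 0]) auto
   then show ?thesis
   proof eventually_elim
    case (elim z)
    then have "\<bar>\<integral>v. g (z + (a - z) * v) * indicator {0<..<1} v \<partial>?M\<bar> <= C * measure ?M (space ?M)"
     by (intro abs_integral_le m AE_I2 bnd) auto
    then show ?case unfolding abel_Phi_def real_norm_def abs_mult using elim
     by (intro mult_mono) auto
   qed
  qed
  have "((%z. sqrt (a - z) * (C * measure ?M (space ?M))) \<longlongrightarrow> sqrt (a - a) * (C * measure ?M (space ?M))) (at_left a)"
   by (intro tendsto_intros)
  then show "((%z. sqrt (a - z) * (C * measure ?M (space ?M))) \<longlongrightarrow> 0) (at_left a)" by simp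
 qed
qed

text \<open>Here q is the field as a function of latitude s. A C^2 function of the polar angle that
  is even about the poles has a bounded first derivative in s, whereas its second derivative may
  grow like 1/(s (1 - s)); these are the bounds imposed.\<close>

locale abel_profile =
 fixes n :: nat and a C :: real and q q' q'' :: "real => real"
 assumes n: "0 < n" and a: "0 < a" "a <= 1"
  and q_measurable [measurable]: "q \<in> borel_measurable borel" "q' \<in> borel_measurable borel"
  and q_deriv: "!!t. 0 < t ==> t < a ==> (q has_real_derivative q' t) (at t)"
   "!!t. 0 < t ==> t < a ==> (q' has_real_derivative q'' t) (at t)"
  and q_bound: "!!t. 0 < t ==> t < a ==> \<bar>q t\<bar> <= C" "!!t. 0 < t ==> t < a ==> \<bar>q' t\<bar> <= C"
   "!!t. 0 < t ==> t < a ==> \<bar>q'' t\<bar> <= C / (t * (1 - t))"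
begin

abbreviation "\<beta> \<equiv> beta_measure ((real n + 1) / 2) (1 / 2)"

sublocale \<beta>: finite_measure \<beta>
 by (rule finite_measure_beta_measure) auto

definition "H z = (\<integral>u. q (z * u) \<partial>\<beta>)"
definition "H1 z = (\<integral>u. u * q' (z * u) \<partial>\<beta>)"
definition "mass = measure \<beta> (space \<beta>)"

lemma C_nonneg: "0 <= C" using q_bound(1)[of "a / 2"] a by linarith

lemma mult_in: "0 < z * u \<and> z * u < a" if "0 < z" "z < a" "0 < u" "u < 1" for z u
proof
 show "0 < z * u" using that by simp
 have "z * u <= z * 1" using that by (intro mult_left_mono) auto
 then have "z * u <= z" by (simp only: mult_1_right)
 then show "z * u < a" using that by linarith
qed

lemma mass_nonneg: "0 <= mass" by (simp add: mass_def)

lemma integrable_q: "0 < z ==> z < a ==> integrable \<beta> (%u. q (z * u))"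
proof (rule \<beta>.integrable_const_bound)
 assume z: "0 < z" "z < a"
 show "AE u in \<beta>. norm (q (z * u)) <= C"
  using AE_beta_measure by eventually_elim (use mult_in[OF z] q_bound(1) in auto)
qed measurable

lemma bound_q': "AE u in \<beta>. \<bar>u * q' (z * u)\<bar> <= C" if z: "0 < z" "z < a"
 using AE_beta_measure
proof eventually_elim
 case (elim u)
 have "\<bar>u\<bar> * \<bar>q' (z * u)\<bar> <= 1 * C"
  using mult_in[OF z, of u] q_bound(2)[of "z * u"] elim by (intro mult_mono) auto
 then show ?case by (simp add: abs_mult)
qed

lemma integrable_q': "0 < z ==> z < a ==> integrable \<beta> (%u. u * q' (z * u))"
 by (rule \<beta>.integrable_const_bound) (use bound_q' in auto)

lemma H_bound: "0 < z ==> z < a ==> \<bar>H z\<bar> <= C * mass"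
 unfolding H_def mass_def
proof (rule \<beta>.abs_integral_le)
 assume z: "0 < z" "z < a"
 show "AE u in \<beta>. \<bar>q (z * u)\<bar> <= C"
  using AE_beta_measure by eventually_elim (use mult_in[OF z] q_bound(1) in auto)
qed measurable

lemma H1_bound: "0 < z ==> z < a ==> \<bar>H1 z\<bar> <= C * mass"
 unfolding H1_def mass_def by (rule \<beta>.abs_integral_le) (use bound_q' in auto)

lemma H_deriv: "(H has_real_derivative H1 z) (at z)" if z: "0 < z" "z < a"
proof -
 obtain h where h: "integrable \<beta> h" "AE u in \<beta>. h u = u * q' (z * u)"
  "((%x. \<integral>u. q (x * u) \<partial>\<beta>) has_real_derivative (\<integral>u. h u \<partial>\<beta>)) (at z)"
 proof (rule DERIV_integral_dominated[where l=0 and r=a and M=\<beta> and f="%x u. q (x * u)"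
    and f'="%x u. u * q' (x * u)" and D="%u. C" and ?x0.0=z])
  show "AE u in \<beta>. \<forall>x. 0 < x \<and> x < a \<longrightarrow> ((%x. q (x * u)) has_real_derivative u * q' (x * u)) (at x) \<and> \<bar>u * q' (x * u)\<bar> <= C"
   using AE_beta_measure
  proof eventually_elim
   case (elim u)
   show ?case
   proof (intro allI impI conjI)
    fix x assume x: "0 < x \<and> x < a"
    have "((%x. x * u) has_real_derivative u) (at x)" by (auto intro!: derivative_eq_intros)
    from DERIV_chain2[OF q_deriv(1) this] mult_in[of x u] x elim
    show "((%x. q (x * u)) has_real_derivative u * q' (x * u)) (at x)" by (simp add: mult.commute)
    have "\<bar>u\<bar> * \<bar>q' (x * u)\<bar> <= 1 * C"
     using mult_in[of x u] q_bound(2)[of "x * u"] x elim by (intro mult_mono) auto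
    then show "\<bar>u * q' (x * u)\<bar> <= C" by (simp add: abs_mult)
   qed
  qed
 qed (use z integrable_q in auto)
 have "(\<integral>u. h u \<partial>\<beta>) = H1 z"
  unfolding H1_def using h(1,2) by (intro integral_cong_AE) auto
 with h(3) show ?thesis by (simp add: H_def[abs_def])
qed

text \<open>The factor u^2 from the chain rule absorbs the growth of q'' at 0, which leaves a bound
  uniform in u.\<close>

lemma H1_deriv:
 assumes z: "0 < z" "z < a"
 obtains D where "(H1 has_real_derivative D) (at z)" "\<bar>D\<bar> <= C * mass / (z * (1 - z))"
proof -
 have b: "\<bar>u\<^sup>2 * q'' (x * u)\<bar> <= C / (x * (1 - x))" if x: "0 < x" "x < a" and u: "0 < u" "u < 1" for x u
 proof -
  have m: "0 < x * u" "x * u < a" using mult_in[OF x u] by auto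
  have le: "x * u <= x" using x u by (simp add: mult_left_le)
  have pos: "0 < 1 - x" "0 < 1 - x * u" using x a m by linarith+
  have "\<bar>u\<^sup>2 * q'' (x * u)\<bar> <= u\<^sup>2 * (C / (x * u * (1 - x * u)))"
   unfolding abs_mult by (intro mult_mono q_bound(3)[OF m]) auto
  also have "... = u * (C / (x * (1 - x * u)))" using u x by (simp add: power2_eq_square)
  also have "... <= 1 * (C / (x * (1 - x)))"
   using u x le C_nonneg pos by (intro mult_mono divide_left_mono mult_left_mono) auto
  finally show ?thesis by simp
 qed
 \<comment> \<open>The bound on q'' is not uniform up to the ends of (0, a), so differentiation
   takes place on a smaller interval around z.\<close>
 define K where "K = C / (z / 2 * (1 - (z + a) / 2))"
 have zp: "0 < z / 2" "0 < 1 - (z + a) / 2" using z a by auto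
 obtain h where h: "integrable \<beta> h" "AE u in \<beta>. h u = u\<^sup>2 * q'' (z * u)"
  "((%x. \<integral>u. u * q' (x * u) \<partial>\<beta>) has_real_derivative (\<integral>u. h u \<partial>\<beta>)) (at z)"
 proof (rule DERIV_integral_dominated[where l="z / 2" and r="(z + a) / 2" and M=\<beta> and f="%x u. u * q' (x * u)"
    and f'="%x u. u\<^sup>2 * q'' (x * u)" and D="%u. K" and ?x0.0=z])
  show "AE u in \<beta>. \<forall>x. z / 2 < x \<and> x < (z + a) / 2 \<longrightarrow>
   ((%x. u * q' (x * u)) has_real_derivative u\<^sup>2 * q'' (x * u)) (at x) \<and> \<bar>u\<^sup>2 * q'' (x * u)\<bar> <= K"
   using AE_beta_measure
  proof eventually_elim
   case (elim u)
   show ?case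
   proof (intro allI impI conjI)
    fix x assume x: "z / 2 < x \<and> x < (z + a) / 2"
    then have x': "0 < x" "x < a" using z by auto
    have "((%x. x * u) has_real_derivative u) (at x)" by (auto intro!: derivative_eq_intros)
    from DERIV_cmult[OF DERIV_chain2[OF q_deriv(2) this], of u] mult_in[of x u] x' elim
    show "((%x. u * q' (x * u)) has_real_derivative u\<^sup>2 * q'' (x * u)) (at x)"
     by (simp add: power2_eq_square mult_ac)
    have "\<bar>u\<^sup>2 * q'' (x * u)\<bar> <= C / (x * (1 - x))" using b[OF x'] elim by auto
    also have "... <= K" unfolding K_def
     using zp x x' C_nonneg by (intro divide_left_mono mult_mono mult_pos_pos) auto
    finally show "\<bar>u\<^sup>2 * q'' (x * u)\<bar> <= K" .
   qed
  qed
 qed (use z integrable_q' in auto)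
 have "\<bar>\<integral>u. h u \<partial>\<beta>\<bar> <= C / (z * (1 - z)) * measure \<beta> (space \<beta>)"
 proof (rule \<beta>.abs_integral_le)
  show "AE u in \<beta>. \<bar>h u\<bar> <= C / (z * (1 - z))"
   using AE_beta_measure h(2) by eventually_elim (use b[OF z] in auto)
 qed (use h(1) in auto)
 then have "\<bar>\<integral>u. h u \<partial>\<beta>\<bar> <= C * mass / (z * (1 - z))" by (simp add: mass_def)
 with h(3) show thesis by (intro that) (simp_all add: H1_def[abs_def])
qed

lemma abel_G_eq: "abel_G n q z = z powr (real n / 2) * H z"
 by (simp add: abel_G_def H_def)

lemma abel_G_deriv:
 assumes z: "0 < z" "z < a"
 shows "(abel_G n q has_real_derivative z powr (real n / 2 - 1) * (real n / 2 * H z + z * H1 z)) (at z)"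
proof -
 have "((%z. z powr (real n / 2)) has_real_derivative real n / 2 * z powr (real n / 2 - 1)) (at z)"
  using z by (intro has_real_derivative_powr) auto
 from DERIV_mult[OF this H_deriv[OF z]]
 have "(abel_G n q has_real_derivative real n / 2 * z powr (real n / 2 - 1) * H z + H1 z * z powr (real n / 2)) (at z)"
  by (simp add: abel_G_eq[abs_def])
 also have "z powr (real n / 2) = z * z powr (real n / 2 - 1)"
  using z powr_add[of z 1 "real n / 2 - 1"] by simp
 finally show ?thesis by (simp add: algebra_simps)
qed

text \<open>The power of w in \<open>abel_gamma\<close> is the one that cancels the singularity of
  the derivative of \<open>abel_G\<close> at 0; what remains is bounded.\<close>

lemma abel_gamma_eq:
 assumes w: "0 < w" "w < a"
 shows "abel_gamma n q w = (1 - w) powr (real n / 2) * (real n / 2 * H w + w * H1 w)"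
proof -
 have "w powr (real n / 2 - 1) * w powr (1 - real n / 2) = 1"
  using w by (simp add: powr_add[symmetric])
 then have e: "w powr (real n / 2 - 1) * y * (w powr (1 - real n / 2) * x) = x * y" for x y
  by (metis mult.assoc mult.commute mult.left_commute mult_1)
 show ?thesis unfolding abel_gamma_def DERIV_imp_deriv[OF abel_G_deriv[OF w]] e ..
qed

definition "gamma_bound = (real n / 2 + 1) * (C * mass)"

lemma inner_bound: "\<bar>real n / 2 * H w + w * H1 w\<bar> <= gamma_bound" if w: "0 < w" "w < a" for w
proof -
 have "\<bar>real n / 2 * H w\<bar> <= real n / 2 * (C * mass)"
  using H_bound[OF w] by (simp add: abs_mult mult_left_mono)
 moreover have "\<bar>w\<bar> * \<bar>H1 w\<bar> <= 1 * (C * mass)"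
  using H1_bound[OF w] w a by (intro mult_mono) auto
 moreover have "gamma_bound = real n / 2 * (C * mass) + 1 * (C * mass)"
  unfolding gamma_bound_def by (rule distrib_right)
 moreover have "\<bar>w * H1 w\<bar> = \<bar>w\<bar> * \<bar>H1 w\<bar>" by (rule abs_mult)
 ultimately show ?thesis by linarith
qed

lemma gamma_bound_nonneg: "0 <= gamma_bound"
 by (simp add: gamma_bound_def C_nonneg mass_nonneg)

lemma abel_gamma_bound:
 assumes w: "0 < w" "w < a"
 shows "\<bar>abel_gamma n q w\<bar> <= gamma_bound"
proof -
 have "(1 - w) powr (real n / 2) <= 1 powr (real n / 2)" using w a by (intro powr_mono2) auto
 then have "\<bar>(1 - w) powr (real n / 2)\<bar> * \<bar>real n / 2 * H w + w * H1 w\<bar> <= 1 * gamma_bound"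
  using inner_bound[OF w] by (intro mult_mono) auto
 then show ?thesis by (simp add: abel_gamma_eq[OF w] abs_mult)
qed

definition "gamma_bound' = (real n / 2 + 2) * (gamma_bound + C * mass)"

text \<open>The worst terms come from (1 - w)^(n/2 - 1) and from the second derivative of
  \<open>H\<close>, and grow like 1/(1 - w). As a <= 1, this is within the bound that
  \<open>abel_Phi_regular\<close> tolerates.\<close>

lemma abel_gamma_deriv:
 assumes w: "0 < w" "w < a"
 shows "\<exists>D. (abel_gamma n q has_real_derivative D) (at w) \<and> \<bar>D\<bar> <= gamma_bound' / (a - w)"
proof -
 obtain H2 where H2: "(H1 has_real_derivative H2) (at w)" "\<bar>H2\<bar> <= C * mass / (w * (1 - w))"
  by (rule H1_deriv[OF w])
 have w1: "0 < 1 - w" using w a by simp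
 let ?Y = "real n / 2 * H w + w * H1 w"
 have "((%x. x powr (real n / 2)) has_real_derivative real n / 2 * (1 - w) powr (real n / 2 - 1)) (at (1 - w))"
  using w1 by (intro has_real_derivative_powr) auto
 moreover have "((%z::real. 1 - z) has_real_derivative - 1) (at w)"
  by (auto intro!: derivative_eq_intros)
 ultimately have 1: "((%z. (1 - z) powr (real n / 2)) has_real_derivative real n / 2 * (1 - w) powr (real n / 2 - 1) * (- 1)) (at w)"
  by (rule DERIV_chain2)
 have 2: "((%w. real n / 2 * H w + w * H1 w) has_real_derivative real n / 2 * H1 w + (1 * H1 w + H2 * w)) (at w)"
  by (intro DERIV_add DERIV_cmult H_deriv[OF w] DERIV_mult DERIV_ident H2(1))
 define D where "D = real n / 2 * (1 - w) powr (real n / 2 - 1) * (- 1) * ?Y + (real n / 2 * H1 w + (1 * H1 w + H2 * w)) * (1 - w) powr (real n / 2)"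
 have "((%w. (1 - w) powr (real n / 2) * (real n / 2 * H w + w * H1 w)) has_real_derivative D) (at w)"
  unfolding D_def by (rule DERIV_mult[OF 1 2])
 then have der: "(abel_gamma n q has_real_derivative D) (at w)"
 proof (rule DERIV_cong_ev[OF refl _ refl, THEN iffD1, rotated])
  have "eventually (%x. x \<in> {0<..<a}) (nhds w)" using w by (intro eventually_nhds_in_open) auto
  then show "eventually (%x. (1 - x) powr (real n / 2) * (real n / 2 * H x + x * H1 x) = abel_gamma n q x) (nhds w)"
   by eventually_elim (use abel_gamma_eq in auto)
 qed
 have p1: "(1 - w) powr (real n / 2) <= 1" using w a powr_mono2[of "real n / 2" "1 - w" 1] by simp
 have p2: "(1 - w) powr (real n / 2 - 1) <= 1 / (1 - w)"
  using w1 p1 by (simp add: powr_diff divide_right_mono)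
 have i1: "1 <= 1 / (1 - w)" using w1 w by simp
 have t1: "\<bar>real n / 2 * (1 - w) powr (real n / 2 - 1) * (- 1) * ?Y\<bar> <= real n / 2 * (1 / (1 - w)) * gamma_bound"
 proof -
  have "\<bar>real n / 2 * (1 - w) powr (real n / 2 - 1) * (- 1) * ?Y\<bar> = real n / 2 * (1 - w) powr (real n / 2 - 1) * \<bar>?Y\<bar>"
   unfolding abs_mult by simp
  also have "... <= real n / 2 * (1 / (1 - w)) * gamma_bound"
   by (intro mult_mono mult_left_mono p2 inner_bound[OF w]) (use w1 in auto)
  finally show ?thesis .
 qed
 have CM: "0 <= C * mass" using C_nonneg mass_nonneg by simp
 have "\<bar>H2 * w\<bar> <= C * mass / (w * (1 - w)) * w"
  unfolding abs_mult by (intro mult_mono H2(2)) (use w w1 CM in auto)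
 also have "... = 1 / (1 - w) * (C * mass)" using w by simp
 finally have t2: "\<bar>H2 * w\<bar> <= 1 / (1 - w) * (C * mass)" .
 have h: "\<bar>H1 w\<bar> <= 1 / (1 - w) * (C * mass)"
  using H1_bound[OF w] mult_right_mono[OF i1 CM] by simp
 have "\<bar>real n / 2 * H1 w\<bar> <= real n / 2 * (1 / (1 - w) * (C * mass))"
  unfolding abs_mult by (intro mult_mono h) auto
 then have "\<bar>real n / 2 * H1 w + (1 * H1 w + H2 * w)\<bar> <= real n / 2 * (1 / (1 - w) * (C * mass)) + 2 * (1 / (1 - w) * (C * mass))"
  using t2 h by linarith
 also have "... = (real n / 2 + 2) * (1 / (1 - w) * (C * mass))" by (rule distrib_right[symmetric])
 finally have "\<bar>(real n / 2 * H1 w + (1 * H1 w + H2 * w)) * (1 - w) powr (real n / 2)\<bar> <= (real n / 2 + 2) * (1 / (1 - w) * (C * mass)) * 1"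
  unfolding abs_mult using p1 CM w1 by (intro mult_mono) auto
 with t1 have "\<bar>D\<bar> <= real n / 2 * (1 / (1 - w)) * gamma_bound + (real n / 2 + 2) * (1 / (1 - w) * (C * mass))"
  unfolding D_def mult_1_right by (rule order_trans[OF abs_triangle_ineq add_mono])
 also have "... <= (real n / 2 + 2) * (1 / (1 - w)) * gamma_bound + (real n / 2 + 2) * (1 / (1 - w) * (C * mass))"
  using gamma_bound_nonneg w1 by (intro add_right_mono mult_right_mono) auto
 also have "... = gamma_bound' / (1 - w)"
 proof -
  have "P * (1 / k) * g + P * (1 / k * c) = P * (g + c) / k" for P k g c :: real
   by (simp add: distrib_left add_divide_distrib)
  then show ?thesis unfolding gamma_bound'_def .
 qed
 also have "... <= gamma_bound' / (a - w)"
  using w a gamma_bound_nonneg CM by (intro divide_left_mono) (auto simp: gamma_bound'_def)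
 finally show ?thesis using der by blast
qed

definition "gamma' w = deriv (abel_gamma n q) w"

lemma gamma': "(abel_gamma n q has_real_derivative gamma' w) (at w)" "\<bar>gamma' w\<bar> <= gamma_bound' / (a - w)"
 if "0 < w" "w < a" for w
 using abel_gamma_deriv[OF that] by (auto simp: gamma'_def DERIV_imp_deriv)

lemma gamma_Phi:
 shows "!!z. 0 <= z ==> z < a ==> integrable (beta_measure (1 / 2) 1) (%v. abel_gamma n q (z + (a - z) * v) * indicator {0<..<1} v)"
  and "!!z. 0 < z ==> z < a ==> \<exists>D. (abel_Phi (abel_gamma n q) a has_real_derivative D) (at z)"
  and "(abel_Phi (abel_gamma n q) a \<longlongrightarrow> 0) (at_left a)"
 using abel_Phi_regular[where g="abel_gamma n q" and g'=gamma' and C=gamma_bound and C'=gamma_bound', OF a(1)]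
  gamma' abel_gamma_bound by blast+

lemma abel_G_nn_integral:
 assumes nn: "!!t. 0 < t ==> t < a ==> 0 <= q t" and z: "0 < z" "z < a"
 shows "(II t. ennreal (q t) * (ennreal (t powr (real n / 2 - 1 / 2) * (z - t) powr (- 1 / 2)) * indicator {0<..<z} t)) = ennreal (abel_G n q z)"
proof -
 have "(II t. ennreal (q t) * (ennreal (t powr (real n / 2 - 1 / 2) * (z - t) powr (- 1 / 2)) * indicator {0<..<z} t)) =
  (II t. ennreal (q t) * (ennreal ((t - 0) powr ((real n + 1) / 2 - 1) * (z - t) powr (1 / 2 - 1)) * indicator {0<..<z} t))"
  by (rule nn_integral_cong) (simp add: add_divide_distrib)
 also have "... = ennreal ((z - 0) powr ((real n + 1) / 2 + 1 / 2 - 1)) * (\<integral>\<^sup>+u. ennreal (q (0 + (z - 0) * u)) \<partial>\<beta>)"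
  by (rule nn_integral_beta_affine) (use z in measurable)
 also have "(\<integral>\<^sup>+u. ennreal (q (0 + (z - 0) * u)) \<partial>\<beta>) = ennreal (H z)"
  unfolding H_def
 proof (subst nn_integral_eq_integral)
  show "AE u in \<beta>. 0 <= q (0 + (z - 0) * u)"
   using AE_beta_measure by eventually_elim (use mult_in[OF z] nn in auto)
 qed (use integrable_q[OF z] in auto)
 also have "(real n + 1) / 2 + 1 / 2 - 1 = real n / 2" by (simp add: field_simps)
 also have "ennreal ((z - 0) powr (real n / 2)) * ennreal (H z) = ennreal (abel_G n q z)"
  by (simp add: abel_G_eq ennreal_mult')
 finally show ?thesis .
qed

end

lemma abel_Phi_nn_integral:
 fixes g g' :: "real => real"
 assumes a: "0 < a"
  and der: "!!w. 0 < w ==> w < a ==> (g has_real_derivative g' w) (at w)"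
  and b0: "!!w. 0 < w ==> w < a ==> \<bar>g w\<bar> <= C"
  and b1: "!!w. 0 < w ==> w < a ==> \<bar>g' w\<bar> <= C' / (a - w)"
  and nn: "!!w. 0 < w ==> w < a ==> 0 <= g w"
  and z: "0 <= z" "z < a"
 shows "(II w. ennreal (g w * (w - z) powr (- 1 / 2)) * indicator {z<..<a} w) = ennreal (abel_Phi g a z)"
proof -
 let ?M = "beta_measure (1 / 2) 1"
 have contg: "continuous_on {z<..<a} g"
  using der z by (intro DERIV_continuous_on[of _ _ g']) (auto intro: has_field_derivative_at_within)
 define h where "h = (%w. indicator {z<..<a} w *\<^sub>R g w)"
 have [measurable]: "h \<in> borel_measurable borel"
  unfolding h_def by (rule borel_measurable_continuous_on_indicator[OF _ contg]) simp
 have ind: "h (z + (a - z) * v) = g (z + (a - z) * v) * indicator {0<..<1} v" for v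
 proof -
  have "z + (a - z) * v < a \<longleftrightarrow> (a - z) * v < (a - z) * 1"
   by (simp only: mult_1_right less_diff_eq add.commute)
  then have "z + (a - z) * v \<in> {z<..<a} \<longleftrightarrow> v \<in> {0<..<1}" using z
   by (simp only: greaterThanLessThan_iff mult_less_cancel_left_pos) (simp add: zero_less_mult_iff)
  then show ?thesis by (simp add: h_def indicator_def)
 qed
 have int: "integrable ?M (%v. g (z + (a - z) * v) * indicator {0<..<1} v)"
  by (rule abel_Phi_integrable[OF a der b0 b1 z])
 have "(II w. ennreal (g w * (w - z) powr (- 1 / 2)) * indicator {z<..<a} w) =
  (II w. ennreal (h w) * (ennreal ((w - z) powr (1 / 2 - 1) * (a - w) powr (1 - 1)) * indicator {z<..<a} w))"
 proof (rule nn_integral_cong, goal_cases)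
  case (1 w)
  show ?case
  proof (cases "w \<in> {z<..<a}")
   case True
   then show ?thesis using nn[of w] z by (simp add: h_def ennreal_mult)
  qed simp
 qed
 also have "... = ennreal ((a - z) powr (1 / 2 + 1 - 1)) * (\<integral>\<^sup>+v. ennreal (h (z + (a - z) * v)) \<partial>?M)"
  by (rule nn_integral_beta_affine) (use z in measurable)
 also have "(\<integral>\<^sup>+v. ennreal (h (z + (a - z) * v)) \<partial>?M) = ennreal (\<integral>v. g (z + (a - z) * v) * indicator {0<..<1} v \<partial>?M)"
  unfolding ind
 proof (rule nn_integral_eq_integral[OF int], rule AE_I2)
  fix v :: real
  have "0 <= h (z + (a - z) * v)" unfolding h_def using nn[of "z + (a - z) * v"] z by (simp add: indicator_def)
  then show "0 <= g (z + (a - z) * v) * indicator {0<..<1} v" unfolding ind .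
 qed
 also have "(a - z) powr (1 / 2 + 1 - 1) = sqrt (a - z)" using z by (simp add: powr_half_sqrt)
 also have "ennreal (sqrt (a - z)) * ennreal (\<integral>v. g (z + (a - z) * v) * indicator {0<..<1} v \<partial>?M) = ennreal (abel_Phi g a z)"
  using z by (simp add: abel_Phi_def ennreal_mult')
 finally show ?thesis .
qed

section \<open>The hypergeometric factor\<close>

text \<open>The incomplete Beta function B(z; 1/2, p + 1); it is used with p = n/2.\<close>

definition cap_J :: "real => real => real" where
 "cap_J p z = integral {0..z} (%v. v powr (- 1 / 2) * (1 - v) powr p)"

text \<open>A closed form of the hypergeometric factor of the density that, unlike the series, makes
  sense at z = 1.\<close>

definition cap_R :: "real => real => real" where
 "cap_R p z = (p + 1 / 2) * cap_J p z + z powr (- 1 / 2) * (1 - z) powr (p + 1)"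

lemma cap_J_integrable:
 fixes p a b :: real
 assumes "0 < p" "0 <= a" "a <= b" "b <= 1"
 shows "(%v. v powr (- 1 / 2) * (1 - v) powr p) integrable_on {a..b}"
proof -
 have "(%v. v powr (1 / 2 - 1) * (1 - v) powr ((p + 1) - 1)) integrable_on {0..1}"
  using has_integral_Beta_real[of "1 / 2" "p + 1"] assms(1) by (auto simp: integrable_on_def)
 then have "(%v. v powr (- 1 / 2) * (1 - v) powr p) integrable_on {0..1}" by simp
 then show ?thesis by (rule integrable_on_subinterval) (use assms in auto)
qed

lemma continuous_on_cap_J:
 assumes "0 < p"
 shows "continuous_on {0..1} (cap_J p)"
 unfolding cap_J_def[abs_def]
 by (rule indefinite_integral_continuous_1, rule cap_J_integrable[OF assms]) auto

lemma cap_J_deriv: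
 assumes p: "0 < p" and z: "0 < z" "z < 1"
 shows "(cap_J p has_real_derivative z powr (- 1 / 2) * (1 - z) powr p) (at z)"
proof -
 let ?f = "%v::real. v powr (- 1 / 2) * (1 - v) powr p"
 \<comment> \<open>The integrand is singular at 0, so the fundamental theorem is applied on [z/2, 1]
   only.\<close>
 define b where "b = z / 2"
 have b: "0 < b" "b < z" using z by (auto simp: b_def)
 have cont: "continuous_on {b..1} ?f"
  using b p by (intro continuous_intros continuous_on_powr') auto
 have "((%u. integral {b..u} ?f) has_real_derivative ?f z) (at z within {b..1})"
  using z b by (intro integral_has_real_derivative cont) auto
 moreover have "at z within {b..1} = at z"
  using z b by (intro at_within_Icc_at) auto
 ultimately have "((%u. integral {0..b} ?f + integral {b..u} ?f) has_real_derivative 0 + ?f z) (at z)"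
  by (intro DERIV_add DERIV_const) simp
 then have "((%u. integral {0..b} ?f + integral {b..u} ?f) has_real_derivative ?f z) (at z)" by simp
 then show ?thesis
 proof (rule DERIV_cong_ev[OF refl _ refl, THEN iffD1, rotated])
  have "eventually (%u. u \<in> {b<..<1}) (nhds z)"
   using z b by (intro eventually_nhds_in_open) auto
  then show "eventually (%u. integral {0..b} ?f + integral {b..u} ?f = cap_J p u) (nhds z)"
  proof eventually_elim
   case (elim u)
   then show ?case unfolding cap_J_def
    using b p by (intro Henstock_Kurzweil_Integration.integral_combine cap_J_integrable) auto
  qed
 qed
qed

lemma cap_R_deriv:
 assumes p: "0 < p" and z: "0 < z" "z < 1"
 shows "(cap_R p has_real_derivative - (1 / 2) * z powr (- 3 / 2) * (1 - z) powr p) (at z)"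
proof -
 have "(cap_R p has_real_derivative (p + 1 / 2) * (z powr (- 1 / 2) * (1 - z) powr p) +
   ((- 1 / 2 * z powr (- 1 / 2 - 1)) * (1 - z) powr (p + 1) + ((p + 1) * (1 - z) powr (p + 1 - 1) * (- 1)) * z powr (- 1 / 2))) (at z)"
 proof -
  have 1: "((%z. z powr (- 1 / 2)) has_real_derivative - 1 / 2 * z powr (- 1 / 2 - 1)) (at z)"
   using z by (intro has_real_derivative_powr) auto
  have "((%x. x powr (p + 1)) has_real_derivative (p + 1) * (1 - z) powr (p + 1 - 1)) (at (1 - z))"
   using z by (intro has_real_derivative_powr) auto
  moreover have "((%z::real. 1 - z) has_real_derivative - 1) (at z)"
   by (auto intro!: derivative_eq_intros)
  ultimately have 2: "((%z. (1 - z) powr (p + 1)) has_real_derivative (p + 1) * (1 - z) powr (p + 1 - 1) * (- 1)) (at z)"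
   by (rule DERIV_chain2)
  show ?thesis unfolding cap_R_def[abs_def]
   by (intro DERIV_add DERIV_cmult cap_J_deriv[OF p z] DERIV_mult 1 2)
 qed
 also have "(p + 1 / 2) * (z powr (- 1 / 2) * (1 - z) powr p) +
   ((- 1 / 2 * z powr (- 1 / 2 - 1)) * (1 - z) powr (p + 1) + ((p + 1) * (1 - z) powr (p + 1 - 1) * (- 1)) * z powr (- 1 / 2))
   = - (1 / 2) * z powr (- 3 / 2) * (1 - z) powr p"
 proof -
  define A where "A = z powr (- 3 / 2)"
  define B where "B = (1 - z) powr p"
  have "z powr (- 1 / 2) = z * A"
  proof -
   have "z powr (- 1 / 2) = z powr (1 + (- 3 / 2))" by simp
   also have "... = z * A" using z by (simp only: powr_add A_def) simp
   finally show ?thesis .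
  qed
  moreover have "z powr (- 1 / 2 - 1) = A" by (simp add: A_def)
  moreover have "(1 - z) powr (p + 1) = B * (1 - z)" using z by (simp add: powr_add B_def)
  moreover have "(1 - z) powr (p + 1 - 1) = B" by (simp add: B_def)
  moreover have "(p + 1 / 2) * (z * A * B) + ((- 1 / 2 * A) * (B * (1 - z)) + ((p + 1) * B * (- 1)) * (z * A)) = - (1 / 2) * A * B"
   by (simp add: algebra_simps)
  ultimately show ?thesis by (simp only: A_def[symmetric] B_def[symmetric])
 qed
 finally show ?thesis .
qed

lemma hyp2F1_one_sums:
 fixes b z :: real
 assumes b: "0 < b" and z: "\<bar>z\<bar> < 1"
 defines "c \<equiv> %n. pochhammer b n / pochhammer (1 / 2) n :: real"
 shows "summable (%n. c n * z ^ n)" "hyp2F1 1 b (1 / 2) z = (\<Sum>n. c n * z ^ n)"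
proof -
 have fact: "pochhammer 1 m = (fact m :: real)" for m by (simp add: pochhammer_fact)
 show "hyp2F1 1 b (1 / 2) z = (\<Sum>n. c n * z ^ n)"
  unfolding hyp2F1_def c_def by (intro suminf_cong) (simp add: fact)
 have cpos: "0 < c n" for n unfolding c_def using b by (intro divide_pos_pos pochhammer_pos) auto
 have ratio: "c (Suc n) = c n * ((b + real n) / (1 / 2 + real n))" for n
  unfolding c_def pochhammer_Suc by simp
 show "summable (%n. c n * z ^ n)"
 proof (cases "z = 0")
  case True
  then show ?thesis by (simp add: summable_0_powser)
 next
  case False
  \<comment> \<open>Any number strictly between |z| and 1 would do, as the ratios of consecutive
    terms tend to |z|.\<close>
  define d where "d = (1 + \<bar>z\<bar>) / 2"
  have d: "\<bar>z\<bar> < d" "d < 1" using z by (auto simp: d_def)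
  have "((%n. \<bar>z\<bar> * ((b + real n) / (1 / 2 + real n))) \<longlongrightarrow> \<bar>z\<bar> * 1) sequentially"
   by (intro tendsto_mult tendsto_const) real_asymp
  then have "eventually (%n. \<bar>z\<bar> * ((b + real n) / (1 / 2 + real n)) < d) sequentially"
   using d by (intro order_tendstoD) auto
  then obtain n0 where n0: "!!n. n \<ge> n0 ==> \<bar>z\<bar> * ((b + real n) / (1 / 2 + real n)) < d"
   by (auto simp: eventually_sequentially)
  show ?thesis
  proof (rule summable_ratio_test[OF d(2)])
   fix n assume n: "n0 <= n"
   have "norm (c (Suc n) * z ^ Suc n) = (\<bar>z\<bar> * ((b + real n) / (1 / 2 + real n))) * norm (c n * z ^ n)"
    using cpos[of n] b by (simp add: ratio abs_mult power_abs)
   also have "... <= d * norm (c n * z ^ n)"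
    using n0[OF n] by (intro mult_right_mono) auto
   finally show "norm (c (Suc n) * z ^ Suc n) <= d * norm (c n * z ^ n)" .
  qed
 qed
qed

text \<open>The upper parameter 1 cancels the factorials and leaves coefficients with c(m+1) (m +
  1/2) = c(m) (b + m). This two-term recurrence is the differential equation; the constant -1/2 is
  due to the initial coefficient c(0) = 1.\<close>

lemma hyp2F1_one_ode:
 fixes b z :: real
 assumes b: "0 < b" and z: "0 < z" "z < 1"
 obtains Y' where "(hyp2F1 1 b (1 / 2) has_real_derivative Y') (at z)"
  "z * (1 - z) * Y' = (1 / 2 + b * z) * hyp2F1 1 b (1 / 2) z - 1 / 2"
proof -
 define c where "c = (%n. pochhammer b n / pochhammer (1 / 2) n :: real)"
 have sm: "summable (%n. c n * x ^ n)" if "norm x < 1" for x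
  using hyp2F1_one_sums(1)[OF b, of x] that by (simp add: c_def)
 have Yeq: "hyp2F1 1 b (1 / 2) x = (\<Sum>n. c n * x ^ n)" if "norm x < 1" for x
  using hyp2F1_one_sums(2)[OF b, of x] that by (simp add: c_def)
 define Y' where "Y' = (\<Sum>n. diffs c n * z ^ n)"
 have "((%x. \<Sum>n. c n * x ^ n) has_real_derivative Y') (at z)"
  unfolding Y'_def by (rule termdiffs_strong'[OF sm]) (use z in auto)
 then have der: "(hyp2F1 1 b (1 / 2) has_real_derivative Y') (at z)"
 proof (rule DERIV_cong_ev[OF refl _ refl, THEN iffD1, rotated])
  have "eventually (%x. x \<in> {0<..<1}) (nhds z)"
   using z by (intro eventually_nhds_in_open) auto
  then show "eventually (%x. (\<Sum>n. c n * x ^ n) = hyp2F1 1 b (1 / 2) x) (nhds z)"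
   by eventually_elim (rule Yeq[symmetric], auto)
 qed
 have sd: "summable (%n. diffs c n * z ^ n)"
  by (rule termdiff_converges[OF _ sm, of z 1]) (use z in auto)
 have step: "c (Suc n) * (real n + 1 / 2) = c n * (b + real n)" for n
 proof -
  have "(1 / 2 + real n :: real) ~= 0" by (simp add: add_pos_nonneg less_imp_neq[symmetric])
  then show ?thesis unfolding c_def pochhammer_Suc by (simp add: add.commute)
 qed
 define Y where "Y = (\<Sum>n. c n * z ^ n)"
 have smz: "summable (%n. c n * z ^ n)" using sm z by simp
 have Y0: "Y = 1 + (\<Sum>n. c (Suc n) * z ^ Suc n)"
  unfolding Y_def using suminf_split_head[OF smz] by (simp add: c_def)
 have sS: "summable (%n. c (Suc n) * z ^ Suc n)" using smz by (subst summable_Suc_iff)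
 have zY': "z * Y' = (\<Sum>n. real (Suc n) * c (Suc n) * z ^ Suc n)"
  unfolding Y'_def using suminf_mult[OF sd, of z] by (simp add: diffs_def mult_ac)
 have sz: "summable (%n. real (Suc n) * c (Suc n) * z ^ Suc n)"
  using summable_mult[OF sd, of z] by (simp add: diffs_def mult_ac)
 have sn: "summable (%n. real n * c n * z ^ n)"
  using sz by (subst summable_Suc_iff[symmetric])
 have zY'2: "z * Y' = (\<Sum>n. real n * c n * z ^ n)"
  unfolding zY' using suminf_split_head[OF sn] by simp
 have "z * Y' - (1 / 2) * (Y - 1) = (\<Sum>n. real (Suc n) * c (Suc n) * z ^ Suc n - (1 / 2) * (c (Suc n) * z ^ Suc n))"
  unfolding zY' Y0 using suminf_diff[OF sz summable_mult[OF sS, of "1 / 2"]] suminf_mult[OF sS, of "1 / 2"] by simp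
 also have "... = (\<Sum>n. z * (b * (c n * z ^ n) + real n * c n * z ^ n))"
 proof (intro suminf_cong)
  fix n
  have "real (Suc n) * c (Suc n) * z ^ Suc n - (1 / 2) * (c (Suc n) * z ^ Suc n) = (c (Suc n) * (real n + 1 / 2)) * z ^ Suc n"
   by (simp add: algebra_simps)
  also have "... = z * (b * (c n * z ^ n) + real n * c n * z ^ n)"
   unfolding step by (simp add: algebra_simps)
  finally show "real (Suc n) * c (Suc n) * z ^ Suc n - (1 / 2) * (c (Suc n) * z ^ Suc n) = z * (b * (c n * z ^ n) + real n * c n * z ^ n)" .
 qed
 also have "... = z * (b * Y + z * Y')"
  unfolding zY'2 Y_def using suminf_mult[OF summable_add[OF summable_mult[OF smz, of b] sn], of z]
   suminf_add[OF summable_mult[OF smz, of b] sn] suminf_mult[OF smz, of b] by simp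
 finally have e: "z * Y' - (1 / 2) * (Y - 1) = z * (b * Y + z * Y')" .
 have "z * (1 - z) * Y' = z * Y' - z * (z * Y')" by (simp add: algebra_simps)
 moreover have "z * (b * Y + z * Y') = b * z * Y + z * (z * Y')" by (simp add: algebra_simps)
 moreover have "(1 / 2 + b * z) * Y = 1 / 2 * Y + b * z * Y" by (simp add: algebra_simps)
 moreover have "U' = P - 1 / 2" if "U' = U - W" "V = X + W" "P = 1 / 2 * y + X" "U - 1 / 2 * (y - 1) = V"
  for U' U W V X P y :: real using that by (simp add: field_simps)
 ultimately have "z * (1 - z) * Y' = (1 / 2 + b * z) * Y - 1 / 2" using e by blast
 moreover have "Y = hyp2F1 1 b (1 / 2) z" using Yeq[of z] z by (simp add: Y_def)
 ultimately show thesis using that der by simp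
qed

text \<open>By the differential equation the difference of the two sides has derivative 0 on (0, 1).
  It tends to 0 at 0: the singular terms z^(-1/2) cancel because the hypergeometric function is 1 +
  O(z), and \<open>cap_J\<close> vanishes there.\<close>

lemma cap_R_eq_hyp2F1:
 fixes p z :: real
 assumes p: "0 < p" and z: "0 < z" "z < 1"
 shows "z powr (- 1 / 2) * (1 - z) powr (p + 1) * hyp2F1 1 (p + 1 / 2) (1 / 2) z = cap_R p z"
proof -
 define b where "b = p + 1 / 2"
 have b: "0 < b" using p by (simp add: b_def)
 define Y where "Y = hyp2F1 1 b (1 / 2)"
 define w where "w = (%z::real. z powr (- 1 / 2) * (1 - z) powr (p + 1))"
 define D where "D = (%z. w z * Y z - cap_R p z)"
 have der: "(D has_real_derivative 0) (at x)" if x: "0 < x" "x < 1" for x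
 proof -
  obtain Y' where Y': "(Y has_real_derivative Y') (at x)" "x * (1 - x) * Y' = (1 / 2 + b * x) * Y x - 1 / 2"
   using hyp2F1_one_ode[OF b x] unfolding Y_def by metis
  have 1: "((%z. z powr (- 1 / 2)) has_real_derivative - 1 / 2 * x powr (- 1 / 2 - 1)) (at x)"
   using x by (intro has_real_derivative_powr) auto
  have "((%x. x powr (p + 1)) has_real_derivative (p + 1) * (1 - x) powr (p + 1 - 1)) (at (1 - x))"
   using x by (intro has_real_derivative_powr) auto
  moreover have "((%z::real. 1 - z) has_real_derivative - 1) (at x)"
   by (auto intro!: derivative_eq_intros)
  ultimately have 2: "((%z. (1 - z) powr (p + 1)) has_real_derivative (p + 1) * (1 - x) powr (p + 1 - 1) * (- 1)) (at x)"
   by (rule DERIV_chain2)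
  have "(D has_real_derivative
   (((- 1 / 2 * x powr (- 1 / 2 - 1)) * (1 - x) powr (p + 1) + ((p + 1) * (1 - x) powr (p + 1 - 1) * (- 1)) * x powr (- 1 / 2)) * Y x
    + Y' * (x powr (- 1 / 2) * (1 - x) powr (p + 1))) - - (1 / 2) * x powr (- 3 / 2) * (1 - x) powr p) (at x)"
   unfolding D_def w_def
   by (intro DERIV_diff DERIV_mult 1 2 Y'(1) cap_R_deriv[OF p x])
  also have "(((- 1 / 2 * x powr (- 1 / 2 - 1)) * (1 - x) powr (p + 1) + ((p + 1) * (1 - x) powr (p + 1 - 1) * (- 1)) * x powr (- 1 / 2)) * Y x
    + Y' * (x powr (- 1 / 2) * (1 - x) powr (p + 1))) - - (1 / 2) * x powr (- 3 / 2) * (1 - x) powr p = 0"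
  proof -
   define A where "A = x powr (- 3 / 2)"
   define B where "B = (1 - x) powr p"
   have "x powr (- 1 / 2) = x * A"
   proof -
    have "x powr (- 1 / 2) = x powr (1 + (- 3 / 2))" by simp
    also have "... = x * A" using x by (simp only: powr_add A_def) simp
    finally show ?thesis .
   qed
   moreover have "x powr (- 1 / 2 - 1) = A" by (simp add: A_def)
   moreover have "(1 - x) powr (p + 1) = B * (1 - x)" using x by (simp add: powr_add B_def)
   moreover have "(1 - x) powr (p + 1 - 1) = B" by (simp add: B_def)
   moreover have "((- 1 / 2 * A) * (B * (1 - x)) + ((p + 1) * B * (- 1)) * (x * A)) * Y x + Y' * ((x * A) * (B * (1 - x))) - - (1 / 2) * A * B
    = A * B * (x * (1 - x) * Y' - ((1 / 2 + b * x) * Y x - 1 / 2))"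
    by (simp add: b_def field_simps)
   then have "((- 1 / 2 * A) * (B * (1 - x)) + ((p + 1) * B * (- 1)) * (x * A)) * Y x + Y' * ((x * A) * (B * (1 - x))) - - (1 / 2) * A * B = 0"
    unfolding Y'(2) by simp
   ultimately show ?thesis by (simp only: A_def[symmetric] B_def[symmetric])
  qed
  finally show ?thesis .
 qed
 have const: "D x = D z" if "0 < x" "x < 1" for x
  by (rule DERIV_isconst3[of 0 1]) (use der that z in auto)
 have lim: "(D \<longlongrightarrow> 0) (at_right 0)"
 proof -
  have Y0: "Y 0 = 1"
  proof -
   have "hyp2F1 1 b (1 / 2) 0 = (\<Sum>n. pochhammer b n / pochhammer (1 / 2) n * 0 ^ n)"
    by (rule hyp2F1_one_sums(2)[OF b]) simp
   also have "... = 1" by (subst powser_zero) simp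
   finally show ?thesis by (simp add: Y_def)
  qed
  obtain Y1 where "(Y has_real_derivative Y1) (at 0)"
  proof -
   define c where "c = (%n. pochhammer b n / pochhammer (1 / 2) n :: real)"
   have sm: "summable (%n. c n * x ^ n)" if "norm x < 1" for x
    using hyp2F1_one_sums(1)[OF b, of x] that by (simp add: c_def)
   have Yeq: "Y x = (\<Sum>n. c n * x ^ n)" if "norm x < 1" for x
    using hyp2F1_one_sums(2)[OF b, of x] that by (simp add: c_def Y_def)
   have "((%x. \<Sum>n. c n * x ^ n) has_real_derivative (\<Sum>n. diffs c n * 0 ^ n)) (at 0)"
    by (rule termdiffs_strong'[OF sm]) auto
   then have "(Y has_real_derivative (\<Sum>n. diffs c n * 0 ^ n)) (at 0)"
   proof (rule DERIV_cong_ev[OF refl _ refl, THEN iffD1, rotated])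
    have "eventually (%x. x \<in> ball 0 1) (nhds (0::real))"
     by (intro eventually_nhds_in_open) auto
    then show "eventually (%x. (\<Sum>n. c n * x ^ n) = Y x) (nhds 0)"
     by eventually_elim (rule Yeq[symmetric], simp add: dist_norm)
   qed
   then show thesis by (rule that)
  qed
  then have "((%x. (Y x - Y 0) / (x - 0)) \<longlongrightarrow> Y1) (at 0)"
   by (simp add: has_field_derivative_iff)
  then have "((%x. (Y x - 1) / x) \<longlongrightarrow> Y1) (at 0)"
   by (simp add: Y0)
  then have "((%x. (Y x - 1) / x) \<longlongrightarrow> Y1) (at_right 0)"
   by (rule tendsto_within_subset) simp
  moreover have "((%x. x powr (1 / 2)) \<longlongrightarrow> (0::real)) (at_right 0)"
   by real_asymp
  moreover have "((%x. (1 - x) powr (p + 1)) \<longlongrightarrow> (1 - 0) powr (p + 1)) (at_right 0)"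
   by (intro tendsto_powr tendsto_intros) auto
  ultimately have l1: "((%x. x powr (1 / 2) * (1 - x) powr (p + 1) * ((Y x - 1) / x)) \<longlongrightarrow> 0 * (1 - 0) powr (p + 1) * Y1) (at_right 0)"
   by (intro tendsto_mult)
  have "(cap_J p \<longlongrightarrow> cap_J p 0) (at 0 within {0..1})"
   using continuous_on_cap_J[OF p] by (auto simp: continuous_on_def)
  then have "(cap_J p \<longlongrightarrow> cap_J p 0) (at_right 0)"
   by (simp add: at_within_Icc_at_right)
  moreover have "cap_J p 0 = 0" by (simp add: cap_J_def)
  ultimately have "(cap_J p \<longlongrightarrow> 0) (at_right 0)" by simp
  then have l2: "((%x. (p + 1 / 2) * cap_J p x) \<longlongrightarrow> (p + 1 / 2) * 0) (at_right 0)"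
   by (intro tendsto_mult tendsto_const)
  have "((%x. x powr (1 / 2) * (1 - x) powr (p + 1) * ((Y x - 1) / x) - (p + 1 / 2) * cap_J p x) \<longlongrightarrow>
    0 * (1 - 0) powr (p + 1) * Y1 - (p + 1 / 2) * 0) (at_right 0)"
   by (rule tendsto_diff[OF l1 l2])
  then have "((%x. x powr (1 / 2) * (1 - x) powr (p + 1) * ((Y x - 1) / x) - (p + 1 / 2) * cap_J p x) \<longlongrightarrow> 0) (at_right 0)"
   by simp
  moreover have "eventually (%x. x powr (1 / 2) * (1 - x) powr (p + 1) * ((Y x - 1) / x) - (p + 1 / 2) * cap_J p x = D x) (at_right 0)"
  proof -
   have "eventually (%x::real. 0 < x) (at_right 0)" by (simp add: eventually_at_right_less)
   then show ?thesis
   proof eventually_elim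
    case (elim x)
    have "x powr (1 / 2) = x powr (1 + (- 1 / 2))" by simp
    also have "... = x * x powr (- 1 / 2)" using elim by (simp only: powr_add) simp
    finally have eq: "x powr (1 / 2) * C * ((Y x - 1) / x) = x powr (- 1 / 2) * C * (Y x - 1)" for C
     using elim by simp
    show ?case unfolding D_def w_def cap_R_def eq by (simp add: algebra_simps)
   qed
  qed
  ultimately show ?thesis by (rule Lim_transform_eventually)
 qed
 have "eventually (%x::real. x \<in> {0<..<1}) (at_right 0)" by (rule eventually_at_right_real) simp
 then have "eventually (%x. D x = D z) (at_right 0)"
  by eventually_elim (use const in auto)
 then have "(D \<longlongrightarrow> D z) (at_right 0)" by (rule tendsto_eventually)
 then have "D z = 0" using lim tendsto_unique[of "at_right (0::real)"] by auto
 then show ?thesis by (simp add: D_def w_def Y_def b_def)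
qed

lemma half_angle_sq: "(sin (x / 2))\<^sup>2 = (1 - cos x) / 2" for x :: real
 using cos_double_sin[of "x / 2"] by simp

text \<open>With z = (cos eta - cos alpha) / (1 + cos eta) one has 1 - z = (1 + cos alpha) / (1 +
  cos eta), so every factor is a function of z.\<close>

lemma cap_factor_eq_cap_R:
 assumes d: "3 <= d" and h: "0 <= \<eta>" "\<eta> < \<alpha>" "\<alpha> < pi"
 shows "cap_factor d \<alpha> \<eta> = cap_R ((real d - 2) / 2) ((cos \<eta> - cos \<alpha>) / (1 + cos \<eta>))"
proof -
 define p where "p = (real d - 2) / 2"
 have p: "0 < p" using d by (simp add: p_def)
 have c: "cos \<alpha> < cos \<eta>" using h by (intro cos_monotone_0_pi) auto
 have c1: "-1 < cos \<alpha>" using h cos_monotone_0_pi[of \<alpha> pi] by simp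
 define z where "z = (cos \<eta> - cos \<alpha>) / (1 + cos \<eta>)"
 have e: "0 < 1 + cos \<eta>" using c c1 by simp
 have z: "0 < z" "z < 1" using c c1 e by (auto simp: z_def divide_simps)
 have 1: "(1 + cos \<alpha>) / (1 + cos \<eta>) = 1 - z" using e by (simp add: z_def field_simps)
 have "(1 + cos \<alpha>) / (cos \<eta> - cos \<alpha>) = ((1 + cos \<alpha>) / (1 + cos \<eta>)) / z"
  using e by (simp add: z_def)
 then have 2: "sqrt ((1 + cos \<alpha>) / (cos \<eta> - cos \<alpha>)) = (1 - z) powr (1 / 2) * z powr (- 1 / 2)"
  using z unfolding 1 by (simp add: real_sqrt_divide powr_half_sqrt powr_minus_divide)
 have 3: "(1 - z) powr ((real d - 1) / 2) * ((1 - z) powr (1 / 2) * z powr (- 1 / 2)) = z powr (- 1 / 2) * (1 - z) powr (p + 1)"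
 proof -
  have "p + 1 = (real d - 1) / 2 + 1 / 2" by (simp add: p_def field_simps)
  then show ?thesis by (simp only: powr_add) simp
 qed
 have 4: "(real d - 1) / 2 = p + 1 / 2" by (simp add: p_def field_simps)
 have "cap_factor d \<alpha> \<eta> = (1 - z) powr ((real d - 1) / 2) * ((1 - z) powr (1 / 2) * z powr (- 1 / 2)) * hyp2F1 1 ((real d - 1) / 2) (1 / 2) z"
  unfolding cap_factor_def 1 2 z_def[symmetric] ..
 also have "... = z powr (- 1 / 2) * (1 - z) powr (p + 1) * hyp2F1 1 (p + 1 / 2) (1 / 2) z"
  unfolding 3 unfolding 4 ..
 also have "... = cap_R p z" by (rule cap_R_eq_hyp2F1[OF p z])
 finally show ?thesis by (simp add: p_def z_def)
qed

lemma continuous_on_cap_R: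
 assumes "0 < p"
 shows "continuous_on {0<..1} (cap_R p)"
 unfolding cap_R_def[abs_def]
 by (intro continuous_intros continuous_on_powr' continuous_on_subset[OF continuous_on_cap_J[OF assms]])
   (use assms in auto)

text \<open>As alpha tends to pi the argument of the series tends to 1, where it diverges, while the
  prefactor tends to 0. Continuity of \<open>cap_R\<close> up to 1 gives the limit of the
  product.\<close>

lemma cap_factor_ext_eq_cap_R:
 assumes d: "3 <= d" and h: "0 <= \<eta>" "\<eta> < \<alpha>" "\<alpha> <= pi"
 shows "cap_factor_ext d \<alpha> \<eta> = cap_R ((real d - 2) / 2) ((cos \<eta> - cos \<alpha>) / (1 + cos \<eta>))"
proof (cases "\<alpha> = pi")
 case False
 then show ?thesis using cap_factor_eq_cap_R[OF d h(1,2)] h by (simp add: cap_factor_ext_def)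
next
 case True
 define p where "p = (real d - 2) / 2"
 have p: "0 < p" using d by (simp add: p_def)
 have e: "0 < 1 + cos \<eta>" using h True cos_monotone_0_pi[of \<eta> pi] by simp
 let ?z = "%a. (cos \<eta> - cos a) / (1 + cos \<eta>)"
 have z1: "?z pi = 1" using e by simp
 have zlim: "(?z \<longlongrightarrow> ?z pi) (at_left pi)"
  using e by (intro tendsto_intros) auto
 have rng: "eventually (%a. a \<in> {\<eta><..<pi}) (at_left pi)"
  using h True by (intro eventually_at_leftI[of \<eta>]) auto
 have zin: "?z a \<in> {0<..1} - {1}" if "a \<in> {\<eta><..<pi}" for a
 proof -
  have "cos a < cos \<eta>" using that h by (intro cos_monotone_0_pi) auto
  moreover have "- 1 < cos a" using that h cos_monotone_0_pi[of a pi] by auto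
  ultimately show ?thesis using e by (auto simp: divide_simps)
 qed
 have "(cap_R p \<longlongrightarrow> cap_R p 1) (at 1 within {0<..1})"
  using continuous_on_cap_R[OF p] by (auto simp: continuous_on_def)
 moreover have "filterlim ?z (at 1 within {0<..1}) (at_left pi)"
 proof -
  have "eventually (%a. ?z a \<in> {0<..1} \<and> ?z a ~= 1) (at_left pi)"
   using rng by eventually_elim (use zin in blast)
  moreover have "(?z \<longlongrightarrow> 1) (at_left pi)" using zlim unfolding z1 .
  ultimately show ?thesis unfolding filterlim_at by blast
 qed
 ultimately have "((%a. cap_R p (?z a)) \<longlongrightarrow> cap_R p 1) (at_left pi)"
  by (rule filterlim_compose)
 moreover have "eventually (%a. cap_R p (?z a) = cap_factor d a \<eta>) (at_left pi)"
  using rng by eventually_elim (use cap_factor_eq_cap_R[OF d h(1)] in \<open>auto simp: p_def\<close>)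
 ultimately have "((%a. cap_factor d a \<eta>) \<longlongrightarrow> cap_R p 1) (at_left pi)"
  by (rule Lim_transform_eventually)
 then have "Lim (at_left pi) (%a. cap_factor d a \<eta>) = cap_R p 1"
  by (intro tendsto_Lim) (auto simp: trivial_limit_at_left_real)
 then have "cap_factor_ext d pi \<eta> = cap_R p 1" by (simp add: cap_factor_ext_def)
 moreover have "cap_R p (?z pi) = cap_R p 1" by (simp only: z1)
 ultimately show ?thesis by (simp only: True p_def)
qed

lemma cap_J_eq_nn_integral:
 assumes p: "0 < p" and z: "0 <= z" "z <= 1"
 shows "(II v. ennreal (v powr (- 1 / 2) * (1 - v) powr p) * indicator {0<..<z} v) = ennreal (cap_J p z)"
proof -
 have "((%v. v powr (- 1 / 2) * (1 - v) powr p) has_integral cap_J p z) {0<..<z}"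
  unfolding cap_J_def using cap_J_integrable[OF p order_refl z] by (simp add: has_integral_Icc_iff_Ioo[symmetric] integrable_integral)
 from nn_integral_has_integral_lebesgue'[OF _ this] show ?thesis by simp
qed

lemma cap_J_nonneg:
 assumes "0 < p" "0 <= z" "z <= 1"
 shows "0 <= cap_J p z"
 unfolding cap_J_def by (rule integral_nonneg) (use cap_J_integrable[OF assms(1) order_refl assms(2,3)] in auto)

text \<open>The Abel integral of (1 - w)^p over s < w < a, by \<open>nn_integral_cap_A\<close>. It
  is the part of the solution that a constant potential contributes.\<close>

definition cap_A :: "real => real => real => real" where
 "cap_A p a s = (1 - s) powr (p + 1 / 2) * cap_J p ((a - s) / (1 - s))"

text \<open>The substitution w = s + (1 - s) v gives 1 - w = (1 - s)(1 - v): a power of 1 - s comes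
  out and v runs up to (a - s)/(1 - s).\<close>

lemma nn_integral_cap_A:
 assumes p: "0 < p" and s: "s < a" "a <= 1"
 shows "(II w. ennreal ((1 - w) powr p * (w - s) powr (- 1 / 2)) * indicator {s<..<a} w) = ennreal (cap_A p a s)"
proof -
 let ?D = "1 - s" and ?z = "(a - s) / (1 - s)"
 have D: "0 < ?D" using s by simp
 have z: "0 <= ?z" "?z <= 1" using s by (auto simp: divide_simps)
 have "(II w. ennreal ((1 - w) powr p * (w - s) powr (- 1 / 2)) * indicator {s<..<a} w) =
  ennreal ?D * (II v. ennreal ((1 - (s + ?D * v)) powr p * ((s + ?D * v) - s) powr (- 1 / 2)) * indicator {s<..<a} (s + ?D * v))"
  using D by (subst nn_integral_real_affine[where c="?D" and t=s]) auto
 also have "... = ennreal ?D * (II v. ennreal (?D powr (p - 1 / 2)) * (ennreal (v powr (- 1 / 2) * (1 - v) powr p) * indicator {0<..<?z} v))"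
 proof (rule arg_cong2[where f="(*)", OF refl], rule nn_integral_cong)
  fix v :: real
  have ind: "s + ?D * v \<in> {s<..<a} \<longleftrightarrow> v \<in> {0<..<?z}"
   using D by (auto simp: pos_less_divide_eq zero_less_mult_iff mult.commute)
  have "(1 - (s + ?D * v)) powr p * ((s + ?D * v) - s) powr (- 1 / 2) = ?D powr (p - 1 / 2) * (v powr (- 1 / 2) * (1 - v) powr p)"
   if v: "v \<in> {0<..<?z}"
  proof -
   have "1 - (s + ?D * v) = ?D * (1 - v)" by (simp add: algebra_simps)
   moreover have "0 <= 1 - v" "0 <= v" using v z by auto
   moreover have "?D powr (p - 1 / 2) = ?D powr p * ?D powr (- 1 / 2)"
    by (simp add: powr_add[symmetric])
   ultimately show ?thesis using D by (simp add: powr_mult mult_ac)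
  qed
  then show "ennreal ((1 - (s + ?D * v)) powr p * ((s + ?D * v) - s) powr (- 1 / 2)) * indicator {s<..<a} (s + ?D * v) =
   ennreal (?D powr (p - 1 / 2)) * (ennreal (v powr (- 1 / 2) * (1 - v) powr p) * indicator {0<..<?z} v)"
   using ind by (auto simp: indicator_def ennreal_mult[symmetric])
 qed
 also have "... = ennreal ?D * (ennreal (?D powr (p - 1 / 2)) * ennreal (cap_J p ?z))"
  by (subst nn_integral_cmult, measurable, subst cap_J_eq_nn_integral[OF p z], rule refl)
 also have "... = ennreal (?D * (?D powr (p - 1 / 2) * cap_J p ?z))"
  using D cap_J_nonneg[OF p z] by (simp add: ennreal_mult)
 also have "?D * (?D powr (p - 1 / 2) * cap_J p ?z) = cap_A p a s"
 proof -
  have "?D powr (p + 1 / 2) = ?D powr (1 + (p - 1 / 2))" by (simp add: algebra_simps)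
  also have "... = ?D * ?D powr (p - 1 / 2)" using D by (simp only: powr_add) simp
  finally show ?thesis by (simp add: cap_A_def)
 qed
 finally show ?thesis .
qed

text \<open>This is where the hypergeometric factor enters: the density belonging to a constant
  potential is minus the derivative of an Abel integral.\<close>

lemma cap_A_deriv:
 assumes p: "0 < p" and s: "s < a" "0 < s" "a <= 1"
 shows "(cap_A p a has_real_derivative - ((1 - s) powr (p - 1 / 2) * cap_R p ((a - s) / (1 - s)))) (at s)"
proof -
 let ?z = "%s. (a - s) / (1 - s)"
 define D where "D = 1 - s"
 have D: "0 < D" using s by (simp add: D_def)
 have 1: "((%s. (1 - s) powr (p + 1 / 2)) has_real_derivative (p + 1 / 2) * D powr (p + 1 / 2 - 1) * (- 1)) (at s)"
 proof -
  have "((%x. x powr (p + 1 / 2)) has_real_derivative (p + 1 / 2) * (1 - s) powr (p + 1 / 2 - 1)) (at (1 - s))"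
   using s by (intro has_real_derivative_powr) auto
  moreover have "((%z::real. 1 - z) has_real_derivative - 1) (at s)"
   by (auto intro!: derivative_eq_intros)
  ultimately show ?thesis unfolding D_def by (rule DERIV_chain2)
 qed
 have pw: "D powr (p + 1 / 2) = D * D powr (p - 1 / 2)"
 proof -
  have "D powr (p + 1 / 2) = D powr (1 + (p - 1 / 2))" by (simp add: algebra_simps)
  also have "... = D * D powr (p - 1 / 2)" using D by (simp only: powr_add) simp
  finally show ?thesis .
 qed
 have dz: "(?z has_real_derivative - (1 - a) / D\<^sup>2) (at s)"
  using D unfolding D_def by (auto intro!: derivative_eq_intros simp: power2_eq_square field_simps)
 show ?thesis
 proof (cases "a = 1")
  case False
  then have z: "0 < ?z s" "?z s < 1" using s by (auto simp: divide_simps)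
  have "((%s. cap_J p (?z s)) has_real_derivative (?z s powr (- 1 / 2) * (1 - ?z s) powr p) * (- (1 - a) / D\<^sup>2)) (at s)"
   by (rule DERIV_chain2[OF cap_J_deriv[OF p z] dz])
  from DERIV_mult[OF 1 this]
  have "(cap_A p a has_real_derivative (p + 1 / 2) * D powr (p + 1 / 2 - 1) * (- 1) * cap_J p (?z s) +
    (?z s powr (- 1 / 2) * (1 - ?z s) powr p) * (- (1 - a) / D\<^sup>2) * D powr (p + 1 / 2)) (at s)"
   unfolding cap_A_def[abs_def] D_def by simp
  also have "1 - ?z s = (D - (a - s)) / D"
   using D unfolding diff_divide_distrib by (simp add: D_def)
  then have "(1 - a) / D\<^sup>2 * D = 1 - ?z s" using D by (simp add: D_def power2_eq_square)
  then have "(?z s powr (- 1 / 2) * (1 - ?z s) powr p) * (- (1 - a) / D\<^sup>2) * D powr (p + 1 / 2)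
   = - (D powr (p - 1 / 2) * (?z s powr (- 1 / 2) * ((1 - ?z s) powr p * (1 - ?z s))))"
  proof -
   assume *: "(1 - a) / D\<^sup>2 * D = 1 - ?z s"
   have "x * w * (- k / q) * (D * y) = - (y * (x * (w * (k / q * D))))" for x w y k q :: real
    by simp
   then show ?thesis unfolding pw *[symmetric] .
  qed
  also have "(1 - ?z s) powr p * (1 - ?z s) = (1 - ?z s) powr (p + 1)" using z by (simp add: powr_add)
  also have "(p + 1 / 2) * D powr (p + 1 / 2 - 1) * (- 1) * cap_J p (?z s) + - (D powr (p - 1 / 2) * (?z s powr (- 1 / 2) * (1 - ?z s) powr (p + 1)))
    = - (D powr (p - 1 / 2) * cap_R p (?z s))"
   by (simp add: cap_R_def algebra_simps)
  finally show ?thesis by (simp add: D_def)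
 next
  \<comment> \<open>The argument of \<open>cap_J\<close> is now constantly 1, an end point where
    \<open>cap_J_deriv\<close> gives nothing; only the power of 1 - s varies.\<close>
  case True
  have "eventually (%x. x \<in> {0<..<1}) (nhds s)"
   using s by (intro eventually_nhds_in_open) auto
  then have "eventually (%x. (1 - x) powr (p + 1 / 2) * cap_J p 1 = cap_A p a x) (nhds s)"
   by eventually_elim (simp add: cap_A_def True)
  moreover have "((%x. (1 - x) powr (p + 1 / 2) * cap_J p 1) has_real_derivative (p + 1 / 2) * D powr (p + 1 / 2 - 1) * (- 1) * cap_J p 1) (at s)"
   by (rule DERIV_cmult_right[OF 1])
  ultimately have "(cap_A p a has_real_derivative (p + 1 / 2) * D powr (p + 1 / 2 - 1) * (- 1) * cap_J p 1) (at s)"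
   by (rule DERIV_cong_ev[OF refl _ refl, THEN iffD1])
  also have "(p + 1 / 2) * D powr (p + 1 / 2 - 1) * (- 1) * cap_J p 1 = - ((1 - s) powr (p - 1 / 2) * cap_R p ((a - s) / (1 - s)))"
   using D p True by (simp add: cap_R_def D_def)
  finally show ?thesis .
 qed
qed

text \<open>An improper fundamental theorem: closed intervals exhaust (l, r), and monotone
  convergence takes the place of integrability.\<close>

lemma nn_integral_FTC_Ioo:
 fixes F f :: "real => real"
 assumes lr: "l < r"
  and m: "(%x. f x * indicator {l<..<r} x) \<in> borel_measurable borel"
  and der: "!!x. l < x ==> x < r ==> (F has_real_derivative f x) (at x)"
  and nn: "!!x. l < x ==> x < r ==> 0 <= f x"
  and L: "(F \<longlongrightarrow> L) (at_right l)" and R: "(F \<longlongrightarrow> R) (at_left r)"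
 shows "(II x. ennreal (f x) * indicator {l<..<r} x) = ennreal (R - L)"
proof -
 define e where "e = (%i::nat. (r - l) / (real i + 3))"
 define g where "g = (%x. f x * indicator {l<..<r} x)"
 have [measurable]: "g \<in> borel_measurable borel" using m by (simp add: g_def)
 have e: "0 < e i" "2 * e i < r - l" for i
 proof -
  show "0 < e i" using lr by (simp add: e_def)
  have "(r - l) * (2 / (real i + 3)) < (r - l) * 1"
   using lr by (intro mult_strict_left_mono) auto
  then show "2 * e i < r - l" by (simp add: e_def mult.commute)
 qed
 have anti: "e j <= e i" if "i <= j" for i j
  unfolding e_def using lr that by (intro divide_left_mono) auto
 have e0: "e \<longlonglongrightarrow> 0" unfolding e_def by real_asymp
 have ne: "e i ~= 0" for i using e(1)[of i] by simp
 let ?I = "%i. {l + e i .. r - e i}"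
 have sub: "?I i \<subseteq> {l<..<r}" for i using e[of i] by auto
 have FTC: "(II x. ennreal (g x) * indicator (?I i) x) = ennreal (F (r - e i) - F (l + e i))" for i
 proof (rule nn_integral_FTC_Icc)
  fix x assume x: "x \<in> {l + e i..r - e i}"
  then have x': "l < x" "x < r" using sub[of i] by auto
  then show "(F has_real_derivative g x) (at x)"
   using der[of x] by (simp add: g_def)
  show "0 <= g x" using nn[of x] x' by (simp add: g_def)
 qed (use e[of i] in auto)
 have inc: "incseq (%i x. ennreal (g x) * indicator (?I i) x)"
 proof (rule incseq_SucI, rule le_funI)
  fix i x
  have "?I i \<subseteq> ?I (Suc i)" using anti[of i "Suc i"] by auto
  then show "ennreal (g x) * indicator (?I i) x <= ennreal (g x) * indicator (?I (Suc i)) x"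
   by (intro mult_left_mono) (auto simp: indicator_def)
 qed
 have sup: "(SUP i. ennreal (g x) * indicator (?I i) x) = ennreal (f x) * indicator {l<..<r} x" for x
 proof (cases "l < x \<and> x < r")
  case True
  then have "0 < min (x - l) (r - x)" by simp
  then have "eventually (%i. e i < min (x - l) (r - x)) sequentially"
   using e0 by (intro order_tendstoD) auto
  then obtain i where i: "e i < min (x - l) (r - x)" by (auto simp: eventually_sequentially)
  show ?thesis
  proof (rule antisym)
   show "(SUP i. ennreal (g x) * indicator (?I i) x) <= ennreal (f x) * indicator {l<..<r} x"
    using True by (intro SUP_least) (auto simp: g_def indicator_def)
   have "ennreal (f x) * indicator {l<..<r} x = ennreal (g x) * indicator (?I i) x"
    using True i by (simp add: g_def)
   then show "ennreal (f x) * indicator {l<..<r} x <= (SUP i. ennreal (g x) * indicator (?I i) x)"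
    by (simp only:) (rule SUP_upper, simp)
  qed
 next
  case False
  then have "g x = 0" by (simp add: g_def)
  then show ?thesis using False by simp
 qed
 have "(II x. ennreal (f x) * indicator {l<..<r} x) = (SUP i. ennreal (F (r - e i) - F (l + e i)))"
  unfolding sup[symmetric] FTC[symmetric]
  by (rule nn_integral_monotone_convergence_SUP[OF inc]) measurable
 moreover have "(%i. ennreal (F (r - e i) - F (l + e i))) \<longlonglongrightarrow> (SUP i. ennreal (F (r - e i) - F (l + e i)))"
 proof (rule LIMSEQ_SUP)
  show "incseq (%i. ennreal (F (r - e i) - F (l + e i)))"
   unfolding FTC[symmetric] using inc by (auto simp: incseq_def le_fun_def intro!: nn_integral_mono)
 qed
 moreover have "(%i. ennreal (F (r - e i) - F (l + e i))) \<longlonglongrightarrow> ennreal (R - L)"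
 proof (intro tendsto_ennrealI tendsto_diff)
  have "filterlim (%i. r - e i) (at_left r) sequentially"
   using e ne tendsto_diff[OF tendsto_const e0, of r] by (auto simp: filterlim_at)
  with R show "(%i. F (r - e i)) \<longlonglongrightarrow> R" by (rule filterlim_compose)
  have "filterlim (%i. l + e i) (at_right l) sequentially"
   using e tendsto_add[OF tendsto_const e0, of l] ne by (auto simp: filterlim_at)
  with L show "(%i. F (l + e i)) \<longlonglongrightarrow> L" by (rule filterlim_compose)
 qed
 ultimately show ?thesis by (simp only: LIMSEQ_unique)
qed

lemma cap_R_nonneg:
 assumes "0 < p" "0 <= z" "z <= 1"
 shows "0 <= cap_R p z"
 unfolding cap_R_def using cap_J_nonneg[OF assms] assms by simp

lemma cap_A_bound:
 assumes p: "0 < p" and s: "0 <= s" "s < a" "a <= 1"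
 shows "0 <= cap_A p a s" "cap_A p a s <= Beta (1 / 2) 1 * sqrt (a - s)"
proof -
 have z: "0 <= (a - s) / (1 - s)" "(a - s) / (1 - s) <= 1" using s by (auto simp: divide_simps)
 show "0 <= cap_A p a s" unfolding cap_A_def using cap_J_nonneg[OF p z] s by simp
 have "ennreal (cap_A p a s) = (II w. ennreal ((1 - w) powr p * (w - s) powr (- 1 / 2)) * indicator {s<..<a} w)"
  by (rule nn_integral_cap_A[symmetric, OF p s(2,3)])
 also have "... <= (II w. ennreal ((w - s) powr (1 / 2 - 1) * (a - w) powr (1 - 1)) * indicator {s<..<a} w)"
 proof (intro nn_integral_mono)
  fix w :: real
  show "ennreal ((1 - w) powr p * (w - s) powr (- 1 / 2)) * indicator {s<..<a} w <=
   ennreal ((w - s) powr (1 / 2 - 1) * (a - w) powr (1 - 1)) * indicator {s<..<a} w"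
  proof (cases "w \<in> {s<..<a}")
   case True
   then have "(1 - w) powr p <= 1 powr p" using s p by (intro powr_mono2) auto
   then have "(1 - w) powr p * (w - s) powr (- 1 / 2) <= 1 * (w - s) powr (- 1 / 2)"
    by (intro mult_right_mono) auto
   then show ?thesis using True by (auto intro!: ennreal_leI)
  qed simp
 qed
 also have "... = ennreal ((a - s) powr (1 / 2 + 1 - 1) * Beta (1 / 2) 1)"
  using s by (intro nn_integral_Beta) auto
 also have "(a - s) powr (1 / 2 + 1 - 1) = sqrt (a - s)" using s by (simp add: powr_half_sqrt)
 finally show "cap_A p a s <= Beta (1 / 2) 1 * sqrt (a - s)"
  using s by (subst (asm) ennreal_le_iff) (auto simp: Beta_def Gamma_real_pos less_imp_le mult.commute)
qed

text \<open>The integrand is the derivative of minus \<open>cap_A\<close>, and \<open>cap_A\<close>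
  vanishes at a like a square root.\<close>

lemma cap_density_tail:
 assumes p: "0 < p" and x: "0 <= x" "x < a" "a <= 1"
 shows "(II s. ennreal ((1 - s) powr (p - 1 / 2) * cap_R p ((a - s) / (1 - s))) * indicator {x<..<a} s) = ennreal (cap_A p a x)"
proof -
 let ?f = "%s. (1 - s) powr (p - 1 / 2) * cap_R p ((a - s) / (1 - s))"
 have z: "0 < (a - s) / (1 - s)" "(a - s) / (1 - s) <= 1" if "s < a" for s using that x by (auto simp: divide_simps)
 have cont: "continuous_on {x<..<a} ?f"
  by (intro continuous_intros continuous_on_compose2[OF continuous_on_cap_R[OF p]] continuous_on_powr')
    (use x z in auto)
 have "(II s. ennreal (?f s) * indicator {x<..<a} s) = ennreal (0 - (- cap_A p a x))"
 proof (rule nn_integral_FTC_Ioo[OF x(2)])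
  show "(%s. ?f s * indicator {x<..<a} s) \<in> borel_measurable borel"
   using borel_measurable_continuous_on_indicator[OF _ cont] by (simp add: mult.commute)
  show "((%s. - cap_A p a s) has_real_derivative ?f s) (at s)" if "x < s" "s < a" for s
   using DERIV_minus[OF cap_A_deriv[OF p, of s a]] that x by simp
  show "0 <= ?f s" if "x < s" "s < a" for s
   using cap_R_nonneg[OF p less_imp_le[OF z(1)[OF that(2)]] z(2)[OF that(2)]] by simp
  have "(cap_A p a \<longlongrightarrow> 0) (at_left a)"
  proof (rule tendsto_sandwich)
   have ev: "eventually (%s. s \<in> {x<..<a}) (at_left a)" using x by (intro eventually_at_leftI[of x]) auto
   show "eventually (%s. 0 <= cap_A p a s) (at_left a)"
    using ev by eventually_elim (use cap_A_bound(1)[OF p] x in auto)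
   show "eventually (%s. cap_A p a s <= Beta (1 / 2) 1 * sqrt (a - s)) (at_left a)"
    using ev by eventually_elim (use cap_A_bound(2)[OF p] x in auto)
   have "((%s. Beta (1 / 2) 1 * sqrt (a - s)) \<longlongrightarrow> Beta (1 / 2) 1 * sqrt (a - a)) (at_left a)"
    by (intro tendsto_intros)
   then show "((%s. Beta (1 / 2) 1 * sqrt (a - s)) \<longlongrightarrow> 0) (at_left a)" by simp
  qed simp
  then have "((%s. - cap_A p a s) \<longlongrightarrow> - 0) (at_left a)" by (rule tendsto_minus)
  then show "((%s. - cap_A p a s) \<longlongrightarrow> 0) (at_left a)" by simp
  have "continuous_on {x..<a} (cap_A p a)"
   unfolding cap_A_def[abs_def]
   by (intro continuous_intros continuous_on_compose2[OF continuous_on_cap_J[OF p]] continuous_on_powr')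
     (use x p in \<open>auto simp: divide_simps\<close>)
  then have "(cap_A p a \<longlongrightarrow> cap_A p a x) (at x within {x..<a})" using x by (auto simp: continuous_on_def)
  moreover have "at x within {x..<a} = at_right x"
   using x by (intro at_within_nhd[of x "{..<a}"]) auto
  ultimately show "((%s. - cap_A p a s) \<longlongrightarrow> - cap_A p a x) (at_right x)"
   by (intro tendsto_minus) simp
 qed
 then show ?thesis by simp
qed

lemma inc_Beta_eq_nn_integral:
 assumes p: "0 < p" and a: "0 <= a" "a <= 1"
 shows "(II w. ennreal (w powr (p - 1) * (1 - w) powr (p + 1 - 1)) * indicator {0<..<a} w) = ennreal (inc_Beta a p (p + 1))"
proof -
 have "(%w. w powr (p - 1) * (1 - w) powr (p + 1 - 1)) integrable_on {0..1}"
  using has_integral_Beta_real[of p "p + 1"] p by (auto simp: integrable_on_def)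
 then have "(%w. w powr (p - 1) * (1 - w) powr (p + 1 - 1)) integrable_on {0..a}"
  by (rule integrable_on_subinterval) (use a in auto)
 then have "((%w. w powr (p - 1) * (1 - w) powr (p + 1 - 1)) has_integral inc_Beta a p (p + 1)) {0<..<a}"
  unfolding inc_Beta_def by (simp add: has_integral_Icc_iff_Ioo[symmetric] integrable_integral)
 from nn_integral_has_integral_lebesgue'[OF _ this] show ?thesis by simp
qed

text \<open>Write s^(p - 1/2) as the integral of its derivative over x < s. Integrating first over s
  > x gives \<open>cap_A\<close> at x, itself an Abel integral in w; integrating next over x < w
  gives a complete Beta integral, and w is left with the incomplete one. For p = 1/2 the weight is 1
  and the tail at 0 is already the answer.\<close>

lemma cap_density_mass:
 assumes p: "1 / 2 <= p" and a: "0 < a" "a <= 1"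
 shows "(II s. ennreal (s powr (p - 1 / 2) * ((1 - s) powr (p - 1 / 2) * cap_R p ((a - s) / (1 - s)))) * indicator {0<..<a} s) =
  ennreal (Gamma (p + 1 / 2) * sqrt pi / Gamma p * inc_Beta a p (p + 1))"
proof (cases "p = 1 / 2")
 case True
 have "(II s. ennreal (s powr (p - 1 / 2) * ((1 - s) powr (p - 1 / 2) * cap_R p ((a - s) / (1 - s)))) * indicator {0<..<a} s) =
  (II s. ennreal ((1 - s) powr (p - 1 / 2) * cap_R p ((a - s) / (1 - s))) * indicator {0<..<a} s)"
  by (rule nn_integral_cong) (auto simp: True indicator_def)
 also have "... = ennreal (cap_A p a 0)" using p a by (intro cap_density_tail) auto
 also have "cap_A p a 0 = Gamma (p + 1 / 2) * sqrt pi / Gamma p * inc_Beta a p (p + 1)"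
  by (simp add: True cap_A_def cap_J_def inc_Beta_def Gamma_one_half_real)
 finally show ?thesis .
next
 case False
 define b where "b = p - 1 / 2"
 have b: "0 < b" and p0: "0 < p" using p False by (auto simp: b_def)
 let ?f = "%s. (1 - s) powr b * cap_R p ((a - s) / (1 - s))"
 have z: "0 < (a - s) / (1 - s)" "(a - s) / (1 - s) <= 1" if "s < a" for s using that a by (auto simp: divide_simps)
 have f0: "0 <= ?f s" if "s < a" for s
  using cap_R_nonneg[OF p0 less_imp_le[OF z(1)[OF that]] z(2)[OF that]] by simp
 have cont: "continuous_on {0<..<a} ?f"
  by (intro continuous_intros continuous_on_compose2[OF continuous_on_cap_R[OF p0]] continuous_on_powr')
    (use a z in auto)
 define h where "h = (%s. ?f s * indicator {0<..<a} s)"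
 have [measurable]: "h \<in> borel_measurable borel"
  using borel_measurable_continuous_on_indicator[OF _ cont] by (simp add: mult.commute h_def)
 have [measurable]: "h \<in> borel_measurable lborel" by simp
 have [measurable]: "Measurable.pred (borel \<Otimes>\<^sub>M borel) (%x::real \<times> real. fst x \<in> {0<..<snd x})"
  "Measurable.pred (borel \<Otimes>\<^sub>M borel) (%x::real \<times> real. snd x \<in> {fst x<..<a})"
  unfolding greaterThanLessThan_iff by measurable
 have h0: "0 <= h s" for s unfolding h_def using f0[of s] by (simp add: indicator_def)
 let ?K = "%x s. ennreal (b * x powr (b - 1)) * indicator {0<..<s} x"
 have pow: "(II x. ?K x s) = ennreal (s powr b)" if "0 < s" for s
 proof -
  have "(II x. ?K x s) = (II x. ennreal b * (ennreal ((x - 0) powr (b - 1) * (s - x) powr (1 - 1)) * indicator {0<..<s} x))"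
   using b by (intro nn_integral_cong) (auto simp: indicator_def ennreal_mult)
  also have "... = ennreal b * ennreal ((s - 0) powr (b + 1 - 1) * Beta b 1)"
   using b that by (subst nn_integral_cmult, measurable, subst nn_integral_Beta) auto
  also have "Beta b 1 = 1 / b"
  proof -
   have "b \<notin> \<int>\<^sub>\<le>\<^sub>0" using b by (auto elim!: nonpos_Ints_cases)
   then show ?thesis using Gamma_plus1[of b] less_imp_neq[OF Gamma_real_pos[OF b], symmetric] b by (simp add: Beta_def)
  qed
  finally show ?thesis using b by (simp add: ennreal_mult'[symmetric])
 qed
 have "(II s. ennreal (s powr (p - 1 / 2) * ((1 - s) powr (p - 1 / 2) * cap_R p ((a - s) / (1 - s)))) * indicator {0<..<a} s) =
  (II s. II x. ?K x s * ennreal (h s))"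
 proof (rule nn_integral_cong, goal_cases)
  case (1 s)
  have "(II x. ?K x s * ennreal (h s)) = (II x. ?K x s) * ennreal (h s)"
   by (rule nn_integral_multc) measurable
  also have "... = ennreal (s powr (p - 1 / 2) * ((1 - s) powr (p - 1 / 2) * cap_R p ((a - s) / (1 - s)))) * indicator {0<..<a} s"
  proof (cases "s \<in> {0<..<a}")
   case True
   then show ?thesis using pow[of s] f0[of s] by (simp add: h_def b_def[symmetric] ennreal_mult)
  qed (simp add: h_def)
  finally show ?case ..
 qed
 also have "... = (II x. II s. ?K x s * ennreal (h s))"
  by (rule lborel_pair.Fubini') measurable
 also have "... = (II x. II w. ?K x w * (ennreal ((1 - w) powr p * (w - x) powr (- 1 / 2)) * indicator {x<..<a} w))"
 proof (rule nn_integral_cong, goal_cases)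
  case (1 x)
  show ?case
  proof (cases "0 < x \<and> x < a")
   case True
   have "(II s. ?K x s * ennreal (h s)) = (II s. ennreal (b * x powr (b - 1)) * (ennreal (h s) * indicator {x<..<a} s))"
    using True by (intro nn_integral_cong) (auto simp: indicator_def h_def)
   also have "... = ennreal (b * x powr (b - 1)) * (II s. ennreal (h s) * indicator {x<..<a} s)"
    by (rule nn_integral_cmult) measurable
   also have "(II s. ennreal (h s) * indicator {x<..<a} s) = (II s. ennreal (?f s) * indicator {x<..<a} s)"
    using True by (intro nn_integral_cong) (auto simp: h_def indicator_def)
   also have "... = ennreal (cap_A p a x)"
    unfolding b_def using True a p0 by (intro cap_density_tail) auto
   also have "... = (II w. ennreal ((1 - w) powr p * (w - x) powr (- 1 / 2)) * indicator {x<..<a} w)"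
    using True a p0 by (intro nn_integral_cap_A[symmetric]) auto
   also have "ennreal (b * x powr (b - 1)) * ... = (II w. ennreal (b * x powr (b - 1)) * (ennreal ((1 - w) powr p * (w - x) powr (- 1 / 2)) * indicator {x<..<a} w))"
    by (rule nn_integral_cmult[symmetric]) measurable
   also have "... = (II w. ?K x w * (ennreal ((1 - w) powr p * (w - x) powr (- 1 / 2)) * indicator {x<..<a} w))"
    using True by (intro nn_integral_cong) (auto simp: indicator_def)
   finally show ?thesis .
  next
   case False
   then have "?K x s * ennreal (h s) = 0" "?K x s * (ennreal ((1 - s) powr p * (s - x) powr (- 1 / 2)) * indicator {x<..<a} s) = 0" for s
    by (auto simp: h_def indicator_def)
   then show ?thesis by (simp only:)
  qed
 qed
 also have "... = (II w. II x. ?K x w * (ennreal ((1 - w) powr p * (w - x) powr (- 1 / 2)) * indicator {x<..<a} w))"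
  by (rule lborel_pair.Fubini'[symmetric]) measurable
 also have "... = (II w. ennreal (b * Beta b (1 / 2)) * (ennreal (w powr (p - 1) * (1 - w) powr (p + 1 - 1)) * indicator {0<..<a} w))"
 proof (rule nn_integral_cong, goal_cases)
  case (1 w)
  show ?case
  proof (cases "w \<in> {0<..<a}")
   case True
   have "(II x. ?K x w * (ennreal ((1 - w) powr p * (w - x) powr (- 1 / 2)) * indicator {x<..<a} w)) =
    (II x. ennreal (b * (1 - w) powr p) * (ennreal ((x - 0) powr (b - 1) * (w - x) powr (1 / 2 - 1)) * indicator {0<..<w} x))"
    using True b by (intro nn_integral_cong) (auto simp: indicator_def ennreal_mult[symmetric] mult_ac)
   also have "... = ennreal (b * (1 - w) powr p) * ennreal ((w - 0) powr (b + 1 / 2 - 1) * Beta b (1 / 2))"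
    using True b by (subst nn_integral_cmult, measurable, subst nn_integral_Beta) auto
   also have "b + 1 / 2 - 1 = p - 1" by (simp add: b_def)
   also have "ennreal (b * (1 - w) powr p) * ennreal ((w - 0) powr (p - 1) * Beta b (1 / 2)) =
     ennreal (b * Beta b (1 / 2)) * ennreal (w powr (p - 1) * (1 - w) powr (p + 1 - 1))"
    using b by (simp add: ennreal_mult'[symmetric] mult_ac Beta_def Gamma_real_pos less_imp_le)
   finally show ?thesis using True by simp
  next
   case False
   then have "?K x w * (ennreal ((1 - w) powr p * (w - x) powr (- 1 / 2)) * indicator {x<..<a} w) = 0" for x
    by (auto simp: indicator_def)
   note zero = this
   show ?thesis unfolding zero using False by simp
  qed
 qed
 also have "... = ennreal (b * Beta b (1 / 2)) * ennreal (inc_Beta a p (p + 1))"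
  by (subst nn_integral_cmult, measurable, subst inc_Beta_eq_nn_integral) (use p0 a in auto)
 also have "... = ennreal (b * Beta b (1 / 2) * inc_Beta a p (p + 1))"
  using b by (simp add: ennreal_mult'[symmetric] Beta_def Gamma_real_pos less_imp_le)
 also have "b * Beta b (1 / 2) = Gamma (p + 1 / 2) * sqrt pi / Gamma p"
 proof -
  have "Gamma (p + 1 / 2) = b * Gamma b" 
  proof -
   have "b \<notin> \<int>\<^sub>\<le>\<^sub>0" using b by (auto elim!: nonpos_Ints_cases)
   then show ?thesis using Gamma_plus1[of b] by (simp add: b_def add.commute)
  qed
  moreover have "b + 1 / 2 = p" by (simp add: b_def)
  ultimately show ?thesis by (simp add: Beta_def Gamma_one_half_real)
 qed
 finally show ?thesis .
qed

section \<open>From polar angles to the latitude variable\<close>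

text \<open>The haversine. Differences of cosines are twice differences of \<open>hav\<close>, so
  the kernels 1/sqrt(cos - cos) of the theorem are Abel kernels in this variable.\<close>

definition hav :: "real => real" where
 "hav x = (1 - cos x) / 2"

lemma hav_eq_sin: "hav x = (sin (x / 2))\<^sup>2"
 by (simp add: hav_def half_angle_sq)

lemma one_minus_hav: "1 - hav x = (cos (x / 2))\<^sup>2"
 by (simp add: hav_eq_sin sin_squared_eq)

lemma hav_deriv: "(hav has_real_derivative sin x / 2) (at x)"
 unfolding hav_def[abs_def] by (auto intro!: derivative_eq_intros)

lemma hav_strict_mono: "0 <= x ==> x < y ==> y <= pi ==> hav x < hav y"
 using cos_monotone_0_pi[of x y] by (simp add: hav_def)

lemma hav_less_imp_less: "hav x < hav y ==> 0 <= y ==> x <= pi ==> x < y"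
 using cos_monotone_0_pi_le[of y x] by (force simp: hav_def)

lemma hav_arccos: "0 <= t ==> t <= 1 ==> hav (arccos (1 - 2 * t)) = t"
 by (simp add: hav_def)

lemma hav_nonneg: "0 <= hav x" by (simp add: hav_def)

lemma hav_le_1: "hav x <= 1" using cos_ge_minus_one[of x] by (simp add: hav_def)

lemma hav_0 [simp]: "hav 0 = 0" by (simp add: hav_def)

lemma integral_Ioo: "integral {a<..<b} f = integral {a..b} f" for f :: "real => real"
 by (simp add: integral_def integrable_on_def has_integral_Icc_iff_Ioo)

text \<open>The formulas for g and F are Henstock integrals over angles; this turns them into
  Bochner integrals against Beta measures, for which the Abel calculus is set up.\<close>

lemma polar_beta_integral:
 fixes F :: "real => real"
 assumes x: "0 <= x1" "x1 < x2" "x2 <= pi"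
  and int: "integrable (beta_measure a b) (%u. F (hav x1 + (hav x2 - hav x1) * u))"
 shows "integral {x1..x2} (%x. F (hav x) * ((hav x - hav x1) powr (a - 1) * (hav x2 - hav x) powr (b - 1)) * (sin x / 2)) =
  (hav x2 - hav x1) powr (a + b - 1) * (\<integral>u. F (hav x1 + (hav x2 - hav x1) * u) \<partial>beta_measure a b)"
proof -
 define l where "l = hav x1"
 define D where "D = hav x2 - hav x1"
 have D: "0 < D" using hav_strict_mono[OF x] by (simp add: D_def)
 define G where "G = (%u. F (l + D * u))"
 define f where "f = (%u. (u powr (a - 1) * (1 - u) powr (b - 1)) * G u)"
 define I where "I = (\<integral>u. G u \<partial>beta_measure a b)"
 have intG: "integrable (beta_measure a b) G" using int by (simp add: G_def l_def D_def)
 then have [measurable]: "G \<in> borel_measurable borel"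
  using borel_measurable_integrable by (simp add: measurable_cong_sets[OF sets_beta_measure refl])
 have bw: "beta_weight a b u * G u = indicator {0<..<1} u *\<^sub>R f u" for u
  by (simp add: beta_weight_def f_def)
 have 1: "integrable lborel (%u. indicator {0<..<1} u *\<^sub>R f u)"
  using intG unfolding beta_measure_def
  by (subst (asm) integrable_density) (simp_all add: beta_weight_nonneg bw)
 have 2: "(\<integral>u. indicator {0<..<1} u *\<^sub>R f u \<partial>lborel) = I"
  unfolding I_def beta_measure_def by (subst integral_density) (simp_all add: beta_weight_nonneg bw)
 have m: "(%u. indicator {0<..<1} u *\<^sub>R f u) \<in> borel_measurable lborel"
  using 1 by (rule borel_measurable_integrable)
 have abs: "f absolutely_integrable_on {0<..<1}"
  unfolding set_integrable_def using 1 integrable_completion[OF m] by simp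
 have val: "integral {0<..<1} f = I"
  using set_lebesgue_integral_eq_integral(2)[OF abs] integral_completion[OF m] 2
  by (simp add: set_lebesgue_integral_def)
 let ?g = "%x. (hav x - l) / D" and ?S = "{x1<..<x2}"
 have strict: "?g y < ?g z" if "y < z" "y \<in> ?S" "z \<in> ?S" for y z
 proof -
  have "hav y < hav z" using that x by (intro hav_strict_mono) auto
  then show ?thesis using D by (simp add: divide_strict_right_mono)
 qed
 have inj: "inj_on ?g ?S"
 proof (rule inj_onI)
  fix y z assume "y \<in> ?S" "z \<in> ?S" "?g y = ?g z"
  then show "y = z" using strict[of y z] strict[of z y] by (cases y z rule: linorder_cases) auto
 qed
 have img: "?g ` ?S = {0<..<1}"
 proof (intro equalityI subsetI)
  fix u assume "u \<in> ?g ` ?S"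
  then obtain y where y: "x1 < y" "y < x2" "u = (hav y - l) / D" by auto
  have "hav x1 < hav y" "hav y < hav x2" using y x by (auto intro!: hav_strict_mono)
  then show "u \<in> {0<..<1}" using D y by (simp add: l_def D_def)
 next
  fix u :: real assume u: "u \<in> {0<..<1}"
  define t where "t = l + D * u"
  have "0 < D * u" "D * u < D * 1" using D u by (auto intro!: mult_strict_left_mono)
  then have t: "hav x1 < t" "t < hav x2" by (auto simp: t_def l_def D_def)
  have t01: "0 <= t" "t <= 1" using t hav_nonneg[of x1] hav_le_1[of x2] by linarith+
  define y where "y = arccos (1 - 2 * t)"
  have hy: "hav y = t" using t01 by (simp add: y_def hav_arccos)
  have yb: "0 <= y" "y <= pi" using t01 by (auto simp: y_def intro!: arccos_lbound arccos_ubound)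
  have "x1 < y" "y < x2" using t hy yb x by (auto intro!: hav_less_imp_less)
  moreover have "?g y = u" using D by (simp add: hy t_def)
  ultimately show "u \<in> ?g ` ?S" by force
 qed
 have "(%x. \<bar>sin x / 2 / D\<bar> * f (?g x)) absolutely_integrable_on ?S \<and> integral ?S (%x. \<bar>sin x / 2 / D\<bar> * f (?g x)) = I"
 proof (rule has_absolute_integral_change_of_variables_1'[where g="?g" and g'="%x. sin x / 2 / D" and f=f and S="?S", THEN iffD2])
  show "(?g has_field_derivative sin y / 2 / D) (at y within ?S)" for y
   
  proof -
   have "((%x. hav x - l) has_real_derivative sin y / 2) (at y)"
    using DERIV_diff[OF hav_deriv DERIV_const, of l y] by simp
   from DERIV_cdivide[OF this, of D] show ?thesis by (rule has_field_derivative_at_within)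
  qed
 qed (use inj img abs val in auto)
 then have cov: "integral ?S (%x. \<bar>sin x / 2 / D\<bar> * f (?g x)) = I" by blast
 have "integral {x1..x2} (%x. F (hav x) * ((hav x - hav x1) powr (a - 1) * (hav x2 - hav x) powr (b - 1)) * (sin x / 2)) =
  integral ?S (%x. F (hav x) * ((hav x - hav x1) powr (a - 1) * (hav x2 - hav x) powr (b - 1)) * (sin x / 2))"
  by (rule integral_Ioo[symmetric])
 also have "... = integral ?S (%x. D powr (a + b - 1) * (\<bar>sin x / 2 / D\<bar> * f (?g x)))"
 proof (rule Henstock_Kurzweil_Integration.integral_cong)
  fix y assume y: "y \<in> ?S"
  define u where "u = ?g y"
  have "u \<in> ?g ` ?S" unfolding u_def using y by (rule imageI)
  then have u: "0 < u" "u < 1" unfolding img by auto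
  have e: "hav y - hav x1 = D * u" "hav x2 - hav y = D * (1 - u)" "l + D * u = hav y"
  proof -
   have Du: "D * u = hav y - l" using D by (simp add: u_def)
   show "hav y - hav x1 = D * u" by (simp add: Du l_def)
   show "hav x2 - hav y = D * (1 - u)" unfolding right_diff_distrib Du by (simp add: D_def l_def)
   show "l + D * u = hav y" by (simp add: Du)
  qed
  have s: "0 <= sin y" using y x by (intro sin_ge_zero) auto
  have p: "D powr (a + b - 1) = D powr (a - 1) * D powr (b - 1) * D"
  proof -
   have "D powr (a + b - 1) = D powr ((a - 1) + (b - 1) + 1)" by simp
   then show ?thesis using D by (simp only: powr_add) simp
  qed
  have q: "(D * u) powr (a - 1) = D powr (a - 1) * u powr (a - 1)" "(D * (1 - u)) powr (b - 1) = D powr (b - 1) * (1 - u) powr (b - 1)"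
   using D u by (auto simp: powr_mult)
  show "F (hav y) * ((hav y - hav x1) powr (a - 1) * (hav x2 - hav y) powr (b - 1)) * (sin y / 2) =
   D powr (a + b - 1) * (\<bar>sin y / 2 / D\<bar> * f (?g y))"
   unfolding u_def[symmetric] f_def G_def e q p using s D by simp
 qed
 also have "... = D powr (a + b - 1) * I" by (simp only: Henstock_Kurzweil_Integration.integral_mult_right cov)
 finally show ?thesis by (simp add: I_def G_def l_def D_def)
qed

lemma powr_half_sq: "0 < x ==> (x\<^sup>2) powr (real m / 2) = x ^ m"
proof -
 assume x: "0 < x"
 have "(x\<^sup>2) powr (real m / 2) = (x powr 2) powr (real m / 2)" using x by simp
 also have "... = x powr real m" by (simp only: powr_powr) simp
 finally show ?thesis using x by (simp add: powr_realpow)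
qed

context abel_profile
begin

context
 fixes p :: "real => real" and \<alpha> :: real and d :: nat
 assumes p: "!!\<theta>. 0 < \<theta> ==> \<theta> < \<alpha> ==> p \<theta> = q (hav \<theta>)"
  and \<alpha>: "0 < \<alpha>" "\<alpha> <= pi" and a_eq: "a = hav \<alpha>" and d: "d = n + 2"
begin

lemma hav_in: "0 < hav \<theta>" "hav \<theta> < a" if "0 < \<theta>" "\<theta> < \<alpha>"
 using hav_strict_mono[of 0 \<theta>] hav_strict_mono[of \<theta> \<alpha>] that \<alpha> by (auto simp: a_eq)

lemma half_pos: "0 < sin (\<theta> / 2)" "0 < cos (\<theta> / 2)" "0 < sin \<theta>" if "0 < \<theta>" "\<theta> < \<alpha>"
 using that \<alpha> by (auto intro!: sin_gt_zero cos_gt_zero)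

text \<open>The factor sqrt 2 comes from cos theta - cos z = 2 (hav z - hav theta) under the root,
  together with sin theta = 2 (sin theta / 2), twice the derivative of \<open>hav\<close>.\<close>

lemma inner_integral:
 assumes z: "0 < z" "z < \<alpha>"
 shows "integral {0..z} (%\<theta>. p \<theta> * sin (\<theta> / 2) ^ (d - 3) * sin \<theta> / sqrt (cos \<theta> - cos z)) = sqrt 2 * abel_G n q (hav z)"
proof -
 have "integral {0..z} (%\<theta>. p \<theta> * sin (\<theta> / 2) ^ (d - 3) * sin \<theta> / sqrt (cos \<theta> - cos z)) =
  integral {0<..<z} (%\<theta>. p \<theta> * sin (\<theta> / 2) ^ (d - 3) * sin \<theta> / sqrt (cos \<theta> - cos z))"
  by (rule integral_Ioo[symmetric])
 also have "... = integral {0<..<z} (%x. sqrt 2 * (q (hav x) * ((hav x - hav 0) powr ((real n + 1) / 2 - 1) * (hav z - hav x) powr (1 / 2 - 1)) * (sin x / 2)))"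
 proof (rule Henstock_Kurzweil_Integration.integral_cong)
  fix x assume x: "x \<in> {0<..<z}"
  have hz: "0 < hav z - hav x" using hav_strict_mono[of x z] x z \<alpha> by auto
  have c: "cos x - cos z = 2 * (hav z - hav x)" by (simp add: hav_def field_simps)
  have e: "(real n + 1) / 2 - 1 = real (n - 1) / 2" using n by (cases n) (auto simp: field_simps)
  have s: "(hav x - hav 0) powr ((real n + 1) / 2 - 1) = sin (x / 2) ^ (n - 1)"
   unfolding e using half_pos[of x] x z by (simp add: hav_eq_sin powr_half_sq)
  have r: "(hav z - hav x) powr (1 / 2 - 1) = 1 / sqrt (hav z - hav x)"
   using hz powr_minus_divide[of "hav z - hav x" "1 / 2"] by (simp add: powr_half_sqrt)
  have gen: "A * B * C / (sqrt 2 * W) = sqrt 2 * (A * (B * (1 / W)) * (C / 2))" for A B C W :: real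
  proof -
   have "sqrt 2 / 2 = 1 / sqrt 2" by (simp add: divide_eq_eq eq_divide_eq)
   then have "(A * B * C / W) * (1 / sqrt 2) = (A * B * C / W) * (sqrt 2 / 2)" by (simp only:)
   then show ?thesis by (simp add: mult.commute)
  qed
  have px: "p x = q (hav x)" using p[of x] x z by simp
  have d3: "d - 3 = n - 1" using d by simp
  show "p x * sin (x / 2) ^ (d - 3) * sin x / sqrt (cos x - cos z) =
   sqrt 2 * (q (hav x) * ((hav x - hav 0) powr ((real n + 1) / 2 - 1) * (hav z - hav x) powr (1 / 2 - 1)) * (sin x / 2))"
   by (simp only: px s r c d3 real_sqrt_mult gen)
 qed
 also have "... = sqrt 2 * integral {0..z} (%x. q (hav x) * ((hav x - hav 0) powr ((real n + 1) / 2 - 1) * (hav z - hav x) powr (1 / 2 - 1)) * (sin x / 2))"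
  by (simp only: integral_Ioo Henstock_Kurzweil_Integration.integral_mult_right)
 also have "... = sqrt 2 * ((hav z - hav 0) powr ((real n + 1) / 2 + 1 / 2 - 1) * (\<integral>u. q (hav 0 + (hav z - hav 0) * u) \<partial>\<beta>))"
  by (subst polar_beta_integral) (use z \<alpha> integrable_q[OF hav_in[OF z]] in auto)
 also have "(real n + 1) / 2 + 1 / 2 - 1 = real n / 2" by (simp add: field_simps)
 finally show ?thesis by (simp add: abel_G_def)
qed

text \<open>By the chain rule the derivative in zeta carries a factor sin(zeta)/2; times the power
  of the cotangent it is the weight w^(1 - n/2) (1 - w)^(n/2) of \<open>abel_gamma\<close>.\<close>

lemma g_fun_eq:
 assumes z: "0 < \<zeta>" "\<zeta> < \<alpha>"
 shows "g_fun d p \<zeta> = sqrt 2 * abel_gamma n q (hav \<zeta>)"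
proof -
 define w where "w = hav \<zeta>"
 define S where "S = sin (\<zeta> / 2)"
 define c where "c = cos (\<zeta> / 2)"
 have Sc: "0 < S" "0 < c" using half_pos[OF z] by (auto simp: S_def c_def)
 have sz: "sin \<zeta> = 2 * S * c" using sin_double[of "\<zeta> / 2"] by (simp add: S_def c_def)
 have w: "w = S\<^sup>2" "1 - w = c\<^sup>2" by (simp_all add: w_def S_def c_def hav_eq_sin one_minus_hav del: one_minus_hav) (simp add: sin_squared_eq)
 let ?G = "deriv (abel_G n q) w"
 have "(abel_G n q has_real_derivative ?G) (at (hav \<zeta>))"
  using DERIV_imp_deriv[OF abel_G_deriv[OF hav_in[OF z]]] abel_G_deriv[OF hav_in[OF z]] by (simp add: w_def)
 from DERIV_cmult[OF DERIV_chain2[OF this hav_deriv], of "sqrt 2"]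
 have "((%z. sqrt 2 * abel_G n q (hav z)) has_real_derivative sqrt 2 * (?G * (sin \<zeta> / 2))) (at \<zeta>)" .
 then have "((%z. integral {0..z} (%\<theta>. p \<theta> * sin (\<theta> / 2) ^ (d - 3) * sin \<theta> / sqrt (cos \<theta> - cos z))) has_real_derivative sqrt 2 * (?G * (sin \<zeta> / 2))) (at \<zeta>)"
 proof (rule DERIV_cong_ev[OF refl _ refl, THEN iffD1, rotated])
  have "eventually (%x. x \<in> {0<..<\<alpha>}) (nhds \<zeta>)" using z by (intro eventually_nhds_in_open) auto
  then show "eventually (%z. sqrt 2 * abel_G n q (hav z) = integral {0..z} (%\<theta>. p \<theta> * sin (\<theta> / 2) ^ (d - 3) * sin \<theta> / sqrt (cos \<theta> - cos z))) (nhds \<zeta>)"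
   by eventually_elim (use inner_integral in auto)
 qed
 then have g: "g_fun d p \<zeta> = cot (\<zeta> / 2) ^ (n - 1) * (sqrt 2 * (?G * (sin \<zeta> / 2)))"
  unfolding g_fun_def using d by (simp add: DERIV_imp_deriv)
 obtain m where m: "n = Suc m" using n by (cases n) auto
 have "w powr (1 - real n / 2) = S\<^sup>2 / S ^ n"
  using Sc powr_half_sq[OF Sc(1), of n] by (simp add: w(1) powr_diff)
 moreover have "(1 - w) powr (real n / 2) = c ^ n" using powr_half_sq[OF Sc(2), of n] by (simp add: w(2))
 moreover have "cot (\<zeta> / 2) = c / S" by (simp add: cot_def c_def S_def)
 moreover have "(c / S) ^ (n - 1) * (2 * S * c / 2) = S\<^sup>2 / S ^ n * c ^ n"
  using Sc by (simp add: m power_divide power2_eq_square)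
 ultimately have "cot (\<zeta> / 2) ^ (n - 1) * (sin \<zeta> / 2) = w powr (1 - real n / 2) * (1 - w) powr (real n / 2)"
  by (simp only: sz)
 moreover have "cot (\<zeta> / 2) ^ (n - 1) * (sqrt 2 * (?G * (sin \<zeta> / 2))) = sqrt 2 * (?G * (cot (\<zeta> / 2) ^ (n - 1) * (sin \<zeta> / 2)))"
  by (simp only: mult_ac)
 ultimately show ?thesis unfolding g by (simp only: abel_gamma_def w_def)
qed

lemma outer_integral:
 assumes h: "0 < h" "h < \<alpha>"
 shows "integral {h..\<alpha>} (%\<zeta>. g_fun d p \<zeta> * sin \<zeta> / sqrt (cos h - cos \<zeta>)) = 2 * abel_Phi (abel_gamma n q) a (hav h)"
proof -
 define F where "F = (%t. abel_gamma n q t * indicator {hav h<..<a} t)"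
 have D: "0 < a - hav h" using hav_in[OF h] by simp
 have ind: "F (hav h + (hav \<alpha> - hav h) * v) = abel_gamma n q (hav h + (a - hav h) * v) * indicator {0<..<1} v" for v
 proof -
  have "hav h + (a - hav h) * v < a \<longleftrightarrow> (a - hav h) * v < (a - hav h) * 1"
   by (simp only: mult_1_right less_diff_eq add.commute)
  then have "hav h + (a - hav h) * v \<in> {hav h<..<a} \<longleftrightarrow> v \<in> {0<..<1}" using D
   by (simp only: greaterThanLessThan_iff mult_less_cancel_left_pos) (simp add: zero_less_mult_iff)
  then show ?thesis unfolding a_eq[symmetric] by (simp add: F_def indicator_def)
 qed
 have "integral {h..\<alpha>} (%\<zeta>. g_fun d p \<zeta> * sin \<zeta> / sqrt (cos h - cos \<zeta>)) = integral {h<..<\<alpha>} (%\<zeta>. g_fun d p \<zeta> * sin \<zeta> / sqrt (cos h - cos \<zeta>))"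
  by (rule integral_Ioo[symmetric])
 also have "... = integral {h<..<\<alpha>} (%x. 2 * (F (hav x) * ((hav x - hav h) powr (1 / 2 - 1) * (hav \<alpha> - hav x) powr (1 - 1)) * (sin x / 2)))"
 proof (rule Henstock_Kurzweil_Integration.integral_cong)
  fix x assume x: "x \<in> {h<..<\<alpha>}"
  have hz: "hav h < hav x" "hav x < hav \<alpha>" using hav_strict_mono[of h x] hav_strict_mono[of x \<alpha>] x h \<alpha> by auto
  have F: "F (hav x) = abel_gamma n q (hav x)" using hz by (simp add: F_def a_eq)
  have c: "cos h - cos x = 2 * (hav x - hav h)" by (simp add: hav_def field_simps)
  have r: "(hav x - hav h) powr (1 / 2 - 1) = 1 / sqrt (hav x - hav h)"
   using hz powr_minus_divide[of "hav x - hav h" "1 / 2"] by (simp add: powr_half_sqrt)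
  have g: "g_fun d p x = sqrt 2 * abel_gamma n q (hav x)" using x h by (intro g_fun_eq) auto
  have o: "(hav \<alpha> - hav x) powr (1 - 1) = 1" using hz by simp
  have gen: "sqrt 2 * A * C / (sqrt 2 * W) = 2 * (A * (1 / W * 1) * (C / 2))" for A C W :: real
   by simp
  show "g_fun d p x * sin x / sqrt (cos h - cos x) = 2 * (F (hav x) * ((hav x - hav h) powr (1 / 2 - 1) * (hav \<alpha> - hav x) powr (1 - 1)) * (sin x / 2))"
   by (simp only: F c r g o real_sqrt_mult gen)
 qed
 also have "... = 2 * integral {h..\<alpha>} (%x. F (hav x) * ((hav x - hav h) powr (1 / 2 - 1) * (hav \<alpha> - hav x) powr (1 - 1)) * (sin x / 2))"
  by (simp only: integral_Ioo Henstock_Kurzweil_Integration.integral_mult_right)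
 also have "integral {h..\<alpha>} (%x. F (hav x) * ((hav x - hav h) powr (1 / 2 - 1) * (hav \<alpha> - hav x) powr (1 - 1)) * (sin x / 2)) =
  (hav \<alpha> - hav h) powr (1 / 2 + 1 - 1) * (\<integral>u. F (hav h + (hav \<alpha> - hav h) * u) \<partial>beta_measure (1 / 2) 1)"
 proof (rule polar_beta_integral)
  show "integrable (beta_measure (1 / 2) 1) (%u. F (hav h + (hav \<alpha> - hav h) * u))"
   unfolding ind using hav_in[OF h] by (intro gamma_Phi(1)) auto
 qed (use h \<alpha> in auto)
 also have "(hav \<alpha> - hav h) powr (1 / 2 + 1 - 1) = sqrt (a - hav h)" using D by (simp add: a_eq powr_half_sqrt)
 finally show ?thesis unfolding ind abel_Phi_def .
qed

text \<open>The sine produced by the chain rule cancels 1/sin eta, and the power of the secant is (1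
  - s)^(-(n-1)/2).\<close>

lemma F_fun_eq:
 assumes h: "0 < \<eta>" "\<eta> < \<alpha>"
 shows "F_fun d p \<alpha> \<eta> = Gamma ((real d - 2) / 2) / (2 * pi powr ((real d + 2) / 2)) *
  ((1 - hav \<eta>) powr (- ((real n - 1) / 2)) * deriv (abel_Phi (abel_gamma n q) a) (hav \<eta>))"
proof -
 obtain D where D: "(abel_Phi (abel_gamma n q) a has_real_derivative D) (at (hav \<eta>))"
  using gamma_Phi(2)[OF hav_in[OF h]] by blast
 from DERIV_cmult[OF DERIV_chain2[OF this hav_deriv], of 2]
 have "((%h. 2 * abel_Phi (abel_gamma n q) a (hav h)) has_real_derivative 2 * (D * (sin \<eta> / 2))) (at \<eta>)" .
 then have "((%h. integral {h..\<alpha>} (%\<zeta>. g_fun d p \<zeta> * sin \<zeta> / sqrt (cos h - cos \<zeta>))) has_real_derivative 2 * (D * (sin \<eta> / 2))) (at \<eta>)"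
 proof (rule DERIV_cong_ev[OF refl _ refl, THEN iffD1, rotated])
  have "eventually (%x. x \<in> {0<..<\<alpha>}) (nhds \<eta>)" using h by (intro eventually_nhds_in_open) auto
  then show "eventually (%h. 2 * abel_Phi (abel_gamma n q) a (hav h) = integral {h..\<alpha>} (%\<zeta>. g_fun d p \<zeta> * sin \<zeta> / sqrt (cos h - cos \<zeta>))) (nhds \<eta>)"
   by eventually_elim (use outer_integral in auto)
 qed
 then have der: "deriv (%h. integral {h..\<alpha>} (%\<zeta>. g_fun d p \<zeta> * sin \<zeta> / sqrt (cos h - cos \<zeta>))) \<eta> = D * sin \<eta>"
  by (simp add: DERIV_imp_deriv)
 have "(1 - hav \<eta>) powr (- ((real n - 1) / 2)) = (1 / cos (\<eta> / 2)) ^ (d - 3)"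
 proof -
  have "(real n - 1) / 2 = real (n - 1) / 2" using n by (simp add: of_nat_diff)
  then show ?thesis using half_pos[OF h] powr_half_sq[of "cos (\<eta> / 2)" "n - 1"]
   by (simp add: one_minus_hav d powr_minus_divide power_divide)
 qed
 then show ?thesis unfolding F_fun_def der DERIV_imp_deriv[OF D] using half_pos[OF h] by simp
qed

end

end

section \<open>The field as a function of latitude\<close>

lemma abs_component_le_1: "x \<in> sphere 0 1 ==> \<bar>x $ k\<bar> <= 1" for x :: "real ^ 'n::finite"
 using component_le_norm_cart[of x k] by simp

lemma linear_isometry_orthogonal_matrix:
 fixes T :: "real ^ 'n::finite => real ^ 'n"
 assumes "linear T" "!!v. norm (T v) = norm v"
 shows "orthogonal_matrix (matrix T)" "matrix T *v v = T v"
proof -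
 have "orthogonal_transformation T" using assms by (simp add: orthogonal_transformation)
 then show "orthogonal_matrix (matrix T)" by (simp add: orthogonal_transformation_matrix)
 show "matrix T *v v = T v" using assms(1) by (simp add: matrix_works)
qed

text \<open>An isometry fixing the pole takes z to x. If its determinant is -1, it is preceded by
  the sign change of a third coordinate, which fixes both the pole and z; d >= 3 provides that
  coordinate.\<close>

lemma rotation_invariant_meridian:
 fixes Q :: "real ^ 'n::finite => ennreal"
 assumes ri: "rotation_invariant k Q" and d: "3 <= CARD('n)" and x: "norm x = 1"
  and kj: "k ~= j" and z: "z = axis k (x $ k) + axis j (sqrt (1 - (x $ k)\<^sup>2))"
 shows "Q x = Q z"
proof -
 have le: "\<bar>x $ k\<bar> <= 1" using component_le_norm_cart[of x k] x by simp
 have z0: "z $ i = 0" if "i ~= k" "i ~= j" for i using that by (simp add: z axis_def)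
 have zk: "z $ k = x $ k" using kj by (simp add: z axis_def)
 have "(norm z)\<^sup>2 = z \<bullet> z" by (simp add: power2_norm_eq_inner)
 also have "... = (x $ k)\<^sup>2 + (sqrt (1 - (x $ k)\<^sup>2))\<^sup>2"
  unfolding z using kj by (simp add: inner_add_left inner_add_right inner_axis_axis power2_eq_square)
 also have "... = 1" using le by (simp add: abs_square_le_1)
 finally have nz: "norm z = 1" by (simp add: power2_eq_1_iff) (metis norm_ge_zero not_one_le_zero neg_0_le_iff_le abs_norm_cancel)
 obtain T where T: "linear T" "!!v. norm (T v) = norm v" "!!v. T v $ k = v $ k" "T z = x"
  by (rule exists_isometry_fixing_coordinate[of z x k]) (use nz x zk in auto)
 have Tk: "T (axis k 1) = axis k 1"
 proof -
  have "(norm (T (axis k 1) - axis k 1))\<^sup>2 = (norm (T (axis k 1)))\<^sup>2 - 2 * (T (axis k 1) \<bullet> axis k 1) + (norm (axis k 1 :: real ^ 'n))\<^sup>2"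
   by (simp add: power2_norm_eq_inner inner_diff inner_commute)
  also have "... = 0" using T(2,3) by (simp add: inner_axis)
  finally show ?thesis by simp
 qed
 note A = linear_isometry_orthogonal_matrix[OF T(1,2)]
 have RI: "Q (A *v y) = Q y" if "orthogonal_matrix A" "det A = 1" "A *v axis k 1 = axis k 1" "norm y = 1" for A y
  using ri that unfolding rotation_invariant_def rotation_matrix_def by auto
 consider "det (matrix T) = 1" | "det (matrix T) = - 1" using det_orthogonal_matrix[OF A(1)] by blast
 then show ?thesis
 proof cases
  case 1
  then have "Q (matrix T *v z) = Q z"
   by (intro RI) (simp_all add: A Tk nz)
  then show ?thesis by (simp add: A T)
 next
  case 2
  have "card {k, j} <= 2" by (simp add: card_insert_if)
  then have "{k, j} ~= UNIV" using d by auto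
  then obtain i where i: "i ~= k" "i ~= j" by auto
  define r where "r = (%v :: real ^ 'n. \<chi> a. if a = i then - v $ a else v $ a)"
  have r1: "linear r" by (rule linearI) (auto simp: r_def vec_eq_iff)
  have r2: "norm (r v) = norm v" for v
   unfolding norm_vec_def L2_set_def r_def by (rule arg_cong[where f=sqrt], rule sum.cong) auto
  note R = linear_isometry_orthogonal_matrix[OF r1 r2]
  have "det (matrix r) = prod (%a. matrix r $ a $ a) UNIV"
   by (rule det_diagonal) (auto simp: matrix_def r_def axis_def)
  also have "... = prod (%a. if a = i then - 1 else 1) UNIV"
   by (rule prod.cong) (auto simp: matrix_def r_def axis_def)
  also have "... = - 1" by simp
  finally have det: "det (matrix T ** matrix r) = 1" using 2 by (simp add: det_mul)
  have rk: "r (axis k 1) = axis k 1" "r z = z" using i z0 by (auto simp: r_def vec_eq_iff axis_def)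
  have orth: "orthogonal_matrix (matrix T ** matrix r)" using A(1) R(1) by (rule orthogonal_matrix_mul)
  have app: "(matrix T ** matrix r) *v v = T (r v)" for v
   by (simp add: matrix_vector_mul_assoc[symmetric] A R)
  have "Q ((matrix T ** matrix r) *v z) = Q z"
   by (rule RI[OF orth det _ nz]) (simp add: app rk Tk)
  then show ?thesis by (simp add: app rk T)
 qed
qed

definition meridian :: "'n::finite => 'n => real => real ^ 'n" where
 "meridian k j \<theta> = cos \<theta> *\<^sub>R axis k 1 + sin \<theta> *\<^sub>R axis j 1"

lemma meridian_nth: "k ~= j ==> meridian k j \<theta> $ k = cos \<theta>"
 by (simp add: meridian_def axis_def)

lemma norm_meridian: "k ~= j ==> norm (meridian k j \<theta>) = 1"
proof -
 assume kj: "k ~= j"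
 have "meridian k j \<theta> \<bullet> meridian k j \<theta> = cos \<theta> * cos \<theta> + sin \<theta> * sin \<theta>"
  unfolding meridian_def using kj by (simp add: inner_add_left inner_add_right inner_axis_axis)
 also have "... = 1" using sin_cos_squared_add[of \<theta>] by (simp add: power2_eq_square add.commute)
 finally show ?thesis by (simp add: norm_eq_1)
qed

lemma rotation_invariant_latitude:
 fixes Q :: "real ^ 'n::finite => ennreal"
 assumes ri: "rotation_invariant k Q" and d: "3 <= CARD('n)" and "norm x = 1" "norm y = 1" "x $ k = y $ k"
 shows "Q x = Q y"
proof -
 obtain j where kj: "k ~= j" using exists_other_index[OF d] by blast
 show ?thesis
  using rotation_invariant_meridian[OF ri d assms(3) kj refl] rotation_invariant_meridian[OF ri d assms(4) kj refl] assms(5)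
  by simp
qed

lemma profile_polar_angle:
 fixes Q :: "real ^ 'n::finite => ennreal"
 assumes ri: "rotation_invariant k Q" and d: "3 <= CARD('n)" and x: "x \<in> sphere 0 1"
 shows "profile k Q (polar_angle k x) = Q x"
 unfolding profile_def
proof (rule the_equality)
 show "\<forall>y\<in>sphere 0 1. polar_angle k y = polar_angle k x \<longrightarrow> Q y = Q x"
 proof (intro ballI impI)
  fix y assume y: "y \<in> sphere 0 1" "polar_angle k y = polar_angle k x"
  then have "y $ k = x $ k"
   using abs_component_le_1[OF x] abs_component_le_1[OF y(1)]
   by (simp add: polar_angle_def arccos_eq_iff)
  then show "Q y = Q x" using x y by (intro rotation_invariant_latitude[OF ri d]) auto
 qed
qed (use x in auto)

lemma C2_curve:
 fixes h :: "'a::euclidean_space => real" and c c1 c2 :: "real => 'a"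
 assumes U: "open U" and h: "C2_on U h"
  and c: "!!t. (c has_vector_derivative c1 t) (at t)" "!!t. (c1 has_vector_derivative c2 t) (at t)"
  and cont: "continuous_on UNIV c2"
 obtains f1 f2 where "!!t. c t \<in> U ==> ((%t. h (c t)) has_real_derivative f1 t) (at t)"
  "!!t. c t \<in> U ==> (f1 has_real_derivative f2 t) (at t)"
  "continuous_on {t. c t \<in> U} f2"
proof -
 obtain h' h'' where h': "!!x. x \<in> U ==> (h has_derivative blinfun_apply (h' x)) (at x)"
  and h'': "!!x. x \<in> U ==> (h' has_derivative blinfun_apply (h'' x)) (at x)"
  and ch'': "continuous_on U h''"
  using h unfolding C2_on_def by blast
 define f1 where "f1 = (%t. blinfun_apply (h' (c t)) (c1 t))"
 define f2 where "f2 = (%t. blinfun_apply (h' (c t)) (c2 t) + blinfun_apply (blinfun_apply (h'' (c t)) (c1 t)) (c1 t))"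
 have cc: "continuous_on UNIV c" "continuous_on UNIV c1"
  using c by (auto intro!: continuous_at_imp_continuous_on has_vector_derivative_continuous)
 show thesis
 proof (rule that[of f1 f2])
  fix t assume t: "c t \<in> U"
  have "(h \<circ> c has_vector_derivative blinfun_apply (h' (c t)) (c1 t)) (at t)"
   by (rule vector_derivative_diff_chain_within[OF c(1)]) (rule has_derivative_at_withinI[OF h'[OF t]])
  then show "((%t. h (c t)) has_real_derivative f1 t) (at t)"
   by (simp add: has_real_derivative_iff_has_vector_derivative o_def f1_def)
  have "(h' \<circ> c has_vector_derivative blinfun_apply (h'' (c t)) (c1 t)) (at t)"
   by (rule vector_derivative_diff_chain_within[OF c(1)]) (rule has_derivative_at_withinI[OF h''[OF t]])
  then have "((%t. h' (c t)) has_vector_derivative blinfun_apply (h'' (c t)) (c1 t)) (at t)"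
   by (simp add: o_def)
  from bounded_bilinear.has_vector_derivative[OF bounded_bilinear_blinfun_apply this c(2)]
  show "(f1 has_real_derivative f2 t) (at t)"
   by (simp add: has_real_derivative_iff_has_vector_derivative f1_def f2_def)
 next
  have ch': "continuous_on U h'"
   using h'' by (auto intro!: continuous_at_imp_continuous_on has_derivative_continuous)
  let ?O = "{t. c t \<in> U}"
  have sub: "continuous_on ?O c" "continuous_on ?O c1" "continuous_on ?O c2"
   using cc cont by (auto intro: continuous_on_subset)
  have 1: "continuous_on ?O (%t. h' (c t))" "continuous_on ?O (%t. h'' (c t))"
   by (rule continuous_on_compose2[OF ch' sub(1)], force) (rule continuous_on_compose2[OF ch'' sub(1)], force)
  have 2: "continuous_on ?O (%t. blinfun_apply (h'' (c t)) (c1 t))"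
   by (rule bounded_bilinear.continuous_on[OF bounded_bilinear_blinfun_apply 1(2) sub(2)])
  show "continuous_on ?O f2" unfolding f2_def
   by (rule continuous_on_add[OF bounded_bilinear.continuous_on[OF bounded_bilinear_blinfun_apply 1(1) sub(3)]
     bounded_bilinear.continuous_on[OF bounded_bilinear_blinfun_apply 2 sub(2)]])
 qed
qed

text \<open>Along the meridian the field agrees locally with a C^2 function of the ambient space.
  That function changes from point to point, so the conclusion is phrased with the intrinsic
  derivatives of phi.\<close>

lemma meridian_C2:
 fixes Q :: "real ^ 'n::finite => ennreal"
 assumes N: "openin (top_of_set (sphere 0 1)) N" and Q: "C2_on_sphere N Q" and kj: "k ~= j"
  and t0: "meridian k j t0 \<in> N"
 defines "\<phi> \<equiv> %t. enn2real (Q (meridian k j t))"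
 shows "(\<phi> has_real_derivative deriv \<phi> t0) (at t0)" "(deriv \<phi> has_real_derivative deriv (deriv \<phi>) t0) (at t0)"
  "isCont (deriv (deriv \<phi>)) t0"
proof -
 let ?c = "meridian k j"
 let ?c1 = "%t. (- sin t) *\<^sub>R axis k 1 + cos t *\<^sub>R axis j 1 :: real ^ 'n"
 obtain U h where U: "open U" "?c t0 \<in> U" "C2_on U h" "!!x. x \<in> U \<inter> N ==> enn2real (Q x) = h x"
  using Q t0 unfolding C2_on_sphere_def by blast
 obtain W where W: "open W" "N = sphere 0 1 \<inter> W" using N by (auto simp: openin_open)
 have c1: "(?c has_vector_derivative ?c1 t) (at t)" for t
  unfolding meridian_def[abs_def] by (auto intro!: derivative_eq_intros simp: has_real_derivative_iff_has_vector_derivative[symmetric])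
 have c2: "(?c1 has_vector_derivative - ?c t) (at t)" for t
  unfolding meridian_def by (auto intro!: derivative_eq_intros simp: has_real_derivative_iff_has_vector_derivative[symmetric])
 have cc: "continuous_on UNIV ?c" unfolding meridian_def[abs_def] by (intro continuous_intros)
 obtain f1 f2 where f: "!!t. ?c t \<in> U ==> ((%t. h (?c t)) has_real_derivative f1 t) (at t)"
  "!!t. ?c t \<in> U ==> (f1 has_real_derivative f2 t) (at t)" "continuous_on {t. ?c t \<in> U} f2"
  using C2_curve[OF U(1,3) c1 c2 continuous_on_minus[OF cc]] by blast
 define S where "S = {t. ?c t \<in> U \<inter> W}"
 have oS: "open S" unfolding S_def
  using open_vimage[of "U \<inter> W" ?c] U(1) W(1) cc by (simp add: vimage_def open_Int)
 have t0S: "t0 \<in> S" using t0 U W by (auto simp: S_def)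
 have ev: "eventually (%t. t \<in> S) (nhds t)" if "t \<in> S" for t using that oS by (rule eventually_nhds_in_open[rotated])
 have phi: "\<phi> t = h (?c t)" if "t \<in> S" for t
  unfolding \<phi>_def using that U(4) W(2) norm_meridian[OF kj, of t] by (auto simp: S_def)
 have d1: "(\<phi> has_real_derivative f1 t) (at t)" if t: "t \<in> S" for t
 proof (rule DERIV_cong_ev[OF refl _ refl, THEN iffD1, OF _ f(1)])
  show "eventually (%t. h (?c t) = \<phi> t) (nhds t)"
   using ev[OF t] by eventually_elim (simp add: phi)
 qed (use t in \<open>auto simp: S_def\<close>)
 then have e1: "deriv \<phi> t = f1 t" if "t \<in> S" for t using that by (simp add: DERIV_imp_deriv)
 have d2: "(deriv \<phi> has_real_derivative f2 t) (at t)" if t: "t \<in> S" for t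
 proof (rule DERIV_cong_ev[OF refl _ refl, THEN iffD1, OF _ f(2)])
  show "eventually (%t. f1 t = deriv \<phi> t) (nhds t)"
   using ev[OF t] by eventually_elim (simp add: e1)
 qed (use t in \<open>auto simp: S_def\<close>)
 then have e2: "deriv (deriv \<phi>) t = f2 t" if "t \<in> S" for t using that by (simp add: DERIV_imp_deriv)
 show "(\<phi> has_real_derivative deriv \<phi> t0) (at t0)" using d1[OF t0S] e1[OF t0S] by simp
 show "(deriv \<phi> has_real_derivative deriv (deriv \<phi>) t0) (at t0)" using d2[OF t0S] e2[OF t0S] by simp
 have "continuous_on S f2" using f(3) by (rule continuous_on_subset) (auto simp: S_def)
 then have "continuous_on S (deriv (deriv \<phi>))" by (rule continuous_on_eq) (simp add: e2)
 then show "isCont (deriv (deriv \<phi>)) t0" using oS t0S by (simp add: continuous_on_eq_continuous_at)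
qed

lemma x_cos_le_sin: "0 <= x ==> x <= pi / 2 ==> x * cos x <= sin x" for x :: real
proof -
 assume x: "0 <= x" "x <= pi / 2"
 have "(%x. sin x - x * cos x) 0 <= (%x. sin x - x * cos x) x"
 proof (rule DERIV_nonneg_imp_nondecreasing[OF x(1)])
  fix y assume y: "0 <= y" "y <= x"
  have "((%x. sin x - x * cos x) has_real_derivative y * sin y) (at y)"
   by (auto intro!: derivative_eq_intros)
  moreover have "0 <= y * sin y" using x y by (intro mult_nonneg_nonneg sin_ge_zero) auto
  ultimately show "\<exists>z. ((%x. sin x - x * cos x) has_real_derivative z) (at y) \<and> 0 <= z" by blast
 qed
 then show ?thesis by simp
qed

lemma angle_le_sin: "0 <= x ==> x <= pi ==> x * (cos (x / 2))\<^sup>2 <= sin x" for x :: real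
proof -
 assume x: "0 <= x" "x <= pi"
 have "x / 2 * cos (x / 2) * cos (x / 2) <= sin (x / 2) * cos (x / 2)"
  using x by (intro mult_right_mono x_cos_le_sin cos_ge_zero) auto
 then show ?thesis using sin_double[of "x / 2"] by (simp add: power2_eq_square)
qed

text \<open>A Lipschitz function is bounded by a multiple of the distance to its zeros, and on
  [0, alpha] the sine is bounded below by a multiple of the distance to its own. This is what allows
  division of phi' by the sine.\<close>

lemma sin_dominates:
 fixes f f' :: "real => real"
 assumes \<alpha>: "0 < \<alpha>" "\<alpha> <= pi"
  and der: "!!t. 0 <= t ==> t <= \<alpha> ==> (f has_real_derivative f' t) (at t)"
  and K: "!!t. 0 <= t ==> t <= \<alpha> ==> \<bar>f' t\<bar> <= K"
  and f0: "f 0 = 0" "\<alpha> = pi ==> f pi = 0"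
 obtains C where "0 <= C" "!!t. 0 <= t ==> t <= \<alpha> ==> \<bar>f t\<bar> <= C * sin t"
proof -
 have lip: "\<bar>f x - f y\<bar> <= K * \<bar>x - y\<bar>" if "x \<in> {0..\<alpha>}" "y \<in> {0..\<alpha>}" for x y
  using field_differentiable_bound[of "{0..\<alpha>}" f f' K x y] that der K
  by (auto intro: has_field_derivative_at_within)
 have K0: "0 <= K" using K[of 0] \<alpha> by linarith
 have b0: "\<bar>f t\<bar> <= K * t" if "0 <= t" "t <= \<alpha>" for t using lip[of t 0] that \<alpha> f0 by simp
 show thesis
 proof (cases "\<alpha> = pi")
  case False
  then have "0 < cos (\<alpha> / 2)" using \<alpha> by (intro cos_gt_zero) auto
  then have c: "0 < (cos (\<alpha> / 2))\<^sup>2" by simp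
  show thesis
  proof (rule that[of "K / (cos (\<alpha> / 2))\<^sup>2"])
   fix t assume t: "0 <= t" "t <= \<alpha>"
   have "cos (\<alpha> / 2) <= cos (t / 2)" using t \<alpha> by (intro cos_monotone_0_pi_le) auto
   then have "(cos (\<alpha> / 2))\<^sup>2 <= (cos (t / 2))\<^sup>2" using \<alpha> by (intro power_mono cos_ge_zero) auto
   then have "t * (cos (\<alpha> / 2))\<^sup>2 <= t * (cos (t / 2))\<^sup>2" using t by (intro mult_left_mono) auto
   also have "... <= sin t" using t \<alpha> by (intro angle_le_sin) auto
   finally have "t <= sin t / (cos (\<alpha> / 2))\<^sup>2" using c by (simp add: pos_le_divide_eq)
   then have "K * t <= K * (sin t / (cos (\<alpha> / 2))\<^sup>2)" using K0 by (intro mult_left_mono)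
   then show "\<bar>f t\<bar> <= K / (cos (\<alpha> / 2))\<^sup>2 * sin t" using b0[OF t] by simp
  qed (use K0 c in auto)
 next
  case True
  have half: "t / 2 <= sin t" if "0 <= t" "t <= pi / 2" for t
  proof -
   have "cos (pi / 4) <= cos (t / 2)" using that by (intro cos_monotone_0_pi_le) auto
   then have "(cos (pi / 4))\<^sup>2 <= (cos (t / 2))\<^sup>2" by (intro power_mono) (auto simp: cos_45)
   then have "1 / 2 <= (cos (t / 2))\<^sup>2" by (simp add: cos_45 power2_eq_square)
   then have "t * (1 / 2) <= t * (cos (t / 2))\<^sup>2" using that by (intro mult_left_mono) auto
   then show ?thesis using angle_le_sin[of t] that by simp
  qed
  show thesis
  proof (rule that[of "2 * K"])
   fix t assume t: "0 <= t" "t <= \<alpha>"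
   show "\<bar>f t\<bar> <= 2 * K * sin t"
   proof (cases "t <= pi / 2")
    case True
    have "K * (t / 2) <= K * sin t" using half[of t] True t K0 by (intro mult_left_mono) auto
    then show ?thesis using b0[OF t] by simp
   next
    case False
    have "\<bar>f t - f pi\<bar> <= K * \<bar>t - pi\<bar>" using t \<open>\<alpha> = pi\<close> by (intro lip) auto
    then have 1: "\<bar>f t\<bar> <= K * (pi - t)" using t f0(2)[OF \<open>\<alpha> = pi\<close>] \<open>\<alpha> = pi\<close> by simp
    have "K * ((pi - t) / 2) <= K * sin (pi - t)" using half[of "pi - t"] False t \<open>\<alpha> = pi\<close> K0 by (intro mult_left_mono) auto
    then show ?thesis using 1 by simp
   qed
  qed (use K0 in auto)
 qed
qed

text \<open>Symmetry about 0 and pi makes phi' vanish at the poles, so phi'/sin is bounded. As a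
  function of s = hav t, phi has first derivative 2 phi'/sin, and its second derivative is 4/sin^2 =
  1/(s (1 - s)) times the bounded function phi'' - cos phi'/sin.\<close>

lemma abel_profile_of_even_C2:
 fixes \<phi> \<phi>' \<phi>'' :: "real => real"
 assumes n: "0 < n" and \<alpha>: "0 < \<alpha>" "\<alpha> <= pi"
  and d1: "!!t. 0 <= t ==> t <= \<alpha> ==> (\<phi> has_real_derivative \<phi>' t) (at t)"
  and d2: "!!t. 0 <= t ==> t <= \<alpha> ==> (\<phi>' has_real_derivative \<phi>'' t) (at t)"
  and ct: "!!t. 0 <= t ==> t <= \<alpha> ==> isCont \<phi>'' t"
  and even: "!!t. \<phi> (- t) = \<phi> t" and refl: "!!t. \<phi> (2 * pi - t) = \<phi> t"
 obtains C q q' q'' where "abel_profile n (hav \<alpha>) C q q' q''" "!!t. 0 < t ==> t < \<alpha> ==> q (hav t) = \<phi> t"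
proof -
 have p0: "\<phi>' 0 = 0"
 proof -
  have "((%x. - x) has_real_derivative - 1) (at (0::real))" by (auto intro!: derivative_eq_intros)
  moreover have "(\<phi> has_real_derivative \<phi>' 0) (at (- 0))" using d1[of 0] \<alpha> by simp
  ultimately have "((%x. \<phi> (- x)) has_real_derivative \<phi>' 0 * (- 1)) (at 0)" by (rule DERIV_chain2[rotated])
  then have "(\<phi> has_real_derivative - \<phi>' 0) (at 0)" by (simp add: even)
  from DERIV_unique[OF this d1[of 0]] \<alpha> have "- \<phi>' 0 = \<phi>' 0" by simp
  then show ?thesis by simp
 qed
 have p1: "\<phi>' pi = 0" if "\<alpha> = pi"
 proof -
  have "((%x. 2 * pi - x) has_real_derivative - 1) (at pi)" by (auto intro!: derivative_eq_intros)
  moreover have "(\<phi> has_real_derivative \<phi>' pi) (at (2 * pi - pi))" using d1[of pi] that by simp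
  ultimately have "((%x. \<phi> (2 * pi - x)) has_real_derivative \<phi>' pi * (- 1)) (at pi)" by (rule DERIV_chain2[rotated])
  then have "(\<phi> has_real_derivative - \<phi>' pi) (at pi)" by (simp add: refl)
  from DERIV_unique[OF this d1[of pi]] that have "- \<phi>' pi = \<phi>' pi" by simp
  then show ?thesis by simp
 qed
 have bdd: "\<exists>K. \<forall>t. 0 <= t \<longrightarrow> t <= \<alpha> \<longrightarrow> \<bar>f t\<bar> <= K" if "!!t. 0 <= t ==> t <= \<alpha> ==> isCont f t" for f :: "real => real"
 proof -
  have "continuous_on {0..\<alpha>} f" using that by (auto intro!: continuous_at_imp_continuous_on)
  then have "bounded (f ` {0..\<alpha>})" by (intro compact_imp_bounded compact_continuous_image) auto
  then obtain K where "\<forall>x\<in>{0..\<alpha>}. \<bar>f x\<bar> <= K" by (auto simp: bounded_iff)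
  then show ?thesis by (intro exI[of _ K]) auto
 qed
 obtain K0 where K0: "!!t. 0 <= t ==> t <= \<alpha> ==> \<bar>\<phi> t\<bar> <= K0" 
 proof -
  have "isCont \<phi> t" if "0 <= t" "t <= \<alpha>" for t using d1[OF that] by (rule DERIV_isCont)
  then show thesis using bdd[of \<phi>] that by blast
 qed
 obtain K2 where K2: "!!t. 0 <= t ==> t <= \<alpha> ==> \<bar>\<phi>'' t\<bar> <= K2" using bdd[of \<phi>''] ct by blast
 obtain C1 where C1: "0 <= C1" "!!t. 0 <= t ==> t <= \<alpha> ==> \<bar>\<phi>' t\<bar> <= C1 * sin t"
  using sin_dominates[of \<alpha> \<phi>' \<phi>'' K2, OF \<alpha>] d2 K2 p0 p1 by blast
 have nn: "0 <= K0" "0 <= K2" using K0[of 0] K2[of 0] \<alpha> by linarith+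
 define a where "a = hav \<alpha>"
 have a: "0 < a" "a <= 1" using hav_strict_mono[of 0 \<alpha>] \<alpha> hav_le_1 by (auto simp: a_def)
 \<comment> \<open>The inverse of \<open>hav\<close> on [0, pi].\<close>
 define A where "A = (%t. arccos (1 - 2 * t))"
 have Ain: "0 < A t" "A t < \<alpha>" "0 < sin (A t)" if t: "0 < t" "t < a" for t
 proof -
  have "0 <= A t" "A t <= pi" "hav (A t) = t" using t a by (auto simp: A_def hav_arccos intro!: arccos_lbound arccos_ubound)
  then show 1: "0 < A t" "A t < \<alpha>" using t \<alpha> hav_less_imp_less[of 0 "A t"] hav_less_imp_less[of "A t" \<alpha>] by (auto simp: a_def)
  then show "0 < sin (A t)" using \<alpha> by (intro sin_gt_zero) auto
 qed
 have sinsq: "(sin (A t))\<^sup>2 = 4 * (t * (1 - t))" if t: "0 < t" "t < a" for t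
 proof -
  have "(sin (A t))\<^sup>2 = 1 - (1 - 2 * t)\<^sup>2" using t a by (simp add: sin_squared_eq A_def)
  also have "... = 4 * (t * (1 - t))" by (simp add: power2_eq_square algebra_simps)
  finally show ?thesis .
 qed
 have Ader: "(A has_real_derivative 2 / sin (A t)) (at t)" if t: "0 < t" "t < a" for t
 proof -
  have "(arccos has_real_derivative inverse (- sqrt (1 - (1 - 2 * t)\<^sup>2))) (at (1 - 2 * t))"
   using t a by (intro DERIV_arccos) auto
  moreover have "((%t::real. 1 - 2 * t) has_real_derivative - 2) (at t)" by (auto intro!: derivative_eq_intros)
  ultimately have "(A has_real_derivative inverse (- sqrt (1 - (1 - 2 * t)\<^sup>2)) * (- 2)) (at t)"
   unfolding A_def by (rule DERIV_chain2)
  moreover have "sqrt (1 - (1 - 2 * t)\<^sup>2) = sin (A t)" using t a by (simp add: A_def sin_arccos)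
  ultimately show ?thesis by (simp add: divide_inverse mult.commute)
 qed
 define q where "q = (%t. if t \<in> {0<..<a} then \<phi> (A t) else 0)"
 define q' where "q' = (%t. if t \<in> {0<..<a} then \<phi>' (A t) * (2 / sin (A t)) else 0)"
 define q'' where "q'' = (%t. (\<phi>'' (A t) * (2 / sin (A t))) * (2 / sin (A t)) + (- (2 * (cos (A t) * (2 / sin (A t)))) / (sin (A t))\<^sup>2) * \<phi>' (A t))"
 have ev: "eventually (%x. x \<in> {0<..<a}) (nhds t)" if "0 < t" "t < a" for t
  using that by (intro eventually_nhds_in_open) auto
 have e1: "((%t. \<phi> (A t)) has_real_derivative \<phi>' (A t) * (2 / sin (A t))) (at t)" if t: "0 < t" "t < a" for t
  by (rule DERIV_chain2[OF d1 Ader[OF t]]) (use Ain[OF t] in auto)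
 have e2: "((%t. \<phi>' (A t) * (2 / sin (A t))) has_real_derivative q'' t) (at t)" if t: "0 < t" "t < a" for t
 proof -
  have 1: "((%t. \<phi>' (A t)) has_real_derivative \<phi>'' (A t) * (2 / sin (A t))) (at t)"
   by (rule DERIV_chain2[OF d2 Ader[OF t]]) (use Ain[OF t] in auto)
  have s': "((%t. sin (A t)) has_real_derivative cos (A t) * (2 / sin (A t))) (at t)"
   by (rule DERIV_chain2[OF DERIV_sin Ader[OF t]])
  have 2: "((%t. 2 / sin (A t)) has_real_derivative - (2 * (cos (A t) * (2 / sin (A t)))) / (sin (A t))\<^sup>2) (at t)"
   using DERIV_divide[OF DERIV_const s', of 2] Ain(3)[OF t] by (simp add: power2_eq_square)
  show ?thesis unfolding q''_def by (rule DERIV_mult[OF 1 2])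
 qed
 have meas: "(%t. if t \<in> {0<..<a} then f t else 0) \<in> borel_measurable borel"
  if f: "!!t. 0 < t ==> t < a ==> (f has_real_derivative f' t) (at t)" for f f' :: "real => real"
 proof -
  have "continuous_on {0<..<a} f"
   using f by (intro DERIV_continuous_on[of _ _ f']) (auto intro: has_field_derivative_at_within)
  then have "(%t. indicator {0<..<a} t *\<^sub>R f t) \<in> borel_measurable borel"
   by (intro borel_measurable_continuous_on_indicator) auto
  moreover have "(%t. indicator {0<..<a} t *\<^sub>R f t) = (%t. if t \<in> {0<..<a} then f t else 0)" by (auto simp: fun_eq_iff)
  ultimately show ?thesis by simp
 qed
 define C where "C = K0 + 2 * C1 + K2 + C1"
 have "abel_profile n a C q q' q''"
 proof
  show "q \<in> borel_measurable borel" unfolding q_def by (rule meas[OF e1])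
  show "q' \<in> borel_measurable borel" unfolding q'_def by (rule meas[OF e2])
 next
  fix t assume t: "0 < t" "t < a"
  show "(q has_real_derivative q' t) (at t)"
  proof (rule DERIV_cong_ev[OF HOL.refl _ HOL.refl, THEN iffD1])
   show "((%t. \<phi> (A t)) has_real_derivative q' t) (at t)" using e1[OF t] t by (simp add: q'_def)
   show "eventually (%t. \<phi> (A t) = q t) (nhds t)" using ev[OF t] by eventually_elim (simp add: q_def)
  qed
  show "(q' has_real_derivative q'' t) (at t)"
  proof (rule DERIV_cong_ev[OF HOL.refl _ HOL.refl, THEN iffD1, OF _ e2[OF t]])
   show "eventually (%t. \<phi>' (A t) * (2 / sin (A t)) = q' t) (nhds t)" using ev[OF t] by eventually_elim (simp add: q'_def)
  qed
  note At = less_imp_le[OF Ain(1)[OF t]] less_imp_le[OF Ain(2)[OF t]]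
  show "\<bar>q t\<bar> <= C" using K0[OF At] t nn C1(1) by (simp add: q_def C_def)
  let ?s = "sin (A t)"
  have s: "0 < ?s" by (rule Ain(3)[OF t])
  have "\<bar>\<phi>' (A t) * (2 / ?s)\<bar> = \<bar>\<phi>' (A t)\<bar> * (2 / ?s)" using s by (simp add: abs_mult)
  also have "... <= C1 * ?s * (2 / ?s)" using C1(2)[OF At] s by (intro mult_right_mono) auto
  also have "... = 2 * C1" using s by simp
  finally have "\<bar>\<phi>' (A t) * (2 / ?s)\<bar> <= 2 * C1" .
  then show "\<bar>q' t\<bar> <= C" using t nn C1(1) by (simp add: q'_def C_def)
  have "q'' t = (4 / ?s\<^sup>2) * (\<phi>'' (A t) - cos (A t) * (\<phi>' (A t) / ?s))"
  proof -
   have "(x * (2 / s)) * (2 / s) + (- (2 * (c * (2 / s))) / s\<^sup>2) * y = (4 / s\<^sup>2) * (x - c * (y / s))" for x c y s :: real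
    by (simp add: power2_eq_square right_diff_distrib diff_divide_distrib)
   then show ?thesis unfolding q''_def .
  qed
  moreover have "\<bar>\<phi>'' (A t) - cos (A t) * (\<phi>' (A t) / ?s)\<bar> <= K2 + 1 * C1"
  proof -
   have "\<bar>\<phi>' (A t)\<bar> / ?s <= C1" using C1(2)[OF At] s by (simp add: pos_divide_le_eq)
   then have "\<bar>\<phi>' (A t) / ?s\<bar> <= C1" using s by simp
   then have "\<bar>cos (A t)\<bar> * \<bar>\<phi>' (A t) / ?s\<bar> <= 1 * C1" by (intro mult_mono) auto
   then have "\<bar>cos (A t) * (\<phi>' (A t) / ?s)\<bar> <= 1 * C1" by (simp only: abs_mult)
   then show ?thesis using K2[OF At] by linarith
  qed
  ultimately have "\<bar>q'' t\<bar> <= (4 / ?s\<^sup>2) * (K2 + 1 * C1)"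
   by (simp only: abs_mult) (intro mult_mono, auto)
  also have "... = (K2 + C1) / (t * (1 - t))" unfolding sinsq[OF t] by simp
  also have "... <= C / (t * (1 - t))" using t a nn C1(1) by (intro divide_right_mono) (auto simp: C_def)
  finally show "\<bar>q'' t\<bar> <= C / (t * (1 - t))" .
 qed (use n a in auto)
 moreover have "q (hav t) = \<phi> t" if t: "0 < t" "t < \<alpha>" for t
 proof -
  have "hav t \<in> {0<..<a}" using hav_strict_mono[of 0 t] hav_strict_mono[of t \<alpha>] t \<alpha> by (simp add: a_def)
  moreover have "1 - 2 * hav t = cos t" by (simp add: hav_def field_simps)
  then have "A (hav t) = t" using t \<alpha> by (simp add: A_def arccos_cos)
  ultimately show ?thesis by (simp add: q_def)
 qed
 ultimately show thesis using that by (simp add: a_def)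
qed

section \<open>Inversion of the Abel equation for a measure of latitudes\<close>

text \<open>On each (0, r) with r < a the two densities define the same finite measure, hence agree
  almost everywhere; then r increases to a through a sequence.\<close>

lemma AE_eq_of_initial_integrals:
 fixes f g :: "real => ennreal"
 assumes [measurable]: "f \<in> borel_measurable borel" "g \<in> borel_measurable borel" and a: "0 < a"
  and eq: "!!z. 0 < z ==> z < a ==> (II x. f x * indicator {0<..<z} x) = (II x. g x * indicator {0<..<z} x)"
  and fin: "!!z. 0 < z ==> z < a ==> (II x. f x * indicator {0<..<z} x) < \<infinity>"
 shows "AE x in lborel. x \<in> {0<..<a} \<longrightarrow> f x = g x"
proof -
 have AEr: "AE x in lborel. x \<in> {0<..<r} \<longrightarrow> f x = g x" if r: "0 < r" "r < a" for r
 proof -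
  let ?f = "%x. f x * indicator {0<..<r} x" and ?g = "%x. g x * indicator {0<..<r} x"
  have em: "emeasure (density lborel (%x. h x * indicator {0<..<r} x)) {..x} =
    (if x <= 0 then 0 else \<integral>\<^sup>+y. h y * indicator {0<..<min x r} y \<partial>lborel)"
   if [measurable]: "h \<in> borel_measurable borel" for h x
  proof -
   have "emeasure (density lborel (%x. h x * indicator {0<..<r} x)) {..x} = (II y. h y * indicator {0<..<r} y * indicator {..x} y)"
    by (subst emeasure_density) auto
   also have "... = (II y. (if x <= 0 then 0 else h y * indicator {0<..<min x r} y))"
   proof (rule nn_integral_cong_AE, goal_cases)
    case 1
    show ?case
     using AE_lborel_singleton[of x] by eventually_elim (auto simp: indicator_def)
   qed
   also have "... = (if x <= 0 then 0 else \<integral>\<^sup>+y. h y * indicator {0<..<min x r} y \<partial>lborel)" by simp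
   finally show ?thesis .
  qed
  have "density lborel ?f = density lborel ?g"
  proof (rule measure_eqI_atMost)
   fix x
   show "emeasure (density lborel ?f) {..x} = emeasure (density lborel ?g) {..x}"
    using r by (auto simp: em intro!: eq)
   have "(II y. f y * indicator {0<..<min x r} y) < \<infinity>" if "\<not> x <= 0" using that r by (intro fin) auto
   then show "emeasure (density lborel ?f) {..x} < \<infinity>" by (simp add: em)
  qed simp_all
  then have "AE x in lborel. ?f x = ?g x"
   using fin[OF r] by (subst (asm) finite_density_unique) auto
  then show ?thesis by eventually_elim (auto simp: indicator_def)
 qed
 define r where "r = (%i::nat. a * (1 - 1 / (real i + 2)))"
 have r: "0 < r i" "r i < a" for i using a by (auto simp: r_def divide_simps)
 have "AE x in lborel. \<forall>i. x \<in> {0<..<r i} \<longrightarrow> f x = g x"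
  using AEr[OF r] by (subst AE_all_countable) blast
 then show ?thesis
 proof eventually_elim
  case (elim x)
  show ?case
  proof
   assume x: "x \<in> {0<..<a}"
   have "r \<longlonglongrightarrow> a" unfolding r_def by real_asymp
   then have "eventually (%i. x < r i) sequentially" using x by (intro order_tendstoD) auto
   then obtain i where "x < r i" by (auto simp: eventually_sequentially)
   then show "f x = g x" using elim x by auto
  qed
 qed
qed

text \<open>A derivative is a limit of difference quotients of a continuous function. The step
  length depends on x so that x plus the step stays below r.\<close>

lemma borel_measurable_deriv_Ioo:
 fixes f f' :: "real => real"
 assumes der: "!!x. l < x ==> x < r ==> (f has_real_derivative f' x) (at x)"
 shows "(%x. f' x * indicator {l<..<r} x) \<in> borel_measurable borel"
proof -
 define h where "h = (%(i::nat) x. (r - x) / (real i + 2))"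
 have h: "0 < h i x" "x + h i x < r" if "x < r" for i x
 proof -
  show "0 < h i x" using that by (simp add: h_def)
  have "(r - x) * (1 / (real i + 2)) < (r - x) * 1" using that by (intro mult_strict_left_mono) auto
  then show "x + h i x < r" by (simp add: h_def)
 qed
 have cf: "continuous_on {l<..<r} f"
  using der by (intro DERIV_continuous_on[of _ _ f']) (auto intro: has_field_derivative_at_within)
 define g where "g = (%i x. (f (x + h i x) - f x) / h i x)"
 have hne: "h i x ~= 0" if "x < r" for i x using h(1)[OF that, of i] by simp
 have ch: "continuous_on {l<..<r} (h i)" for i unfolding h_def by (intro continuous_intros) auto
 have "continuous_on {l<..<r} (g i)" for i
 proof -
  have "(%x. x + h i x) ` {l<..<r} \<subseteq> {l<..<r}"
  proof (rule image_subsetI)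
   fix x assume "x \<in> {l<..<r}"
   then show "x + h i x \<in> {l<..<r}" using h(1)[of x i] h(2)[of x i] by auto
  qed
  then have "continuous_on {l<..<r} (%x. f (x + h i x))"
   by (intro continuous_on_compose2[OF cf] continuous_on_add continuous_on_id ch)
  then show ?thesis unfolding g_def
   by (intro continuous_on_divide continuous_on_diff cf ch) (use hne in auto)
 qed
 then have gm: "(%x. indicator {l<..<r} x *\<^sub>R g i x) \<in> borel_measurable borel" for i
  by (intro borel_measurable_continuous_on_indicator) auto
 show ?thesis
 proof (rule borel_measurable_LIMSEQ_real[OF _ gm])
  fix x
  show "(%i. indicator {l<..<r} x *\<^sub>R g i x) \<longlonglongrightarrow> f' x * indicator {l<..<r} x"
  proof (cases "x \<in> {l<..<r}")
   case True
   then have xr: "l < x" "x < r" by auto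
   have "((%h. (f (x + h) - f x) / h) \<longlongrightarrow> f' x) (at 0)" using der[OF xr] by (simp add: DERIV_def)
   moreover have "(%i. h i x) \<longlonglongrightarrow> 0" unfolding h_def by real_asymp
   then have "filterlim (%i. h i x) (at 0) sequentially" using hne[OF xr(2)] by (simp add: filterlim_at)
   ultimately have "(%i. (f (x + h i x) - f x) / h i x) \<longlonglongrightarrow> f' x" by (rule filterlim_compose)
   then show ?thesis using True by (simp add: g_def)
  qed simp
 qed
qed

lemma deriv_nonneg_of_mono:
 fixes f :: "real => real"
 assumes mono: "!!x y. l < x ==> x < y ==> y < r ==> f x <= f y"
  and x: "l < x" "x < r" and der: "(f has_real_derivative D) (at x)"
 shows "0 <= D"
proof (rule mono_on_imp_deriv_nonneg[OF _ der, of "{l<..<r}"])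
 show "mono_on {l<..<r} f"
  by (rule mono_onI) (metis greaterThanLessThan_iff mono order_le_less)
qed (use x in \<open>simp add: interior_open\<close>)

lemma ennreal_eq_diff:
 assumes "x + ennreal A = ennreal B" "0 <= A" "0 <= B"
 shows "x = ennreal (B - A)" "A <= B"
proof -
 have "ennreal A <= x + ennreal A" by simp
 then show "A <= B" using assms by simp
 have "x = (x + ennreal A) - ennreal A" by simp
 also have "... = ennreal (B - A)" unfolding assms(1) using assms(2) by (simp add: ennreal_minus)
 finally show "x = ennreal (B - A)" .
qed

lemma abel_half_kernel:
 assumes "z < t"
 shows "(II w. ennreal ((w - z) powr (- 1 / 2) * (t - w) powr (- 1 / 2)) * indicator {z<..<t} w) = ennreal pi"
proof -
 have "(II w. ennreal ((w - z) powr (1 / 2 - 1) * (t - w) powr (1 / 2 - 1)) * indicator {z<..<t} w)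
  = ennreal ((t - z) powr (1 / 2 + 1 / 2 - 1) * Beta (1 / 2) (1 / 2))"
  using assms by (intro nn_integral_Beta) auto
 then show ?thesis using assms by (simp add: Beta_def Gamma_one_half_real)
qed

context abel_profile
begin

text \<open>The factor of \<open>copson_kernel\<close> that depends on w alone.\<close>

definition "abel_W w = sqrt (w / (1 - w)) ^ n / w"

lemma abel_W_eq: "0 < w ==> w < a ==> abel_W w = w powr (real n / 2 - 1) * inverse ((1 - w) powr (real n / 2))"
proof -
 assume w: "0 < w" "w < a"
 have "sqrt (w / (1 - w)) ^ n = (w / (1 - w)) powr (real n / 2)" using w a n by (intro powr_half_nat[symmetric]) auto
 also have "... = w powr (real n / 2) / (1 - w) powr (real n / 2)" by (rule powr_divide)
 finally have "abel_W w = w powr (real n / 2) / (1 - w) powr (real n / 2) / w" by (simp only: abel_W_def)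
 moreover have "w powr (real n / 2 - 1) = w powr (real n / 2) / w" using w by (simp add: powr_diff)
 moreover have "A / B / C = A / C * inverse B" for A B C :: real by (simp only: divide_inverse mult_ac)
 ultimately show ?thesis by (simp only:)
qed

lemma abel_W_pos: "0 < w ==> w < a ==> 0 < abel_W w"
 using a by (simp add: abel_W_eq)

text \<open>The datum of the second Abel step: the contribution of a constant potential minus that
  of the field. The parameter b will be a multiple of the constant c of the equilibrium
  condition.\<close>

definition "total_gamma b w = b * (real n / 2) * (1 - w) powr (real n / 2) - abel_gamma n q w"

text \<open>Minus the derivative of the Abel integral of \<open>total_gamma\<close> (see
  \<open>abel_Phi_total_deriv\<close>), with the share of the constant in closed form.\<close>

definition "abel_density b s = b * (real n / 2) * ((1 - s) powr (real n / 2 - 1 / 2) * cap_R (real n / 2) ((a - s) / (1 - s)))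
 + deriv (abel_Phi (abel_gamma n q) a) s"

lemma total_gamma_eq:
 assumes "0 < w" "w < a"
 shows "total_gamma b w = (1 - w) powr (real n / 2) * (b * (real n / 2) - (real n / 2 * H w + w * H1 w))"
 unfolding total_gamma_def abel_gamma_eq[OF assms] by (simp add: algebra_simps)

lemma power_deriv:
 assumes w: "0 < w" "w < a"
 shows "((%w. (1 - w) powr (real n / 2)) has_real_derivative real n / 2 * (1 - w) powr (real n / 2 - 1) * (- 1)) (at w)"
  "\<bar>real n / 2 * (1 - w) powr (real n / 2 - 1) * (- 1)\<bar> <= real n / 2 / (a - w)"
  "\<bar>(1 - w) powr (real n / 2)\<bar> <= 1"
proof -
 have w1: "0 < 1 - w" using w a by simp
 have "((%x. x powr (real n / 2)) has_real_derivative real n / 2 * (1 - w) powr (real n / 2 - 1)) (at (1 - w))"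
  using w1 by (intro has_real_derivative_powr) auto
 moreover have "((%z::real. 1 - z) has_real_derivative - 1) (at w)"
  by (auto intro!: derivative_eq_intros)
 ultimately show "((%w. (1 - w) powr (real n / 2)) has_real_derivative real n / 2 * (1 - w) powr (real n / 2 - 1) * (- 1)) (at w)"
  by (rule DERIV_chain2)
 have p1: "(1 - w) powr (real n / 2) <= 1" using w a powr_mono2[of "real n / 2" "1 - w" 1] by simp
 then show "\<bar>(1 - w) powr (real n / 2)\<bar> <= 1" by simp
 have "(1 - w) powr (real n / 2 - 1) <= 1 / (1 - w)"
  using w1 p1 by (simp add: powr_diff divide_right_mono)
 also have "... <= 1 / (a - w)" using w a by (intro divide_left_mono) auto
 finally have "real n / 2 * (1 - w) powr (real n / 2 - 1) <= real n / 2 * (1 / (a - w))" by (intro mult_left_mono) auto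
 then show "\<bar>real n / 2 * (1 - w) powr (real n / 2 - 1) * (- 1)\<bar> <= real n / 2 / (a - w)" by (simp add: abs_mult)
qed

lemma total_gamma_regular:
 assumes b: "0 <= b" and w: "0 < w" "w < a"
 shows "\<bar>total_gamma b w\<bar> <= b * (real n / 2) + gamma_bound"
  "(total_gamma b has_real_derivative b * (real n / 2) * (real n / 2 * (1 - w) powr (real n / 2 - 1) * (- 1)) - gamma' w) (at w)"
  "\<bar>b * (real n / 2) * (real n / 2 * (1 - w) powr (real n / 2 - 1) * (- 1)) - gamma' w\<bar> <= (b * (real n / 2) * (real n / 2) + gamma_bound') / (a - w)"
proof -
 have bp: "0 <= b * (real n / 2)" using b by simp
 have "\<bar>b * (real n / 2) * (1 - w) powr (real n / 2)\<bar> <= b * (real n / 2) * 1"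
  unfolding abs_mult[of "b * (real n / 2)"] using power_deriv(3)[OF w] bp by (intro mult_mono) auto
 then show "\<bar>total_gamma b w\<bar> <= b * (real n / 2) + gamma_bound"
  unfolding total_gamma_def using abel_gamma_bound[OF w] by linarith
 show "(total_gamma b has_real_derivative b * (real n / 2) * (real n / 2 * (1 - w) powr (real n / 2 - 1) * (- 1)) - gamma' w) (at w)"
  unfolding total_gamma_def[abs_def] by (intro DERIV_diff DERIV_cmult power_deriv(1)[OF w] gamma'(1)[OF w])
 have "\<bar>b * (real n / 2) * (real n / 2 * (1 - w) powr (real n / 2 - 1) * (- 1))\<bar> <= b * (real n / 2) * (real n / 2 / (a - w))"
  unfolding abs_mult[of "b * (real n / 2)"] using power_deriv(2)[OF w] bp by (intro mult_mono) auto
 moreover have "b * (real n / 2) * (real n / 2 / (a - w)) + gamma_bound' / (a - w) = (b * (real n / 2) * (real n / 2) + gamma_bound') / (a - w)"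
  by (simp add: add_divide_distrib)
 ultimately show "\<bar>b * (real n / 2) * (real n / 2 * (1 - w) powr (real n / 2 - 1) * (- 1)) - gamma' w\<bar> <= (b * (real n / 2) * (real n / 2) + gamma_bound') / (a - w)"
  using gamma'(2)[OF w] by linarith
qed

lemma abel_Phi_total_gamma:
 assumes z: "0 <= z" "z < a"
 shows "abel_Phi (total_gamma b) a z = b * (real n / 2) * cap_A (real n / 2) a z - abel_Phi (abel_gamma n q) a z"
proof -
 let ?M = "beta_measure (1 / 2) 1"
 let ?g = "%w. (1 - w) powr (real n / 2)"
 have ig: "integrable ?M (%v. ?g (z + (a - z) * v) * indicator {0<..<1} v)"
  using abel_Phi_regular(1)[where g="?g" and g'="%w. real n / 2 * (1 - w) powr (real n / 2 - 1) * (- 1)" and C=1 and C'="real n / 2" and a=a]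
   power_deriv a z by blast
 have "ennreal (abel_Phi ?g a z) = (II w. ennreal (?g w * (w - z) powr (- 1 / 2)) * indicator {z<..<a} w)"
  by (rule abel_Phi_nn_integral[symmetric, OF a(1) power_deriv(1) power_deriv(3) power_deriv(2)]) (use z in auto)
 also have "... = ennreal (cap_A (real n / 2) a z)"
  using n z a by (intro nn_integral_cap_A) auto
 finally have "ennreal (abel_Phi ?g a z) = ennreal (cap_A (real n / 2) a z)" .
 moreover have "0 <= abel_Phi ?g a z" unfolding abel_Phi_def
  using z by (intro mult_nonneg_nonneg Bochner_Integration.integral_nonneg) auto
 moreover have "0 <= cap_A (real n / 2) a z" using n z a by (intro cap_A_bound) auto
 ultimately have e: "cap_A (real n / 2) a z = abel_Phi ?g a z" by simp
 have "(\<integral>v. total_gamma b (z + (a - z) * v) * indicator {0<..<1} v \<partial>?M) =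
  (\<integral>v. b * (real n / 2) * (?g (z + (a - z) * v) * indicator {0<..<1} v) - abel_gamma n q (z + (a - z) * v) * indicator {0<..<1} v \<partial>?M)"
  by (rule Bochner_Integration.integral_cong) (auto simp: total_gamma_def indicator_def)
 also have "... = b * (real n / 2) * (\<integral>v. ?g (z + (a - z) * v) * indicator {0<..<1} v \<partial>?M) - (\<integral>v. abel_gamma n q (z + (a - z) * v) * indicator {0<..<1} v \<partial>?M)"
  using ig gamma_Phi(1)[OF z] by (subst Bochner_Integration.integral_diff) auto
 finally have "abel_Phi (total_gamma b) a z = sqrt (a - z) * (b * (real n / 2) * (\<integral>v. ?g (z + (a - z) * v) * indicator {0<..<1} v \<partial>?M) - (\<integral>v. abel_gamma n q (z + (a - z) * v) * indicator {0<..<1} v \<partial>?M))"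
  by (simp only: abel_Phi_def)
 also have "... = b * (real n / 2) * (sqrt (a - z) * (\<integral>v. ?g (z + (a - z) * v) * indicator {0<..<1} v \<partial>?M)) - sqrt (a - z) * (\<integral>v. abel_gamma n q (z + (a - z) * v) * indicator {0<..<1} v \<partial>?M)"
  by (simp only: right_diff_distrib mult_ac)
 finally show ?thesis unfolding e by (simp only: abel_Phi_def)
qed

lemma abel_Phi_deriv:
 assumes "0 < z" "z < a"
 shows "(abel_Phi (abel_gamma n q) a has_real_derivative deriv (abel_Phi (abel_gamma n q) a) z) (at z)"
proof -
 obtain D where D: "(abel_Phi (abel_gamma n q) a has_real_derivative D) (at z)"
  using gamma_Phi(2)[OF assms] by blast
 then show ?thesis by (simp add: DERIV_imp_deriv)
qed

lemma abel_Phi_total_deriv: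
 assumes z: "0 < z" "z < a"
 shows "(abel_Phi (total_gamma b) a has_real_derivative - abel_density b z) (at z)"
proof -
 have "((%z. b * (real n / 2) * cap_A (real n / 2) a z - abel_Phi (abel_gamma n q) a z) has_real_derivative
  b * (real n / 2) * (- ((1 - z) powr (real n / 2 - 1 / 2) * cap_R (real n / 2) ((a - z) / (1 - z)))) - deriv (abel_Phi (abel_gamma n q) a) z) (at z)"
  using n z a by (intro DERIV_diff DERIV_cmult cap_A_deriv abel_Phi_deriv) auto
 then have "((%z. b * (real n / 2) * cap_A (real n / 2) a z - abel_Phi (abel_gamma n q) a z) has_real_derivative - abel_density b z) (at z)"
  by (simp add: abel_density_def)
 then show ?thesis
 proof (rule DERIV_cong_ev[OF refl _ refl, THEN iffD1, rotated])
  have "eventually (%x. x \<in> {0<..<a}) (nhds z)" using z by (intro eventually_nhds_in_open) auto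
  then show "eventually (%z. b * (real n / 2) * cap_A (real n / 2) a z - abel_Phi (abel_gamma n q) a z = abel_Phi (total_gamma b) a z) (nhds z)"
   by eventually_elim (use abel_Phi_total_gamma in auto)
 qed
qed

lemma abel_density_measurable: "(%s. abel_density b s * indicator {z<..<a} s) \<in> borel_measurable borel" if "0 <= z"
proof -
 have "(%x. - abel_density b x * indicator {z<..<a} x) \<in> borel_measurable borel"
  by (rule borel_measurable_deriv_Ioo[where f="abel_Phi (total_gamma b) a"]) (use that abel_Phi_total_deriv in auto)
 then have "(%x. - (- abel_density b x * indicator {z<..<a} x)) \<in> borel_measurable borel" by measurable
 then show ?thesis by simp
qed

text \<open>Here m stands for the distribution of latitudes of the equilibrium measure, known only
  to be a finite measure. The derivative of the equation in z isolates the inner integral, an Abel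
  transform of t^(-(n-1)/2) dm(t); one more Abel transform gives the tails of that measure, and
  their derivative its density.\<close>

context
 fixes m :: "real measure" and b \<kappa> :: real
 assumes m: "finite_measure m" "sets m = sets borel" "AE t in m. 0 < t \<and> t <= a"
  and b: "0 <= b" and \<kappa>: "0 < \<kappa>"
  and q0: "!!t. 0 < t ==> t < a ==> 0 <= q t"
  and eq: "!!z. 0 < z ==> z < a ==>
   (II w. ennreal (abel_W w) * (\<integral>\<^sup>+t. (if w < t then ennreal (1 / (sqrt t ^ (n - 1) * sqrt (t - w))) else 0) \<partial>m) * indicator {0<..<z} w)
    + ennreal (\<kappa> * abel_G n q z) = ennreal (\<kappa> * (b * z powr (real n / 2)))"
begin

definition "Mfun w = (\<integral>\<^sup>+t. (if w < t then ennreal (1 / (sqrt t ^ (n - 1) * sqrt (t - w))) else 0) \<partial>m)"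

interpretation m: finite_measure m by (rule m(1))

lemma sets_m [measurable_cong]: "sets m = sets borel" by (rule m(2))

lemma Mfun_measurable [measurable]: "Mfun \<in> borel_measurable borel"
 unfolding Mfun_def[abs_def] by measurable

lemma abel_W_measurable [measurable]: "abel_W \<in> borel_measurable borel"
 unfolding abel_W_def[abs_def] by measurable

definition "Kfun z = \<kappa> * (b * z powr (real n / 2)) - \<kappa> * abel_G n q z"

lemma abel_G_nonneg: "0 < z ==> z < a ==> 0 <= abel_G n q z"
proof -
 assume z: "0 < z" "z < a"
 have "0 <= H z" unfolding H_def
 proof (rule integral_nonneg_AE)
  show "AE u in \<beta>. 0 <= q (z * u)" using AE_beta_measure by eventually_elim (use mult_in[OF z] q0 in auto)
 qed
 then show ?thesis by (simp add: abel_G_eq)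
qed

lemma Kfun: "(II w. ennreal (abel_W w) * Mfun w * indicator {0<..<z} w) = ennreal (Kfun z)" "0 <= Kfun z" if z: "0 < z" "z < a"
proof -
 have nn: "0 <= \<kappa> * abel_G n q z" "0 <= \<kappa> * (b * z powr (real n / 2))"
  using abel_G_nonneg[OF z] \<kappa> b by auto
 note * = ennreal_eq_diff[OF eq[OF z] nn]
 show "(II w. ennreal (abel_W w) * Mfun w * indicator {0<..<z} w) = ennreal (Kfun z)"
  unfolding Kfun_def Mfun_def by (rule *(1))
 show "0 <= Kfun z" unfolding Kfun_def using *(2) by simp
qed

lemma Kfun_deriv: "(Kfun has_real_derivative \<kappa> * abel_W z * total_gamma b z) (at z)" if z: "0 < z" "z < a"
proof -
 have "((%z. z powr (real n / 2)) has_real_derivative real n / 2 * z powr (real n / 2 - 1)) (at z)"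
  using z by (intro has_real_derivative_powr) auto
 then have 1: "(Kfun has_real_derivative \<kappa> * (b * (real n / 2 * z powr (real n / 2 - 1))) - \<kappa> * (z powr (real n / 2 - 1) * (real n / 2 * H z + z * H1 z))) (at z)"
  unfolding Kfun_def[abs_def] by (intro DERIV_diff DERIV_cmult abel_G_deriv[OF z])
 have "0 < (1 - z) powr (real n / 2)" using z a by simp
 then have 2: "\<kappa> * (b * (r * u)) - \<kappa> * (u * y) = \<kappa> * (u * inverse ((1 - z) powr (real n / 2))) * ((1 - z) powr (real n / 2) * (b * r - y))" for u y r
  by (simp add: algebra_simps)
 show ?thesis using 1 unfolding total_gamma_eq[OF z] abel_W_eq[OF z] 2 .
qed

text \<open>The left side of the equation integrates a nonnegative function up to z. So
  \<open>Kfun\<close> is increasing, and its derivative is a positive multiple of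
  \<open>total_gamma\<close>.\<close>

lemma total_gamma_nonneg: "0 <= total_gamma b z" if z: "0 < z" "z < a"
proof -
 have mono: "Kfun x <= Kfun y" if "0 < x" "x < y" "y < a" for x y
 proof -
  have "ennreal (Kfun x) = (II w. ennreal (abel_W w) * Mfun w * indicator {0<..<x} w)"
   by (rule Kfun(1)[symmetric]) (use that in auto)
  also have "... <= (II w. ennreal (abel_W w) * Mfun w * indicator {0<..<y} w)"
   by (rule nn_integral_mono, rule mult_left_mono) (use that in \<open>auto simp: indicator_def\<close>)
  also have "... = ennreal (Kfun y)"
   by (rule Kfun(1)) (use that in auto)
  finally have "ennreal (Kfun x) <= ennreal (Kfun y)" .
  then show ?thesis using Kfun(2)[of y] that by simp
 qed
 have "0 <= \<kappa> * abel_W z * total_gamma b z"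
  by (rule deriv_nonneg_of_mono[OF mono z Kfun_deriv[OF z]])
 moreover have "0 < \<kappa> * abel_W z" using \<kappa> abel_W_pos[OF z] by simp
 ultimately show ?thesis by (simp only: zero_le_mult_iff) auto
qed

lemma total_gamma_continuous: "continuous_on {0<..<a} (total_gamma b)"
 using total_gamma_regular(2)[OF b]
 by (intro DERIV_continuous_on) (auto intro: has_field_derivative_at_within)

definition "gamma_cut w = total_gamma b w * indicator {0<..<a} w"

lemma gamma_cut_measurable [measurable]: "gamma_cut \<in> borel_measurable borel"
proof -
 have "(%w. indicator {0<..<a} w *\<^sub>R total_gamma b w) \<in> borel_measurable borel"
  by (rule borel_measurable_continuous_on_indicator[OF _ total_gamma_continuous]) simp
 then show ?thesis by (simp add: gamma_cut_def[abs_def] mult.commute)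
qed

text \<open>Both sides, weighted by \<open>abel_W\<close>, have the same integral
  \<open>Kfun z\<close> over each (0, z). For the right side this is the fundamental theorem, with
  \<open>Kfun\<close> tending to 0 at 0 because it lies between 0 and a multiple of w^(n/2).\<close>

lemma Mfun_AE: "AE w in lborel. w \<in> {0<..<a} \<longrightarrow> Mfun w = ennreal (\<kappa> * total_gamma b w)"
proof -
 have "AE w in lborel. w \<in> {0<..<a} \<longrightarrow> ennreal (abel_W w) * Mfun w = ennreal (\<kappa> * abel_W w * gamma_cut w)"
 proof (rule AE_eq_of_initial_integrals[OF _ _ a(1)])
  fix z assume z: "0 < z" "z < a"
  show "(II w. ennreal (abel_W w) * Mfun w * indicator {0<..<z} w) < \<infinity>"
   by (simp add: Kfun(1)[OF z])
  have "(II w. ennreal (\<kappa> * abel_W w * gamma_cut w) * indicator {0<..<z} w) = ennreal (Kfun z - 0)"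
  proof (rule nn_integral_FTC_Ioo[OF z(1)])
   fix w assume "0 < w" "w < z"
   then have w: "0 < w" "w < a" using z by auto
   have e: "gamma_cut w = total_gamma b w" using w by (simp add: gamma_cut_def)
   show "(Kfun has_real_derivative \<kappa> * abel_W w * gamma_cut w) (at w)"
    unfolding e by (rule Kfun_deriv[OF w])
   show "0 <= \<kappa> * abel_W w * gamma_cut w"
    unfolding e using \<kappa> abel_W_pos[OF w] total_gamma_nonneg[OF w] by (intro mult_nonneg_nonneg) auto
  next
   have "isCont Kfun z" using Kfun_deriv[OF z] by (rule DERIV_isCont)
   then show "(Kfun \<longlongrightarrow> Kfun z) (at_left z)" unfolding isCont_def by (rule tendsto_within_subset) simp
   show "(Kfun \<longlongrightarrow> 0) (at_right 0)"
   proof (rule Lim_null_comparison)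
    have "eventually (%w. w \<in> {0<..<a}) (at_right 0)" using a by (intro eventually_at_rightI[of _ a]) auto
    then show "eventually (%w. norm (Kfun w) <= \<kappa> * b * w powr (real n / 2)) (at_right 0)"
    proof eventually_elim
     case (elim w)
     have "0 <= \<kappa> * abel_G n q w" using abel_G_nonneg[of w] elim \<kappa> by simp
     then have "Kfun w <= \<kappa> * (b * w powr (real n / 2))" unfolding Kfun_def by linarith
     then show ?case using Kfun(2)[of w] elim by (simp add: mult.assoc)
    qed
    have "((%w::real. w powr (real n / 2)) \<longlongrightarrow> 0) (at_right 0)"
     by (rule tendsto_zero_powrI[OF tendsto_ident_at tendsto_const]) (use n in \<open>auto simp: eventually_at_filter\<close>)
    then have "((%w::real. \<kappa> * b * w powr (real n / 2)) \<longlongrightarrow> \<kappa> * b * 0) (at_right 0)" by (intro tendsto_mult tendsto_const)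
    then show "((%w::real. \<kappa> * b * w powr (real n / 2)) \<longlongrightarrow> 0) (at_right 0)" by simp
   qed
  qed measurable
  then show "(II w. ennreal (abel_W w) * Mfun w * indicator {0<..<z} w) =
   (II w. ennreal (\<kappa> * abel_W w * gamma_cut w) * indicator {0<..<z} w)"
   by (simp add: Kfun(1)[OF z])
 qed measurable
 then show ?thesis
 proof eventually_elim
  case (elim w)
  show ?case
  proof
   assume w: "w \<in> {0<..<a}"
   then have W: "0 < abel_W w" by (intro abel_W_pos) auto
   have "ennreal (abel_W w) * Mfun w = ennreal (\<kappa> * abel_W w * total_gamma b w)"
    using elim w by (simp add: gamma_cut_def)
   also have "... = ennreal (abel_W w) * ennreal (\<kappa> * total_gamma b w)"
    using W by (subst ennreal_mult'[symmetric]) (auto simp: mult_ac)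
   finally show "Mfun w = ennreal (\<kappa> * total_gamma b w)"
    using W by (subst (asm) ennreal_mult_cancel_left) auto
  qed
 qed
qed

definition "tail z = (\<integral>\<^sup>+t. (if z < t then ennreal (1 / sqrt t ^ (n - 1)) else 0) \<partial>m)"

text \<open>Integrate \<open>Mfun\<close> against (w - z)^(-1/2) in two ways. Exchanging integrals,
  the two half-order kernels between z and t integrate to pi, which leaves pi times the tail;
  inserting \<open>Mfun_AE\<close> gives \<open>abel_Phi\<close>.\<close>

lemma tail_eq: "tail z = ennreal (\<kappa> / pi * abel_Phi (total_gamma b) a z)" if z: "0 < z" "z < a"
proof -
 let ?k = "%w t. (if w < t then ennreal (1 / (sqrt t ^ (n - 1) * sqrt (t - w))) else 0)"
 let ?e = "%w. ennreal ((w - z) powr (- 1 / 2)) * indicator {z<..<a} w"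
 interpret P: pair_sigma_finite m lborel ..
 have "(II w. Mfun w * ?e w) = (II w. \<integral>\<^sup>+t. ?k w t * ?e w \<partial>m)"
  unfolding Mfun_def by (intro nn_integral_cong_AE AE_I2 nn_integral_multc[symmetric]) measurable
 also have "... = (\<integral>\<^sup>+t. (II w. ?k w t * ?e w) \<partial>m)"
  by (rule P.Fubini') measurable
 also have "... = (\<integral>\<^sup>+t. ennreal pi * (if z < t then ennreal (1 / sqrt t ^ (n - 1)) else 0) \<partial>m)"
 proof (rule nn_integral_cong_AE, goal_cases)
  case 1
  show ?case
   using m(3)
  proof eventually_elim
   case (elim t)
   show ?case
   proof (cases "z < t")
    case True
    have "(II w. ?k w t * ?e w) = (II w. ennreal (1 / sqrt t ^ (n - 1)) * (ennreal ((w - z) powr (- 1 / 2) * (t - w) powr (- 1 / 2)) * indicator {z<..<t} w))"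
    proof (rule nn_integral_cong, goal_cases)
     case (1 w)
     show ?case
     proof (cases "z < w \<and> w < t")
      case True
      have "(t - w) powr (- 1 / 2) = 1 / sqrt (t - w)"
       using True powr_minus_divide[of "t - w" "1 / 2"] by (simp add: powr_half_sqrt)
      then show ?thesis using True elim by (simp add: ennreal_mult'[symmetric] mult_ac)
     qed auto
    qed
    also have "... = ennreal (1 / sqrt t ^ (n - 1)) * ennreal pi"
     by (subst nn_integral_cmult, measurable, subst abel_half_kernel[OF True], rule refl)
    finally show ?thesis using True by (simp add: mult.commute)
   next
    case False
    then have "?k w t * ?e w = 0" for w by (auto simp: indicator_def)
    note zero = this
    show ?thesis unfolding zero using False by simp
   qed
  qed
 qed
 also have "... = ennreal pi * tail z" unfolding tail_def by (rule nn_integral_cmult) measurable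
 finally have 1: "(II w. Mfun w * ?e w) = ennreal pi * tail z" .
 have "(II w. Mfun w * ?e w) = (II w. ennreal \<kappa> * (ennreal (gamma_cut w * (w - z) powr (- 1 / 2)) * indicator {z<..<a} w))"
 proof (rule nn_integral_cong_AE, goal_cases)
  case 1
  show ?case
   using Mfun_AE
  proof eventually_elim
   case (elim w)
   show ?case
   proof (cases "w \<in> {z<..<a}")
    case True
    then have w: "0 < w" "w < a" using z by auto
    have "Mfun w = ennreal (\<kappa> * total_gamma b w)" using elim w by simp
    then show ?thesis using True w total_gamma_nonneg[OF w] \<kappa> by (simp add: gamma_cut_def ennreal_mult'[symmetric] mult_ac)
   qed simp
  qed
 qed
 also have "... = ennreal \<kappa> * (II w. ennreal (gamma_cut w * (w - z) powr (- 1 / 2)) * indicator {z<..<a} w)"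
  by (rule nn_integral_cmult) measurable
 also have "(II w. ennreal (gamma_cut w * (w - z) powr (- 1 / 2)) * indicator {z<..<a} w) =
  (II w. ennreal (total_gamma b w * (w - z) powr (- 1 / 2)) * indicator {z<..<a} w)"
  using z by (intro nn_integral_cong_AE AE_I2) (auto simp: gamma_cut_def indicator_def)
 also have "... = ennreal (abel_Phi (total_gamma b) a z)"
  using z by (intro abel_Phi_nn_integral[OF a(1) total_gamma_regular(2)[OF b] total_gamma_regular(1)[OF b] total_gamma_regular(3)[OF b] total_gamma_nonneg]) auto
 finally have "ennreal pi * tail z = ennreal \<kappa> * ennreal (abel_Phi (total_gamma b) a z)" using 1 by simp
 also have "... = ennreal pi * ennreal (\<kappa> / pi * abel_Phi (total_gamma b) a z)"
  using \<kappa> by (simp add: ennreal_mult'[symmetric])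
 finally show ?thesis by (subst (asm) ennreal_mult_cancel_left) auto
qed

lemma abel_Phi_total_nonneg: "0 <= abel_Phi (total_gamma b) a z" if z: "0 < z" "z < a"
 unfolding abel_Phi_def
proof (intro mult_nonneg_nonneg integral_nonneg_AE)
 show "AE v in beta_measure (1 / 2) 1. 0 <= total_gamma b (z + (a - z) * v) * indicator {0<..<1} v"
  using AE_beta_measure
 proof eventually_elim
  case (elim v)
  have "0 < (a - z) * v" using elim z by simp
  moreover have "(a - z) * v < (a - z) * 1" using elim z by (intro mult_strict_left_mono) auto
  then have "z + (a - z) * v < a" by simp
  ultimately have "0 < z + (a - z) * v" "z + (a - z) * v < a" using z by auto
  then show ?case by (simp add: total_gamma_nonneg)
 qed
qed (use z in auto)

text \<open>Tails of a measure decrease, so minus the derivative of their closed form is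
  nonnegative.\<close>

lemma abel_density_nonneg: "0 <= abel_density b z" if z: "0 < z" "z < a"
proof (rule deriv_nonneg_of_mono[of 0 a "%z. - abel_Phi (total_gamma b) a z" z])
 fix x y assume xy: "0 < x" "x < y" "y < a"
 have "tail y <= tail x" unfolding tail_def using xy by (intro nn_integral_mono) auto
 then have "ennreal (\<kappa> / pi * abel_Phi (total_gamma b) a y) <= ennreal (\<kappa> / pi * abel_Phi (total_gamma b) a x)"
  using xy by (simp add: tail_eq)
 moreover have "0 <= \<kappa> / pi * abel_Phi (total_gamma b) a x" using xy \<kappa> by (intro mult_nonneg_nonneg abel_Phi_total_nonneg) auto
 ultimately have "\<kappa> / pi * abel_Phi (total_gamma b) a y <= \<kappa> / pi * abel_Phi (total_gamma b) a x" by simp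
 moreover have "0 < \<kappa> / pi" using \<kappa> by simp
 ultimately show "- abel_Phi (total_gamma b) a x <= - abel_Phi (total_gamma b) a y"
  by (simp only: mult_le_cancel_left_pos neg_le_iff_le)
next
 show "((%z. - abel_Phi (total_gamma b) a z) has_real_derivative abel_density b z) (at z)"
  using DERIV_minus[OF abel_Phi_total_deriv[OF z]] by simp
qed (use z in auto)

lemma abel_density_tail:
 assumes z: "0 < z" "z < a"
 shows "(II s. ennreal (\<kappa> / pi * abel_density b s) * indicator {z<..<a} s) = tail z"
proof -
 let ?F = "%s. - (\<kappa> / pi * abel_Phi (total_gamma b) a s)"
 have "(II s. ennreal (\<kappa> / pi * abel_density b s) * indicator {z<..<a} s) = ennreal (0 - ?F z)"
 proof (rule nn_integral_FTC_Ioo[OF z(2), where F="?F"])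
  have "(%s. \<kappa> / pi * (abel_density b s * indicator {z<..<a} s)) \<in> borel_measurable borel"
   using abel_density_measurable[OF less_imp_le[OF z(1)]] by measurable
  then show "(%s. \<kappa> / pi * abel_density b s * indicator {z<..<a} s) \<in> borel_measurable borel" by (simp add: mult.assoc)
  fix s assume s: "z < s" "s < a"
  show "(?F has_real_derivative \<kappa> / pi * abel_density b s) (at s)"
   using DERIV_minus[OF DERIV_cmult[OF abel_Phi_total_deriv[of s b], of "\<kappa> / pi"]] s z by simp
  show "0 <= \<kappa> / pi * abel_density b s" using \<kappa> s z by (intro mult_nonneg_nonneg abel_density_nonneg) auto
 next
  have "isCont ?F z" using DERIV_minus[OF DERIV_cmult[OF abel_Phi_total_deriv[OF z, of b], of "\<kappa> / pi"]] by (rule DERIV_isCont)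
  then show "(?F \<longlongrightarrow> ?F z) (at_right z)" unfolding isCont_def by (rule tendsto_within_subset) simp
  have "(abel_Phi (total_gamma b) a \<longlongrightarrow> 0) (at_left a)"
   using abel_Phi_regular(3)[OF a(1) total_gamma_regular(2)[OF b] total_gamma_regular(1)[OF b] total_gamma_regular(3)[OF b]] by blast
  then have "(?F \<longlongrightarrow> - (\<kappa> / pi * 0)) (at_left a)" by (intro tendsto_minus tendsto_mult tendsto_const)
  then show "(?F \<longlongrightarrow> 0) (at_left a)" by simp
 qed
 then show ?thesis by (simp add: tail_eq[OF z])
qed

text \<open>Above r > 0 the tails of t^(-(n-1)/2) dm(t) are finite and determine that measure;
  multiplying by t^((n-1)/2) returns to m.\<close>

lemma abel_inversion_restrict:
 assumes r: "0 < r" "r < a" and [measurable]: "A \<in> sets borel"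
 shows "(\<integral>\<^sup>+t. (if r < t then indicator A t else 0) \<partial>m) =
  (II s. indicator A s * (ennreal (sqrt s ^ (n - 1)) * (ennreal (\<kappa> / pi * abel_density b s) * indicator {r<..<a} s)))"
proof -
 define d where "d = (%s. ennreal (\<kappa> / pi * (abel_density b s * indicator {r<..<a} s)))"
 have [measurable]: "d \<in> borel_measurable borel" using abel_density_measurable[OF less_imp_le[OF r(1)]] unfolding d_def by measurable
 have d_eq: "d s = ennreal (\<kappa> / pi * abel_density b s) * indicator {r<..<a} s" for s
  by (simp add: d_def indicator_def)
 let ?N1 = "density m (%t. if r < t then ennreal (1 / sqrt t ^ (n - 1)) else 0)"
 let ?N2 = "density lborel d"
 have e1: "emeasure ?N1 {x<..} = tail (max r x)" for x
 proof -
  have "emeasure ?N1 {x<..} = (\<integral>\<^sup>+t. (if r < t then ennreal (1 / sqrt t ^ (n - 1)) else 0) * indicator {x<..} t \<partial>m)"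
   by (subst emeasure_density) auto
  also have "... = tail (max r x)"
   unfolding tail_def by (intro nn_integral_cong_AE AE_I2) (auto simp: indicator_def)
  finally show ?thesis .
 qed
 have e2: "emeasure ?N2 {x<..} = (II s. ennreal (\<kappa> / pi * abel_density b s) * indicator {max r x<..<a} s)" for x
 proof -
  have "emeasure ?N2 {x<..} = (II s. d s * indicator {x<..} s)"
   by (subst emeasure_density) auto
  also have "... = (II s. ennreal (\<kappa> / pi * abel_density b s) * indicator {max r x<..<a} s)"
   unfolding d_eq by (intro nn_integral_cong_AE AE_I2) (auto simp: indicator_def)
  finally show ?thesis .
 qed
 have big: "tail x = 0" if "a <= x" for x
 proof -
  have "tail x = (\<integral>\<^sup>+t. 0 \<partial>m)" unfolding tail_def
  proof (rule nn_integral_cong_AE, goal_cases)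
   case 1
   show ?case
    using m(3) by eventually_elim (use that in auto)
  qed
  then show ?thesis by simp
 qed
 have "?N1 = ?N2"
 proof (rule measure_eqI_lessThan)
  fix x
  show "emeasure ?N1 {x<..} = emeasure ?N2 {x<..}"
  proof (cases "max r x < a")
   case True
   then show ?thesis unfolding e1 e2 using r by (intro abel_density_tail[symmetric]) auto
  next
   case False
   then have empty: "{max r x<..<a} = {}" by auto
   show ?thesis unfolding e1 e2 empty using big[of "max r x"] False by simp
  qed
  show "emeasure ?N1 {x<..} < \<infinity>"
   unfolding e1 using tail_eq[of "max r x"] big[of "max r x"] r by (cases "max r x < a") auto
 qed (simp_all add: m(2))
 have "(\<integral>\<^sup>+t. (if r < t then indicator A t else 0) \<partial>m) = (\<integral>\<^sup>+t. (if r < t then ennreal (1 / sqrt t ^ (n - 1)) else 0) * (ennreal (sqrt t ^ (n - 1)) * indicator A t) \<partial>m)"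
 proof (intro nn_integral_cong_AE AE_I2)
  fix t
  have "ennreal (1 / sqrt t ^ (n - 1)) * ennreal (sqrt t ^ (n - 1)) = 1" if "r < t"
   using that r by (simp add: ennreal_mult'[symmetric])
  then show "(if r < t then indicator A t else 0) = (if r < t then ennreal (1 / sqrt t ^ (n - 1)) else 0) * (ennreal (sqrt t ^ (n - 1)) * indicator A t)"
   by (simp add: mult.assoc[symmetric])
 qed
 also have "... = (\<integral>\<^sup>+t. ennreal (sqrt t ^ (n - 1)) * indicator A t \<partial>?N1)"
  by (subst nn_integral_density) auto
 also have "... = (\<integral>\<^sup>+t. ennreal (sqrt t ^ (n - 1)) * indicator A t \<partial>?N2)" by (simp only: \<open>?N1 = ?N2\<close>)
 also have "... = (II s. d s * (ennreal (sqrt s ^ (n - 1)) * indicator A s))"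
  by (subst nn_integral_density) auto
 also have "... = (II s. indicator A s * (ennreal (sqrt s ^ (n - 1)) * (ennreal (\<kappa> / pi * abel_density b s) * indicator {r<..<a} s)))"
  unfolding d_eq by (intro nn_integral_cong_AE AE_I2) (simp add: mult_ac)
 finally show ?thesis .
qed

text \<open>Let r decrease to 0 in \<open>abel_inversion_restrict\<close>; by assumption m has no
  mass at 0.\<close>

theorem abel_inversion:
 "m = density lborel (%s. ennreal (sqrt s ^ (n - 1)) * (ennreal (\<kappa> / pi * (abel_density b s * indicator {0<..<a} s))))"
 (is "m = density lborel ?D")
proof (rule measure_eqI)
 have dm [measurable]: "(%s. abel_density b s * indicator {0<..<a} s) \<in> borel_measurable borel"
  by (rule abel_density_measurable) simp
 show "sets m = sets (density lborel ?D)" by (simp add: m(2))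
 fix A assume "A \<in> sets m"
 then have [measurable]: "A \<in> sets borel" by (simp add: m(2))
 define r where "r = (%i::nat. a / (real i + 2))"
 have r: "0 < r i" "r i < a" for i using a by (auto simp: r_def divide_simps)
 have anti: "r j <= r i" if "i <= j" for i j using that a by (auto simp: r_def intro!: divide_left_mono)
 have r0: "r \<longlonglongrightarrow> 0" unfolding r_def by real_asymp
 have ex: "\<exists>i. r i < t" if "0 < t" for t
 proof -
  have "eventually (%i. r i < t) sequentially" using r0 that by (intro order_tendstoD) auto
  then show ?thesis by (auto simp: eventually_sequentially)
 qed
 have sup: "(SUP i. if r i < t then x else 0) = (if 0 < t then x else 0)" for t and x :: ennreal
 proof (cases "0 < t")
  case True
  then obtain i where "r i < t" using ex by blast
  show ?thesis
  proof (rule antisym)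
   have "(if r i < t then x else 0) <= (SUP i. if r i < t then x else 0)" by (rule SUP_upper) simp
   then show "(if 0 < t then x else 0) <= (SUP i. if r i < t then x else 0)" using True \<open>r i < t\<close> by simp
   show "(SUP i. if r i < t then x else 0) <= (if 0 < t then x else 0)"
    by (rule SUP_least) (simp add: True)
  qed
 next
  case False
  then have "\<not> r i < t" for i using r(1)[of i] by auto
  then show ?thesis using False by simp
 qed
 let ?g = "%s. indicator A s * ?D s"
 have "emeasure m A = (\<integral>\<^sup>+t. indicator A t \<partial>m)" by simp
 also have "... = (\<integral>\<^sup>+t. (if 0 < t then indicator A t else 0) \<partial>m)"
 proof (rule nn_integral_cong_AE, goal_cases)
  case 1
  show ?case using m(3) by eventually_elim simp
 qed
 also have "... = (\<integral>\<^sup>+t. (SUP i. if r i < t then indicator A t else 0) \<partial>m)" by (simp only: sup)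
 also have "... = (SUP i. \<integral>\<^sup>+t. (if r i < t then indicator A t else 0) \<partial>m)"
 proof (rule nn_integral_monotone_convergence_SUP)
  show "incseq (%i t. if r i < t then indicator A t else 0 :: ennreal)"
   using anti by (auto simp: incseq_def le_fun_def intro: order_le_less_trans)
 qed measurable
 also have "... = (SUP i. II s. (if r i < s then ?g s else 0))"
 proof (rule SUP_cong[OF refl])
  fix i
  show "(\<integral>\<^sup>+t. (if r i < t then indicator A t else 0) \<partial>m) = (II s. (if r i < s then ?g s else 0))"
  proof (subst abel_inversion_restrict[OF r \<open>A \<in> sets borel\<close>], rule nn_integral_cong)
   fix s
   show "indicator A s * (ennreal (sqrt s ^ (n - 1)) * (ennreal (\<kappa> / pi * abel_density b s) * indicator {r i<..<a} s)) = (if r i < s then ?g s else 0)"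
    using r[of i] by (auto simp: indicator_def)
  qed
 qed
 also have "... = (II s. (SUP i. if r i < s then ?g s else 0))"
 proof (rule nn_integral_monotone_convergence_SUP[symmetric])
  show "incseq (%i s. if r i < s then ?g s else 0)"
  proof (intro incseq_SucI le_funI)
   fix i s
   show "(if r i < s then ?g s else 0) <= (if r (Suc i) < s then ?g s else 0)"
    using anti[of i "Suc i"] by auto
  qed
 qed measurable
 also have "... = (II s. (if 0 < s then ?g s else 0))" by (simp only: sup)
 also have "... = (II s. ?D s * indicator A s)"
  by (intro nn_integral_cong_AE AE_I2) (auto simp: indicator_def)
 also have "... = emeasure (density lborel ?D) A" by (subst emeasure_density) auto
 finally show "emeasure m A = emeasure (density lborel ?D) A" .
qed

end

end

section \<open>Supports, finite energies and test integrals on the sphere\<close>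

text \<open>By Lindelof's theorem countably many open null sets cover the complement of the
  support.\<close>

lemma AE_in_supp:
 fixes \<mu> :: "(real ^ 'n::finite) measure"
 assumes \<mu>: "sets \<mu> = sets sphere_borel"
 shows "AE x in \<mu>. x \<in> supp \<mu>"
proof -
 have sp: "space \<mu> = sphere 0 1" using sets_eq_imp_space_eq[OF \<mu>] by (simp add: space_restrict_space)
 define \<U> where "\<U> = {U. open U \<and> emeasure \<mu> (U \<inter> space \<mu>) = 0}"
 obtain \<V> where V: "\<V> \<subseteq> \<U>" "countable \<V>" "\<Union>\<V> = \<Union>\<U>"
  by (rule Lindelof[of \<U>]) (auto simp: \<U>_def)
 have "AE x in \<mu>. \<forall>U\<in>\<V>. x \<notin> U"
  unfolding AE_ball_countable[OF V(2)]
 proof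
  fix U assume "U \<in> \<V>"
  then have U: "open U" "emeasure \<mu> (U \<inter> space \<mu>) = 0" using V(1) by (auto simp: \<U>_def)
  have "U \<inter> space \<mu> \<in> sets \<mu>" unfolding \<mu> sp sets_restrict_space using U(1) by auto
  then show "AE x in \<mu>. x \<notin> U" using U(2) by (intro AE_I[of _ _ "U \<inter> space \<mu>"]) auto
 qed
 then show ?thesis
  using AE_space
 proof eventually_elim
  case (elim x)
  then have "x \<notin> \<Union>\<U>" using V(3) by auto
  then show ?case using elim(2) unfolding supp_def \<U>_def by (auto simp: zero_less_iff_neq_zero)
 qed
qed

lemma finite_energy_no_atoms:
 fixes \<mu> :: "(real ^ 'n::finite) measure"
 assumes d: "3 <= CARD('n)" and \<mu>: "unit_sphere_measure \<mu>" and fin: "energy \<mu> < \<infinity>" and e: "norm e = 1"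
 shows "AE x in \<mu>. x ~= e"
proof -
 note D = unit_sphere_measureD[OF \<mu>]
 have [measurable]: "{e} \<in> sets \<mu>" unfolding D(1) sets_restrict_space using e by (auto intro!: image_eqI[of _ _ "{e}"])
 have kee: "kern e e = \<infinity>" using d by (simp add: kern_def)
 have "emeasure \<mu> {e} = 0"
 proof (rule ccontr)
  assume nz: "emeasure \<mu> {e} ~= 0"
  have "\<infinity> = \<infinity> * emeasure \<mu> {e}" using nz by (simp add: ennreal_top_mult)
  also have "... = (\<integral>\<^sup>+y. \<infinity> * indicator {e} y \<partial>\<mu>)" by (subst nn_integral_cmult) auto
  also have "... <= potential \<mu> e"
   unfolding potential_def by (rule nn_integral_mono) (auto simp: indicator_def kee)
  finally have pe: "potential \<mu> e = \<infinity>" by (simp add: top_unique)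
  have "\<infinity> = \<infinity> * emeasure \<mu> {e}" using nz by (simp add: ennreal_top_mult)
  also have "... = (\<integral>\<^sup>+y. \<infinity> * indicator {e} y \<partial>\<mu>)" by (subst nn_integral_cmult) auto
  also have "... <= energy \<mu>"
   unfolding energy_eq_potential by (rule nn_integral_mono) (auto simp: indicator_def pe)
  finally show False using fin by (simp add: top_unique)
 qed
 then show ?thesis using e D(2) by (intro AE_I[of _ _ "{e}"]) auto
qed

lemma sqrt_power_powr: "0 < x ==> sqrt x ^ m = x powr (real m / 2)"
 using powr_half_sq[of "sqrt x" m] by simp

lemma Beta_real_pos: "0 < a ==> 0 < b ==> 0 < Beta a (b :: real)"
 by (simp add: Beta_def Gamma_real_pos add_pos_pos)

lemma nth_eq_1_imp_axis:
 fixes x :: "real ^ 'n::finite"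
 assumes "norm x = 1" "\<bar>c\<bar> = 1" "x $ k = c"
 shows "x = axis k c"
proof -
 have "(norm (x - axis k c))\<^sup>2 = (norm x)\<^sup>2 - 2 * (x \<bullet> axis k c) + (norm (axis k c :: real ^ 'n))\<^sup>2"
  by (simp add: power2_norm_eq_inner inner_diff inner_commute)
 also have "(norm (axis k c :: real ^ 'n))\<^sup>2 = c * c" by (simp add: power2_norm_eq_inner inner_axis_axis)
 also have "(norm x)\<^sup>2 - 2 * (x \<bullet> axis k c) + c * c = 1 - c * c" using assms by (simp add: inner_axis)
 also have "c * c = 1" using abs_mult_self_eq[of c] assms(2) by simp
 finally show ?thesis by simp
qed

text \<open>With w as the outer variable, the density h and the latitude t of the point of
  observation are separated, each seen through its own Abel kernel.\<close>

lemma surface_potential_Fubini: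
 fixes k :: "'n::finite" and h :: "real => ennreal" and y :: "real ^ 'n"
 assumes n: "CARD('n) = n + 2" "0 < n"
  and h [measurable]: "h \<in> borel_measurable borel"
  and t: "0 < t" "t < 1"
  and y: "norm y = 1" "y $ k = 1 - 2 * t"
 shows "(\<integral>\<^sup>+x. h ((1 - x $ k) / 2) * kern x y \<partial>surface_measure) =
  (II w. (II s. (if w < s \<and> s < 1 then h s * ennreal (sqrt (1 - s) ^ (n - 1) / sqrt (s - w)) else 0)) *
   ennreal (real n * unit_ball_vol n * (sqrt (w / (1 - w)) ^ n / w)) * (if w < t then ennreal (1 / (sqrt t ^ (n - 1) * sqrt (t - w))) else 0) *
   indicator {0<..<1} w)"
proof -
 let ?C = "real n * unit_ball_vol n"
 have C: "0 <= ?C" by simp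
 let ?K = "%s w. (if 0 < w \<and> w < s \<and> w < t \<and> s < 1 then
   h s * ennreal (?C * sqrt (s * (1 - s)) ^ (n - 1) / sqrt (s * t) ^ (n - 1) * copson_kernel n s t w) else 0)"
 have cm [measurable]: "(%z. copson_kernel n (fst z) t (snd z)) \<in> borel_measurable (lborel \<Otimes>\<^sub>M lborel)"
  unfolding copson_kernel_def by measurable
 have "(\<integral>\<^sup>+x. h ((1 - x $ k) / 2) * kern x y \<partial>surface_measure) =
  (II s. h s * ennreal (?C * sqrt (s * (1 - s)) ^ (n - 1) / sqrt (s * t) ^ (n - 1)) *
   (II w. ennreal (copson_kernel n s t w) * indicator {0<..<min s t} w) * indicator {0<..<1} s)"
  using surface_potential[OF n h t y] by simp
 also have "... = (II s. II w. ?K s w)"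
 proof (rule nn_integral_cong, goal_cases)
  case (1 s)
  have [measurable]: "copson_kernel n s t \<in> borel_measurable borel" unfolding copson_kernel_def[abs_def] by measurable
  let ?c = "h s * ennreal (?C * sqrt (s * (1 - s)) ^ (n - 1) / sqrt (s * t) ^ (n - 1)) * indicator {0<..<1} s"
  have "h s * ennreal (?C * sqrt (s * (1 - s)) ^ (n - 1) / sqrt (s * t) ^ (n - 1)) *
   (II w. ennreal (copson_kernel n s t w) * indicator {0<..<min s t} w) * indicator {0<..<1} s =
   ?c * (II w. ennreal (copson_kernel n s t w) * indicator {0<..<min s t} w)" by (simp only: mult_ac)
  also have "... = (II w. ?c * (ennreal (copson_kernel n s t w) * indicator {0<..<min s t} w))"
   by (rule nn_integral_cmult[symmetric]) measurable
  also have "... = (II w. ?K s w)"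
  proof (rule nn_integral_cong, goal_cases)
   case (1 w)
   show ?case
   proof (cases "0 < w \<and> w < s \<and> w < t \<and> s < 1")
    case True
    then have nn: "0 <= ?C * sqrt (s * (1 - s)) ^ (n - 1) / sqrt (s * t) ^ (n - 1)" using t by simp
    show ?thesis unfolding ennreal_mult'[OF nn] using True by (simp add: mult.assoc)
   qed (auto simp: indicator_def)
  qed
  finally show ?case .
 qed
 also have "... = (II w. II s. ?K s w)"
  by (rule lborel_pair.Fubini'[symmetric]) measurable
 also have "... = (II w. (II s. (if w < s \<and> s < 1 then h s * ennreal (sqrt (1 - s) ^ (n - 1) / sqrt (s - w)) else 0)) *
   ennreal (?C * (sqrt (w / (1 - w)) ^ n / w)) * (if w < t then ennreal (1 / (sqrt t ^ (n - 1) * sqrt (t - w))) else 0) *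
   indicator {0<..<1} w)"
 proof (rule nn_integral_cong, goal_cases)
  case (1 w)
  let ?c = "ennreal (?C * (sqrt (w / (1 - w)) ^ n / w)) * (if w < t then ennreal (1 / (sqrt t ^ (n - 1) * sqrt (t - w))) else 0) * indicator {0<..<1} w"
  have "(II s. ?K s w) = (II s. (if w < s \<and> s < 1 then h s * ennreal (sqrt (1 - s) ^ (n - 1) / sqrt (s - w)) else 0) * ?c)"
  proof (rule nn_integral_cong, goal_cases)
   case (1 s)
   show ?case
   proof (cases "0 < w \<and> w < s \<and> w < t \<and> s < 1")
    case True
    have gen: "c * (a * b) / (a * e) * (W / (w * u * v)) = b / u * (c * (W / w)) * (1 / (e * v))" if "a ~= 0"
     for a b c e u v W w :: real using that by (simp add: mult_ac)
    have ne: "sqrt s ^ (n - 1) ~= 0" using True by simp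
    have "?C * sqrt (s * (1 - s)) ^ (n - 1) / sqrt (s * t) ^ (n - 1) * copson_kernel n s t w =
     sqrt (1 - s) ^ (n - 1) / sqrt (s - w) * (?C * (sqrt (w / (1 - w)) ^ n / w)) * (1 / (sqrt t ^ (n - 1) * sqrt (t - w)))"
     unfolding copson_kernel_def real_sqrt_mult power_mult_distrib by (rule gen[OF ne])
    moreover have "0 <= sqrt (1 - s) ^ (n - 1) / sqrt (s - w)" "0 <= ?C * (sqrt (w / (1 - w)) ^ n / w)" using True C by auto
    ultimately have "ennreal (?C * sqrt (s * (1 - s)) ^ (n - 1) / sqrt (s * t) ^ (n - 1) * copson_kernel n s t w) =
     ennreal (sqrt (1 - s) ^ (n - 1) / sqrt (s - w)) * ennreal (?C * (sqrt (w / (1 - w)) ^ n / w)) * ennreal (1 / (sqrt t ^ (n - 1) * sqrt (t - w)))"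
     by (simp only: ennreal_mult' mult_nonneg_nonneg)
    then show ?thesis using True by (simp add: mult.assoc)
   qed (auto simp: indicator_def)
  qed
  also have "... = (II s. (if w < s \<and> s < 1 then h s * ennreal (sqrt (1 - s) ^ (n - 1) / sqrt (s - w)) else 0)) * ?c"
   by (rule nn_integral_multc) measurable
  finally show ?case
   by (simp only: mult.assoc)
 qed
 finally show ?thesis .
qed

lemma finite_surface_measure:
 assumes n: "CARD('n) = n + 2" "0 < n"
 shows "finite_measure (surface_measure :: (real ^ 'n::finite) measure)"
proof -
 fix k :: 'n
 let ?C = "real n * unit_ball_vol n * Beta (real n / 2) (1 / 2) * 2 ^ n"
 have C: "0 <= ?C" using n by (simp add: less_imp_le[OF Beta_real_pos])
 have "emeasure (surface_measure :: (real ^ 'n) measure) (space surface_measure) = (\<integral>\<^sup>+x. (%_. 1) ((1 - x $ k) / 2) \<partial>(surface_measure :: (real ^ 'n) measure))"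
  by simp
 also have "... = (II s. 1 * ennreal (?C * sqrt (s * (1 - s)) ^ (n - 1)) * indicator {0<..<1} s)"
  by (rule nn_integral_surface_profile[OF n]) simp
 also have "... <= (II s. ennreal ?C * indicator {0<..<1} (s::real))"
 proof (rule nn_integral_mono, goal_cases)
  case (1 s)
  show ?case
  proof (cases "s \<in> {0<..<1}")
   case True
   then have "s * (1 - s) <= 1 * 1" by (intro mult_mono) auto
   then have "sqrt (s * (1 - s)) ^ (n - 1) <= 1" using True by (intro power_le_one) auto
   then have "?C * sqrt (s * (1 - s)) ^ (n - 1) <= ?C * 1" using C by (intro mult_left_mono) auto
   then show ?thesis using True by (simp add: ennreal_leI)
  qed simp
 qed
 also have "... = ennreal ?C" by (subst nn_integral_cmult) auto
 finally show ?thesis by (intro finite_measureI) (auto simp: top_unique)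
qed

lemma surface_id_measurable: "(%x. x) \<in> borel_measurable (surface_measure :: (real ^ 'n::finite) measure)"
 by (rule measurable_sphereI[OF _ sets_surface_measure]) simp

lemma space_surface_measure: "space (surface_measure :: (real ^ 'n::finite) measure) = sphere 0 1"
 using sets_eq_imp_space_eq[OF sets_surface_measure] by (simp add: space_restrict_space)

lemma AE_surface_latitude:
 fixes k :: "'n::finite"
 assumes n: "CARD('n) = n + 2" "0 < n" and A: "A \<in> null_sets lborel"
 shows "AE x in surface_measure. (1 - x $ k) / 2 \<notin> A \<and> 0 < (1 - x $ k) / 2 \<and> (1 - x $ k) / 2 < 1"
proof -
 have [measurable]: "A \<in> sets borel" using A by (auto simp: null_sets_def)
 let ?h = "%s::real. if s \<in> A \<or> \<not> (0 < s \<and> s < 1) then 1 else (0::ennreal)"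
 have [measurable]: "(%x::real ^ 'n. (1 - x $ k) / 2) \<in> borel_measurable surface_measure"
  by (rule measurable_sphereI[OF _ sets_surface_measure]) simp
 have "(\<integral>\<^sup>+x. ?h ((1 - x $ k) / 2) \<partial>(surface_measure :: (real ^ 'n) measure)) =
  (II s. ?h s * ennreal (real n * unit_ball_vol n * Beta (real n / 2) (1 / 2) * 2 ^ n * sqrt (s * (1 - s)) ^ (n - 1)) * indicator {0<..<1} s)"
  by (rule nn_integral_surface_profile[OF n]) measurable
 also have "... = (\<integral>\<^sup>+s. 0 \<partial>(lborel :: real measure))"
 proof (rule nn_integral_cong_AE, goal_cases)
  case 1
  show ?case
   using AE_not_in[OF A] by eventually_elim (auto simp: indicator_def)
 qed
 finally have zero: "(\<integral>\<^sup>+x. ?h ((1 - x $ k) / 2) \<partial>(surface_measure :: (real ^ 'n) measure)) = 0" by simp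
 have "(%x. ?h ((1 - x $ k) / 2)) \<in> borel_measurable (surface_measure :: (real ^ 'n) measure)" by measurable
 from nn_integral_0_iff_AE[OF this] zero
 have "AE x in (surface_measure :: (real ^ 'n) measure). ?h ((1 - x $ k) / 2) = 0" by blast
 then show ?thesis by eventually_elim (auto split: if_splits)
qed

text \<open>Off the two poles the potential of surface measure is a constant, a product of two Beta
  values. This admits surface measure as a test in \<open>equilibrium_AE_ge\<close>.\<close>

lemma energy_surface_measure:
 assumes n: "CARD('n) = n + 2" "0 < n"
 shows "energy (surface_measure :: (real ^ 'n::finite) measure) < \<infinity>"
proof -
 fix k :: 'n
 let ?\<sigma> = "surface_measure :: (real ^ 'n) measure"
 interpret s: finite_measure ?\<sigma> by (rule finite_surface_measure[OF n])
 define B1 where "B1 = Beta (1 / 2) ((real n + 1) / 2)"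
 define B2 where "B2 = Beta (real n / 2) (1 / 2)"
 let ?C = "real n * unit_ball_vol n"
 have B: "0 <= B1" "0 <= B2" 
  unfolding B1_def B2_def using n by (auto intro!: less_imp_le[OF Beta_real_pos])
 have e1: "(real n + 1) / 2 - 1 = real (n - 1) / 2" using n by (cases n) (auto simp: field_simps)
 have inner: "(II s. (if w < s \<and> s < 1 then 1 * ennreal (sqrt (1 - s) ^ (n - 1) / sqrt (s - w)) else 0)) = ennreal ((1 - w) powr (real n / 2) * B1)"
  if w: "0 < w" "w < 1" for w
 proof -
  have "(II s. (if w < s \<and> s < 1 then 1 * ennreal (sqrt (1 - s) ^ (n - 1) / sqrt (s - w)) else 0)) =
   (II s. ennreal ((s - w) powr (1 / 2 - 1) * (1 - s) powr ((real n + 1) / 2 - 1)) * indicator {w<..<1} s)"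
  proof (rule nn_integral_cong, goal_cases)
   case (1 s)
   show ?case
    unfolding e1 using sqrt_power_powr[of "1 - s" "n - 1"] powr_minus_divide[of "s - w" "1 / 2"]
    by (simp add: powr_half_sqrt)
  qed
  also have "... = ennreal ((1 - w) powr (1 / 2 + (real n + 1) / 2 - 1) * B1)"
   unfolding B1_def using w by (intro nn_integral_Beta) auto
  also have "1 / 2 + (real n + 1) / 2 - 1 = real n / 2" by (simp add: field_simps)
  finally show ?thesis .
 qed
 have pot: "potential ?\<sigma> y = ennreal (?C * B1 * B2)" if y: "norm y = 1" "0 < (1 - y $ k) / 2" "(1 - y $ k) / 2 < 1" for y
 proof -
  define t where "t = (1 - y $ k) / 2"
  have t: "0 < t" "t < 1" "y $ k = 1 - 2 * t" using y by (auto simp: t_def field_simps)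
  have st: "sqrt t ^ (n - 1) = t powr (real (n - 1) / 2)" by (rule sqrt_power_powr[OF t(1)])
  have "potential ?\<sigma> y = (\<integral>\<^sup>+x. (%_. 1) ((1 - x $ k) / 2) * kern x y \<partial>?\<sigma>)"
   unfolding potential_def by (rule nn_integral_cong) (simp, rule kern_commute)
  also have "... = (II w. (II s. (if w < s \<and> s < 1 then (%_. 1) s * ennreal (sqrt (1 - s) ^ (n - 1) / sqrt (s - w)) else 0)) *
   ennreal (?C * (sqrt (w / (1 - w)) ^ n / w)) * (if w < t then ennreal (1 / (sqrt t ^ (n - 1) * sqrt (t - w))) else 0) * indicator {0<..<1} w)"
   by (rule surface_potential_Fubini[OF n _ t(1,2) y(1) t(3)]) simp
  also have "... = (II w. ennreal (?C * B1 / sqrt t ^ (n - 1)) * (ennreal ((w - 0) powr (real n / 2 - 1) * (t - w) powr (1 / 2 - 1)) * indicator {0<..<t} w))"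
  proof (rule nn_integral_cong, goal_cases)
   case (1 w)
   show ?case
   proof (cases "0 < w \<and> w < t")
    case True
    then have w: "0 < w" "w < 1" using t by auto
    have r: "sqrt (w / (1 - w)) ^ n / w = w powr (real n / 2 - 1) / (1 - w) powr (real n / 2)"
    proof -
     have "sqrt (w / (1 - w)) ^ n = w powr (real n / 2) / (1 - w) powr (real n / 2)"
      using w sqrt_power_powr[of w n] sqrt_power_powr[of "1 - w" n] by (simp add: real_sqrt_divide power_divide)
     moreover have "w powr (real n / 2 - 1) = w powr (real n / 2) / w" using w by (simp add: powr_diff)
     ultimately show ?thesis by simp
    qed
    have P: "0 < (1 - w) powr (real n / 2)" using w by simp
    have s: "(t - w) powr (1 / 2 - 1) = 1 / sqrt (t - w)"
     using True powr_minus_divide[of "t - w" "1 / 2"] by (simp add: powr_half_sqrt)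
    have gen: "P * b * (c * (u / P)) * (1 / (e * v)) = c * b / e * (u * (1 / v))" if "0 < P" for P b c u e v :: real
     using that by simp
    have "ennreal ((1 - w) powr (real n / 2) * B1) * ennreal (?C * (sqrt (w / (1 - w)) ^ n / w)) * ennreal (1 / (sqrt t ^ (n - 1) * sqrt (t - w))) =
     ennreal ((1 - w) powr (real n / 2) * B1 * (?C * (sqrt (w / (1 - w)) ^ n / w)) * (1 / (sqrt t ^ (n - 1) * sqrt (t - w))))"
     using B w t True by (simp add: ennreal_mult'[symmetric])
    also have "(1 - w) powr (real n / 2) * B1 * (?C * (sqrt (w / (1 - w)) ^ n / w)) * (1 / (sqrt t ^ (n - 1) * sqrt (t - w))) =
     ?C * B1 / sqrt t ^ (n - 1) * (w powr (real n / 2 - 1) * (t - w) powr (1 / 2 - 1))"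
     unfolding r s by (rule gen[OF P])
    also have "ennreal ... = ennreal (?C * B1 / sqrt t ^ (n - 1)) * ennreal (w powr (real n / 2 - 1) * (t - w) powr (1 / 2 - 1))"
     using B t by (intro ennreal_mult') auto
    finally show ?thesis using True w inner[OF w] by simp
   qed (auto simp: indicator_def)
  qed
  also have "... = ennreal (?C * B1 / sqrt t ^ (n - 1)) * ennreal ((t - 0) powr (real n / 2 + 1 / 2 - 1) * B2)"
   unfolding B2_def using n t by (subst nn_integral_cmult, measurable, subst nn_integral_Beta) auto
  also have "real n / 2 + 1 / 2 - 1 = real (n - 1) / 2" using n by (cases n) (auto simp: field_simps)
  also have "ennreal (?C * B1 / sqrt t ^ (n - 1)) * ennreal ((t - 0) powr (real (n - 1) / 2) * B2) = ennreal (?C * B1 * B2)"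
   unfolding st using t B by (subst ennreal_mult'[symmetric]) simp_all
  finally show ?thesis .
 qed
 have "energy ?\<sigma> = (\<integral>\<^sup>+x. ennreal (?C * B1 * B2) \<partial>?\<sigma>)"
  unfolding energy_eq_potential
 proof (rule nn_integral_cong_AE, goal_cases)
  case 1
  show ?case
  proof -
   have "AE x in ?\<sigma>. 0 < (1 - x $ k) / 2 \<and> (1 - x $ k) / 2 < 1"
    using AE_surface_latitude[OF n, of "{}" k] by simp
   then show ?thesis using AE_surface_norm by eventually_elim (use pot in auto)
  qed
 qed
 also have "... < \<infinity>" using less_top[THEN iffD1, OF s.emeasure_finite[of "space ?\<sigma>"]] by (simp add: ennreal_mult_less_top)
 finally show ?thesis .
qed

text \<open>By symmetry of the kernel, testing U^mu with a zonal function means integrating the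
  potential of that function against mu. The potential is zonal as well, so only the distribution of
  latitudes of mu appears, although mu may be asymmetric.\<close>

lemma potential_test:
 fixes k :: "'n::finite" and h :: "real => ennreal" and \<mu> :: "(real ^ 'n) measure"
 assumes n: "CARD('n) = n + 2" "0 < n"
  and h [measurable]: "h \<in> borel_measurable borel"
  and \<mu>: "unit_sphere_measure \<mu>" and lat: "AE y in \<mu>. 0 < (1 - y $ k) / 2 \<and> (1 - y $ k) / 2 < 1"
 shows "(\<integral>\<^sup>+x. h ((1 - x $ k) / 2) * potential \<mu> x \<partial>surface_measure) =
  (II w. (II s. (if w < s \<and> s < 1 then h s * ennreal (sqrt (1 - s) ^ (n - 1) / sqrt (s - w)) else 0)) *
   ennreal (real n * unit_ball_vol n * (sqrt (w / (1 - w)) ^ n / w)) *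
   (\<integral>\<^sup>+t. (if w < t then ennreal (1 / (sqrt t ^ (n - 1) * sqrt (t - w))) else 0) \<partial>distr \<mu> borel (%x. (1 - x $ k) / 2)) *
   indicator {0<..<1} w)"
proof -
 let ?\<sigma> = "surface_measure :: (real ^ 'n) measure"
 let ?t = "%x::real ^ 'n. (1 - x $ k) / 2"
 note D = unit_sphere_measureD[OF \<mu>]
 interpret s: finite_measure ?\<sigma> by (rule finite_surface_measure[OF n])
 interpret m: finite_measure \<mu> by (rule D(4))
 interpret P: pair_sigma_finite ?\<sigma> \<mu> ..
 interpret L: pair_sigma_finite \<mu> "lborel :: real measure" ..
 note [measurable] = D(5) surface_id_measurable
 have tb: "?t \<in> borel_measurable borel" by measurable
 have [measurable]: "?t \<in> borel_measurable \<mu>" "?t \<in> borel_measurable ?\<sigma>"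
  by (rule measurable_sphereI[OF tb D(1)], rule measurable_sphereI[OF tb sets_surface_measure])
 have [measurable]: "(%z. kern (fst z) (snd z)) \<in> borel_measurable (?\<sigma> \<Otimes>\<^sub>M \<mu>)"
  by (rule measurable_kern_pair[OF surface_id_measurable D(5)])
 let ?A = "%w. (II s. (if w < s \<and> s < 1 then h s * ennreal (sqrt (1 - s) ^ (n - 1) / sqrt (s - w)) else 0))"
 let ?W = "%w. ennreal (real n * unit_ball_vol n * (sqrt (w / (1 - w)) ^ n / w))"
 let ?k = "%w t. (if w < t then ennreal (1 / (sqrt t ^ (n - 1) * sqrt (t - w))) else 0)"
 have Am [measurable]: "?A \<in> borel_measurable lborel" by measurable
 have k1: "(%y. kern x y) \<in> borel_measurable \<mu>" for x by measurable
 have "(\<integral>\<^sup>+x. h (?t x) * potential \<mu> x \<partial>?\<sigma>) = (\<integral>\<^sup>+x. \<integral>\<^sup>+y. h (?t x) * kern x y \<partial>\<mu> \<partial>?\<sigma>)"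
  unfolding potential_def by (rule nn_integral_cong, rule nn_integral_cmult[symmetric], rule k1)
 also have "... = (\<integral>\<^sup>+y. \<integral>\<^sup>+x. h (?t x) * kern x y \<partial>?\<sigma> \<partial>\<mu>)"
  by (rule P.Fubini'[symmetric]) measurable
 also have "... = (\<integral>\<^sup>+y. (II w. ?A w * ?W w * ?k w (?t y) * indicator {0<..<1} w) \<partial>\<mu>)"
 proof (rule nn_integral_cong_AE, goal_cases)
  case 1
  show ?case
   using lat AE_space
  proof eventually_elim
   case (elim y)
   show ?case
   proof (rule surface_potential_Fubini[OF n h])
    show "y $ k = 1 - 2 * ?t y" by (simp add: field_simps)
   qed (use elim D(2) in auto)
  qed
 qed
 also have "... = (II w. \<integral>\<^sup>+y. ?A w * ?W w * ?k w (?t y) * indicator {0<..<1} w \<partial>\<mu>)"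
  by (rule L.Fubini'[symmetric]) measurable
 also have "... = (II w. ?A w * ?W w * (\<integral>\<^sup>+t. ?k w t \<partial>distr \<mu> borel ?t) * indicator {0<..<1} w)"
 proof (rule nn_integral_cong, goal_cases)
  case (1 w)
  have "(\<integral>\<^sup>+y. ?A w * ?W w * ?k w (?t y) * indicator {0<..<1} w \<partial>\<mu>) = (\<integral>\<^sup>+y. (?A w * ?W w * indicator {0<..<1} w) * ?k w (?t y) \<partial>\<mu>)"
   by (simp only: mult_ac)
  also have "... = (?A w * ?W w * indicator {0<..<1} w) * (\<integral>\<^sup>+y. ?k w (?t y) \<partial>\<mu>)"
   by (rule nn_integral_cmult) measurable
  also have "(\<integral>\<^sup>+y. ?k w (?t y) \<partial>\<mu>) = (\<integral>\<^sup>+t. ?k w t \<partial>distr \<mu> borel ?t)"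
   by (rule nn_integral_distr[symmetric]) measurable
  finally show ?case
   by (simp only: mult_ac)
 qed
 finally show ?thesis .
qed

text \<open>The meridian curve is continued past both poles. The angles t, -t and 2 pi - t give
  points of the same latitude, which provides the symmetry required by
  \<open>abel_profile_of_even_C2\<close>.\<close>

lemma field_abel_profile:
 fixes Q :: "real ^ 'n::finite => ennreal"
 assumes n: "CARD('n) = n + 2" "0 < n" and ri: "rotation_invariant k Q"
  and N: "openin (top_of_set (sphere 0 1)) N" and Q: "C2_on_sphere N Q"
  and \<alpha>: "0 < \<alpha>" "\<alpha> <= pi" and cap: "north_cap k \<alpha> \<subseteq> N"
 obtains C q q' q'' where "abel_profile n (hav \<alpha>) C q q' q''"
  "!!x. norm x = 1 ==> 0 < (1 - x $ k) / 2 ==> (1 - x $ k) / 2 < hav \<alpha> ==> Q x = ennreal (q ((1 - x $ k) / 2))"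
  "!!t. 0 < t ==> t < hav \<alpha> ==> 0 <= q t"
  "!!\<theta>. 0 < \<theta> ==> \<theta> < \<alpha> ==> enn2real (profile k Q \<theta>) = q (hav \<theta>)"
proof -
 have d: "3 <= CARD('n)" using n by simp
 obtain j where kj: "k ~= j" using exists_other_index[OF d] by blast
 let ?M = "meridian k j"
 define \<phi> where "\<phi> = (%t. enn2real (Q (?M t)))"
 have pM: "polar_angle k (?M t) = t" if "0 <= t" "t <= pi" for t
  using that by (simp add: polar_angle_def meridian_nth[OF kj] arccos_cos)
 have MN: "?M t \<in> N" if "0 <= t" "t <= \<alpha>" for t
  using cap pM[of t] that \<alpha> norm_meridian[OF kj, of t] by (auto simp: north_cap_def)
 have lat: "Q x = Q y" if "norm x = 1" "norm y = 1" "x $ k = y $ k" for x y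
  by (rule rotation_invariant_latitude[OF ri d that])
 have even: "\<phi> (- t) = \<phi> t" "\<phi> (2 * pi - t) = \<phi> t" for t
  unfolding \<phi>_def using lat[of "?M (- t)" "?M t"] lat[of "?M (2 * pi - t)" "?M t"]
  by (simp_all add: norm_meridian[OF kj] meridian_nth[OF kj] cos_diff)
 obtain C q q' q'' where ap: "abel_profile n (hav \<alpha>) C q q' q''" and qphi: "!!t. 0 < t ==> t < \<alpha> ==> q (hav t) = \<phi> t"
 proof (rule abel_profile_of_even_C2[OF n(2) \<alpha>, of \<phi> "deriv \<phi>" "deriv (deriv \<phi>)"])
  fix t assume t: "0 <= t" "t <= \<alpha>"
  note * = meridian_C2[OF N Q kj MN[OF t], folded \<phi>_def]
  show "(\<phi> has_real_derivative deriv \<phi> t) (at t)" by (rule *(1))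
  show "(deriv \<phi> has_real_derivative deriv (deriv \<phi>) t) (at t)" by (rule *(2))
  show "isCont (deriv (deriv \<phi>)) t" by (rule *(3))
 next
  show "\<phi> (- t) = \<phi> t" "\<phi> (2 * pi - t) = \<phi> t" for t by (rule even)+
 next
  fix C q q' q''
  assume "abel_profile n (hav \<alpha>) C q q' q''" "!!t. 0 < t ==> t < \<alpha> ==> q (hav t) = \<phi> t"
  then show thesis by (rule that)
 qed
 show thesis
 proof (rule that[OF ap])
  fix x :: "real ^ 'n" assume x: "norm x = 1" "0 < (1 - x $ k) / 2" "(1 - x $ k) / 2 < hav \<alpha>"
  define \<theta> where "\<theta> = arccos (x $ k)"
  have le: "\<bar>x $ k\<bar> <= 1" using component_le_norm_cart[of x k] x by simp
  have c: "cos \<theta> = x $ k" "0 <= \<theta>" "\<theta> <= pi" using le by (auto simp: \<theta>_def intro: arccos_lbound arccos_ubound)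
  have hv: "hav \<theta> = (1 - x $ k) / 2" by (simp add: hav_def c)
  have th: "0 < \<theta>" "\<theta> < \<alpha>" using x c \<alpha> hav_less_imp_less[of 0 \<theta>] hav_less_imp_less[of \<theta> \<alpha>] by (auto simp: hv)
  have "Q x = Q (?M \<theta>)" using x by (intro lat) (simp_all add: norm_meridian[OF kj] meridian_nth[OF kj] c)
  moreover have "Q (?M \<theta>) < \<infinity>" using Q MN[of \<theta>] th by (simp add: C2_on_sphere_def)
  ultimately have "Q x = ennreal (\<phi> \<theta>)" by (simp add: \<phi>_def less_top)
  then show "Q x = ennreal (q ((1 - x $ k) / 2))" using qphi[OF th] by (simp add: hv)
 next
  fix t assume t: "0 < t" "t < hav \<alpha>"
  define \<theta> where "\<theta> = arccos (1 - 2 * t)"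
  have t1: "t <= 1" using t hav_le_1[of \<alpha>] by simp
  have c: "hav \<theta> = t" "0 <= \<theta>" "\<theta> <= pi" using t t1 by (auto simp: \<theta>_def hav_arccos intro: arccos_lbound arccos_ubound)
  have th: "0 < \<theta>" "\<theta> < \<alpha>" using t c \<alpha> hav_less_imp_less[of 0 \<theta>] hav_less_imp_less[of \<theta> \<alpha>] by auto
  show "0 <= q t" using qphi[OF th] by (simp add: c \<phi>_def)
 next
  fix \<theta> assume th: "0 < \<theta>" "\<theta> < \<alpha>"
  have "profile k Q (polar_angle k (?M \<theta>)) = Q (?M \<theta>)"
   by (rule profile_polar_angle[OF ri d]) (simp add: norm_meridian[OF kj])
  then show "enn2real (profile k Q \<theta>) = q (hav \<theta>)" using th \<alpha> pM[of \<theta>] qphi[OF th] by (simp add: \<phi>_def)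
 qed
qed

lemma C2_on_sphere_tendsto:
 fixes Q :: "real ^ 'n::finite => ennreal"
 assumes N: "openin (top_of_set (sphere 0 1)) N" and Q: "C2_on_sphere N Q" and x: "x \<in> N"
 shows "(Q \<longlongrightarrow> Q x) (at x within sphere 0 1)"
proof -
 obtain U h where U: "open U" "x \<in> U" "C2_on U h" "!!y. y \<in> U \<inter> N ==> enn2real (Q y) = h y"
  using Q x unfolding C2_on_sphere_def by blast
 obtain W where W: "open W" "N = sphere 0 1 \<inter> W" using N by (auto simp: openin_open)
 have fin: "y \<in> N ==> Q y < \<infinity>" for y using Q by (simp add: C2_on_sphere_def)
 have eq: "Q y = ennreal (h y)" if "y \<in> U \<inter> N" for y
  using U(4)[OF that, symmetric] fin[of y] that by (simp add: less_top)
 obtain h' where "(h has_derivative h') (at x)" using U(2,3) unfolding C2_on_def by blast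
 then have "(h \<longlongrightarrow> h x) (at x)" using has_derivative_continuous isCont_def by blast
 then have "(h \<longlongrightarrow> h x) (at x within sphere 0 1)" by (rule tendsto_within_subset) simp
 then have "((%y. ennreal (h y)) \<longlongrightarrow> Q x) (at x within sphere 0 1)"
  unfolding eq[OF IntI[OF U(2) x]] by (rule tendsto_ennrealI)
 moreover have "eventually (%y. ennreal (h y) = Q y) (at x within sphere 0 1)"
  unfolding eventually_at_topological
 proof (intro exI[of _ "U \<inter> W"] conjI ballI impI)
  show "open (U \<inter> W)" "x \<in> U \<inter> W" using U W x by auto
  show "ennreal (h y) = Q y" if "y \<in> U \<inter> W" "y ~= x" "y \<in> sphere 0 1" for y
   using eq[of y] that W by simp
 qed
 ultimately show ?thesis by (rule Lim_transform_eventually)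
qed

lemma lsc_on_sphere_measurable:
 fixes Q :: "real ^ 'n::finite => ennreal"
 assumes "lsc_on (sphere 0 1) Q"
 shows "Q \<in> borel_measurable sphere_borel"
proof (rule borel_measurableI_greater)
 fix c
 have "openin (top_of_set (sphere 0 1)) {x \<in> sphere 0 1. c < Q x}" using assms unfolding lsc_on_def by blast
 then obtain W where "open W" "{x \<in> sphere 0 1. c < Q x} = sphere 0 1 \<inter> W" by (auto simp: openin_open)
 then show "{x \<in> space sphere_borel. c < Q x} \<in> sets sphere_borel"
  by (auto simp: space_restrict_space sets_restrict_space)
qed

lemma nn_integral_Ioo_pos:
 fixes f :: "real => real"
 assumes a: "0 < a" and m: "(%s. ennreal (f s) * indicator {0<..<a} s) \<in> borel_measurable borel"
  and pos: "!!s. 0 < s ==> s < a ==> 0 < f s"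
 shows "0 < (II s. ennreal (f s) * indicator {0<..<a} s)"
proof (rule ccontr)
 assume "\<not> ?thesis"
 then have "(II s. ennreal (f s) * indicator {0<..<a} s) = 0" by (simp add: not_less)
 moreover have "(%s. ennreal (f s) * indicator {0<..<a} s) \<in> borel_measurable lborel" using m by simp
 ultimately have "AE s in lborel. ennreal (f s) * indicator {0<..<a} s = 0"
  using nn_integral_0_iff_AE by blast
 then have "AE s in lborel. s \<notin> {0<..<a}"
 proof eventually_elim
  case (elim s)
  show ?case
  proof
   assume s: "s \<in> {0<..<a}"
   then have "ennreal (f s) = 0" using elim by simp
   moreover have "0 < f s" using s by (intro pos) auto
   ultimately show False by simp
  qed
 qed
 then have "{0<..<a} \<in> null_sets lborel" by (subst AE_iff_null_sets) auto
 then show False using a by (simp add: null_sets_def)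
qed

text \<open>Normalized surface measure on the latitudes (0, a) is a competitor of finite weighted
  energy, because Q is bounded there.\<close>

lemma weighted_energy_finite:
 fixes Q :: "real ^ 'n::finite => ennreal"
 assumes n: "CARD('n) = n + 2" "0 < n" and eq: "equilibrium_measure Q \<mu>"
  and Q: "Q \<in> borel_measurable sphere_borel" and a: "0 < a" "a <= 1"
  and bound: "!!x. norm x = 1 ==> 0 < (1 - x $ k) / 2 ==> (1 - x $ k) / 2 < a ==> Q x <= ennreal C"
 shows "weighted_energy Q \<mu> < \<infinity>"
proof -
 let ?\<sigma> = "surface_measure :: (real ^ 'n) measure"
 let ?t = "%x::real ^ 'n. (1 - x $ k) / 2"
 interpret s: finite_measure ?\<sigma> by (rule finite_surface_measure[OF n])
 have [measurable]: "?t \<in> borel_measurable ?\<sigma>" by (rule measurable_sphereI[OF _ sets_surface_measure]) simp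
 have [measurable]: "Q \<in> borel_measurable ?\<sigma>" using Q by (simp add: measurable_cong_sets[OF sets_surface_measure refl])
 define E where "E = {x \<in> space ?\<sigma>. ?t x \<in> {0<..<a}}"
 have E [measurable]: "E \<in> sets ?\<sigma>" unfolding E_def by measurable
 let ?C = "real n * unit_ball_vol n * Beta (real n / 2) (1 / 2) * 2 ^ n"
 have C: "0 < ?C" using n by (simp add: Beta_real_pos unit_ball_vol_pos)
 have "emeasure ?\<sigma> E = (\<integral>\<^sup>+x. indicator E x \<partial>?\<sigma>)" by simp
 also have "... = (\<integral>\<^sup>+x. indicator {0<..<a} (?t x) \<partial>?\<sigma>)"
  by (rule nn_integral_cong) (simp add: E_def indicator_def)
 also have "... = (II s. indicator {0<..<a} s * ennreal (?C * sqrt (s * (1 - s)) ^ (n - 1)) * indicator {0<..<1} s)"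
  by (rule nn_integral_surface_profile[OF n]) measurable
 also have "... = (II s. ennreal (?C * sqrt (s * (1 - s)) ^ (n - 1)) * indicator {0<..<a} s)"
  by (rule nn_integral_cong) (use a in \<open>auto simp: indicator_def\<close>)
 also have "0 < ..."
 proof (rule nn_integral_Ioo_pos[OF a(1)])
  fix s assume "0 < s" "s < a"
  then have "0 < sqrt (s * (1 - s)) ^ (n - 1)" using a by simp
  then show "0 < ?C * sqrt (s * (1 - s)) ^ (n - 1)" by (rule mult_pos_pos[OF C])
 qed measurable
 finally have pos: "0 < emeasure ?\<sigma> E" .
 obtain L where L: "unit_sphere_measure L" "energy L < \<infinity>"
  "!!f. f \<in> borel_measurable ?\<sigma> ==> (\<integral>\<^sup>+x. f x \<partial>L) * emeasure ?\<sigma> E = (\<integral>\<^sup>+x. f x * indicator E x \<partial>?\<sigma>)"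
  using normalized_restriction[OF s.finite_measure_axioms sets_surface_measure E pos energy_surface_measure[OF n]] by blast
 have "(\<integral>\<^sup>+x. Q x \<partial>L) * emeasure ?\<sigma> E = (\<integral>\<^sup>+x. Q x * indicator E x \<partial>?\<sigma>)" by (rule L(3)) measurable
 also have "... <= (\<integral>\<^sup>+x. ennreal C * indicator E x \<partial>?\<sigma>)"
 proof (rule nn_integral_mono)
  fix x assume "x \<in> space ?\<sigma>"
  then have "norm x = 1" by (simp add: space_surface_measure)
  then show "Q x * indicator E x <= ennreal C * indicator E x" using bound[of x] by (simp add: E_def indicator_def)
 qed
 also have "... = ennreal C * emeasure ?\<sigma> E" by (subst nn_integral_cmult) auto
 also have "... < \<infinity>" using less_top[THEN iffD1, OF s.emeasure_finite[of E]] by (simp add: ennreal_mult_less_top)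
 finally have "(\<integral>\<^sup>+x. Q x \<partial>L) < \<infinity>" using pos by (auto simp: ennreal_mult_less_top less_top ennreal_top_mult)
 then have "weighted_energy Q L < \<infinity>" using L(2) by (simp add: weighted_energy_def ennreal_mult_less_top)
 moreover have "weighted_energy Q \<mu> <= weighted_energy Q L"
  using eq L(1) unfolding equilibrium_measure_def min_energy_def by (auto intro: INF_lower)
 ultimately show ?thesis by (rule le_less_trans[rotated])
qed

text \<open>On the unit sphere |x - y|^2 = 2 (1 - x . y), so up to a constant the kernel is (1 - x .
  y)^(-n/2) and \<open>measure_eqI_energy\<close> applies to the images of the measures in the whole
  space.\<close>

lemma sphere_measure_eqI_energy:
 fixes M N :: "(real ^ 'n::finite) measure"
 assumes n: "CARD('n) = n + 2" "0 < n"
  and M: "finite_measure M" "sets M = sets sphere_borel" and N: "finite_measure N" "sets N = sets sphere_borel"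
  and I: "!!P R. P \<in> {M, N} ==> R \<in> {M, N} ==> (\<integral>\<^sup>+x. potential R x \<partial>P) = ennreal e" and e: "0 <= e"
 shows "M = N"
proof -
 define p where "p = real n / 2"
 have p: "0 < p" using n by (simp add: p_def)
 let ?D = "%P. distr P borel (%x::real ^ 'n. x)"
 let ?K = "%x y::real ^ 'n. if x \<bullet> y = 1 then \<infinity> else ennreal ((1 - x \<bullet> y) powr (- p))"
 have K: "?K x y = ennreal (2 powr p) * kern x y" if x: "norm x = 1" and y: "norm y = 1" for x y
 proof -
  have sq: "(norm (x - y))\<^sup>2 = 2 * (1 - x \<bullet> y)"
  proof -
   have "(norm (x - y))\<^sup>2 = (norm x)\<^sup>2 - 2 * (x \<bullet> y) + (norm y)\<^sup>2"
    by (simp add: power2_norm_eq_inner inner_diff inner_commute)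
   then show ?thesis using x y by simp
  qed
  show ?thesis
  proof (cases "x \<bullet> y = 1")
   case True
   then have "norm (x - y) = 0" using sq by simp
   then show ?thesis using True n by (simp add: kern_def ennreal_mult_top power_0_left)
  next
   case False
   then have "0 < norm (x - y)" using sq by (auto simp: zero_less_norm_iff)
   then have e1: "norm (x - y) ^ n = ((norm (x - y))\<^sup>2) powr p" unfolding p_def by (rule powr_half_sq[symmetric])
   have pos: "0 < 1 - x \<bullet> y" using \<open>0 < norm (x - y)\<close> sq zero_less_power[of "norm (x - y)" 2] by simp
   then have "(2 * (1 - x \<bullet> y)) powr p = 2 powr p * (1 - x \<bullet> y) powr p" by (intro powr_mult; simp)
   then have "norm (x - y) ^ n = 2 powr p * (1 - x \<bullet> y) powr p" by (simp only: e1 sq)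
   then have "kern x y = ennreal (inverse (2 powr p * (1 - x \<bullet> y) powr p))"
    using n \<open>0 < 1 - x \<bullet> y\<close> by (simp add: kern_def inverse_ennreal)
   then have "ennreal (2 powr p) * kern x y = ennreal (2 powr p * inverse (2 powr p * (1 - x \<bullet> y) powr p))"
    by (simp add: ennreal_mult')
   also have "2 powr p * inverse (2 powr p * (1 - x \<bullet> y) powr p) = (1 - x \<bullet> y) powr (- p)"
    by (simp add: powr_minus)
   finally show ?thesis using False by simp
  qed
 qed
 have sp: "space P = sphere 0 1" "(%x. x) \<in> borel_measurable P" "finite_measure P" "sets P = sets sphere_borel" if "P \<in> {M, N}" for P
  using that M N sets_eq_imp_space_eq[of P sphere_borel] measurable_sphereI[of "%x. x" borel P] by (auto simp: space_restrict_space)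
 have Km: "(%z. ?K (fst z) (snd z)) \<in> borel_measurable (borel \<Otimes>\<^sub>M borel)" by measurable
 have inner: "(\<integral>\<^sup>+y. ?K x y \<partial>?D R) = ennreal (2 powr p) * potential R x" if R: "R \<in> {M, N}" and x: "norm x = 1" for R x
 proof -
  have "(\<integral>\<^sup>+y. ?K x y \<partial>?D R) = (\<integral>\<^sup>+y. ?K x y \<partial>R)"
   by (rule nn_integral_distr[OF sp(2)[OF R]]) measurable
  also have "... = (\<integral>\<^sup>+y. ennreal (2 powr p) * kern x y \<partial>R)"
   by (rule nn_integral_cong, rule K[OF x]) (simp add: sp(1)[OF R])
  also have "... = ennreal (2 powr p) * potential R x"
   unfolding potential_def
   by (rule nn_integral_cmult, rule borel_measurable_kern[OF _ sp(2)[OF R]]) simp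
  finally show ?thesis .
 qed
 have "?D M = ?D N"
 proof (rule measure_eqI_energy[where p=p and c="2 powr p * e"])
  have fin: "finite_measure (?D P)" "AE x in ?D P. norm x = 1" if P: "P \<in> {M, N}" for P
  proof -
   interpret finite_measure P by (rule sp(3)[OF P])
   show "finite_measure (?D P)" by (rule finite_measure_distr[OF sp(2)[OF P]])
   show "AE x in ?D P. norm x = 1"
    using sp(1)[OF P] by (subst AE_distr_iff[OF sp(2)[OF P]]) (measurable, auto intro!: AE_I2)
  qed
  show "finite_measure (?D M)" "finite_measure (?D N)" "AE x in ?D M. norm x = 1" "AE x in ?D N. norm x = 1"
   by (rule fin; simp)+
  fix P' R' assume "P' \<in> {?D M, ?D N}" "R' \<in> {?D M, ?D N}"
  then obtain P R where P: "P \<in> {M, N}" "P' = ?D P" and R: "R \<in> {M, N}" "R' = ?D R" by auto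
  interpret R: finite_measure "?D R" by (rule fin[OF R(1)])
  have Km': "(%z. ?K (fst z) (snd z)) \<in> borel_measurable (borel \<Otimes>\<^sub>M ?D R)"
   using Km by (simp cong: measurable_cong_sets)
  have m: "(%x. \<integral>\<^sup>+y. ?K x y \<partial>?D R) \<in> borel_measurable borel"
   using R.borel_measurable_nn_integral_fst[OF Km'] by simp
  have "(\<integral>\<^sup>+x. \<integral>\<^sup>+y. ?K x y \<partial>?D R \<partial>?D P) = (\<integral>\<^sup>+x. \<integral>\<^sup>+y. ?K x y \<partial>?D R \<partial>P)"
   by (rule nn_integral_distr[OF sp(2)[OF P(1)]]) (use m in simp)
  also have "... = (\<integral>\<^sup>+x. ennreal (2 powr p) * potential R x \<partial>P)"
   by (rule nn_integral_cong, rule inner[OF R(1)]) (simp add: sp(1)[OF P(1)])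
  also have "... = ennreal (2 powr p) * ennreal e"
  proof -
   have "potential R \<in> borel_measurable P"
    by (rule borel_measurable_potential[OF _ sp(2)[OF P(1)] sp(2)[OF R(1)]])
      (rule finite_measure.axioms(1)[OF sp(3)[OF R(1)]])
   then show ?thesis by (simp add: nn_integral_cmult I[OF P(1) R(1)])
  qed
  also have "... = ennreal (2 powr p * e)" by (simp add: ennreal_mult')
  finally show "(\<integral>\<^sup>+x. \<integral>\<^sup>+y. ?K x y \<partial>R' \<partial>P') = ennreal (2 powr p * e)" unfolding P(2) R(2) .
 qed (use p in auto)
 show "M = N"
 proof (rule measure_eqI)
  show "sets M = sets N" by (simp add: M N)
  fix A assume A: "A \<in> sets M"
  have Ab: "A \<in> sets borel" "A \<subseteq> sphere 0 1" using A unfolding M(2) sets_restrict_space by auto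
  have em: "emeasure (?D P) A = emeasure P A" if P: "P \<in> {M, N}" for P
   using Ab by (subst emeasure_distr[OF sp(2)[OF P]]) (auto simp: sp(1)[OF P] Int_absorb2)
  show "emeasure M A = emeasure N A" using em[of M] em[of N] \<open>?D M = ?D N\<close> by simp
 qed
qed

lemma tail_kernel_measurable:
 fixes m :: "real measure"
 assumes m: "finite_measure m" "sets m = sets borel"
 shows "(%w. \<integral>\<^sup>+t. (if w < t then ennreal (1 / (sqrt t ^ (n - 1) * sqrt (t - w))) else 0) \<partial>m) \<in> borel_measurable borel"
proof -
 interpret m: finite_measure m by (rule m(1))
 note [measurable_cong] = m(2)
 show ?thesis by measurable
qed

section \<open>The equilibrium condition on the cap as an Abel equation\<close>

text \<open>The field enters through its latitude profile on the open cap and its continuity on the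
  support. Nothing is said about symmetry of mu, which has to be derived.\<close>

locale cap_equilibrium = abel_profile n "hav \<alpha>" Cq q q' q'' for n \<alpha> Cq q q' q'' +
 fixes Q :: "real ^ 'n::finite => ennreal" and \<mu> :: "(real ^ 'n) measure" and k :: 'n
 assumes card: "CARD('n) = n + 2" and alpha: "0 < \<alpha>" "\<alpha> <= pi"
  and eqm: "equilibrium_measure Q \<mu>" and Qm: "Q \<in> borel_measurable sphere_borel"
  and Qq: "!!x. norm x = 1 ==> 0 < (1 - x $ k) / 2 ==> (1 - x $ k) / 2 < hav \<alpha> ==> Q x = ennreal (q ((1 - x $ k) / 2))"
  and q0: "!!t. 0 < t ==> t < hav \<alpha> ==> 0 <= q t"
  and cap: "supp \<mu> = north_cap k \<alpha>"
  and Qcont: "!!x. x \<in> supp \<mu> ==> (Q \<longlongrightarrow> Q x) (at x within sphere 0 1)"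
begin

declare Mfun_measurable [measurable del] gamma_cut_measurable [measurable del] abel_W_measurable [measurable del]
 sets_m [measurable_cong del]

abbreviation "\<sigma> \<equiv> surface_measure :: (real ^ 'n) measure"

abbreviation "lat \<equiv> %x::real ^ 'n. (1 - x $ k) / 2"

text \<open>The area of the unit sphere of dimension n - 1; \<open>C2\<close> below is the constant
  in the latitude density of surface measure.\<close>

definition "C1 = real n * unit_ball_vol n"
definition "C2 = real n * unit_ball_vol n * Beta (real n / 2) (1 / 2) * 2 ^ n"
text \<open>The constant value of U^mu + Q in the equilibrium condition.\<close>

definition "c = enn2real (energy \<mu> + (\<integral>\<^sup>+x. Q x \<partial>\<mu>))"
definition "b = c * Beta ((real n + 1) / 2) (1 / 2)"
text \<open>After testing, \<open>C2\<close> appears on the side of the field and pi times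
  \<open>C1\<close> on the side of the potential; this is their ratio.\<close>

definition "\<kappa> = C2 / (pi * C1)"
definition "m = distr \<mu> borel lat"

lemma C_pos: "0 < C1" "0 < C2" "0 < \<kappa>"
proof -
 show 1: "0 < C1" "0 < C2" using n by (simp_all add: C1_def C2_def Beta_real_pos unit_ball_vol_pos)
 then show "0 < \<kappa>" by (simp add: \<kappa>_def)
qed

lemmas mu = unit_sphere_measureD[OF eqm[unfolded equilibrium_measure_def, THEN conjunct1]]

lemma usm: "unit_sphere_measure \<mu>" using eqm by (simp add: equilibrium_measure_def)

sublocale mu: finite_measure \<mu> by (rule mu(4))
sublocale sig: finite_measure \<sigma> by (rule finite_surface_measure[OF card n])

lemma lat_borel: "lat \<in> borel_measurable borel" by measurable

lemma lat_measurable [measurable]: "lat \<in> borel_measurable \<mu>" "lat \<in> borel_measurable \<sigma>"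
 by (rule measurable_sphereI[OF lat_borel mu(1)], rule measurable_sphereI[OF lat_borel sets_surface_measure])

lemma Q_measurable [measurable]: "Q \<in> borel_measurable \<mu>" "Q \<in> borel_measurable \<sigma>"
 using Qm by (simp_all add: measurable_cong_sets[OF mu(1) refl] measurable_cong_sets[OF sets_surface_measure refl])

lemma potential_measurable [measurable]: "potential \<mu> \<in> borel_measurable \<mu>" "potential \<mu> \<in> borel_measurable \<sigma>"
 by (rule borel_measurable_potential[OF mu.sigma_finite_measure_axioms mu(5) mu(5)],
   rule borel_measurable_potential[OF mu.sigma_finite_measure_axioms surface_id_measurable mu(5)])

lemma fin: "weighted_energy Q \<mu> < \<infinity>"
proof (rule weighted_energy_finite[OF card n eqm Qm a])
 fix x :: "real ^ 'n" assume x: "norm x = 1" "0 < lat x" "lat x < hav \<alpha>"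
 show "Q x <= ennreal Cq" unfolding Qq[OF x] using q_bound(1)[OF x(2,3)] by (intro ennreal_leI) auto
qed

lemma c_eq: "energy \<mu> + (\<integral>\<^sup>+x. Q x \<partial>\<mu>) = ennreal c" "0 <= c"
 using weighted_energy_finiteD[OF fin] by (simp_all add: c_def less_top)

lemma b_nonneg: "0 <= b"
 unfolding b_def using c_eq(2) by (intro mult_nonneg_nonneg less_imp_le[OF Beta_real_pos]) auto

lemma hav_polar: "norm x = 1 ==> hav (polar_angle k x) = lat x" "norm x = 1 ==> 0 <= polar_angle k x" "norm x = 1 ==> polar_angle k x <= pi"
 using abs_component_le_1[of x k] by (auto simp: hav_def polar_angle_def abs_le_iff intro!: arccos_lbound arccos_ubound)

lemma cap_iff: "norm x = 1 ==> polar_angle k x <= \<alpha> \<longleftrightarrow> lat x <= hav \<alpha>"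
 using hav_polar[of x] alpha hav_less_imp_less[of \<alpha> "polar_angle k x"] hav_strict_mono[of \<alpha> "polar_angle k x"]
 by (metis less_imp_le not_le)

text \<open>The poles carry no mass because a measure of finite energy has no atoms.\<close>

lemma AE_cap: "AE x in \<mu>. 0 < lat x \<and> lat x <= hav \<alpha> \<and> lat x < 1"
proof -
 have d: "3 <= CARD('n)" using card n by simp
 have at: "AE x in \<mu>. x ~= e" if "norm e = 1" for e
  by (rule finite_energy_no_atoms[OF d usm weighted_energy_finiteD(1)[OF fin] that])
 have "AE x in \<mu>. x ~= axis k 1" "AE x in \<mu>. x ~= axis k (- 1)"
  by (rule at; simp add: norm_eq_1 inner_axis_axis)+
 then show ?thesis
  using AE_in_supp[OF mu(1)] AE_space
 proof eventually_elim
  case (elim x)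
  then have x: "norm x = 1" using mu(2) by simp
  have "lat x <= hav \<alpha>" using elim(3) x cap_iff[OF x] by (simp add: cap north_cap_def)
  moreover have "x $ k ~= 1" "x $ k ~= - 1"
   using nth_eq_1_imp_axis[OF x, of 1 k] nth_eq_1_imp_axis[OF x, of "- 1" k] elim by auto
  ultimately show ?case using component_le_norm_cart[of x k] x by (auto simp: abs_le_iff)
 qed
qed

text \<open>The lower bound comes from perturbation and holds almost everywhere for surface measure;
  the upper bound holds at every point of the support, which is the cap.\<close>

lemma potential_eq: "AE x in \<sigma>. 0 < lat x \<and> lat x < hav \<alpha> \<longrightarrow> potential \<mu> x + Q x = ennreal c"
proof -
 have ge: "AE x in \<sigma>. ennreal c <= potential \<mu> x + Q x"
  using equilibrium_AE_ge[OF eqm fin Qm sig.finite_measure_axioms sets_surface_measure energy_surface_measure[OF card n]]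
  by (simp add: c_eq)
 have le: "AE x in \<mu>. potential \<mu> x + Q x <= ennreal c"
  using equilibrium_AE_eq[OF eqm fin Qm] by eventually_elim (simp add: c_eq)
 show ?thesis
  using ge AE_surface_norm
 proof eventually_elim
  case (elim x)
  show ?case
  proof
   assume t: "0 < lat x \<and> lat x < hav \<alpha>"
   then have xs: "x \<in> supp \<mu>" using cap_iff[OF elim(2)] elim(2) by (simp add: cap north_cap_def)
   have "potential \<mu> x + Q x <= ennreal c"
    by (rule potential_le_on_supp[OF usm le xs Qcont[OF xs]])
   then show "potential \<mu> x + Q x = ennreal c" using elim(1) by simp
  qed
 qed
qed

lemma m_facts: "finite_measure m" "sets m = sets borel" "AE t in m. 0 < t \<and> t <= hav \<alpha>"
proof -
 show "finite_measure m" unfolding m_def by (rule mu.finite_measure_distr) measurable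
 show "sets m = sets borel" by (simp add: m_def)
 show "AE t in m. 0 < t \<and> t <= hav \<alpha>"
  unfolding m_def by (subst AE_distr_iff) (measurable, use AE_cap in \<open>auto elim: eventually_mono\<close>)
qed

lemma half_minus: "real n / 2 - 1 / 2 = real (n - 1) / 2"
 using n by (cases n) (auto simp: field_simps)

text \<open>The equilibrium condition is tested with a zonal function h whose Abel integral in
  \<open>potential_test\<close> is pi for w < z and 0 beyond. The potential then yields an integral
  over (0, z), the field yields \<open>abel_G\<close> and the constant yields a Beta
  integral.\<close>

lemma abel_equation:
 assumes z: "0 < z" "z < hav \<alpha>"
 shows "(II w. ennreal (abel_W w) * (\<integral>\<^sup>+t. (if w < t then ennreal (1 / (sqrt t ^ (n - 1) * sqrt (t - w))) else 0) \<partial>m) * indicator {0<..<z} w)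
    + ennreal (\<kappa> * abel_G n q z) = ennreal (\<kappa> * (b * z powr (real n / 2)))"
proof -
 have z1: "z < 1" using z a by simp
 define h where "h = (%s::real. if 0 < s \<and> s < z then ennreal (1 / (sqrt (1 - s) ^ (n - 1) * sqrt (z - s))) else 0)"
 have [measurable]: "h \<in> borel_measurable borel" unfolding h_def by measurable
 let ?M = "%w. (\<integral>\<^sup>+t. (if w < t then ennreal (1 / (sqrt t ^ (n - 1) * sqrt (t - w))) else 0) \<partial>m)"
 interpret m: finite_measure m by (rule m_facts(1))
 have [measurable]: "?M \<in> borel_measurable borel" by (rule tail_kernel_measurable[OF m_facts(1,2)])
 have [measurable]: "abel_W \<in> borel_measurable borel" unfolding abel_W_def[abs_def] by measurable
 let ?I = "(II w. ennreal (abel_W w) * ?M w * indicator {0<..<z} w)"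
 \<comment> \<open>The latitude density of surface measure cancels the power of 1 - s in h and
   leaves a pure Abel kernel at z.\<close>
 have hq: "h s * ennreal (C2 * sqrt (s * (1 - s)) ^ (n - 1)) = ennreal C2 * ennreal (s powr (real n / 2 - 1 / 2) * (z - s) powr (- 1 / 2))"
  if s: "0 < s" "s < z" for s
 proof -
  have ne: "0 < sqrt (1 - s) ^ (n - 1)" using s z1 by simp
  have e1: "s powr (real n / 2 - 1 / 2) = sqrt s ^ (n - 1)" unfolding half_minus using sqrt_power_powr[OF s(1), of "n - 1"] by simp
  have e2: "(z - s) powr (- 1 / 2) = 1 / sqrt (z - s)" using s powr_minus_divide[of "z - s" "1 / 2"] by (simp add: powr_half_sqrt)
  have "1 / (B * D) * (C * (A * B)) = C * (A * (1 / D))" if "0 < B" for A B C D :: real using that by simp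
  from this[OF ne, of "sqrt (z - s)" C2 "sqrt s ^ (n - 1)"]
  have e: "1 / (sqrt (1 - s) ^ (n - 1) * sqrt (z - s)) * (C2 * sqrt (s * (1 - s)) ^ (n - 1)) = C2 * (s powr (real n / 2 - 1 / 2) * (z - s) powr (- 1 / 2))"
   unfolding e1 e2 real_sqrt_mult power_mult_distrib .
  have "h s * ennreal (C2 * sqrt (s * (1 - s)) ^ (n - 1)) = ennreal (1 / (sqrt (1 - s) ^ (n - 1) * sqrt (z - s)) * (C2 * sqrt (s * (1 - s)) ^ (n - 1)))"
   using s z1 by (simp add: h_def ennreal_mult'[symmetric])
  also have "... = ennreal C2 * ennreal (s powr (real n / 2 - 1 / 2) * (z - s) powr (- 1 / 2))"
   unfolding e using C_pos(2) by (intro ennreal_mult') simp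
  finally show ?thesis .
 qed
 \<comment> \<open>The powers of 1 - s cancel here too, and two half-order kernels meet between w
   and z; their integral is pi for every w < z.\<close>
 have inner: "(II s. (if w < s \<and> s < 1 then h s * ennreal (sqrt (1 - s) ^ (n - 1) / sqrt (s - w)) else 0)) = (if w < z then ennreal pi else 0)"
  if w: "0 < w" for w
 proof (cases "w < z")
  case True
  have "(II s. (if w < s \<and> s < 1 then h s * ennreal (sqrt (1 - s) ^ (n - 1) / sqrt (s - w)) else 0)) =
   (II s. ennreal ((s - w) powr (- 1 / 2) * (z - s) powr (- 1 / 2)) * indicator {w<..<z} s)"
  proof (rule nn_integral_cong, goal_cases)
   case (1 s)
   show ?case
   proof (cases "w < s \<and> s < z")
    case True
    then have s: "0 < s" "s < z" "s < 1" "w < s" using w z1 by auto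
    have ne: "0 < sqrt (1 - s) ^ (n - 1)" using s by simp
    have e: "(z - s) powr (- 1 / 2) = 1 / sqrt (z - s)" "(s - w) powr (- 1 / 2) = 1 / sqrt (s - w)"
     using s powr_minus_divide[of "z - s" "1 / 2"] powr_minus_divide[of "s - w" "1 / 2"] by (simp_all add: powr_half_sqrt)
    have "1 / (B * D) * (B / E) = 1 / E * (1 / D)" if "0 < B" for B D E :: real using that by simp
    from this[OF ne, of "sqrt (z - s)" "sqrt (s - w)"]
    have "ennreal (1 / (sqrt (1 - s) ^ (n - 1) * sqrt (z - s))) * ennreal (sqrt (1 - s) ^ (n - 1) / sqrt (s - w)) = ennreal ((s - w) powr (- 1 / 2) * (z - s) powr (- 1 / 2))"
     using s unfolding e by (subst ennreal_mult'[symmetric]) simp_all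
    then show ?thesis using s by (simp add: h_def)
   next
    case False
    then show ?thesis by (auto simp: h_def)
   qed
  qed
  then show ?thesis using abel_half_kernel[OF True] True by simp
 next
  case False
  then have zero: "(if w < s \<and> s < 1 then h s * ennreal (sqrt (1 - s) ^ (n - 1) / sqrt (s - w)) else 0) = 0" for s
   by (auto simp: h_def)
  show ?thesis unfolding zero using False by simp
 qed
 have T1: "(\<integral>\<^sup>+x. h (lat x) * potential \<mu> x \<partial>\<sigma>) = ennreal (pi * C1) * ?I"
 proof -
  have lat01: "AE y in \<mu>. 0 < lat y \<and> lat y < 1" using AE_cap by eventually_elim auto
  have "(\<integral>\<^sup>+x. h (lat x) * potential \<mu> x \<partial>\<sigma>) = (II w. (II s. (if w < s \<and> s < 1 then h s * ennreal (sqrt (1 - s) ^ (n - 1) / sqrt (s - w)) else 0)) *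
   ennreal (real n * unit_ball_vol n * (sqrt (w / (1 - w)) ^ n / w)) * ?M w * indicator {0<..<1} w)"
   unfolding m_def by (rule potential_test[OF card n _ usm lat01]) measurable
  also have "... = (II w. ennreal (pi * C1) * (ennreal (abel_W w) * ?M w * indicator {0<..<z} w))"
  proof (rule nn_integral_cong, goal_cases)
   case (1 w)
   show ?case
   proof (cases "0 < w")
    case w: True
    have e: "ennreal (real n * unit_ball_vol n * (sqrt (w / (1 - w)) ^ n / w)) = ennreal C1 * ennreal (abel_W w)"
     unfolding abel_W_def C1_def[symmetric] using C_pos(1) by (intro ennreal_mult') simp
    have e2: "ennreal (pi * C1) = ennreal pi * ennreal C1" by (intro ennreal_mult') simp
    show ?thesis unfolding inner[OF w] e e2 using w z1 by (auto simp: indicator_def mult_ac)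
   qed (simp add: indicator_def)
  qed
  also have "... = ennreal (pi * C1) * ?I" by (rule nn_integral_cmult) measurable
  finally show ?thesis .
 qed
 have T2: "(\<integral>\<^sup>+x. h (lat x) * Q x \<partial>\<sigma>) = ennreal (C2 * abel_G n q z)"
 proof -
  have "(\<integral>\<^sup>+x. h (lat x) * Q x \<partial>\<sigma>) = (\<integral>\<^sup>+x. (%s. h s * ennreal (q s)) (lat x) \<partial>\<sigma>)"
  proof (rule nn_integral_cong)
   fix x :: "real ^ 'n" assume "x \<in> space \<sigma>"
   then have x: "norm x = 1" by (simp add: space_surface_measure)
   show "h (lat x) * Q x = (%s. h s * ennreal (q s)) (lat x)"
    using Qq[OF x] z by (cases "0 < lat x \<and> lat x < z") (auto simp: h_def)
  qed
  also have "... = (II s. h s * ennreal (q s) * ennreal (C2 * sqrt (s * (1 - s)) ^ (n - 1)) * indicator {0<..<1} s)"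
   unfolding C2_def by (rule nn_integral_surface_profile[OF card n]) measurable
  also have "... = (II s. ennreal C2 * (ennreal (q s) * (ennreal (s powr (real n / 2 - 1 / 2) * (z - s) powr (- 1 / 2)) * indicator {0<..<z} s)))"
  proof (rule nn_integral_cong, goal_cases)
   case (1 s)
   show ?case
   proof (cases "0 < s \<and> s < z")
    case True
    have "h s * ennreal (q s) * ennreal (C2 * sqrt (s * (1 - s)) ^ (n - 1)) = ennreal (q s) * (h s * ennreal (C2 * sqrt (s * (1 - s)) ^ (n - 1)))"
     by (simp only: mult_ac)
    also have "... = ennreal C2 * (ennreal (q s) * ennreal (s powr (real n / 2 - 1 / 2) * (z - s) powr (- 1 / 2)))"
     using hq True by (simp only: mult_ac)
    finally show ?thesis using True z1 by simp
   qed (auto simp: h_def indicator_def)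
  qed
  also have "... = ennreal C2 * ennreal (abel_G n q z)"
   by (subst nn_integral_cmult, measurable, subst abel_G_nn_integral[OF q0 z], auto)
  also have "... = ennreal (C2 * abel_G n q z)" using C_pos by (simp add: ennreal_mult')
  finally show ?thesis .
 qed
 have T3: "(\<integral>\<^sup>+x. h (lat x) * (potential \<mu> x + Q x) \<partial>\<sigma>) = ennreal (C2 * (b * z powr (real n / 2)))"
 proof -
  have "(\<integral>\<^sup>+x. h (lat x) * (potential \<mu> x + Q x) \<partial>\<sigma>) = (\<integral>\<^sup>+x. (%s. ennreal c * h s) (lat x) \<partial>\<sigma>)"
  proof (rule nn_integral_cong_AE, goal_cases)
   case 1
   show ?case
    using potential_eq
   proof eventually_elim
    case (elim x)
    show ?case using elim z by (cases "0 < lat x \<and> lat x < z") (auto simp: h_def mult.commute)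
   qed
  qed
  also have "... = (II s. ennreal c * h s * ennreal (C2 * sqrt (s * (1 - s)) ^ (n - 1)) * indicator {0<..<1} s)"
   unfolding C2_def by (rule nn_integral_surface_profile[OF card n]) measurable
  also have "... = (II s. ennreal (c * C2) * (ennreal ((s - 0) powr ((real n + 1) / 2 - 1) * (z - s) powr (1 / 2 - 1)) * indicator {0<..<z} s))"
  proof (rule nn_integral_cong, goal_cases)
   case (1 s)
   show ?case
   proof (cases "0 < s \<and> s < z")
    case True
    have e: "(real n + 1) / 2 - 1 = real n / 2 - 1 / 2" "(1 / 2 - 1 :: real) = - 1 / 2" by (simp_all add: field_simps)
    have e2: "ennreal (c * C2) = ennreal c * ennreal C2" using c_eq(2) by (rule ennreal_mult')
    have "ennreal c * h s * ennreal (C2 * sqrt (s * (1 - s)) ^ (n - 1)) = ennreal c * (ennreal C2 * ennreal (s powr (real n / 2 - 1 / 2) * (z - s) powr (- 1 / 2)))"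
     using hq True by (simp only: mult.assoc)
    then show ?thesis unfolding e e2 using True z1 by (simp add: mult.assoc)
   qed (auto simp: h_def indicator_def)
  qed
  also have "... = ennreal (c * C2) * ennreal ((z - 0) powr ((real n + 1) / 2 + 1 / 2 - 1) * Beta ((real n + 1) / 2) (1 / 2))"
   using z by (subst nn_integral_cmult, measurable, subst nn_integral_Beta) auto
  also have "(real n + 1) / 2 + 1 / 2 - 1 = real n / 2" by (simp add: field_simps)
  also have "ennreal (c * C2) * ennreal ((z - 0) powr (real n / 2) * Beta ((real n + 1) / 2) (1 / 2)) = ennreal (C2 * (b * z powr (real n / 2)))"
   using c_eq(2) C_pos(2) by (subst ennreal_mult'[symmetric]) (simp_all add: b_def mult_ac)
  finally show ?thesis .
 qed
 have "ennreal (pi * C1) * ?I + ennreal (C2 * abel_G n q z) = ennreal (C2 * (b * z powr (real n / 2)))"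
  unfolding T1[symmetric] T2[symmetric] T3[symmetric] by (subst nn_integral_add[symmetric]) (measurable, simp add: distrib_left)
 then have e0: "ennreal (1 / (pi * C1)) * (ennreal (pi * C1) * ?I + ennreal (C2 * abel_G n q z)) = ennreal (1 / (pi * C1)) * ennreal (C2 * (b * z powr (real n / 2)))"
  by (simp only:)
 have one: "ennreal (1 / (pi * C1)) * ennreal (pi * C1) = 1" using C_pos(1) by (simp add: ennreal_mult'[symmetric])
 have sc: "ennreal (1 / (pi * C1)) * ennreal (C2 * y) = ennreal (\<kappa> * y)" for y
  using C_pos(1) by (simp add: ennreal_mult'[symmetric] \<kappa>_def)
 have l: "ennreal (1 / (pi * C1)) * (ennreal (pi * C1) * x + ennreal (C2 * y)) = x + ennreal (\<kappa> * y)" for x y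
  by (simp only: distrib_left sc mult.assoc[symmetric] one mult_1)
 show ?thesis using e0 unfolding l sc .
qed

lemma m_eq: "m = density lborel (%s. ennreal (sqrt s ^ (n - 1)) * (ennreal (\<kappa> / pi * (abel_density b s * indicator {0<..<hav \<alpha>} s))))"
 by (rule abel_inversion[OF m_facts b_nonneg C_pos(3)]) (use q0 abel_equation in auto)

lemma density_nonneg: "0 <= abel_density b s" if "0 < s" "s < hav \<alpha>"
 by (rule abel_density_nonneg[OF m_facts b_nonneg C_pos(3) _ _ that]) (use q0 abel_equation in auto)

end

section \<open>The zonal candidate and its identification with mu\<close>

context cap_equilibrium
begin

text \<open>The density of \<open>m\<close> divided by the latitude density of surface measure, as
  \<open>fe_weight\<close> verifies.\<close>

definition "dens s = 1 / (pi\<^sup>2 * C1) * ((1 - s) powr (- ((real n - 1) / 2)) * abel_density b s)"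

definition "fe s = ennreal (dens s * indicator {0<..<hav \<alpha>} s)"

lemma abel_density_cut_measurable [measurable]: "(%s. abel_density b' s * indicator {0<..<hav \<alpha>} s) \<in> borel_measurable borel"
 by (rule abel_density_measurable) simp

lemma dens_cut_measurable [measurable]: "(%s. dens s * indicator {0<..<hav \<alpha>} s) \<in> borel_measurable borel"
proof -
 have "(%s. dens s * indicator {0<..<hav \<alpha>} s) = (%s. 1 / (pi\<^sup>2 * C1) * ((1 - s) powr (- ((real n - 1) / 2)) * (abel_density b s * indicator {0<..<hav \<alpha>} s)))"
  by (simp add: dens_def mult.assoc)
 then show ?thesis by simp
qed

lemma fe_measurable [measurable]: "fe \<in> borel_measurable borel"
 unfolding fe_def[abs_def] by measurable

lemma fe_pos: "0 < fe s ==> s \<in> {0<..<hav \<alpha>}"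
 by (cases "s \<in> {0<..<hav \<alpha>}") (simp_all add: fe_def)

lemma fe_weight:
 "fe s * (ennreal (C2 * sqrt (s * (1 - s)) ^ (n - 1)) * indicator {0<..<1} s) =
  ennreal (sqrt s ^ (n - 1)) * (ennreal (\<kappa> / pi * (abel_density b s * indicator {0<..<hav \<alpha>} s)))"
proof (cases "s \<in> {0<..<hav \<alpha>}")
 case True
 then have s: "0 < s" "s < hav \<alpha>" "s < 1" using a by auto
 define T where "T = sqrt (1 - s) ^ (n - 1)"
 have T: "0 < T" using s by (simp add: T_def)
 have "(1 - s) powr (- ((real n - 1) / 2)) = 1 / T"
  using sqrt_power_powr[of "1 - s" "n - 1"] s n by (simp add: T_def powr_minus_divide of_nat_diff)
 then have d: "dens s = 1 / (pi\<^sup>2 * C1) * (1 / T * abel_density b s)" by (simp only: dens_def)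
 have gen: "1 / (P\<^sup>2 * C) * (1 / T * A) * (D * (S * T)) = S * (D / (P * C) / P * A)" if "0 < T" for P C A D S T :: real
  using that by (simp add: power2_eq_square mult_ac)
 have ad: "0 <= abel_density b s" by (rule density_nonneg[OF s(1,2)])
 have "fe s * (ennreal (C2 * sqrt (s * (1 - s)) ^ (n - 1)) * indicator {0<..<1} s) =
  ennreal (1 / (pi\<^sup>2 * C1) * (1 / T * abel_density b s) * (C2 * (sqrt s ^ (n - 1) * T)))"
  using s ad T C_pos by (simp add: fe_def d T_def real_sqrt_mult power_mult_distrib ennreal_mult'[symmetric])
 also have "... = ennreal (sqrt s ^ (n - 1) * (\<kappa> / pi * abel_density b s))"
  unfolding gen[OF T] \<kappa>_def ..
 also have "... = ennreal (sqrt s ^ (n - 1)) * ennreal (\<kappa> / pi * abel_density b s)"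
  using s by (intro ennreal_mult') simp
 finally show ?thesis using s by simp
qed (simp add: fe_def)

text \<open>The zonal measure with the same distribution of latitudes as mu.\<close>

definition "\<nu> = density \<sigma> (%x. fe (lat x))"

lemma nn_integral_nu:
 assumes [measurable]: "h \<in> borel_measurable borel"
 shows "(\<integral>\<^sup>+x. h (lat x) \<partial>\<nu>) = (\<integral>\<^sup>+t. h t \<partial>m)"
proof -
 have "(\<integral>\<^sup>+x. h (lat x) \<partial>\<nu>) = (\<integral>\<^sup>+x. (%s. fe s * h s) (lat x) \<partial>\<sigma>)"
  unfolding \<nu>_def by (rule nn_integral_density) measurable
 also have "... = (II s. fe s * h s * ennreal (C2 * sqrt (s * (1 - s)) ^ (n - 1)) * indicator {0<..<1} s)"
  unfolding C2_def by (rule nn_integral_surface_profile[OF card n]) measurable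
 also have "... = (II s. ennreal (sqrt s ^ (n - 1)) * (ennreal (\<kappa> / pi * (abel_density b s * indicator {0<..<hav \<alpha>} s))) * h s)"
 proof (rule nn_integral_cong, goal_cases)
  case (1 s)
  show ?case
   unfolding fe_weight[symmetric] by (simp only: mult_ac)
 qed
 also have "... = (\<integral>\<^sup>+t. h t \<partial>m)"
  by (subst m_eq, rule nn_integral_density[symmetric]) measurable
 finally show ?thesis .
qed

lemma nn_integral_mu:
 assumes "h \<in> borel_measurable borel"
 shows "(\<integral>\<^sup>+x. h (lat x) \<partial>\<mu>) = (\<integral>\<^sup>+t. h t \<partial>m)"
 unfolding m_def by (rule nn_integral_distr[symmetric, OF lat_measurable(1)]) (use assms in simp)

text \<open>Since m now has a density, the boundary parallel of the cap is known to be null.\<close>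

lemma AE_m: "AE t in m. 0 < t \<and> t < hav \<alpha>"
 by (subst m_eq, subst AE_density) (measurable, auto intro!: AE_I2 simp: indicator_def split: if_splits)

lemma AE_mu: "AE x in \<mu>. 0 < lat x \<and> lat x < hav \<alpha>"
proof -
 have s: "{t \<in> space borel. 0 < t \<and> t < hav \<alpha>} \<in> sets borel" by measurable
 show ?thesis using AE_m unfolding m_def AE_distr_iff[OF lat_measurable(1) s] .
qed

lemma AE_nu: "AE x in \<nu>. 0 < lat x \<and> lat x < hav \<alpha> \<and> norm x = 1"
proof -
 have "AE x in \<sigma>. 0 < fe (lat x) \<longrightarrow> 0 < lat x \<and> lat x < hav \<alpha> \<and> norm x = 1"
  using AE_surface_norm by eventually_elim (auto simp: fe_def indicator_def split: if_splits)
 then show ?thesis unfolding \<nu>_def by (subst AE_density) measurable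
qed

lemma usm_nu: "unit_sphere_measure \<nu>"
proof -
 have "emeasure \<nu> (space \<nu>) = (\<integral>\<^sup>+x. (%_. 1) (lat x) \<partial>\<nu>)" by simp
 also have "... = (\<integral>\<^sup>+t. (%_. 1) t \<partial>m)" by (rule nn_integral_nu) simp
 also have "... = (\<integral>\<^sup>+x. (%_. 1) (lat x) \<partial>\<mu>)" by (rule nn_integral_mu[symmetric]) simp
 also have "... = 1" using mu(3) by simp
 finally show ?thesis by (simp add: unit_sphere_measure_def \<nu>_def sets_surface_measure)
qed

lemmas nu = unit_sphere_measureD[OF usm_nu]

definition "u t = (II w. (II s. (if w < s \<and> s < 1 then fe s * ennreal (sqrt (1 - s) ^ (n - 1) / sqrt (s - w)) else 0)) *
   ennreal (real n * unit_ball_vol n * (sqrt (w / (1 - w)) ^ n / w)) * (if w < t then ennreal (1 / (sqrt t ^ (n - 1) * sqrt (t - w))) else 0) *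
   indicator {0<..<1} w)"

lemma u_measurable [measurable]: "u \<in> borel_measurable borel"
proof -
 have [measurable]: "(%w. II s. (if w < s \<and> s < 1 then fe s * ennreal (sqrt (1 - s) ^ (n - 1) / sqrt (s - w)) else 0)) \<in> borel_measurable borel"
  by measurable
 show ?thesis unfolding u_def[abs_def] by measurable
qed

lemma potential_nu: "potential \<nu> y = u (lat y)" if y: "norm y = 1" "0 < lat y" "lat y < 1"
proof -
 have km: "(%x. kern y x) \<in> borel_measurable \<sigma>" by (rule borel_measurable_kern[OF _ surface_id_measurable]) simp
 have yk: "y $ k = 1 - 2 * lat y" by (simp add: field_simps)
 have "potential \<nu> y = (\<integral>\<^sup>+x. fe (lat x) * kern y x \<partial>\<sigma>)"
  unfolding potential_def \<nu>_def by (rule nn_integral_density[OF _ km]) measurable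
 also have "... = (\<integral>\<^sup>+x. fe (lat x) * kern x y \<partial>\<sigma>)" by (simp only: kern_commute[of y])
 also have "... = u (lat y)" unfolding u_def by (rule surface_potential_Fubini[OF card n fe_measurable y(2,3,1) yk])
 finally show ?thesis .
qed

text \<open>The potential of nu is a function of latitude, so mu and nu give it the same integral.
  The potential of mu equals c - Q almost everywhere on the cap for surface measure, hence nu-almost
  everywhere, and Q has the same integral under both measures; so the integral of U^mu under nu is
  the energy of mu. All mutual energies coincide.\<close>

lemma mu_eq_nu: "\<mu> = \<nu>"
proof -
 interpret nu: finite_measure \<nu> by (rule nu(4))
 have a1: "t < 1" if "t < hav \<alpha>" for t using that a by simp
 have "(\<integral>\<^sup>+x. potential \<nu> x \<partial>\<mu>) = (\<integral>\<^sup>+x. u (lat x) \<partial>\<mu>)"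
 proof (rule nn_integral_cong_AE, goal_cases)
  case 1
  show ?case
   using AE_mu AE_space
  proof eventually_elim
   case (elim x)
   then show ?case using mu(2) a1[of "lat x"] by (intro potential_nu) auto
  qed
 qed
 also have "... = (\<integral>\<^sup>+t. u t \<partial>m)" by (rule nn_integral_mu) measurable
 finally have numu: "(\<integral>\<^sup>+x. potential \<nu> x \<partial>\<mu>) = (\<integral>\<^sup>+t. u t \<partial>m)" .
 have "(\<integral>\<^sup>+x. potential \<nu> x \<partial>\<nu>) = (\<integral>\<^sup>+x. u (lat x) \<partial>\<nu>)"
 proof (rule nn_integral_cong_AE, goal_cases)
  case 1
  show ?case
   using AE_nu
  proof eventually_elim
   case (elim x)
   then show ?case using a1[of "lat x"] by (intro potential_nu) auto
  qed
 qed
 also have "... = (\<integral>\<^sup>+t. u t \<partial>m)" by (rule nn_integral_nu) measurable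
 finally have nunu: "(\<integral>\<^sup>+x. potential \<nu> x \<partial>\<nu>) = (\<integral>\<^sup>+t. u t \<partial>m)" .
 have comm: "(\<integral>\<^sup>+x. potential \<mu> x \<partial>\<nu>) = (\<integral>\<^sup>+x. potential \<nu> x \<partial>\<mu>)"
  by (rule nn_integral_potential_commute[OF mu.sigma_finite_measure_axioms nu.sigma_finite_measure_axioms mu(5) nu(5)])
 define J where "J = (\<integral>\<^sup>+t. ennreal (q t) \<partial>m)"
 have "(\<integral>\<^sup>+x. Q x \<partial>\<mu>) = (\<integral>\<^sup>+x. (%t. ennreal (q t)) (lat x) \<partial>\<mu>)"
 proof (rule nn_integral_cong_AE, goal_cases)
  case 1
  show ?case
   using AE_mu AE_space
  proof eventually_elim
   case (elim x)
   then show ?case using mu(2) Qq[of x] by auto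
  qed
 qed
 also have "... = J" unfolding J_def by (rule nn_integral_mu) measurable
 finally have Qmu: "(\<integral>\<^sup>+x. Q x \<partial>\<mu>) = J" .
 have "(\<integral>\<^sup>+x. Q x \<partial>\<nu>) = (\<integral>\<^sup>+x. (%t. ennreal (q t)) (lat x) \<partial>\<nu>)"
 proof (rule nn_integral_cong_AE, goal_cases)
  case 1
  show ?case
   using AE_nu by eventually_elim (use Qq in auto)
 qed
 also have "... = J" unfolding J_def by (rule nn_integral_nu) measurable
 finally have Qnu: "(\<integral>\<^sup>+x. Q x \<partial>\<nu>) = J" .
 have pm: "potential \<mu> \<in> borel_measurable \<nu>" "Q \<in> borel_measurable \<nu>"
  using potential_measurable(2) Q_measurable(2) by (simp_all add: \<nu>_def)
 \<comment> \<open>The integral of the field is finite, so it may be cancelled in the extended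
   reals.\<close>
 have J: "J ~= top" using weighted_energy_finiteD(2)[OF fin] unfolding Qmu by auto
 have "(\<integral>\<^sup>+x. potential \<mu> x \<partial>\<nu>) + J = (\<integral>\<^sup>+x. potential \<mu> x + Q x \<partial>\<nu>)"
  unfolding Qnu[symmetric] by (rule nn_integral_add[symmetric, OF pm])
 also have "... = (\<integral>\<^sup>+x. ennreal c \<partial>\<nu>)"
 proof (rule nn_integral_cong_AE)
  have "AE x in \<sigma>. 0 < fe (lat x) \<longrightarrow> potential \<mu> x + Q x = ennreal c"
   using potential_eq
  proof eventually_elim
   case (elim x)
   show ?case
   proof
    assume "0 < fe (lat x)"
    then have "lat x \<in> {0<..<hav \<alpha>}" by (rule fe_pos)
    then show "potential \<mu> x + Q x = ennreal c" using elim unfolding greaterThanLessThan_iff by blast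
   qed
  qed
  then show "AE x in \<nu>. potential \<mu> x + Q x = ennreal c" unfolding \<nu>_def by (subst AE_density) measurable
 qed
 also have "... = energy \<mu> + J" using nu(3) c_eq(1) by (simp add: Qmu)
 finally have "(\<integral>\<^sup>+x. potential \<mu> x \<partial>\<nu>) + J = energy \<mu> + J" .
 then have munu: "(\<integral>\<^sup>+x. potential \<mu> x \<partial>\<nu>) = energy \<mu>" using J by simp
 define e where "e = enn2real (energy \<mu>)"
 have e: "energy \<mu> = ennreal e" "0 <= e" using weighted_energy_finiteD(1)[OF fin] by (simp_all add: e_def less_top)
 show ?thesis
 proof (rule sphere_measure_eqI_energy[OF card n mu.finite_measure_axioms mu(1) nu.finite_measure_axioms nu(1) _ e(2)])
  fix P R assume "P \<in> {\<mu>, \<nu>}" "R \<in> {\<mu>, \<nu>}"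
  then show "(\<integral>\<^sup>+x. potential R x \<partial>P) = ennreal e"
   using munu comm numu nunu energy_eq_potential[of \<mu>] e(1) by auto
 qed
qed

section \<open>The constant C_Q and the final formula\<close>

lemma integral_hav:
 fixes G :: "real => real"
 assumes G: "integrable lborel G" and z: "!!s. s \<notin> {0<..<hav \<alpha>} ==> G s = 0"
 shows "integral {0..\<alpha>} (%x. G (hav x) * (sin x / 2)) = (\<integral>s. G s \<partial>lborel)"
proof -
 let ?a = "hav \<alpha>"
 have Gm [measurable]: "G \<in> borel_measurable borel" using borel_measurable_integrable[OF G] by simp
 have i: "integrable lborel (%u. G (?a * u))"
  using lborel_integrable_real_affine_iff[of ?a G 0] a G by simp
 have v: "(\<integral>s. G s \<partial>lborel) = ?a * (\<integral>u. G (?a * u) \<partial>lborel)"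
  using lborel_integral_real_affine[of ?a G 0] a by simp
 have w: "beta_weight 1 1 u * G (?a * u) = G (?a * u)" for u
 proof (cases "u \<in> {0<..<1}")
  case False
  then have "?a * u \<notin> {0<..<?a}" using a by (auto simp: zero_less_mult_iff mult_less_cancel_left1)
  then show ?thesis by (simp add: z)
 qed (simp add: beta_weight_def)
 have "integrable (beta_measure 1 1) (%u. G (?a * u))"
  unfolding beta_measure_def by (subst integrable_density) (simp_all add: beta_weight_nonneg w i)
 moreover have "(\<integral>u. G (?a * u) \<partial>beta_measure 1 1) = (\<integral>u. G (?a * u) \<partial>lborel)"
  unfolding beta_measure_def by (subst integral_density) (simp_all add: beta_weight_nonneg w)
 ultimately have I: "integral {0..\<alpha>} (%x. G (hav x) * ((hav x - hav 0) powr (1 - 1) * (hav \<alpha> - hav x) powr (1 - 1)) * (sin x / 2)) = ?a * (\<integral>u. G (?a * u) \<partial>lborel)"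
  using polar_beta_integral[of 0 \<alpha> 1 1 G] alpha a by simp
 have e: "G (hav x) * ((hav x - hav 0) powr (1 - 1) * (hav \<alpha> - hav x) powr (1 - 1)) * (sin x / 2) = G (hav x) * (sin x / 2)" for x
  using z[of "hav x"] by (cases "hav x \<in> {0<..<hav \<alpha>}") auto
 show ?thesis using I unfolding e v .
qed

text \<open>The constant in front of F, for d = n + 2.\<close>

definition "K0 = Gamma ((real (n + 2) - 2) / 2) / (2 * pi powr ((real (n + 2) + 2) / 2))"

lemma C1_eq: "C1 = 2 * pi powr (real n / 2) / Gamma (real n / 2)"
proof -
 have G: "0 < Gamma (real n / 2)" using n by (intro Gamma_real_pos) simp
 have "real n / 2 \<notin> \<int>\<^sub>\<le>\<^sub>0" using n by (auto elim!: nonpos_Ints_cases)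
 then have g: "Gamma (real n / 2 + 1) = real n / 2 * Gamma (real n / 2)" by (rule Gamma_plus1)
 have "x * (P / (x / 2 * y)) = 2 * P / y" if "x ~= 0" for x P y :: real using that by simp
 from this[of "real n" "pi powr (real n / 2)" "Gamma (real n / 2)"]
 show ?thesis using n unfolding C1_def unit_ball_vol_def g by simp
qed

lemma K0_eq: "K0 = 1 / (pi\<^sup>2 * C1)"
proof -
 have e: "(real (n + 2) - 2) / 2 = real n / 2" "(real (n + 2) + 2) / 2 = real n / 2 + 2" by (simp_all add: field_simps)
 have "pi powr (real n / 2 + 2) = pi powr (real n / 2) * pi\<^sup>2" by (simp add: powr_add)
 then show ?thesis unfolding K0_def e C1_eq by simp
qed

text \<open>The weighted mass of the hypergeometric part, from \<open>cap_density_mass\<close> with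
  p = n/2.\<close>

definition "X = Gamma (real n / 2 + 1 / 2) * sqrt pi / Gamma (real n / 2) * inc_Beta (hav \<alpha>) (real n / 2) (real n / 2 + 1)"

lemma inc_Beta_pos: "0 < inc_Beta (hav \<alpha>) (real n / 2) (real n / 2 + 1)"
proof -
 have "0 < (II w. ennreal (w powr (real n / 2 - 1) * (1 - w) powr (real n / 2 + 1 - 1)) * indicator {0<..<hav \<alpha>} w)"
  by (rule nn_integral_Ioo_pos[OF a(1)]) (measurable, use a in auto)
 also have "... = ennreal (inc_Beta (hav \<alpha>) (real n / 2) (real n / 2 + 1))"
  using n a by (intro inc_Beta_eq_nn_integral) auto
 finally show ?thesis by simp
qed

text \<open>The latitude form, without constants, of F times the power of the sine in the integral
  that defines C_Q.\<close>

definition "G3 s = sqrt s ^ (n - 1) * deriv (abel_Phi (abel_gamma n q) (hav \<alpha>)) s * indicator {0<..<hav \<alpha>} s"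

text \<open>The mass of the whole density is 1 because mu is a unit measure, and the mass of the
  hypergeometric part is \<open>X\<close>. The field part is their difference, which also settles
  its integrability without any estimate of F.\<close>

lemma G3_integral: "has_bochner_integral lborel G3 (pi / \<kappa> - b * (real n / 2) * X)"
proof -
 let ?R = "%s. (1 - s) powr (real n / 2 - 1 / 2) * cap_R (real n / 2) ((hav \<alpha> - s) / (1 - s))"
 define G1 where "G1 = (%s. sqrt s ^ (n - 1) * (?R s * indicator {0<..<hav \<alpha>} s))"
 define G2 where "G2 = (%s. sqrt s ^ (n - 1) * (\<kappa> / pi * (abel_density b s * indicator {0<..<hav \<alpha>} s)))"
 have R0: "0 <= ?R s" if "0 < s" "s < hav \<alpha>" for s
 proof -
  have "0 <= (hav \<alpha> - s) / (1 - s)" "(hav \<alpha> - s) / (1 - s) <= 1" using that a by (auto simp: divide_simps)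
  then show ?thesis using n by (intro mult_nonneg_nonneg cap_R_nonneg) auto
 qed
 \<comment> \<open>The hypergeometric part is written as a difference of two functions of the form
   \<open>abel_density\<close>, which are known to be measurable.\<close>
 have Rm: "(%s. ?R s * indicator {0<..<hav \<alpha>} s) \<in> borel_measurable borel"
 proof -
  have me: "(%s. 2 / real n * (abel_density 1 s * indicator {0<..<hav \<alpha>} s - abel_density 0 s * indicator {0<..<hav \<alpha>} s)) \<in> borel_measurable borel"
   by measurable
  have e: "2 / real n * (abel_density 1 s * indicator {0<..<hav \<alpha>} s - abel_density 0 s * indicator {0<..<hav \<alpha>} s) = ?R s * indicator {0<..<hav \<alpha>} s" for s
   using n by (cases "s \<in> {0<..<hav \<alpha>}") (simp_all add: abel_density_def)
  show ?thesis using me unfolding e .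
 qed
 have X0: "0 <= X" unfolding X_def using inc_Beta_pos n by (intro mult_nonneg_nonneg divide_nonneg_nonneg less_imp_le[OF Gamma_real_pos]) auto
 have h1: "has_bochner_integral lborel G1 X"
 proof (rule has_bochner_integral_nn_integral[OF _ _ X0])
  show "G1 \<in> borel_measurable lborel" unfolding G1_def using Rm by measurable
  show "AE s in lborel. 0 <= G1 s"
  proof (rule AE_I2)
   fix s show "0 <= G1 s" using R0[of s] by (cases "s \<in> {0<..<hav \<alpha>}") (simp_all add: G1_def)
  qed
  have "(II s. ennreal (G1 s)) = (II s. ennreal (s powr (real n / 2 - 1 / 2) * ?R s) * indicator {0<..<hav \<alpha>} s)"
  proof (rule nn_integral_cong, goal_cases)
   case (1 s)
   show ?case
   proof (cases "s \<in> {0<..<hav \<alpha>}")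
    case True
    then have "sqrt s ^ (n - 1) = s powr (real n / 2 - 1 / 2)" unfolding half_minus by (intro sqrt_power_powr) auto
    then show ?thesis using True by (simp add: G1_def)
   qed (simp add: G1_def)
  qed
  also have "... = ennreal X"
   unfolding X_def using n a by (intro cap_density_mass) auto
  finally show "(II s. ennreal (G1 s)) = ennreal X" .
 qed
 have h2: "has_bochner_integral lborel G2 1"
 proof (rule has_bochner_integral_nn_integral)
  show "G2 \<in> borel_measurable lborel" unfolding G2_def by measurable
  have k: "0 <= \<kappa> / pi" using C_pos by simp
  show "AE s in lborel. 0 <= G2 s"
  proof (rule AE_I2)
   fix s
   show "0 <= G2 s"
   proof (cases "s \<in> {0<..<hav \<alpha>}")
    case True
    then have "0 <= abel_density b s" by (intro density_nonneg) auto
    then show ?thesis using True unfolding G2_def by (intro mult_nonneg_nonneg k) auto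
   qed (simp add: G2_def)
  qed
  have "(II s. ennreal (G2 s)) = (II s. ennreal (sqrt s ^ (n - 1)) * (ennreal (\<kappa> / pi * (abel_density b s * indicator {0<..<hav \<alpha>} s))) * 1)"
  proof (rule nn_integral_cong, goal_cases)
   case (1 s)
   show ?case
   proof (cases "s \<in> {0<..<hav \<alpha>}")
    case True
    then show ?thesis unfolding G2_def mult_1_right by (intro ennreal_mult') auto
   qed (simp add: G2_def)
  qed
  also have "... = (\<integral>\<^sup>+t. 1 \<partial>m)"
   by (subst m_eq, rule nn_integral_density[symmetric]) measurable
  also have "... = (\<integral>\<^sup>+x. (%_. 1) (lat x) \<partial>\<mu>)" by (rule nn_integral_mu[symmetric]) simp
  also have "... = ennreal 1" using mu(3) by simp
  finally show "(II s. ennreal (G2 s)) = ennreal 1" .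
 qed simp
 have G3: "G3 = (%s. pi / \<kappa> * G2 s - b * (real n / 2) * G1 s)"
 proof
  fix s
  have gen: "S * D = P / k * (S * (k / P * (B * R + D))) - B * (S * R)" if "P ~= 0" "k ~= 0" for S D P k B R :: real
   using that by (simp add: algebra_simps)
  show "G3 s = pi / \<kappa> * G2 s - b * (real n / 2) * G1 s"
   using C_pos(3) gen[of pi \<kappa> "sqrt s ^ (n - 1)" "deriv (abel_Phi (abel_gamma n q) (hav \<alpha>)) s" "b * (real n / 2)" "?R s"]
   by (cases "s \<in> {0<..<hav \<alpha>}") (simp_all only: G1_def G2_def G3_def abel_density_def indicator_simps mult_1_right mult_zero_right mult_zero_left diff_self pi_neq_zero less_imp_neq[symmetric] not_False_eq_True simp_thms)
 qed
 show ?thesis unfolding G3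
  using has_bochner_integral_diff[OF has_bochner_integral_mult_right[OF h2, of "pi / \<kappa>"] has_bochner_integral_mult_right[OF h1, of "b * (real n / 2)"]]
  by simp
qed

context
 fixes p :: "real => real"
 assumes p: "!!\<theta>. 0 < \<theta> ==> \<theta> < \<alpha> ==> p \<theta> = q (hav \<theta>)"
begin

lemma F_fun_hav:
 assumes h: "0 < \<eta>" "\<eta> < \<alpha>"
 shows "F_fun (n + 2) p \<alpha> \<eta> = K0 * ((1 - hav \<eta>) powr (- ((real n - 1) / 2)) * deriv (abel_Phi (abel_gamma n q) (hav \<alpha>)) (hav \<eta>))"
 unfolding K0_def by (rule F_fun_eq[OF p alpha refl refl h])

lemma F_fun_integral: "integral {0..\<alpha>} (%\<eta>. F_fun (n + 2) p \<alpha> \<eta> * sin \<eta> ^ (n + 2 - 2)) = K0 * 2 ^ n * (pi / \<kappa> - b * (real n / 2) * X)"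
proof -
 have "integral {0..\<alpha>} (%\<eta>. F_fun (n + 2) p \<alpha> \<eta> * sin \<eta> ^ (n + 2 - 2)) = integral {0<..<\<alpha>} (%\<eta>. F_fun (n + 2) p \<alpha> \<eta> * sin \<eta> ^ (n + 2 - 2))"
  by (rule integral_Ioo[symmetric])
 also have "... = integral {0<..<\<alpha>} (%\<eta>. (K0 * 2 ^ n) * (G3 (hav \<eta>) * (sin \<eta> / 2)))"
 proof (rule Henstock_Kurzweil_Integration.integral_cong)
  fix \<eta> assume "\<eta> \<in> {0<..<\<alpha>}"
  then have h: "0 < \<eta>" "\<eta> < \<alpha>" by auto
  have s: "hav \<eta> \<in> {0<..<hav \<alpha>}" using hav_strict_mono[of 0 \<eta>] hav_strict_mono[of \<eta> \<alpha>] h alpha by simp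
  obtain r where r: "n = Suc r" using n by (cases n) auto
  have S: "0 < sin (\<eta> / 2)" "0 < cos (\<eta> / 2)" using h alpha by (auto intro!: sin_gt_zero cos_gt_zero)
  have q1: "sqrt (hav \<eta>) = sin (\<eta> / 2)" using S by (simp add: hav_eq_sin)
  have q2: "(1 - hav \<eta>) powr (- ((real n - 1) / 2)) = 1 / cos (\<eta> / 2) ^ r"
   using powr_half_sq[OF S(2), of r] by (simp add: one_minus_hav r powr_minus_divide)
  have sn: "sin \<eta> = 2 * sin (\<eta> / 2) * cos (\<eta> / 2)" using sin_double[of "\<eta> / 2"] by simp
  have gen: "K * (1 / C ^ r * D) * (2 * A * C) ^ Suc r = K * 2 ^ Suc r * (A ^ r * D * 1 * ((2 * A * C) / 2))" if "0 < C" for K C D A :: real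
   using that by (simp add: power_mult_distrib)
  show "F_fun (n + 2) p \<alpha> \<eta> * sin \<eta> ^ (n + 2 - 2) = (K0 * 2 ^ n) * (G3 (hav \<eta>) * (sin \<eta> / 2))"
   unfolding F_fun_hav[OF h] G3_def q1 q2 sn using s r gen[OF S(2)] by simp
 qed
 also have "... = (K0 * 2 ^ n) * integral {0..\<alpha>} (%\<eta>. G3 (hav \<eta>) * (sin \<eta> / 2))"
  by (simp only: integral_Ioo Henstock_Kurzweil_Integration.integral_mult_right)
 also have "integral {0..\<alpha>} (%\<eta>. G3 (hav \<eta>) * (sin \<eta> / 2)) = (\<integral>s. G3 s \<partial>lborel)"
 proof (rule integral_hav)
  show "integrable lborel G3" using G3_integral unfolding has_bochner_integral_iff by (rule conjunct1)
 qed (simp add: G3_def)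
 also have "(\<integral>s. G3 s \<partial>lborel) = pi / \<kappa> - b * (real n / 2) * X"
  using G3_integral unfolding has_bochner_integral_iff by (rule conjunct2)
 finally show ?thesis .
qed

text \<open>In the braces defining C_Q the mass of F is subtracted from the total mass, so what
  remains is the mass of the hypergeometric part; dividing by the mass of its unit multiple returns
  the coefficient that this part has in the solution.\<close>

lemma C_const_eq: "C_const (n + 2) p \<alpha> = b * (real n / 2) * K0"
proof -
 define g where "g = Gamma (real n / 2)"
 define g' where "g' = Gamma (real n / 2 + 1 / 2)"
 define B where "B = inc_Beta (hav \<alpha>) (real n / 2) (real n / 2 + 1)"
 define P where "P = pi powr (real n / 2)"
 define s where "s = sqrt pi"
 have pos: "0 < g" "0 < g'" "0 < B" "0 < P" "0 < s"
  using n inc_Beta_pos by (auto simp: g_def g'_def B_def P_def s_def intro!: Gamma_real_pos add_pos_pos)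
 have e: "real (n + 2) / 2 - 1 = real n / 2" "(real (n + 2) - 1) / 2 = real n / 2 + 1 / 2" "(real (n + 2) - 2) / 2 = real n / 2"
  "real (n + 2) / 2 = real n / 2 + 1" "n + 2 - 2 = n" by (simp_all add: field_simps)
 have ps: "pi powr (real n / 2 + 1 / 2) = P * s" by (simp add: powr_add P_def s_def powr_half_sqrt)
 have Bt: "Beta (real n / 2) (1 / 2) = g * s / g'" by (simp add: Beta_def g_def g'_def s_def Gamma_one_half_real)
 have C1: "C1 = 2 * P / g" by (simp add: C1_eq P_def g_def)
 have C2: "C2 = C1 * (g * s / g') * 2 ^ n" by (simp add: C2_def C1_def Bt)
 \<comment> \<open>The reciprocal of the area of the unit sphere of dimension d - 2: the first term
   in the braces is total mass 1 in these units.\<close>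
 have K: "K0 * 2 ^ n * (pi / \<kappa>) = g' / (2 * (P * s))"
  unfolding K0_eq \<kappa>_def C2 C1 using pos by (simp add: power2_eq_square field_simps)
 have X: "X = g' * s / g * B" by (simp add: X_def g_def g'_def s_def B_def)
 have "C_const (n + 2) p \<alpha> = g / (2 ^ n * s * g') * inverse B * (g' / (2 * (P * s)) - K0 * 2 ^ n * (pi / \<kappa> - b * (real n / 2) * X))"
  unfolding C_const_def unfolding F_fun_integral unfolding e(1-3) unfolding e(4,5)
   hav_eq_sin[symmetric] ps g_def[symmetric] g'_def[symmetric] s_def[symmetric] B_def[symmetric] by (rule refl)
 also have "g' / (2 * (P * s)) - K0 * 2 ^ n * (pi / \<kappa> - b * (real n / 2) * X) = K0 * 2 ^ n * (b * (real n / 2)) * X"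
  unfolding right_diff_distrib K by simp
 also have "g / (2 ^ n * s * g') * inverse B * (K0 * 2 ^ n * (b * (real n / 2)) * X) = b * (real n / 2) * K0"
  unfolding X using pos by (simp add: field_simps)
 finally show ?thesis .
qed

lemma eq_density_hav:
 assumes h: "0 < \<eta>" "\<eta> < \<alpha>"
 shows "eq_density (n + 2) p \<alpha> \<eta> = dens (hav \<eta>)"
proof -
 have s: "0 < hav \<eta>" "hav \<eta> < hav \<alpha>" "hav \<eta> < 1" using hav_strict_mono[of 0 \<eta>] hav_strict_mono[of \<eta> \<alpha>] h alpha a by auto
 let ?r = "(1 - hav \<eta>) powr (- ((real n - 1) / 2))"
 let ?R = "cap_R (real n / 2) ((hav \<alpha> - hav \<eta>) / (1 - hav \<eta>))"
 have "cap_factor_ext (n + 2) \<alpha> \<eta> = cap_R ((real (n + 2) - 2) / 2) ((cos \<eta> - cos \<alpha>) / (1 + cos \<eta>))"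
  using h alpha n by (intro cap_factor_ext_eq_cap_R) auto
 also have "(cos \<eta> - cos \<alpha>) / (1 + cos \<eta>) = (hav \<alpha> - hav \<eta>) / (1 - hav \<eta>)"
 proof -
  have h: "hav \<alpha> - hav \<eta> = (cos \<eta> - cos \<alpha>) / 2" "1 - hav \<eta> = (1 + cos \<eta>) / 2" by (simp_all add: hav_def field_simps)
  have "x / y = (x / 2) / (y / 2)" for x y :: real by simp
  then show ?thesis unfolding h .
 qed
 also have "(real (n + 2) - 2) / 2 = real n / 2" by simp
 finally have cf: "cap_factor_ext (n + 2) \<alpha> \<eta> = ?R" .
 have one: "?r * (1 - hav \<eta>) powr (real n / 2 - 1 / 2) = 1"
  using s by (simp add: powr_add[symmetric] diff_divide_distrib)
 have "dens (hav \<eta>) = K0 * (?r * (b * (real n / 2) * ((1 - hav \<eta>) powr (real n / 2 - 1 / 2) * ?R) + deriv (abel_Phi (abel_gamma n q) (hav \<alpha>)) (hav \<eta>)))"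
  unfolding dens_def K0_eq abel_density_def ..
 also have "... = b * (real n / 2) * K0 * ((?r * (1 - hav \<eta>) powr (real n / 2 - 1 / 2)) * ?R) + K0 * (?r * deriv (abel_Phi (abel_gamma n q) (hav \<alpha>)) (hav \<eta>))"
  by (simp only: distrib_left mult_ac)
 also have "... = eq_density (n + 2) p \<alpha> \<eta>"
  unfolding one eq_density_def C_const_eq cf F_fun_hav[OF h] by simp
 finally show ?thesis by simp
qed

text \<open>The closed formula is established at latitudes strictly between 0 and that of the
  boundary. The pole and the boundary parallel form a null set for surface measure, so the values
  there do not affect the density.\<close>

lemma equilibrium_density:
 "has_real_density \<mu> \<sigma> (%x. if polar_angle k x <= \<alpha> then eq_density (n + 2) p \<alpha> (polar_angle k x) else 0)"
proof -
 let ?f = "%x. if polar_angle k x <= \<alpha> then eq_density (n + 2) p \<alpha> (polar_angle k x) else 0"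
 \<comment> \<open>The values at the two end latitudes are kept as the formula gives them, so that
   the claimed density is literally a Borel function of latitude.\<close>
 let ?g = "%s. if s = 0 then eq_density (n + 2) p \<alpha> 0 else if s = hav \<alpha> then eq_density (n + 2) p \<alpha> \<alpha> else dens s * indicator {0<..<hav \<alpha>} s"
 have f: "?f x = ?g (lat x)" if x: "norm x = 1" for x
 proof -
  define \<theta> where "\<theta> = polar_angle k x"
  have th: "hav \<theta> = lat x" "0 <= \<theta>" "\<theta> <= pi" using hav_polar[OF x] by (auto simp: \<theta>_def)
  consider "\<theta> = 0" | "0 < \<theta>" "\<theta> < \<alpha>" | "\<theta> = \<alpha>" | "\<alpha> < \<theta>" using th by linarith
  then show ?thesis unfolding \<theta>_def[symmetric] th(1)[symmetric]
  proof cases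
   case 2
   then have "hav \<theta> \<in> {0<..<hav \<alpha>}" using hav_strict_mono[of 0 \<theta>] hav_strict_mono[of \<theta> \<alpha>] alpha by simp
   then show "(if \<theta> <= \<alpha> then eq_density (n + 2) p \<alpha> \<theta> else 0) = ?g (hav \<theta>)" using 2 eq_density_hav[OF 2] by simp
  next
   case 4
   then have "hav \<alpha> < hav \<theta>" using th alpha by (intro hav_strict_mono) auto
   then show "(if \<theta> <= \<alpha> then eq_density (n + 2) p \<alpha> \<theta> else 0) = ?g (hav \<theta>)" using 4 a by simp
  qed (use alpha a in auto)
 qed
 have gm: "?g \<in> borel_measurable borel" by measurable
 have glm: "(%x. ?g (lat x)) \<in> borel_measurable \<sigma>"
  by (rule measurable_compose[OF lat_measurable(2) gm])
 have fm: "?f \<in> borel_measurable \<sigma>"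
  by (rule measurable_cong[THEN iffD1, OF _ glm]) (simp add: f space_surface_measure)
 have "{0, hav \<alpha>} \<in> null_sets lborel" by (intro finite_imp_null_set_lborel) simp
 from AE_surface_latitude[OF card n this, of k]
 have gAE: "AE x in \<sigma>. ?g (lat x) = dens (lat x) * indicator {0<..<hav \<alpha>} (lat x)"
  by eventually_elim simp
 have fAE: "AE x in \<sigma>. ?f x = dens (lat x) * indicator {0<..<hav \<alpha>} (lat x)"
  using gAE AE_surface_norm
 proof eventually_elim
  case (elim x)
  show ?case using elim(1) f[OF elim(2)] by (rule trans[rotated])
 qed
 have dn: "0 <= dens s * indicator {0<..<hav \<alpha>} s" for s
 proof (cases "s \<in> {0<..<hav \<alpha>}")
  case True
  then show ?thesis using density_nonneg[of s] C_pos(1) by (simp add: dens_def)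
 qed simp
 show ?thesis unfolding has_real_density_def
 proof (intro conjI)
  show "?f \<in> borel_measurable \<sigma>" by (rule fm)
  show "AE x in \<sigma>. 0 <= ?f x" using fAE
  proof eventually_elim
   case (elim x)
   show ?case unfolding elim by (rule dn)
  qed
  have fl: "(%x. fe (lat x)) \<in> borel_measurable \<sigma>" by (rule measurable_compose[OF lat_measurable(2) fe_measurable])
  have "\<nu> = density \<sigma> (%x. ennreal (?f x))" unfolding \<nu>_def
  proof (rule density_cong[OF fl])
   show "(%x. ennreal (?f x)) \<in> borel_measurable \<sigma>" using fm by (rule measurable_compose) simp
   show "AE x in \<sigma>. fe (lat x) = ennreal (?f x)" using fAE
   proof eventually_elim
    case (elim x)
    show ?case unfolding elim fe_def ..
   qed
  qed
  then show "\<mu> = density \<sigma> (%x. ennreal (?f x))" using mu_eq_nu by simp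
 qed
qed

end

end

theorem theorem1p3:
 fixes Q :: "real ^ 'n::finite \<Rightarrow> ennreal"
  and \<mu> :: "(real ^ 'n) measure"
  and N :: "(real ^ 'n) set"
  and k :: 'n
  and d :: nat
  and \<alpha> :: real
 assumes "d = CARD('n)" and "d \<ge> 3"
  and "external_field Q"
  and "rotation_invariant k Q"
  and "equilibrium_measure Q \<mu>"
  and "openin (top_of_set (sphere 0 1)) N" and "supp \<mu> \<subseteq> N"
  and "C2_on_sphere N Q"
  and "0 < \<alpha>" and "\<alpha> \<le> pi"
  and "supp \<mu> = north_cap k \<alpha>"
 shows "has_real_density \<mu> surface_measure
      (\<lambda>x. if polar_angle k x \<le> \<alpha>
        then eq_density d (\<lambda>\<theta>. enn2real (profile k Q \<theta>)) \<alpha> (polar_angle k x)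
        else 0)"
proof -
 define n where "n = d - 2"
 have nd: "CARD('n) = n + 2" "0 < n" "d = n + 2" using assms(1,2) by (auto simp: n_def)
 obtain C q q' q'' where q: "abel_profile n (hav \<alpha>) C q q' q''"
  "\<And>x. norm x = 1 \<Longrightarrow> 0 < (1 - x $ k) / 2 \<Longrightarrow> (1 - x $ k) / 2 < hav \<alpha> \<Longrightarrow> Q x = ennreal (q ((1 - x $ k) / 2))"
  "\<And>t. 0 < t \<Longrightarrow> t < hav \<alpha> \<Longrightarrow> 0 \<le> q t"
  "\<And>\<theta>. 0 < \<theta> \<Longrightarrow> \<theta> < \<alpha> \<Longrightarrow> enn2real (profile k Q \<theta>) = q (hav \<theta>)"
  using field_abel_profile[OF nd(1,2) assms(4,6,8-10)] assms(7,11) by metis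
 have "lsc_on (sphere 0 1) Q" using assms(3) by (simp add: external_field_def)
 then have Qm: "Q \<in> borel_measurable sphere_borel" by (rule lsc_on_sphere_measurable)
 interpret abel_profile n "hav \<alpha>" C q q' q'' by (rule q(1))
 interpret cap_equilibrium n \<alpha> C q q' q'' Q \<mu> k
 proof
  show "CARD('n) = n + 2" by (rule nd(1))
  fix x assume "x \<in> supp \<mu>"
  then have "x \<in> N" using assms(7) by auto
  then show "(Q \<longlongrightarrow> Q x) (at x within sphere 0 1)" by (rule C2_on_sphere_tendsto[OF assms(6,8)])
 qed (use assms Qm q in auto)
 show ?thesis unfolding nd(3) by (rule equilibrium_density[OF q(4)])
qed

end
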